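(* Assume the density $\rho=\rho(N)$ follows one of the regimes (Super1), (Super2), (Hyper2), (Super3), and $L=(N/\rho)^{1/d}$. Then $F_L(1):=\sum_{j\ge1}\frac{W_{L,j}-\theta}{j}$ converges absolutely, and for every $\epsilon>0$, $$H_{N-j}(L)\sim\frac{e^{F_L(1)}N^{\theta-1}\big(1-\tau-\frac jN\big)^{\theta-1}}{\Gamma(\theta)}\qquad(N\to\infty),$$ uniformly in integers $0\le j\le(1-\tau-\epsilon)N$.
   Context: Fix an integer $d\ge1$ and a real $\theta>0$. $X$ is a random vector in $\mathbb R^d$ with density $\varphi$, a Schwartz function, with $\mathbb E X=0$ and covariance $\operatorname{Cov}(X)$; $\varphi^{*j}$ is the $j$-fold convolution. $W_{L,j}:=\theta L^d\sum_{k\in\mathbb Z^d}\varphi^{*j}(Lk)$; $G_L(z):=\sum_{j\ge1}W_{L,j}z^j/j$; $H_n(L)$ is defined by $\sum_{n\ge0}H_n(L)z^n=e^{G_L(z)}$. $\alpha_c:=\frac{\theta}{2\pi\sqrt{\det\operatorname{Cov}(X)}}$, $\rho_c:=\theta\sum_{j\ge1}\varphi^{*j}(0)$. Regimes: (Super1) $d=1$, $\rho/\sqrt N\to\infty$, $\rho\le N$; (Super2) $d=2$, $\rho/\log N\to\alpha\in(\alpha_c,\infty)$ (and $\rho\le N$); (Hyper2) $d=2$, $\rho/\log N\to\infty$, $\rho\le N$; (Super3) $d\ge3$, $\rho>\rho_c$ fixed. The parameter $\tau$ is $0$ in (Super1) and (Hyper2), $\alpha_c/\alpha$ in (Super2),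 and $\rho_c/\rho$ in (Super3). *)

theory Defs
  imports "HOL-Analysis.Analysis" "HOL-Computational_Algebra.Formal_Power_Series"
begin

text \<open>Schwartz functions on R^d (d = CARD('n)): all iterated partial derivatives
  exist everywhere and decay faster than any polynomial.  D alpha is the partial
  derivative of f along the list of coordinate directions alpha.\<close>
definition schwartz :: "(real^'n \<Rightarrow> real) \<Rightarrow> bool" where
  "schwartz f \<longleftrightarrow> (\<exists>D :: 'n list \<Rightarrow> real^'n \<Rightarrow> real.
      D [] = f \<and>
      (\<forall>\<alpha> x i. ((\<lambda>t. D \<alpha> (x + t *\<^sub>R axis i 1)) has_real_derivative D (i # \<alpha>) x) (at 0)) \<and>
      (\<forall>\<alpha> (m::nat). \<exists>C. \<forall>x. (1 + norm x) ^ m * \<bar>D \<alpha> x\<bar> \<le> C))"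

text \<open>conv_power phi j is the j-fold convolution phi^{*j} (meaningful for j >= 1).\<close>
fun conv_power :: "(real^'n \<Rightarrow> real) \<Rightarrow> nat \<Rightarrow> real^'n \<Rightarrow> real" where
  "conv_power \<phi> 0 = (\<lambda>_. 0)"
| "conv_power \<phi> (Suc 0) = \<phi>"
| "conv_power \<phi> (Suc (Suc j)) =
     (\<lambda>x. integral\<^sup>L lborel (\<lambda>y. conv_power \<phi> (Suc j) (x - y) * \<phi> y))"

text \<open>W_{L,j} = theta L^d sum_{k in Z^d} phi^{*j}(L k).\<close>
definition W :: "real \<Rightarrow> (real^'n \<Rightarrow> real) \<Rightarrow> real \<Rightarrow> nat \<Rightarrow> real" where
  "W \<theta> \<phi> L j = \<theta> * L ^ CARD('n) *
     infsum (\<lambda>k::'n \<Rightarrow> int. conv_power \<phi> j (L *\<^sub>R (\<chi> i. of_int (k i)))) UNIV"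

text \<open>G_L(z) = sum_{j>=1} W_{L,j} z^j / j as a formal power series.\<close>
definition G_fps :: "real \<Rightarrow> (real^'n \<Rightarrow> real) \<Rightarrow> real \<Rightarrow> real fps" where
  "G_fps \<theta> \<phi> L = Abs_fps (\<lambda>j. if j = 0 then 0 else W \<theta> \<phi> L j / of_nat j)"

text \<open>H_n(L): coefficients of exp(G_L(z)).\<close>
definition H :: "real \<Rightarrow> (real^'n \<Rightarrow> real) \<Rightarrow> nat \<Rightarrow> real \<Rightarrow> real" where
  "H \<theta> \<phi> n L = fps_nth (fps_compose (fps_exp 1) (G_fps \<theta> \<phi> L)) n"

text \<open>Covariance matrix of a centred density.\<close>
definition cov_matrix :: "(real^'n \<Rightarrow> real) \<Rightarrow> real^'n^'n" where
  "cov_matrix \<phi> = (\<chi> i j. integral\<^sup>L lborel (\<lambda>x. (x $ i) * (x $ j) * \<phi> x))"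

definition alpha_c :: "real \<Rightarrow> (real^'n \<Rightarrow> real) \<Rightarrow> real" where
  "alpha_c \<theta> \<phi> = \<theta> / (2 * pi * sqrt (det (cov_matrix \<phi>)))"

definition rho_c :: "real \<Rightarrow> (real^'n \<Rightarrow> real) \<Rightarrow> real" where
  "rho_c \<theta> \<phi> = \<theta> * (\<Sum>j. conv_power \<phi> (Suc j) 0)"

text \<open>F_L(1) = sum_{j>=1} (W_{L,j} - theta)/j.\<close>
definition F_term :: "real \<Rightarrow> (real^'n \<Rightarrow> real) \<Rightarrow> real \<Rightarrow> nat \<Rightarrow> real" where
  "F_term \<theta> \<phi> L j = (W \<theta> \<phi> L (Suc j) - \<theta>) / real (Suc j)"

end

theory Submission
  imports Defs "HOL-Probability.Probability" "HOL-Real_Asymp.Real_Asymp"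
begin

text \<open>By Poisson summation, \<open>W\<^bsub>L,j\<^esub> / \<theta>\<close> is the sum over \<open>k \<in> \<int>\<^sup>d\<close> of the \<open>j\<close>-th powers of the
  characteristic function of \<open>X\<close> at \<open>k / L\<close>. Hence \<open>W\<^bsub>L,j\<^esub> - \<theta>\<close> is \<open>O((L\<^sup>2 / j)\<^bsup>d/2\<^esup>)\<close> for
  \<open>j \<le> L\<^sup>2\<close> and \<open>O((L\<^sup>2 / j)\<^sup>2)\<close> afterwards. As \<open>L\<^sup>2 = o(N)\<close>, the sum of these deviations is
  \<open>(\<tau> + o(1)) N\<close>, carried by indices \<open>o(N)\<close>: it is negligible for \<open>d = 1\<close>, it comes from
  \<open>L\<^sup>d \<phi>\<^sup>*\<^sup>j(0)\<close> with \<open>j\<close> bounded for \<open>d \<ge> 3\<close>, and for \<open>d = 2\<close> from the logarithmic sum of the local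
  limit \<open>L\<^sup>2 / (2 \<pi> j sqrt (det Cov))\<close> over \<open>j \<le> L\<^sup>2\<close>.

  For \<open>z = exp (- s / N)\<close> this makes the generating function of the \<open>H\<^sub>n\<close> asymptotic to
  \<open>exp (F\<^sub>L(1)) z\<^sup>\<tau>\<^sup>N (1 - z)\<^sup>-\<^sup>\<theta>\<close>, and Karamata's argument yields the partial sums of the \<open>H\<^sub>n\<close>. The
  recurrence \<open>n H\<^sub>n = \<Sum>\<^sub>j W\<^sub>j H\<^bsub>n-j\<^esub>\<close> passes from partial sums to the \<open>H\<^sub>n\<close> themselves: its term
  \<open>\<theta> \<Sum>\<^sub>j H\<^bsub>n-j\<^esub>\<close> is a partial sum, and the remaining short jumps have mass about \<open>\<tau> N < n\<close>, so they
  contract the error by a factor bounded away from 1.\<close>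

section \<open>Exponentials of power series\<close>

text \<open>The Tauberian step yields only averages: nothing makes the \<open>H\<^sub>n\<close>
  monotone, so single coefficients cannot be read off partial sums, and the recurrence must supply
  the missing regularity. Subtracting its limit form
  \<open>s f(s) = \<theta> g(s) + \<tau> f(s)\<close>, where \<open>f\<close> is the derivative of
  the limiting partial-sum profile \<open>g\<close>, leaves vanishing terms plus \<tau> times the
  error at slightly smaller indices, divided by \<open>s > \<tau>\<close>. The error must first be
  known to be bounded; this takes a separate maximum argument, since the profile
  \<open>(s - \<tau>) powr (\<theta> - 1)\<close> is singular at \<tau> when \<theta> < 1. Jumps
  lead downwards, so each contraction step gives up a piece of the range; the pieces can be
  arbitrarily small while the factor stays fixed.

  On the analytic side one bound carries most of the load: the characteristic function is dominated
  by a product of factors \<open>1 / (1 + c \<xi>\<^sub>i\<^sup>2)\<close>. The product form turns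
  sums over the lattice into powers of one-dimensional sums, Bernoulli's inequality transports the
  bound to j-th powers, and in the Gaussian limit it yields positive definiteness of the
  covariance.\<close>

lemma fps_exp_compose_rec:
  fixes G :: "real fps"
  assumes "fps_nth G 0 = 0"
  shows "real n * fps_nth (fps_exp 1 oo G) n =
    (\<Sum>j=1..n. real j * fps_nth G j * fps_nth (fps_exp 1 oo G) (n - j))"
proof (cases n)
  case (Suc m)
  have "fps_deriv (fps_exp 1 oo G) = fps_deriv G * (fps_exp 1 oo G)"
    using fps_compose_deriv[OF assms, of "fps_exp 1"] by (simp add: mult.commute)
  hence "fps_nth (fps_deriv (fps_exp 1 oo G)) m = fps_nth (fps_deriv G * (fps_exp 1 oo G)) m"
    by simp
  hence "real n * fps_nth (fps_exp 1 oo G) n =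
     (\<Sum>i=0..m. real (i+1) * fps_nth G (i+1) * fps_nth (fps_exp 1 oo G) (m - i))"
    by (simp add: Suc fps_mult_nth)
  also have "\<dots> = (\<Sum>j=1..n. real j * fps_nth G j * fps_nth (fps_exp 1 oo G) (n - j))"
    by (rule sum.reindex_bij_witness[of _ "\<lambda>j. j - 1" Suc]) (auto simp: Suc)
  finally show ?thesis .
qed simp

text \<open>Nonnegative coefficients make every series absolutely convergent, so Cauchy products
  apply to the powers of \<open>G\<close>. This ties formal powers to actual sums.\<close>

lemma fps_power_sums:
  fixes G :: "real fps"
  assumes nonneg: "\<And>n. fps_nth G n \<ge> 0" and x: "0 \<le> x"
    and sums: "(\<lambda>n. fps_nth G n * x ^ n) sums S"
  shows "fps_nth (G ^ k) n \<ge> 0 \<and> (\<lambda>n. fps_nth (G ^ k) n * x ^ n) sums (S ^ k)"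
proof (induction k arbitrary: n)
  case 0
  have "(\<lambda>n. fps_nth (1 :: real fps) n * x ^ n) sums (\<Sum>n\<in>{0}. fps_nth (1 :: real fps) n * x ^ n)"
    by (rule sums_finite) auto
  then show ?case by simp
next
  case (Suc k)
  have nn: "fps_nth (G ^ Suc k) n \<ge> 0" for n
    using Suc nonneg by (auto simp: fps_mult_nth intro!: sum_nonneg)
  have "(\<lambda>n. \<Sum>i\<le>n. (fps_nth G i * x ^ i) * (fps_nth (G ^ k) (n - i) * x ^ (n - i))) sums
      ((\<Sum>n. fps_nth G n * x ^ n) * (\<Sum>n. fps_nth (G ^ k) n * x ^ n))"
    by (rule Cauchy_product_sums)
       (use Suc nonneg x sums in \<open>auto simp: abs_mult dest: sums_summable\<close>)
  also have "(\<Sum>n. fps_nth G n * x ^ n) * (\<Sum>n. fps_nth (G ^ k) n * x ^ n) = S ^ Suc k"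
    using Suc sums by (simp add: sums_iff)
  also have "(\<lambda>n. \<Sum>i\<le>n. (fps_nth G i * x ^ i) * (fps_nth (G ^ k) (n - i) * x ^ (n - i))) =
      (\<lambda>n. fps_nth (G ^ Suc k) n * x ^ n)"
  proof
    fix n
    show "(\<Sum>i\<le>n. (fps_nth G i * x ^ i) * (fps_nth (G ^ k) (n - i) * x ^ (n - i))) = fps_nth (G ^ Suc k) n * x ^ n"
      unfolding power_Suc fps_mult_nth sum_distrib_right atLeast0AtMost
      by (intro sum.cong refl) (simp add: mult_ac flip: power_add)
  qed
  finally show ?case using nn by blast
qed

text \<open>The double series over exponents \<open>k\<close> and degrees \<open>n\<close> has
  nonnegative terms, so it may be summed in either order. Summing over \<open>n\<close> first gives
  \<open>S ^ k / fact k\<close>; summing over \<open>k\<close> first gives the coefficients of the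
  formal composition.\<close>

lemma fps_exp_compose_sums:
  fixes G :: "real fps"
  assumes nonneg: "\<And>n. fps_nth G n \<ge> 0" and G0: "fps_nth G 0 = 0" and x: "0 \<le> x"
    and sums: "(\<lambda>n. fps_nth G n * x ^ n) sums S"
  shows "(\<lambda>n. fps_nth (fps_exp 1 oo G) n * x ^ n) sums exp S"
proof -
  define f where "f = (\<lambda>(k::nat, n::nat). fps_nth (G ^ k) n * x ^ n / fact k)"
  note P = fps_power_sums[OF nonneg x sums]
  have f_nonneg: "f (k, n) \<ge> 0" for k n
    using P[of k n] x by (auto simp: f_def)
  have inner: "((\<lambda>n. f (k, n)) has_sum (S ^ k / fact k)) UNIV" for k
    by (rule sums_nonneg_imp_has_sum)
       (use f_nonneg[of k] P[of k] in \<open>auto simp: f_def intro!: sums_divide\<close>)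
  have S: "S \<ge> 0"
    using suminf_nonneg[OF sums_summable[OF sums]] nonneg x sums by (simp add: sums_iff)
  have outer: "((\<lambda>k. S ^ k / fact k) has_sum exp S) UNIV"
    by (rule sums_nonneg_imp_has_sum)
       (use exp_converges[of S] S in \<open>auto simp: field_simps\<close>)
  have sm: "f summable_on (UNIV \<times> UNIV)"
    by (rule summable_on_SigmaI[where g = "\<lambda>k. S ^ k / fact k"])
       (use inner outer f_nonneg in \<open>auto dest: has_sum_imp_summable\<close>)
  have "(f has_sum exp S) (UNIV \<times> UNIV)"
    by (rule has_sum_SigmaI[where g = "\<lambda>k. S ^ k / fact k"]) (use inner outer sm in auto)
  hence sw: "((\<lambda>(n, k). f (k, n)) has_sum exp S) (UNIV \<times> UNIV)"
    by (subst (asm) has_sum_swap) auto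
  have "((\<lambda>n. fps_nth (fps_exp 1 oo G) n * x ^ n) has_sum exp S) UNIV"
  proof (rule has_sum_SigmaD[OF sw])
    fix n :: nat
    \<comment> \<open>As \<open>fps_nth G 0 = 0\<close>, the power \<open>G ^ k\<close> starts in
      degree \<open>k\<close> at the earliest. Only \<open>k \<le> n\<close> contributes, in
      agreement with the finite sum that defines \<open>fps_compose\<close>.\<close>
    have "((\<lambda>k. f (k, n)) has_sum (\<Sum>k\<in>{0..n}. f (k, n))) UNIV"
    proof (rule has_sum_finite_neutralI)
      fix k assume "k \<in> UNIV - {0..n}"
      hence "n < k" by auto
      thus "f (k, n) = 0"
        using startsby_zero_power_prefix[OF G0, of k] by (auto simp: f_def)
    qed auto
    also have "(\<Sum>k\<in>{0..n}. f (k, n)) = fps_nth (fps_exp 1 oo G) n * x ^ n"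
      by (simp add: f_def fps_compose_nth sum_distrib_right)
    finally show "((\<lambda>y. case (n, y) of (n, k) \<Rightarrow> f (k, n)) has_sum fps_nth (fps_exp 1 oo G) n * x ^ n) UNIV"
      by simp
  qed
  thus ?thesis by (rule has_sum_imp_sums)
qed

lemma fps_exp_compose_nonneg:
  fixes G :: "real fps"
  assumes nonneg: "\<And>n. fps_nth G n \<ge> 0"
  shows "fps_nth (fps_exp 1 oo G) n \<ge> 0"
proof -
  have "fps_nth (G ^ k) n \<ge> 0" for k n
    using nonneg by (induction k arbitrary: n) (auto simp: fps_mult_nth intro!: sum_nonneg mult_nonneg_nonneg)
  thus ?thesis by (auto simp: fps_compose_nth intro!: sum_nonneg)
qed

section \<open>A Karamata theorem for triangular arrays\<close>

text \<open>In the variable \<open>y = exp (- n / N)\<close> the hypotheses say that two measures on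
  [0, 1] have the same limiting moments of every order \<open>k \<ge> 1\<close>, hence the same
  limit against \<open>y * q y\<close>. The extra factor \<open>y\<close> is there because the
  moment of order 0, the total mass, is not controlled.\<close>

lemma laplace_polynomial_diff:
  fixes a b :: "nat \<Rightarrow> nat \<Rightarrow> real" and c :: "nat \<Rightarrow> real" and p :: "nat \<Rightarrow> real" and m :: nat
  assumes sa: "\<And>k. k \<ge> 1 \<Longrightarrow> \<forall>\<^sub>F N in sequentially. summable (\<lambda>n. a N n * exp (- (real n / real N)) ^ k)"
    and sb: "\<And>k. k \<ge> 1 \<Longrightarrow> \<forall>\<^sub>F N in sequentially. summable (\<lambda>n. b N n * exp (- (real n / real N)) ^ k)"
    and la: "\<And>k. k \<ge> 1 \<Longrightarrow> (\<lambda>N. \<Sum>n. a N n * exp (- (real n / real N)) ^ k) \<longlonglongrightarrow> c k"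
    and lb: "\<And>k. k \<ge> 1 \<Longrightarrow> (\<lambda>N. \<Sum>n. b N n * exp (- (real n / real N)) ^ k) \<longlonglongrightarrow> c k"
  defines "q \<equiv> (\<lambda>y. \<Sum>i\<le>m. p i * y ^ i)"
  shows "(\<forall>\<^sub>F N in sequentially. summable (\<lambda>n. a N n * exp (- (real n / real N)) * q (exp (- (real n / real N))))
            \<and> summable (\<lambda>n. b N n * exp (- (real n / real N)) * q (exp (- (real n / real N)))))
    \<and> (\<lambda>N. (\<Sum>n. a N n * exp (- (real n / real N)) * q (exp (- (real n / real N))))
         - (\<Sum>n. b N n * exp (- (real n / real N)) * q (exp (- (real n / real N))))) \<longlonglongrightarrow> 0"
proof -
  have gen: "(\<forall>\<^sub>F N in sequentially. summable (\<lambda>n. a N n * exp (- (real n / real N)) * q (exp (- (real n / real N)))))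
    \<and> (\<lambda>N. (\<Sum>n. a N n * exp (- (real n / real N)) * q (exp (- (real n / real N))))) \<longlonglongrightarrow> (\<Sum>i\<le>m. p i * c (Suc i))"
    if sa: "\<And>k. k \<ge> 1 \<Longrightarrow> \<forall>\<^sub>F N in sequentially. summable (\<lambda>n. a N n * exp (- (real n / real N)) ^ k)"
    and la: "\<And>k. k \<ge> 1 \<Longrightarrow> (\<lambda>N. \<Sum>n. a N n * exp (- (real n / real N)) ^ k) \<longlonglongrightarrow> c k"
    for a :: "nat \<Rightarrow> nat \<Rightarrow> real"
  proof -
    have eq: "a N n * exp (- (real n / real N)) * q (exp (- (real n / real N))) =
        (\<Sum>i\<le>m. p i * (a N n * exp (- (real n / real N)) ^ (Suc i)))" for N n
      by (simp add: q_def sum_distrib_left mult_ac)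
    have ev: "\<forall>\<^sub>F N in sequentially. \<forall>i\<in>{..m}. summable (\<lambda>n. a N n * exp (- (real n / real N)) ^ (Suc i))"
      by (subst eventually_ball_finite_distrib) (auto intro!: sa simp del: power_Suc)
    have ev2: "\<forall>\<^sub>F N in sequentially. summable (\<lambda>n. a N n * exp (- (real n / real N)) * q (exp (- (real n / real N))))
       \<and> (\<Sum>n. a N n * exp (- (real n / real N)) * q (exp (- (real n / real N)))) =
         (\<Sum>i\<le>m. p i * (\<Sum>n. a N n * exp (- (real n / real N)) ^ (Suc i)))"
      using ev
    proof eventually_elim
      case (elim N)
      have "(\<lambda>n. \<Sum>i\<le>m. p i * (a N n * exp (- (real n / real N)) ^ (Suc i))) sums
          (\<Sum>i\<le>m. p i * (\<Sum>n. a N n * exp (- (real n / real N)) ^ (Suc i)))"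
        by (intro sums_sum sums_mult summable_sums) (use elim in blast)
      thus ?case unfolding eq sums_iff by simp
    qed
    have "(\<lambda>N. \<Sum>i\<le>m. p i * (\<Sum>n. a N n * exp (- (real n / real N)) ^ (Suc i))) \<longlonglongrightarrow> (\<Sum>i\<le>m. p i * c (Suc i))"
      by (intro tendsto_sum tendsto_mult tendsto_const la) auto
    moreover have "\<forall>\<^sub>F N in sequentially. (\<Sum>i\<le>m. p i * (\<Sum>n. a N n * exp (- (real n / real N)) ^ (Suc i))) =
        (\<Sum>n. a N n * exp (- (real n / real N)) * q (exp (- (real n / real N))))"
      using ev2 by eventually_elim simp
    ultimately have "(\<lambda>N. \<Sum>n. a N n * exp (- (real n / real N)) * q (exp (- (real n / real N)))) \<longlonglongrightarrow> (\<Sum>i\<le>m. p i * c (Suc i))"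
      by (rule Lim_transform_eventually)
    thus ?thesis using ev2 by (auto elim: eventually_mono)
  qed
  note A = gen[OF sa la] and B = gen[OF sb lb]
  show ?thesis
    using eventually_conj[OF conjunct1[OF A] conjunct1[OF B]]
      tendsto_diff[OF conjunct2[OF A] conjunct2[OF B]] by auto
qed

text \<open>Karamata's argument in one-sided form. Two arrays are compared with each other, so no
  limit measure has to be constructed, and the room between \<open>x\<close> and \<open>x'\<close>
  accommodates a continuous cutoff, to which polynomial approximation applies.\<close>

lemma laplace_compare:
  fixes a b :: "nat \<Rightarrow> nat \<Rightarrow> real" and c :: "nat \<Rightarrow> real"
  assumes sa: "\<And>k. k \<ge> 1 \<Longrightarrow> \<forall>\<^sub>F N in sequentially. summable (\<lambda>n. a N n * exp (- (real n / real N)) ^ k)"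
    and sb: "\<And>k. k \<ge> 1 \<Longrightarrow> \<forall>\<^sub>F N in sequentially. summable (\<lambda>n. b N n * exp (- (real n / real N)) ^ k)"
    and la: "\<And>k. k \<ge> 1 \<Longrightarrow> (\<lambda>N. \<Sum>n. a N n * exp (- (real n / real N)) ^ k) \<longlonglongrightarrow> c k"
    and lb: "\<And>k. k \<ge> 1 \<Longrightarrow> (\<lambda>N. \<Sum>n. b N n * exp (- (real n / real N)) ^ k) \<longlonglongrightarrow> c k"
    and a0: "\<And>N n. a N n \<ge> 0" and b0: "\<And>N n. b N n \<ge> 0"
    and x: "x < x'" and \<epsilon>: "\<epsilon> > 0"
  shows "\<forall>\<^sub>F N in sequentially. (\<Sum>n | real n \<le> x * real N. a N n) \<le> (\<Sum>n | real n \<le> x' * real N. b N n) + \<epsilon>"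
proof -
  define u u' where "u = exp (- x)" and "u' = exp (- x')"
  have uu: "0 < u'" "u' < u" using x by (auto simp: u_def u'_def)
  \<comment> \<open>A linear ramp from 0 at \<open>u'\<close> to 1 at \<open>u\<close>: it lies
    above the indicator of \<open>n \<le> x * N\<close> and below that of
    \<open>n \<le> x' * N\<close>.\<close>
  define T where "T = (\<lambda>y::real. max 0 (min 1 ((y - u') / (u - u'))))"
  \<comment> \<open>Only polynomials times \<open>y\<close> can be integrated, so the ramp is
    divided by \<open>y\<close>. Replacing \<open>y\<close> by \<open>max y u'\<close> avoids the
    singularity at 0 and keeps \<open>y * g y = T y\<close>, because \<open>T\<close> vanishes below
    \<open>u'\<close>.\<close>
  define g where "g = (\<lambda>y::real. T y / max y u')"
  have T01: "0 \<le> T y" "T y \<le> 1" for y by (auto simp: T_def)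
  have T1: "T y = 1" if "y \<ge> u" for y
    using that uu by (auto simp: T_def min_def max_def field_simps)
  have T0: "T y = 0" if "y \<le> u'" for y
    using that uu by (auto simp: T_def min_def max_def field_simps)
  have gT: "y * g y = T y" for y
    using uu T0[of y] by (auto simp: g_def max_def)
  have cg: "continuous_on {0..1} g"
    unfolding g_def T_def using uu by (intro continuous_intros) (auto simp: max_def)
  \<comment> \<open>The approximation error is at most \<open>\<eta> * y\<close>, so it integrates
    to at most \<eta> times the first moment, which is eventually below
    \<open>\<bar>c 1\<bar> + 1\<close>. Each of the two arrays then costs at most
    \<open>\<epsilon> / 4\<close>.\<close>
  define \<eta> where "\<eta> = \<epsilon> / (4 * (\<bar>c 1\<bar> + 1))"
  have \<eta>: "\<eta> > 0" using \<epsilon> by (auto simp: \<eta>_def intro!: divide_pos_pos)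
  obtain h where h: "polynomial_function h" "\<And>y. y \<in> {0..1} \<Longrightarrow> norm (g y - h y) < \<eta>"
    using Stone_Weierstrass_polynomial_function[OF compact_Icc cg \<eta>] by blast
  from h(1) obtain p m where hp: "h = (\<lambda>y. \<Sum>i\<le>m. p i * y ^ i)"
    by (auto simp: real_polynomial_function_eq[symmetric] real_polynomial_function_iff_sum)
  have hp': "h y = (\<Sum>i\<le>m. p i * y ^ i)" for y by (simp add: hp)
  let ?y = "\<lambda>N n. exp (- (real n / real N))"
  have L: "(\<forall>\<^sub>F N in sequentially. summable (\<lambda>n. a N n * ?y N n * h (?y N n)) \<and> summable (\<lambda>n. b N n * ?y N n * h (?y N n)))
    \<and> (\<lambda>N. (\<Sum>n. a N n * ?y N n * h (?y N n)) - (\<Sum>n. b N n * ?y N n * h (?y N n))) \<longlonglongrightarrow> 0"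
    unfolding hp' by (rule laplace_polynomial_diff[where a = a and b = b and c = c and p = p and m = m, OF sa sb la lb])
  have e1: "\<forall>\<^sub>F N in sequentially. \<bar>(\<Sum>n. a N n * ?y N n * h (?y N n)) - (\<Sum>n. b N n * ?y N n * h (?y N n))\<bar> < \<epsilon>/4"
    using conjunct2[OF L] \<epsilon> unfolding tendsto_iff dist_real_def
    by (auto dest!: spec[of _ "\<epsilon>/4"])
  have e2: "\<forall>\<^sub>F N in sequentially. (\<Sum>n. a N n * ?y N n) < \<bar>c 1\<bar> + 1" 
    by (rule order_tendstoD(2)[where y = "c 1"]) (use la[of 1] in auto)
  have e3: "\<forall>\<^sub>F N in sequentially. (\<Sum>n. b N n * ?y N n) < \<bar>c 1\<bar> + 1" 
    by (rule order_tendstoD(2)[where y = "c 1"]) (use lb[of 1] in auto)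
  have s1: "\<forall>\<^sub>F N in sequentially. summable (\<lambda>n. a N n * ?y N n)" using sa[of 1] by simp
  have s2: "\<forall>\<^sub>F N in sequentially. summable (\<lambda>n. b N n * ?y N n)" using sb[of 1] by simp
  have "\<forall>\<^sub>F N in sequentially. (\<Sum>n | real n \<le> x * real N. a N n) \<le> (\<Sum>n | real n \<le> x' * real N. b N n) + \<epsilon>"
  proof (rule eventually_mono[OF eventually_conj[OF e1 eventually_conj[OF eventually_conj[OF e2 e3]
       eventually_conj[OF eventually_conj[OF s1 s2] eventually_conj[OF conjunct1[OF L] eventually_gt_at_top[of 0]]]]]],
       (elim conjE), goal_cases)
    case elim: (1 N)
    have N: "real N > 0" using elim by simp
    have y01: "?y N n \<in> {0..1}" for n using N by auto
    have close: "\<bar>T (?y N n) - ?y N n * h (?y N n)\<bar> \<le> \<eta> * ?y N n" for n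
    proof -
      have "\<bar>T (?y N n) - ?y N n * h (?y N n)\<bar> = ?y N n * \<bar>g (?y N n) - h (?y N n)\<bar>"
        using gT[of "?y N n"] abs_mult[of "?y N n" "g (?y N n) - h (?y N n)"] by (simp add: right_diff_distrib)
      also have "\<dots> \<le> ?y N n * \<eta>"
        using h(2)[OF y01[of n]] by (intro mult_left_mono) auto
      finally show ?thesis by (simp add: mult.commute)
    qed
    have key: "\<bar>(\<Sum>n. w n * T (?y N n)) - (\<Sum>n. w n * ?y N n * h (?y N n))\<bar> \<le> \<eta> * (\<Sum>n. w n * ?y N n)
       \<and> summable (\<lambda>n. w n * T (?y N n))"
      if w: "\<And>n. w n \<ge> 0" and sw: "summable (\<lambda>n. w n * ?y N n)" and swh: "summable (\<lambda>n. w n * ?y N n * h (?y N n))"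
      for w :: "nat \<Rightarrow> real"
    proof -
      have c: "\<bar>w n * T (?y N n) - w n * ?y N n * h (?y N n)\<bar> \<le> \<eta> * (w n * ?y N n)" for n
      proof -
        have "w n * \<bar>T (?y N n) - ?y N n * h (?y N n)\<bar> \<le> w n * (\<eta> * ?y N n)"
          by (rule mult_left_mono[OF close w])
        moreover have "w n * T (?y N n) - w n * ?y N n * h (?y N n) = w n * (T (?y N n) - ?y N n * h (?y N n))"
          by (simp add: right_diff_distrib mult.assoc)
        ultimately show ?thesis using w[of n] by (simp add: abs_mult mult.left_commute)
      qed
      have sd: "summable (\<lambda>n. \<bar>w n * T (?y N n) - w n * ?y N n * h (?y N n)\<bar>)"
        by (rule summable_comparison_test'[OF summable_mult[OF sw, of \<eta>], of 0]) (use c in auto)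
      hence sd': "summable (\<lambda>n. w n * T (?y N n) - w n * ?y N n * h (?y N n))"
        by (rule summable_rabs_cancel)
      have sT: "summable (\<lambda>n. w n * T (?y N n))"
        using summable_add[OF sd' swh] by simp
      have d1: "(\<Sum>n. w n * T (?y N n)) - (\<Sum>n. w n * ?y N n * h (?y N n)) =
          (\<Sum>n. w n * T (?y N n) - w n * ?y N n * h (?y N n))"
        by (rule suminf_diff[OF sT swh])
      have d2: "\<bar>\<Sum>n. w n * T (?y N n) - w n * ?y N n * h (?y N n)\<bar>
          \<le> (\<Sum>n. \<bar>w n * T (?y N n) - w n * ?y N n * h (?y N n)\<bar>)"
        by (rule summable_rabs[OF sd])
      have d3: "(\<Sum>n. \<bar>w n * T (?y N n) - w n * ?y N n * h (?y N n)\<bar>) \<le> (\<Sum>n. \<eta> * (w n * ?y N n))"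
        by (rule suminf_le[OF c sd summable_mult[OF sw]])
      have d4: "(\<Sum>n. \<eta> * (w n * ?y N n)) = \<eta> * (\<Sum>n. w n * ?y N n)" by (rule suminf_mult[OF sw])
      show ?thesis unfolding d1 using order_trans[OF d2 d3] sT unfolding d4 by (rule conjI)
    qed
    have ka: "\<bar>(\<Sum>n. a N n * T (?y N n)) - (\<Sum>n. a N n * ?y N n * h (?y N n))\<bar> \<le> \<eta> * (\<Sum>n. a N n * ?y N n)
       \<and> summable (\<lambda>n. a N n * T (?y N n))"
      by (rule key) (use elim a0 in auto)
    have kb: "\<bar>(\<Sum>n. b N n * T (?y N n)) - (\<Sum>n. b N n * ?y N n * h (?y N n))\<bar> \<le> \<eta> * (\<Sum>n. b N n * ?y N n)
       \<and> summable (\<lambda>n. b N n * T (?y N n))"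
      by (rule key) (use elim b0 in auto)
    have \<eta>c: "\<eta> * (\<bar>c 1\<bar> + 1) = \<epsilon>/4"
      unfolding \<eta>_def by (simp add: field_simps add_nonneg_eq_0_iff)
    have \<eta>1: "\<eta> * (\<Sum>n. a N n * ?y N n) \<le> \<epsilon>/4"
      unfolding \<eta>c[symmetric] using elim \<eta> by (intro mult_left_mono) auto
    have \<eta>2: "\<eta> * (\<Sum>n. b N n * ?y N n) \<le> \<epsilon>/4"
      unfolding \<eta>c[symmetric] using elim \<eta> by (intro mult_left_mono) auto
    have fin: "finite {n. real n \<le> z * real N}" for z
      by (rule finite_subset[of _ "{..nat \<lfloor>z * real N\<rfloor>}"]) (auto intro: le_nat_floor)
    have "(\<Sum>n | real n \<le> x * real N. a N n) = (\<Sum>n | real n \<le> x * real N. a N n * T (?y N n))"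
      by (intro sum.cong refl, subst T1) (use N in \<open>auto simp: u_def field_simps\<close>)
    also have "\<dots> \<le> (\<Sum>n. a N n * T (?y N n))"
      by (rule sum_le_suminf[OF conjunct2[OF ka] fin]) (rule mult_nonneg_nonneg[OF a0 T01(1)])
    finally have A: "(\<Sum>n | real n \<le> x * real N. a N n) \<le> (\<Sum>n. a N n * T (?y N n))" .
    have "(\<Sum>n. b N n * T (?y N n)) = (\<Sum>n | real n \<le> x' * real N. b N n * T (?y N n))"
    proof (rule suminf_finite[OF fin[of x']])
      fix n assume "n \<notin> {n. real n \<le> x' * real N}"
      hence "T (?y N n) = 0"
        by (intro T0) (use N in \<open>simp add: u'_def field_simps\<close>)
      thus "b N n * T (?y N n) = 0" by simp
    qed
    also have "\<dots> \<le> (\<Sum>n | real n \<le> x' * real N. b N n)"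
      by (intro sum_mono mult_left_le T01 b0)
    finally have B: "(\<Sum>n. b N n * T (?y N n)) \<le> (\<Sum>n | real n \<le> x' * real N. b N n)" .
    have arith: "p \<le> r + \<epsilon>" if "p \<le> p1" "r1 \<le> r" "\<bar>p1 - p2\<bar> \<le> p3" "\<bar>r1 - r2\<bar> \<le> r3" "p3 \<le> \<epsilon>/4" "r3 \<le> \<epsilon>/4" "\<bar>p2 - r2\<bar> < \<epsilon>/4"
      for p p1 p2 p3 r r1 r2 r3 :: real
      using that by linarith
    show ?case
      using arith[OF A B conjunct1[OF ka] conjunct1[OF kb] \<eta>1 \<eta>2 elim(1)] .
  qed
  thus ?thesis .
qed

section \<open>The reference array: coefficients of a shifted negative binomial series\<close>

lemma pochhammer_fact_sums:
  fixes \<theta> x :: real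
  assumes "\<bar>x\<bar> < 1"
  shows "(\<lambda>k. pochhammer \<theta> k / fact k * x ^ k) sums (1 - x) powr (- \<theta>)"
proof -
  have "(\<lambda>n. (- \<theta> gchoose n) * (- x) ^ n) sums (1 + (- x)) powr (- \<theta>)"
    by (rule gen_binomial_real) (use assms in auto)
  also have "(\<lambda>n. (- \<theta> gchoose n) * (- x) ^ n) = (\<lambda>k. pochhammer \<theta> k / fact k * x ^ k)"
  proof
    fix k :: nat
    have "(- \<theta> gchoose k) * (- x) ^ k = ((- 1) ^ k * (- 1) ^ k) * (pochhammer \<theta> k / fact k * x ^ k)"
      by (subst power_minus[of x]) (simp add: gbinomial_pochhammer)
    also have "(- 1) ^ k * (- 1 :: real) ^ k = 1" by (simp flip: power_mult_distrib)
    finally show "(- \<theta> gchoose k) * (- x) ^ k = pochhammer \<theta> k / fact k * x ^ k" by simp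
  qed
  finally show ?thesis by simp
qed

text \<open>Taking partial sums multiplies the generating function
  \<open>(1 - x) powr - \<theta>\<close> by \<open>1 / (1 - x)\<close>, which raises \<theta> by
  one.\<close>

lemma sum_pochhammer_fact:
  fixes \<theta> :: real
  shows "(\<Sum>k\<le>m. pochhammer \<theta> k / fact k) = pochhammer (\<theta> + 1) m / fact m"
proof (induction m)
  case (Suc m)
  have "pochhammer \<theta> (Suc m) = \<theta> * pochhammer (\<theta> + 1) m" by (rule pochhammer_rec)
  moreover have "pochhammer (\<theta> + 1) (Suc m) = pochhammer (\<theta> + 1) m * (\<theta> + 1 + real m)"
    by (simp add: pochhammer_Suc)
  moreover have aux: "P / f + \<theta> * P / ((1 + x) * f) = P * (\<theta> + 1 + x) / ((1 + x) * f)" if "f \<noteq> 0" "x \<ge> 0" for P f x :: real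
    using that by (simp add: divide_simps) (simp add: algebra_simps)
  ultimately show ?case using Suc aux[of "fact m" "real m" "pochhammer (\<theta> + 1) m"] by simp
qed simp

text \<open>The product formula for the reciprocal Gamma function:
  \<open>rGamma_series \<theta> m\<close> has the numerator
  \<open>pochhammer \<theta> (m + 1)\<close>, from which the first factor \<theta> is split
  off.\<close>

lemma pochhammer_fact_asymp:
  fixes \<theta> :: real
  assumes "\<theta> > 0"
  shows "(\<lambda>m. pochhammer (\<theta> + 1) m / fact m / real m powr \<theta>) \<longlonglongrightarrow> 1 / Gamma (\<theta> + 1)"
proof -
  have "(\<lambda>m. rGamma_series \<theta> m / \<theta>) \<longlonglongrightarrow> rGamma \<theta> / \<theta>"
    by (intro tendsto_intros) (use assms in auto)
  moreover have "\<forall>\<^sub>F m in sequentially. rGamma_series \<theta> m / \<theta> = pochhammer (\<theta> + 1) m / fact m / real m powr \<theta>"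
    using eventually_gt_at_top[of 0]
    by eventually_elim
       (use assms in \<open>auto simp: rGamma_series_def pochhammer_rec powr_def field_simps\<close>)
  ultimately have "(\<lambda>m. pochhammer (\<theta> + 1) m / fact m / real m powr \<theta>) \<longlonglongrightarrow> rGamma \<theta> / \<theta>"
    by (rule Lim_transform_eventually)
  also have "rGamma \<theta> / \<theta> = 1 / Gamma (\<theta> + 1)"
    using assms by (subst Gamma_plus1) (simp_all add: rGamma_inverse_Gamma field_simps nonpos_Ints_def)
  finally show ?thesis .
qed

lemma nat_floor_over_tendsto:
  fixes \<tau> :: real
  assumes "\<tau> \<ge> 0"
  shows "(\<lambda>N. real (nat \<lfloor>\<tau> * real N\<rfloor>) / real N) \<longlonglongrightarrow> \<tau>"
proof (rule tendsto_sandwich)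
  show "\<forall>\<^sub>F N in sequentially. \<tau> - 1 / real N \<le> real (nat \<lfloor>\<tau> * real N\<rfloor>) / real N"
    using eventually_gt_at_top[of 0]
  proof eventually_elim
    case (elim N)
    have "\<tau> * real N - 1 \<le> real (nat \<lfloor>\<tau> * real N\<rfloor>)" by linarith
    hence "(\<tau> * real N - 1) / real N \<le> real (nat \<lfloor>\<tau> * real N\<rfloor>) / real N"
      by (rule divide_right_mono) simp
    thus ?case using elim by (simp add: diff_divide_distrib)
  qed
  show "\<forall>\<^sub>F N in sequentially. real (nat \<lfloor>\<tau> * real N\<rfloor>) / real N \<le> \<tau>"
    using eventually_gt_at_top[of 0]
  proof eventually_elim
    case (elim N)
    have "real (nat \<lfloor>\<tau> * real N\<rfloor>) \<le> \<tau> * real N" using assms by (intro of_nat_floor) auto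
    thus ?case using elim by (simp add: field_simps)
  qed
  show "(\<lambda>N. \<tau> - 1 / real N) \<longlonglongrightarrow> \<tau>" by real_asymp
qed auto

text \<open>The coefficients of \<open>z ^ t * (1 - z) powr - \<theta>\<close> with \<open>t\<close>
  the integer part of \<open>\<tau> * N\<close>, divided by \<open>N powr \<theta>\<close>. The
  Laplace transform has the limit that is expected of the array under study, while the partial sums
  are explicit; this makes it the partner in \<open>laplace_compare\<close>.\<close>

definition shifted_coeff :: "real \<Rightarrow> real \<Rightarrow> nat \<Rightarrow> nat \<Rightarrow> real" where
  "shifted_coeff \<theta> \<tau> N n = (let t = nat \<lfloor>\<tau> * real N\<rfloor> in
     if n < t then 0 else pochhammer \<theta> (n - t) / fact (n - t) / real N powr \<theta>)"

lemma shifted_coeff_nonneg: "\<theta> > 0 \<Longrightarrow> shifted_coeff \<theta> \<tau> N n \<ge> 0"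
  by (auto simp: shifted_coeff_def Let_def pochhammer_nonneg)

lemma one_minus_exp_asymp:
  fixes s :: real
  assumes "s > 0"
  shows "(\<lambda>N. real N * (1 - exp (- (s / real N)))) \<longlonglongrightarrow> s"
  using assms by real_asymp

lemma shifted_coeff_laplace:
  fixes \<theta> \<tau> :: real
  assumes \<theta>: "\<theta> > 0" and \<tau>: "\<tau> \<ge> 0" and k: "k \<ge> 1"
  shows "(\<forall>\<^sub>F N in sequentially. summable (\<lambda>n. shifted_coeff \<theta> \<tau> N n * exp (- (real n / real N)) ^ k))
    \<and> (\<lambda>N. \<Sum>n. shifted_coeff \<theta> \<tau> N n * exp (- (real n / real N)) ^ k)
        \<longlonglongrightarrow> exp (- (\<tau> * real k)) * real k powr (- \<theta>)"
proof -
  have sums: "(\<lambda>n. shifted_coeff \<theta> \<tau> N n * exp (- (real n / real N)) ^ k) sums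
     (exp (- (real k / real N)) ^ (nat \<lfloor>\<tau> * real N\<rfloor>) * (real N * (1 - exp (- (real k / real N)))) powr (- \<theta>))"
    if N: "N > 0" for N
  proof -
    define t where "t = nat \<lfloor>\<tau> * real N\<rfloor>"
    define x where "x = exp (- (real k / real N))"
    have x: "0 < x" "x < 1" using N k by (auto simp: x_def)
    have xp: "exp (- (real n / real N)) ^ k = x ^ n" for n
      by (simp add: x_def mult.commute flip: exp_of_nat_mult)
    have "(\<lambda>m. (x ^ t / real N powr \<theta>) * (pochhammer \<theta> m / fact m * x ^ m)) sums
        ((x ^ t / real N powr \<theta>) * (1 - x) powr (- \<theta>))"
      by (intro sums_mult pochhammer_fact_sums) (use x in auto)
    hence "(\<lambda>m. shifted_coeff \<theta> \<tau> N (m + t) * x ^ (m + t)) sums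
        ((x ^ t / real N powr \<theta>) * (1 - x) powr (- \<theta>))"
      by (simp add: shifted_coeff_def Let_def flip: t_def) (simp add: power_add mult_ac)
    hence "(\<lambda>m. shifted_coeff \<theta> \<tau> N m * x ^ m) sums
        ((x ^ t / real N powr \<theta>) * (1 - x) powr (- \<theta>) + (\<Sum>m<t. shifted_coeff \<theta> \<tau> N m * x ^ m))"
      by (subst (asm) sums_iff_shift)
    also have "(\<Sum>m<t. shifted_coeff \<theta> \<tau> N m * x ^ m) = 0"
      by (rule sum.neutral) (auto simp: shifted_coeff_def Let_def t_def)
    also have "x ^ t / real N powr \<theta> * (1 - x) powr (- \<theta>) + 0 = x ^ t * (real N * (1 - x)) powr (- \<theta>)"
      using x N by (subst powr_mult) (auto simp: powr_minus divide_simps)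
    finally show ?thesis unfolding xp by (simp add: t_def x_def)
  qed
  have "(\<lambda>N. real (nat \<lfloor>\<tau> * real N\<rfloor>) / real N) \<longlonglongrightarrow> \<tau>"
    using \<tau> by (rule nat_floor_over_tendsto)
  hence "(\<lambda>N. exp (- (real k * (real (nat \<lfloor>\<tau> * real N\<rfloor>) / real N)))) \<longlonglongrightarrow> exp (- (real k * \<tau>))"
    by (intro tendsto_intros)
  hence l1: "(\<lambda>N. exp (- (real k / real N)) ^ (nat \<lfloor>\<tau> * real N\<rfloor>)) \<longlonglongrightarrow> exp (- (\<tau> * real k))"
    by (simp add: mult_ac flip: exp_of_nat_mult)
  have l2: "(\<lambda>N. (real N * (1 - exp (- (real k / real N)))) powr (- \<theta>)) \<longlonglongrightarrow> real k powr (- \<theta>)"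
    by (intro tendsto_intros one_minus_exp_asymp) (use k in auto)
  have "(\<lambda>N. exp (- (real k / real N)) ^ (nat \<lfloor>\<tau> * real N\<rfloor>) * (real N * (1 - exp (- (real k / real N)))) powr (- \<theta>))
     \<longlonglongrightarrow> exp (- (\<tau> * real k)) * real k powr (- \<theta>)"
    by (intro tendsto_mult l1 l2)
  moreover have "\<forall>\<^sub>F N in sequentially. exp (- (real k / real N)) ^ (nat \<lfloor>\<tau> * real N\<rfloor>) * (real N * (1 - exp (- (real k / real N)))) powr (- \<theta>)
     = (\<Sum>n. shifted_coeff \<theta> \<tau> N n * exp (- (real n / real N)) ^ k)"
    using eventually_gt_at_top[of 0] by eventually_elim (use sums in \<open>simp add: sums_iff\<close>)
  ultimately have "(\<lambda>N. \<Sum>n. shifted_coeff \<theta> \<tau> N n * exp (- (real n / real N)) ^ k)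
        \<longlonglongrightarrow> exp (- (\<tau> * real k)) * real k powr (- \<theta>)"
    by (rule Lim_transform_eventually)
  moreover have "\<forall>\<^sub>F N in sequentially. summable (\<lambda>n. shifted_coeff \<theta> \<tau> N n * exp (- (real n / real N)) ^ k)"
    using eventually_gt_at_top[of 0] by eventually_elim (use sums in \<open>simp add: sums_iff\<close>)
  ultimately show ?thesis by blast
qed

lemma shifted_coeff_sum:
  fixes \<theta> \<tau> x :: real
  assumes \<theta>: "\<theta> > 0" and \<tau>: "\<tau> \<ge> 0"
  shows "(\<lambda>N. \<Sum>n | real n \<le> x * real N. shifted_coeff \<theta> \<tau> N n) \<longlonglongrightarrow> (max 0 (x - \<tau>)) powr \<theta> / Gamma (\<theta> + 1)"
proof (cases "x \<le> \<tau>")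
  case False
  hence x: "x > \<tau>" "x > 0" using \<tau> by auto
  define m where "m = (\<lambda>N. nat \<lfloor>x * real N\<rfloor> - nat \<lfloor>\<tau> * real N\<rfloor>)"
  have eq: "(\<Sum>n | real n \<le> x * real N. shifted_coeff \<theta> \<tau> N n) =
      pochhammer (\<theta> + 1) (m N) / fact (m N) / real N powr \<theta>" for N
  proof -
    define t where "t = nat \<lfloor>\<tau> * real N\<rfloor>"
    have t: "t \<le> nat \<lfloor>x * real N\<rfloor>" unfolding t_def
      using x by (intro nat_mono floor_mono mult_right_mono) auto
    have "{n. real n \<le> x * real N} = {..nat \<lfloor>x * real N\<rfloor>}"
      using x by (auto simp: le_nat_iff le_floor_iff)
    hence "(\<Sum>n | real n \<le> x * real N. shifted_coeff \<theta> \<tau> N n) = (\<Sum>n\<le>nat \<lfloor>x * real N\<rfloor>. shifted_coeff \<theta> \<tau> N n)"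
      by simp
    also have "\<dots> = (\<Sum>n\<in>{t..nat \<lfloor>x * real N\<rfloor>}. shifted_coeff \<theta> \<tau> N n)"
      by (rule sum.mono_neutral_right) (auto simp: shifted_coeff_def Let_def t_def)
    also have "\<dots> = (\<Sum>k\<le>m N. pochhammer \<theta> k / fact k / real N powr \<theta>)"
      by (rule sum.reindex_bij_witness[of _ "\<lambda>k. k + t" "\<lambda>n. n - t"])
         (use t in \<open>auto simp: m_def shifted_coeff_def Let_def simp flip: t_def\<close>)
    also have "\<dots> = (\<Sum>k\<le>m N. pochhammer \<theta> k / fact k) / real N powr \<theta>"
      by (simp add: sum_divide_distrib)
    finally show ?thesis by (simp add: sum_pochhammer_fact)
  qed
  have lim: "(\<lambda>N. real (nat \<lfloor>x * real N\<rfloor>) / real N) \<longlonglongrightarrow> x" "(\<lambda>N. real (nat \<lfloor>\<tau> * real N\<rfloor>) / real N) \<longlonglongrightarrow> \<tau>"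
    by (rule nat_floor_over_tendsto, use x \<tau> in simp)+
  have mN: "real (m N) = real (nat \<lfloor>x * real N\<rfloor>) - real (nat \<lfloor>\<tau> * real N\<rfloor>)" for N
    unfolding m_def using x by (intro of_nat_diff nat_mono floor_mono mult_right_mono) auto
  have l1: "(\<lambda>N. real (m N) / real N) \<longlonglongrightarrow> x - \<tau>"
    unfolding mN diff_divide_distrib by (intro tendsto_diff lim)
  have "filterlim (\<lambda>N. real (m N)) at_top sequentially"
  proof -
    have "filterlim (\<lambda>N. (real (m N) / real N) * real N) at_top sequentially"
      by (rule filterlim_tendsto_pos_mult_at_top[OF l1]) (use x filterlim_real_sequentially in auto)
    moreover have "\<forall>\<^sub>F N in sequentially. real (m N) / real N * real N = real (m N)"
      using eventually_gt_at_top[of 0] by eventually_elim auto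
    ultimately show ?thesis using filterlim_cong[OF refl refl] by fast
  qed
  hence "filterlim (\<lambda>N. nat \<lfloor>real (m N)\<rfloor>) at_top sequentially"
    by (intro filterlim_compose[OF filterlim_nat_sequentially] filterlim_compose[OF filterlim_floor_sequentially])
  hence m_top: "filterlim m at_top sequentially" by simp
  have "(\<lambda>N. (pochhammer (\<theta> + 1) (m N) / fact (m N) / real (m N) powr \<theta>) * (real (m N) / real N) powr \<theta>)
       \<longlonglongrightarrow> 1 / Gamma (\<theta> + 1) * (x - \<tau>) powr \<theta>"
    using filterlim_compose[OF pochhammer_fact_asymp[OF \<theta>] m_top] x
    by (intro tendsto_mult tendsto_powr l1 tendsto_const) auto
  moreover have "\<forall>\<^sub>F N in sequentially. (pochhammer (\<theta> + 1) (m N) / fact (m N) / real (m N) powr \<theta>) * (real (m N) / real N) powr \<theta>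
     = pochhammer (\<theta> + 1) (m N) / fact (m N) / real N powr \<theta>"
    using filterlim_at_top_dense[THEN iffD1, OF \<open>filterlim (\<lambda>N. real (m N)) at_top sequentially\<close>, THEN spec, of 0]
    by eventually_elim (auto simp: powr_divide)
  ultimately show ?thesis unfolding eq using x
    by (auto intro: Lim_transform_eventually)
next
  case True
  \<comment> \<open>For \<open>x \<le> \<tau>\<close> no index beyond \<open>t\<close> is reached,
    and \<open>n = t\<close> alone can contribute, with value
    \<open>1 / N powr \<theta>\<close>.\<close>
  have ev: "\<forall>\<^sub>F N in sequentially. (\<Sum>n | real n \<le> x * real N. shifted_coeff \<theta> \<tau> N n) \<le> 1 / real N powr \<theta>
     \<and> (\<Sum>n | real n \<le> x * real N. shifted_coeff \<theta> \<tau> N n) \<ge> 0"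
    using eventually_gt_at_top[of 0]
  proof eventually_elim
    case (elim N)
    define t where "t = nat \<lfloor>\<tau> * real N\<rfloor>"
    have "x * real N \<le> \<tau> * real N" using True by (intro mult_right_mono) auto
    moreover have "\<tau> * real N < real t + 1" using \<tau> unfolding t_def by linarith
    ultimately have sub: "{n. real n \<le> x * real N} \<subseteq> {..t}"
      by auto
    have "(\<Sum>n | real n \<le> x * real N. shifted_coeff \<theta> \<tau> N n) \<le> (\<Sum>n\<le>t. shifted_coeff \<theta> \<tau> N n)"
      by (rule sum_mono2) (use sub \<theta> in \<open>auto simp: shifted_coeff_nonneg\<close>)
    also have "\<dots> = (\<Sum>n\<in>{t}. shifted_coeff \<theta> \<tau> N n)"
      by (rule sum.mono_neutral_right) (auto simp: shifted_coeff_def Let_def t_def)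
    also have "\<dots> = 1 / real N powr \<theta>" by (simp add: shifted_coeff_def Let_def t_def)
    finally show ?case using \<theta> by (auto intro!: sum_nonneg shifted_coeff_nonneg)
  qed
  have "(\<lambda>N. 1 / real N powr \<theta>) \<longlonglongrightarrow> 0" using \<theta> by real_asymp
  hence "(\<lambda>N. \<Sum>n | real n \<le> x * real N. shifted_coeff \<theta> \<tau> N n) \<longlonglongrightarrow> 0"
    by (rule tendsto_sandwich[rotated -2, OF tendsto_const]) (use ev in \<open>auto elim: eventually_mono\<close>)
  moreover have "max 0 (x - \<tau>) = 0" using True by simp
  ultimately show ?thesis using \<theta> by simp
qed

text \<open>The comparison of arrays is pointwise and loses a shift of the argument. Partial sums
  are monotone and the limit is uniformly continuous, so finitely many grid points
  \<open>k / K\<close> suffice: neighbouring grid points enclose every \<open>n / N\<close>.\<close>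

lemma partial_sum_uniform:
  fixes a :: "nat \<Rightarrow> nat \<Rightarrow> real" and \<theta> \<tau> :: real
  assumes \<theta>: "\<theta> > 0" and \<tau>: "\<tau> \<ge> 0" and a0: "\<And>N n. a N n \<ge> 0"
    and sa: "\<And>k. k \<ge> 1 \<Longrightarrow> \<forall>\<^sub>F N in sequentially. summable (\<lambda>n. a N n * exp (- (real n / real N)) ^ k)"
    and la: "\<And>k. k \<ge> 1 \<Longrightarrow> (\<lambda>N. \<Sum>n. a N n * exp (- (real n / real N)) ^ k) \<longlonglongrightarrow> exp (- (\<tau> * real k)) * real k powr (- \<theta>)"
    and \<epsilon>: "\<epsilon> > 0"
  shows "\<forall>\<^sub>F N in sequentially. \<forall>n\<le>N.
     \<bar>(\<Sum>i\<le>n. a N i) - max 0 (real n / real N - \<tau>) powr \<theta> / Gamma (\<theta> + 1)\<bar> \<le> \<epsilon>"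
proof -
  define g where "g = (\<lambda>x. max 0 (x - \<tau>) powr \<theta> / Gamma (\<theta> + 1))"
  have Gpos: "Gamma (\<theta> + 1) > 0" using \<theta> by (intro Gamma_real_pos) auto
  have gmono: "g x \<le> g y" if "x \<le> y" for x y
    unfolding g_def using that \<theta> Gpos by (intro divide_right_mono powr_mono2) auto
  \<comment> \<open>The interval reaches up to 3 because the enclosure uses grid points
    \<open>(k + 2) / K\<close> with \<open>k \<le> K\<close> and \<open>K \<ge> 1\<close>.\<close>
  have "continuous_on {0..3} g"
    unfolding g_def
    by (intro continuous_on_divide continuous_on_powr' continuous_on_max continuous_intros) (use \<theta> less_imp_neq[OF Gpos] in auto)
  hence "uniformly_continuous_on {0..3} g"
    by (rule compact_uniformly_continuous) auto
  then obtain \<delta> where \<delta>: "\<delta> > 0" "\<And>x y. x \<in> {0..3} \<Longrightarrow> y \<in> {0..3} \<Longrightarrow> dist y x < \<delta> \<Longrightarrow> dist (g y) (g x) < \<epsilon> / 2"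
    unfolding uniformly_continuous_on_def using \<epsilon> by (metis half_gt_zero)
  obtain K :: nat where K: "K > 0" "3 / real K < \<delta>"
    using reals_Archimedean2[of "3 / \<delta>"] \<delta>(1)
    by (metis divide_less_eq divide_pos_pos mult.commute of_nat_0_less_iff order_less_trans zero_less_numeral)
  let ?b = "shifted_coeff \<theta> \<tau>"
  let ?S = "\<lambda>c N x. \<Sum>n | real n \<le> x * real N. c N n"
  have sb: "\<And>k. k \<ge> 1 \<Longrightarrow> \<forall>\<^sub>F N in sequentially. summable (\<lambda>n. ?b N n * exp (- (real n / real N)) ^ k)"
   and lb: "\<And>k. k \<ge> 1 \<Longrightarrow> (\<lambda>N. \<Sum>n. ?b N n * exp (- (real n / real N)) ^ k) \<longlonglongrightarrow> exp (- (\<tau> * real k)) * real k powr (- \<theta>)"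
    using shifted_coeff_laplace[OF \<theta> \<tau>] by auto
  have up: "\<forall>\<^sub>F N in sequentially. ?S a N (real k / real K) \<le> g (real (k+1) / real K) + \<epsilon>/2" for k
  proof -
    have "\<forall>\<^sub>F N in sequentially. ?S a N (real k / real K) \<le> ?S ?b N (real (k+1) / real K) + \<epsilon>/4"
      by (rule laplace_compare[where a = a and b = ?b, OF sa sb la lb a0 shifted_coeff_nonneg[OF \<theta>]])
         (use K \<epsilon> in \<open>auto simp: divide_simps\<close>)
    moreover have "\<forall>\<^sub>F N in sequentially. ?S ?b N (real (k+1) / real K) < g (real (k+1) / real K) + \<epsilon>/4"
      by (rule order_tendstoD(2)[OF shifted_coeff_sum[OF \<theta> \<tau>]]) (use \<epsilon> in \<open>auto simp: g_def\<close>)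
    ultimately show ?thesis by eventually_elim auto
  qed
  have lo: "\<forall>\<^sub>F N in sequentially. g (real k / real K) - \<epsilon>/2 \<le> ?S a N (real (k+1) / real K)" for k
  proof -
    have "\<forall>\<^sub>F N in sequentially. ?S ?b N (real k / real K) \<le> ?S a N (real (k+1) / real K) + \<epsilon>/4"
      by (rule laplace_compare[where a = ?b and b = a, OF sb sa lb la shifted_coeff_nonneg[OF \<theta>] a0])
         (use K \<epsilon> in \<open>auto simp: divide_simps\<close>)
    moreover have "\<forall>\<^sub>F N in sequentially. g (real k / real K) - \<epsilon>/4 < ?S ?b N (real k / real K)"
      by (rule order_tendstoD(1)[OF shifted_coeff_sum[OF \<theta> \<tau>]]) (use \<epsilon> in \<open>auto simp: g_def\<close>)
    ultimately show ?thesis by eventually_elim auto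
  qed
  have "\<forall>\<^sub>F N in sequentially. \<forall>k\<in>{..K+1}. ?S a N (real k / real K) \<le> g (real (k+1) / real K) + \<epsilon>/2
     \<and> g (real k / real K) - \<epsilon>/2 \<le> ?S a N (real (k+1) / real K)"
    by (intro eventually_ball_finite ballI eventually_conj up lo) auto
  thus ?thesis using eventually_gt_at_top[of 0]
  proof eventually_elim
    case (elim N)
    have N: "real N > 0" using elim by simp
    show ?case
    proof (intro allI impI)
      fix n assume n: "n \<le> N"
      define x where "x = real n / real N"
      have x: "0 \<le> x" "x \<le> 1" using n N by (auto simp: x_def)
      define k where "k = nat \<lfloor>x * real K\<rfloor>"
      have k1: "real k \<le> x * real K" "x * real K < real k + 1" using x unfolding k_def by auto
      define e where "e = 1 / real K"
      have e: "e > 0" "real k * e \<le> x" "x < real k * e + e" "3 / real K = 3 * e"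
        using k1 K(1) by (auto simp: e_def field_simps)
      have ke: "real i / real K = real i * e" for i by (simp add: e_def)
      have kK: "k \<le> K"
      proof -
        have "real k \<le> 1 * real K" using k1 x by (meson mult_right_mono of_nat_0_le_iff order_trans)
        thus ?thesis by simp
      qed
      have fin: "finite {n. real n \<le> z * real N}" for z
        by (rule finite_subset[of _ "{..nat \<lfloor>z * real N\<rfloor>}"]) (auto intro: le_nat_floor)
      have le1: "(\<Sum>i\<le>n. a N i) \<le> ?S a N (real (k+1) / real K)"
      proof (rule sum_mono2[OF fin[of "real (k+1) / real K"]])
        have "x \<le> real (k+1) / real K" using k1 K by (simp add: field_simps)
        hence "real n \<le> real (k+1) / real K * real N" using N by (simp add: x_def field_simps)
        thus "{..n} \<subseteq> {m. real m \<le> real (k+1) / real K * real N}" by auto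
      qed (use a0 in auto)
      have c: "\<bar>g y - g x\<bar> < \<epsilon> / 2" if "y \<in> {0..3}" "\<bar>y - x\<bar> < \<delta>" for y
        using \<delta>(2)[of x y] that x by (auto simp: dist_real_def)
      have "?S a N (real (k+1) / real K) \<le> g (real (k+2) / real K) + \<epsilon>/2"
        using bspec[OF elim(1), of "k+1"] kK by (auto simp: add_ac)
      moreover have "g (real (k+2) / real K) < g x + \<epsilon>/2"
      proof -
        have "real (k+2) / real K \<le> 3" using K kK by (simp add: field_simps)
        moreover have "\<bar>real (k+2) / real K - x\<bar> < 3 / real K"
          unfolding ke using e by (simp add: algebra_simps abs_less_iff)
        ultimately have "\<bar>g (real (k+2) / real K) - g x\<bar> < \<epsilon>/2" using K by (intro c) auto
        thus ?thesis by linarith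
      qed
      ultimately have U: "(\<Sum>i\<le>n. a N i) \<le> g x + \<epsilon>" using le1 by linarith
      have D: "g x - \<epsilon> \<le> (\<Sum>i\<le>n. a N i)"
      \<comment> \<open>In the first cell no grid point lies one step further down; nonnegativity of
        the sum and \<open>g 0 = 0\<close> take its place.\<close>
      proof (cases "k = 0")
        case True
        have "\<bar>g 0 - g x\<bar> < \<epsilon>/2"
        proof (rule c)
          have "x < 1 / real K" using True k1 K by (simp add: field_simps)
          also have "\<dots> \<le> 3 / real K" by (intro divide_right_mono) auto
          finally show "\<bar>0 - x\<bar> < \<delta>" using K x by linarith
        qed auto
        moreover have "g 0 = 0" using \<tau> \<theta> by (simp add: g_def)
        moreover have "(\<Sum>i\<le>n. a N i) \<ge> 0" using a0 by (intro sum_nonneg) auto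
        ultimately show ?thesis using \<epsilon> by linarith
      next
        case False
        have "g (real (k-1) / real K) - \<epsilon>/2 \<le> ?S a N (real (k-1+1) / real K)"
          using bspec[OF elim(1), of "k-1"] kK by auto
        also have "\<dots> \<le> (\<Sum>i\<le>n. a N i)"
        proof (rule sum_mono2[of "{..n}"])
          have "real k / real K \<le> x" using k1 K by (simp add: field_simps)
          hence "real k / real K * real N \<le> real n" using N by (simp add: x_def field_simps)
          thus "{m. real m \<le> real (k-1+1) / real K * real N} \<subseteq> {..n}" using False by auto
        qed (use a0 in auto)
        finally have "g (real (k-1) / real K) - \<epsilon>/2 \<le> (\<Sum>i\<le>n. a N i)" .
        moreover have "\<bar>g (real (k-1) / real K) - g x\<bar> < \<epsilon>/2"
        proof (rule c)
          show "real (k-1) / real K \<in> {0..3}" using K kK by (auto simp: field_simps)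
          have "\<bar>real (k-1) / real K - x\<bar> < 3 / real K"
            unfolding ke using e False by (simp add: algebra_simps abs_less_iff of_nat_diff)
          thus "\<bar>real (k-1) / real K - x\<bar> < \<delta>" using K by auto
        qed
        ultimately show ?thesis by linarith
      qed
      show "\<bar>(\<Sum>i\<le>n. a N i) - max 0 (real n / real N - \<tau>) powr \<theta> / Gamma (\<theta> + 1)\<bar> \<le> \<epsilon>"
        using U D by (simp add: g_def x_def abs_le_iff)
    qed
  qed
qed

section \<open>Coefficients of exponentials with nearly constant weights\<close>

text \<open>The factor \<open>min 1 u\<close> joins a quadratic bound for small \<open>u\<close> to
  a linear one for large \<open>u\<close>, so that concentrated mass and its tail can be estimated
  in one formula.\<close>

lemma exp_minus_taylor1:
  fixes u :: real
  assumes "u \<ge> 0"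
  shows "\<bar>1 - exp (- u) - u\<bar> \<le> u * min 1 u"
proof -
  have 1: "1 - u \<le> exp (- u)" using exp_ge_add_one_self[of "-u"] by simp
  have 2: "exp (- u) \<le> 1" using assms by simp
  have "exp (- u) \<le> 1 / (1 + u)"
    using exp_ge_add_one_self[of u] assms by (simp add: exp_minus divide_simps)
  also have "\<dots> \<le> 1 - u + u * u" using assms by (simp add: divide_simps) (simp add: algebra_simps)
  finally have 3: "exp (- u) \<le> 1 - u + u * u" .
  show ?thesis using 1 2 3 assms by (auto simp: min_def)
qed

text \<open>The mass of \<open>W N - \<theta>\<close>, of order \<open>\<tau> N\<close>, sits at indices \<open>o(N)\<close>; hence on the scale
  \<open>1 - z = O(1 / N)\<close> the function \<open>exp (G N z)\<close> behaves like \<open>exp (F N) z\<^sup>\<tau>\<^sup>N (1 - z)\<^sup>-\<^sup>\<theta>\<close>.\<close>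
locale exp_coeff =
  fixes \<theta> \<tau> p C :: real and W :: "nat \<Rightarrow> nat \<Rightarrow> real"
  assumes \<theta>: "\<theta> > 0" and \<tau>: "\<tau> \<ge> 0" and p: "p > 0" and C: "C \<ge> 0"
    and W_nonneg: "\<And>N j. W N j \<ge> 0"
    and summable_dev: "\<forall>\<^sub>F N in sequentially. summable (\<lambda>j. \<bar>W N (Suc j) - \<theta>\<bar>)"
    and mean_dev: "(\<lambda>N. (\<Sum>j. W N (Suc j) - \<theta>) / real N) \<longlonglongrightarrow> \<tau>"
    and mean_abs_dev: "(\<lambda>N. (\<Sum>j. \<bar>W N (Suc j) - \<theta>\<bar>) / real N) \<longlonglongrightarrow> \<tau>"
    and W_bound: "\<forall>\<^sub>F N in sequentially. \<forall>j\<ge>1. W N j \<le> C * (1 + (real N / real j) powr p)"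
    and tail_sum: "\<And>\<eta>. \<eta> > 0 \<Longrightarrow>
       (\<lambda>N. (\<Sum>j. if real (Suc j) > \<eta> * real N then \<bar>W N (Suc j) - \<theta>\<bar> else 0) / real N) \<longlonglongrightarrow> 0"
    and tail_sup: "\<And>\<eta> \<epsilon>. \<eta> > 0 \<Longrightarrow> \<epsilon> > 0 \<Longrightarrow>
       \<forall>\<^sub>F N in sequentially. \<forall>j. real j > \<eta> * real N \<longrightarrow> \<bar>W N j - \<theta>\<bar> \<le> \<epsilon>"
begin

section \<open>Laplace transforms and partial sums of the normalised coefficients\<close>

definition G :: "nat \<Rightarrow> real fps" where
  "G N = Abs_fps (\<lambda>j. if j = 0 then 0 else W N j / real j)"

definition h :: "nat \<Rightarrow> nat \<Rightarrow> real" where "h N n = fps_nth (fps_exp 1 oo G N) n"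

definition F :: "nat \<Rightarrow> real" where "F N = (\<Sum>j. (W N (Suc j) - \<theta>) / real (Suc j))"

text \<open>Normalised so that the goal reads: \<open>x N n\<close> is close to a fixed profile at
  \<open>n / N\<close>.\<close>

definition x :: "nat \<Rightarrow> nat \<Rightarrow> real" where "x N n = h N n / (exp (F N) * real N powr (\<theta> - 1))"

lemma G_nonneg: "fps_nth (G N) n \<ge> 0"
  using W_nonneg by (simp add: G_def)

lemma h_nonneg: "h N n \<ge> 0"
  unfolding h_def by (rule fps_exp_compose_nonneg) (rule G_nonneg)

lemma x_nonneg: "x N n \<ge> 0"
  unfolding x_def using h_nonneg by auto

lemma h_rec: "real n * h N n = (\<Sum>j=1..n. W N j * h N (n - j))"
proof -
  have "real n * h N n = (\<Sum>j=1..n. real j * fps_nth (G N) j * h N (n - j))"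
    unfolding h_def by (rule fps_exp_compose_rec) (simp add: G_def)
  also have "\<dots> = (\<Sum>j=1..n. W N j * h N (n - j))"
    by (rule sum.cong) (auto simp: G_def)
  finally show ?thesis .
qed

lemma x_rec: "real n * x N n = (\<Sum>j=1..n. W N j * x N (n - j))"
  unfolding x_def times_divide_eq_right h_rec by (simp add: sum_divide_distrib)

text \<open>The constant part \<theta> of the weights sums to \<open>- \<theta> * ln (1 - y)\<close>
  and produces the factor \<open>(1 - y) powr - \<theta>\<close>. The deviations left in the
  exponent are summable even without the help of \<open>y ^ j / j\<close>.\<close>

lemma h_sums:
  assumes s: "summable (\<lambda>j. \<bar>W N (Suc j) - \<theta>\<bar>)" and y: "0 < y" "y < 1"
  shows "(\<lambda>n. h N n * y ^ n) sums ((1 - y) powr (- \<theta>) * exp (\<Sum>j. (W N (Suc j) - \<theta>) / real (Suc j) * y ^ Suc j))"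
proof -
  have "(\<lambda>n. - ((- (- y)) ^ n) / real n) sums ln (1 + (- y))"
    by (rule ln_series') (use y in auto)
  hence "(\<lambda>n. - \<theta> * (- (y ^ n) / real n)) sums (- \<theta> * ln (1 - y))"
    by (intro sums_mult) simp
  hence s1: "(\<lambda>n. - \<theta> * (- (y ^ Suc n) / real (Suc n))) sums (- \<theta> * ln (1 - y))"
    by (subst sums_Suc_iff) simp
  have "summable (\<lambda>j. \<bar>(W N (Suc j) - \<theta>) / real (Suc j) * y ^ Suc j\<bar>)"
  proof (rule summable_comparison_test'[OF s, of 0])
    fix j :: nat
    have "y ^ Suc j \<le> 1" using y by (intro power_le_one) auto
    hence "y ^ Suc j / real (Suc j) \<le> 1" using y by (simp add: divide_simps del: power_Suc)
    hence "\<bar>W N (Suc j) - \<theta>\<bar> * (y ^ Suc j / real (Suc j)) \<le> \<bar>W N (Suc j) - \<theta>\<bar>"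
      by (intro mult_left_le) auto
    thus "norm \<bar>(W N (Suc j) - \<theta>) / real (Suc j) * y ^ Suc j\<bar> \<le> \<bar>W N (Suc j) - \<theta>\<bar>"
      using y by (simp add: abs_mult del: power_Suc)
  qed
  hence s2: "(\<lambda>j. (W N (Suc j) - \<theta>) / real (Suc j) * y ^ Suc j) sums (\<Sum>j. (W N (Suc j) - \<theta>) / real (Suc j) * y ^ Suc j)"
    by (rule summable_sums[OF summable_rabs_cancel])
  have "(\<lambda>n. fps_nth (G N) (Suc n) * y ^ Suc n) sums (- \<theta> * ln (1 - y) + (\<Sum>j. (W N (Suc j) - \<theta>) / real (Suc j) * y ^ Suc j))"
  proof (rule sums_cong[THEN iffD1, OF _ sums_add[OF s1 s2]])
    fix n :: nat
    have "- \<theta> * (- z / m) + (w - \<theta>) / m * z = w / m * z" for w m z :: real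
      by (simp add: diff_divide_distrib algebra_simps)
    thus "- \<theta> * (- (y ^ Suc n) / real (Suc n)) + (W N (Suc n) - \<theta>) / real (Suc n) * y ^ Suc n
        = fps_nth (G N) (Suc n) * y ^ Suc n"
      by (simp add: G_def)
  qed
  hence "(\<lambda>n. fps_nth (G N) n * y ^ n) sums (- \<theta> * ln (1 - y) + (\<Sum>j. (W N (Suc j) - \<theta>) / real (Suc j) * y ^ Suc j))"
    by (subst (asm) sums_Suc_iff) (simp add: G_def)
  hence "(\<lambda>n. h N n * y ^ n) sums exp (- \<theta> * ln (1 - y) + (\<Sum>j. (W N (Suc j) - \<theta>) / real (Suc j) * y ^ Suc j))"
    unfolding h_def by (intro fps_exp_compose_sums G_nonneg) (use y in \<open>auto simp: G_def\<close>)
  thus ?thesis using y unfolding exp_add by (simp add: powr_def)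
qed

text \<open>For \<open>j = o(N)\<close> the quotient \<open>(exp (- k j / N) - 1) / j\<close> is
  close to \<open>- k / N\<close>, so the concentrated deviations contribute \<open>- k\<close>
  times their mean, which tends to \<tau>. \<open>D\<close> collects the error of this
  linearisation.\<close>

lemma dev_limit:
  assumes k: "k \<ge> 1"
  shows "(\<lambda>N. (\<Sum>j. (W N (Suc j) - \<theta>) / real (Suc j) * exp (- (real k / real N)) ^ Suc j) - F N) \<longlonglongrightarrow> - (\<tau> * real k)"
proof -
  define D where "D = (\<lambda>N. (\<Sum>j. (W N (Suc j) - \<theta>) / real (Suc j) * exp (- (real k / real N)) ^ Suc j) - F N
     + real k * ((\<Sum>j. W N (Suc j) - \<theta>) / real N))"
  have "D \<longlonglongrightarrow> 0"
  proof (rule LIMSEQ_I)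
    fix \<epsilon> :: real assume \<epsilon>: "\<epsilon> > 0"
    \<comment> \<open>With this choice the indices \<open>j \<le> \<eta> * N\<close> contribute at
      most \<open>k * k * \<eta> * (\<tau> + 1) = \<epsilon> / 4\<close>; the tail adds at most
      another \<open>\<epsilon> / 4\<close>.\<close>
    define \<eta> where "\<eta> = \<epsilon> / (4 * real k * real k * (\<tau> + 1))"
    have \<eta>: "\<eta> > 0" using \<epsilon> k \<tau> by (simp add: \<eta>_def)
    have e1: "\<forall>\<^sub>F N in sequentially. (\<Sum>j. \<bar>W N (Suc j) - \<theta>\<bar>) / real N < \<tau> + 1"
      by (rule order_tendstoD(2)[OF mean_abs_dev]) simp
    have e2: "\<forall>\<^sub>F N in sequentially. (\<Sum>j. if real (Suc j) > \<eta> * real N then \<bar>W N (Suc j) - \<theta>\<bar> else 0) / real N < \<epsilon> / (4 * real k)"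
      by (rule order_tendstoD(2)[OF tail_sum[OF \<eta>]]) (use \<epsilon> k in auto)
    have "\<forall>\<^sub>F N in sequentially. norm (D N - 0) < \<epsilon>"
      using e1 e2 summable_dev eventually_gt_at_top[of 0]
    proof eventually_elim
      case (elim N)
      define v where "v = (\<lambda>j. W N (Suc j) - \<theta>)"
      define t where "t = (\<lambda>j. if real (Suc j) > \<eta> * real N then \<bar>v j\<bar> else 0)"
      define y where "y = exp (- (real k / real N))"
      have sv: "summable (\<lambda>j. \<bar>v j\<bar>)" using elim by (simp add: v_def)
      have st: "summable t"
        by (rule summable_comparison_test'[OF sv, of 0]) (auto simp: t_def)
      have sv0: "summable v" using sv by (rule summable_rabs_cancel)
      have y: "0 < y" "y \<le> 1" by (auto simp: y_def)
      have s1: "summable (\<lambda>j. v j / real (Suc j) * y ^ Suc j)"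
      proof (rule summable_rabs_cancel, rule summable_comparison_test'[OF sv, of 0])
        fix j :: nat
        have "y ^ Suc j \<le> 1" using y by (intro power_le_one) auto
        hence "y ^ Suc j / real (Suc j) \<le> 1" using y by (simp add: divide_simps del: power_Suc)
        hence "\<bar>v j\<bar> * (y ^ Suc j / real (Suc j)) \<le> \<bar>v j\<bar>"
          by (intro mult_left_le) auto
        thus "norm \<bar>v j / real (Suc j) * y ^ Suc j\<bar> \<le> \<bar>v j\<bar>"
          using y by (simp add: abs_mult del: power_Suc)
      qed
      have s2: "summable (\<lambda>j. v j / real (Suc j))"
      proof (rule summable_rabs_cancel, rule summable_comparison_test'[OF sv, of 0])
        fix j :: nat
        have "\<bar>v j\<bar> * 1 \<le> \<bar>v j\<bar> * real (Suc j)" by (intro mult_left_mono) auto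
        thus "norm \<bar>v j / real (Suc j)\<bar> \<le> \<bar>v j\<bar>"
          by (simp add: divide_le_eq)
      qed
      have s3: "summable (\<lambda>j. real k / real N * v j)" using sv0 by (rule summable_mult)
      have Deq: "D N = (\<Sum>j. v j / real (Suc j) * y ^ Suc j - v j / real (Suc j) + real k / real N * v j)"
        using suminf_add[OF summable_diff[OF s1 s2] s3] suminf_diff[OF s1 s2] suminf_mult[OF sv0, of "real k / real N"]
        by (simp add: D_def F_def v_def y_def)
      have bnd: "\<bar>v j / real (Suc j) * y ^ Suc j - v j / real (Suc j) + real k / real N * v j\<bar>
          \<le> real k / real N * (real k * \<eta> * \<bar>v j\<bar> + t j)" for j
      proof -
        define u where "u = real k * real (Suc j) / real N"
        have u: "u \<ge> 0" by (simp add: u_def)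
        have yu: "y ^ Suc j = exp (- u)"
          unfolding y_def u_def exp_of_nat_mult[symmetric] by (simp add: field_simps)
        have alg: "a / m * e - a / m + real k / real N * a = - (a / m) * (1 - e - real k * m / real N)"
          if "m \<noteq> 0" for a m e :: real using that elim by (simp add: field_simps)
        have "v j / real (Suc j) * y ^ Suc j - v j / real (Suc j) + real k / real N * v j =
            - (v j / real (Suc j)) * (1 - exp (- u) - u)"
          unfolding yu unfolding u_def by (rule alg) simp
        hence "\<bar>v j / real (Suc j) * y ^ Suc j - v j / real (Suc j) + real k / real N * v j\<bar> =
            \<bar>v j\<bar> / real (Suc j) * \<bar>1 - exp (- u) - u\<bar>"
          by (simp add: abs_mult)
        also have "\<dots> \<le> \<bar>v j\<bar> / real (Suc j) * (u * min 1 u)"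
          by (intro mult_left_mono exp_minus_taylor1 u) auto
        also have "\<dots> = real k / real N * (\<bar>v j\<bar> * min 1 u)"
          by (simp add: u_def)
        also have "\<dots> \<le> real k / real N * (real k * \<eta> * \<bar>v j\<bar> + t j)"
        proof (intro mult_left_mono)
          show "\<bar>v j\<bar> * min 1 u \<le> real k * \<eta> * \<bar>v j\<bar> + t j"
          proof (cases "real (Suc j) > \<eta> * real N")
            case True
            have "\<bar>v j\<bar> * min 1 u \<le> \<bar>v j\<bar>" by (intro mult_left_le) auto
            thus ?thesis using True \<eta> by (simp add: t_def add_increasing)
          next
            case False
            hence "real k * real (Suc j) \<le> real k * (\<eta> * real N)" by (intro mult_left_mono) auto
            hence "u \<le> real k * \<eta>" using elim(4) unfolding u_def
              by (simp add: pos_divide_le_eq mult.assoc)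
            hence "\<bar>v j\<bar> * min 1 u \<le> \<bar>v j\<bar> * (real k * \<eta>)" by (intro mult_left_mono) auto
            thus ?thesis using False by (simp add: t_def mult_ac)
          qed
        qed auto
        finally show ?thesis .
      qed
      have srhs: "summable (\<lambda>j. real k / real N * (real k * \<eta> * \<bar>v j\<bar> + t j))"
        by (intro summable_mult summable_add sv st)
      have sabs: "summable (\<lambda>j. \<bar>v j / real (Suc j) * y ^ Suc j - v j / real (Suc j) + real k / real N * v j\<bar>)"
        by (rule summable_comparison_test'[OF srhs, of 0]) (use bnd in auto)
      have "\<bar>D N\<bar> \<le> (\<Sum>j. real k / real N * (real k * \<eta> * \<bar>v j\<bar> + t j))"
        unfolding Deq by (rule order_trans[OF summable_rabs[OF sabs] suminf_le[OF bnd sabs srhs]])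
      also have "\<dots> = real k / real N * (real k * \<eta> * (\<Sum>j. \<bar>v j\<bar>) + (\<Sum>j. t j))"
        using suminf_add[OF summable_mult[OF sv] st, of "real k * \<eta>"] suminf_mult[OF sv, of "real k * \<eta>"]
          suminf_mult[OF summable_add[OF summable_mult[OF sv] st], of "real k / real N" "real k * \<eta>"] by simp
      also have "\<dots> = real k * (real k * \<eta> * ((\<Sum>j. \<bar>v j\<bar>) / real N)) + real k * ((\<Sum>j. t j) / real N)"
        by (simp add: algebra_simps add_divide_distrib)
      also have "\<dots> \<le> real k * (real k * \<eta> * (\<tau> + 1)) + real k * (\<epsilon> / (4 * real k))"
        unfolding t_def v_def
        by (intro add_mono mult_left_mono less_imp_le[OF elim(1)] less_imp_le[OF elim(2)]) (use \<eta> in auto)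
      also have "\<dots> = \<epsilon> / 2" using k \<tau> by (simp add: \<eta>_def field_simps add_nonneg_eq_0_iff)
      also have "\<dots> < \<epsilon>" using \<epsilon> by simp
      finally show "norm (D N - 0) < \<epsilon>" by simp
    qed
    thus "\<exists>no. \<forall>n\<ge>no. norm (D n - 0) < \<epsilon>" by (simp add: eventually_sequentially)
  qed
  from tendsto_diff[OF this tendsto_mult[OF tendsto_const[of "real k"] mean_dev]]
  show ?thesis by (simp add: D_def mult.commute)
qed

text \<open>At \<open>y = exp (- k / N)\<close> the factor
  \<open>(N * (1 - y)) powr - \<theta>\<close> tends to \<open>k powr - \<theta>\<close>, and the
  normalisation by \<open>exp (F N)\<close> leaves exactly the difference treated in
  \<open>dev_limit\<close>. The result is the transform of the reference array.\<close>

lemma laplace_x: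
  assumes k: "k \<ge> 1"
  shows "(\<forall>\<^sub>F N in sequentially. summable (\<lambda>n. x N n / real N * exp (- (real n / real N)) ^ k))
    \<and> (\<lambda>N. \<Sum>n. x N n / real N * exp (- (real n / real N)) ^ k) \<longlonglongrightarrow> exp (- (\<tau> * real k)) * real k powr (- \<theta>)"
proof -
  let ?S = "\<lambda>N. (\<Sum>j. (W N (Suc j) - \<theta>) / real (Suc j) * exp (- (real k / real N)) ^ Suc j)"
  have ev: "\<forall>\<^sub>F N in sequentially. (\<lambda>n. x N n / real N * exp (- (real n / real N)) ^ k) sums
     ((real N * (1 - exp (- (real k / real N)))) powr (- \<theta>) * exp (?S N - F N))"
    using summable_dev eventually_gt_at_top[of 0]
  proof eventually_elim
    case (elim N)
    define y where "y = exp (- (real k / real N))"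
    have y: "0 < y" "y < 1" using elim k by (auto simp: y_def)
    have yp: "exp (- (real n / real N)) ^ k = y ^ n" for n
      by (simp add: y_def mult.commute flip: exp_of_nat_mult)
    have Np: "real N powr \<theta> = real N powr (\<theta> - 1) * real N"
      using elim powr_add[of "real N" "\<theta> - 1" 1] by simp
    have "(\<lambda>n. h N n * y ^ n / (exp (F N) * real N powr \<theta>)) sums
       ((1 - y) powr (- \<theta>) * exp (?S N) / (exp (F N) * real N powr \<theta>))"
      unfolding y_def by (intro sums_divide h_sums elim) (use y in \<open>auto simp: y_def\<close>)
    also have "(1 - y) powr (- \<theta>) * exp (?S N) / (exp (F N) * real N powr \<theta>) =
        (real N * (1 - y)) powr (- \<theta>) * exp (?S N - F N)"
      using y by (subst powr_mult) (auto simp: powr_minus exp_diff field_simps)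
    also have "(\<lambda>n. h N n * y ^ n / (exp (F N) * real N powr \<theta>)) = (\<lambda>n. x N n / real N * exp (- (real n / real N)) ^ k)"
      unfolding yp x_def Np by (simp add: mult_ac)
    finally show ?case by (simp add: y_def)
  qed
  have "(\<lambda>N. (real N * (1 - exp (- (real k / real N)))) powr (- \<theta>) * exp (?S N - F N))
      \<longlonglongrightarrow> real k powr (- \<theta>) * exp (- (\<tau> * real k))"
    by (intro tendsto_intros one_minus_exp_asymp dev_limit) (use k in auto)
  moreover have "\<forall>\<^sub>F N in sequentially. (real N * (1 - exp (- (real k / real N)))) powr (- \<theta>) * exp (?S N - F N)
      = (\<Sum>n. x N n / real N * exp (- (real n / real N)) ^ k)"
    using ev by eventually_elim (simp add: sums_iff)
  ultimately have "(\<lambda>N. \<Sum>n. x N n / real N * exp (- (real n / real N)) ^ k) \<longlonglongrightarrow> exp (- (\<tau> * real k)) * real k powr (- \<theta>)"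
    by (subst mult.commute) (rule Lim_transform_eventually)
  thus ?thesis using ev by (auto elim!: eventually_mono simp: sums_iff)
qed

lemma partial_sums:
  assumes "\<epsilon> > 0"
  shows "\<forall>\<^sub>F N in sequentially. \<forall>n\<le>N.
     \<bar>(\<Sum>i\<le>n. x N i) / real N - max 0 (real n / real N - \<tau>) powr \<theta> / Gamma (\<theta> + 1)\<bar> \<le> \<epsilon>"
proof -
  have "\<forall>\<^sub>F N in sequentially. \<forall>n\<le>N.
     \<bar>(\<Sum>i\<le>n. x N i / real N) - max 0 (real n / real N - \<tau>) powr \<theta> / Gamma (\<theta> + 1)\<bar> \<le> \<epsilon>"
    using partial_sum_uniform[OF \<theta> \<tau>, of "\<lambda>N n. x N n / real N" \<epsilon>] laplace_x x_nonneg assms by simp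
  thus ?thesis by (simp add: sum_divide_distrib)
qed

lemma total_bound: "\<forall>\<^sub>F N in sequentially. (\<Sum>i\<le>N. x N i) \<le> (1 / Gamma (\<theta> + 1) + 1) * real N"
  using partial_sums[of 1, OF zero_less_one] eventually_gt_at_top[of 0]
proof eventually_elim
  case (elim N)
  have "Gamma (\<theta> + 1) > 0" using \<theta> by (intro Gamma_real_pos) auto
  have "max 0 (real N / real N - \<tau>) powr \<theta> \<le> 1 powr \<theta>"
    using \<tau> \<theta> elim by (intro powr_mono2) auto
  hence "max 0 (real N / real N - \<tau>) powr \<theta> / Gamma (\<theta> + 1) \<le> 1 / Gamma (\<theta> + 1)"
    using \<open>Gamma (\<theta> + 1) > 0\<close> by (intro divide_right_mono) auto
  moreover have "(\<Sum>i\<le>N. x N i) / real N \<le> max 0 (real N / real N - \<tau>) powr \<theta> / Gamma (\<theta> + 1) + 1"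
    using elim(1)[rule_format, of N] by linarith
  ultimately have "(\<Sum>i\<le>N. x N i) / real N \<le> 1 / Gamma (\<theta> + 1) + 1" by linarith
  thus ?case using elim by (simp add: divide_le_eq)
qed

end

section \<open>A priori bound above the critical index, and the limit profile\<close>

context exp_coeff begin

text \<open>The numerator bounds the mass of the short jumps divided by \<open>N\<close>. In the
  denominator, \<open>\<tau> + e/2\<close> bounds \<open>n / N\<close> from below and the power
  measures the weight lost in a short jump. At \<eta> = 0 the quotient is below 1, and continuity
  from the right gives a positive \<eta>.\<close>

lemma contraction_parameter:
  assumes e: "e > 0"
  obtains \<eta> where "0 < \<eta>" "\<eta> \<le> 1/2" "(\<tau> + e/8 + \<theta> * \<eta>) / ((\<tau> + e/2) * (1 - \<eta>) powr p) < 1"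
proof -
  have "((\<lambda>\<eta>. (\<tau> + e/8 + \<theta> * \<eta>) / ((\<tau> + e/2) * (1 - \<eta>) powr p)) \<longlongrightarrow> (\<tau> + e/8 + \<theta> * 0) / ((\<tau> + e/2) * (1 - 0) powr p)) (at_right 0)"
    using e \<tau> by (intro tendsto_intros) auto
  moreover have "(\<tau> + e/8 + \<theta> * 0) / ((\<tau> + e/2) * (1 - 0) powr p) < 1"
    using e \<tau> by (simp add: divide_less_eq)
  ultimately have "\<forall>\<^sub>F \<eta> in at_right 0. (\<tau> + e/8 + \<theta> * \<eta>) / ((\<tau> + e/2) * (1 - \<eta>) powr p) < 1"
    by (rule order_tendstoD(2))
  moreover have "\<forall>\<^sub>F \<eta> in at_right (0::real). \<eta> \<in> {0<..<1/2}"
    by (rule eventually_at_right_real) simp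
  ultimately have "\<forall>\<^sub>F \<eta> in at_right 0. 0 < \<eta> \<and> \<eta> \<le> 1/2 \<and> (\<tau> + e/8 + \<theta> * \<eta>) / ((\<tau> + e/2) * (1 - \<eta>) powr p) < 1"
    by eventually_elim auto
  hence "\<exists>\<eta>. 0 < \<eta> \<and> \<eta> \<le> 1/2 \<and> (\<tau> + e/8 + \<theta> * \<eta>) / ((\<tau> + e/2) * (1 - \<eta>) powr p) < 1"
    by (rule eventually_happens'[rotated]) simp
  thus ?thesis using that by blast
qed

text \<open>The weight \<open>(n - a N)\<^sup>p\<close> is chosen so that a jump of size comparable to its distance to the
  critical point costs only \<open>O(N\<^sup>p)\<close>, while shorter jumps are a contraction since their total mass is
  at most about \<open>\<tau> N < a N\<close>.\<close>
lemma x_bounded: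
  assumes e: "e > 0"
  obtains B where "B > 0" "\<forall>\<^sub>F N in sequentially. \<forall>n\<le>N. (\<tau> + e) * real N \<le> real n \<longrightarrow> x N n \<le> B"
proof -
  obtain \<eta> where \<eta>: "0 < \<eta>" "\<eta> \<le> 1/2" and r1: "(\<tau> + e/8 + \<theta> * \<eta>) / ((\<tau> + e/2) * (1 - \<eta>) powr p) < 1"
    using contraction_parameter[OF e] by metis
  define r where "r = (\<tau> + e/8 + \<theta> * \<eta>) / ((\<tau> + e/2) * (1 - \<eta>) powr p)"
  define a where "a = \<tau> + e/2"
  have a: "a > 0" using \<tau> e by (simp add: a_def)
  define B1 where "B1 = 1 / Gamma (\<theta> + 1) + 1"
  have B1: "B1 > 0" using Gamma_real_pos[of "\<theta> + 1"] \<theta> by (simp add: B1_def add_pos_pos)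
  \<comment> \<open>The cost of all long jumps: the weight bound times the partial sum
    \<open>B1 * N\<close>, after division by \<open>n \<ge> a * N\<close>.\<close>
  define K where "K = C * (1 + (1/\<eta>) powr p) * B1 / a"
  have K: "K \<ge> 0" using C B1 a by (auto simp: K_def)
  define B where "B = K / (1 - r) * (2 / e) powr p + 1"
  have r: "r < 1" using r1 by (simp add: r_def)
  have B: "B > 0" using K r by (auto simp: B_def intro!: add_nonneg_pos)
  have e1: "\<forall>\<^sub>F N in sequentially. (\<Sum>j. \<bar>W N (Suc j) - \<theta>\<bar>) / real N < \<tau> + e/8"
    by (rule order_tendstoD(2)[OF mean_abs_dev]) (use e in simp)
  have "\<forall>\<^sub>F N in sequentially. \<forall>n\<le>N. (\<tau> + e) * real N \<le> real n \<longrightarrow> x N n \<le> B"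
    using e1 summable_dev W_bound total_bound eventually_gt_at_top[of 0]
  proof eventually_elim
    case (elim N)
    have N: "real N > 0" using elim by simp
    define w where "w = (\<lambda>n. (real n - a * real N) powr p)"
    define S where "S = {n. a * real N < real n \<and> n \<le> N}"
    have finS: "finite S" by (rule finite_subset[of _ "{..N}"]) (auto simp: S_def)
    show ?case
    proof (intro allI impI)
      fix n0 assume n0: "n0 \<le> N" "(\<tau> + e) * real N \<le> real n0"
      have eN: "e / 2 * real N \<le> real n0 - a * real N" using n0 by (simp add: a_def algebra_simps)
      moreover have "e / 2 * real N > 0" using e N by simp
      ultimately have n0S: "n0 \<in> S" using n0 by (auto simp: S_def)
      \<comment> \<open>A maximum over finitely many indices for a fixed \<open>N\<close>, hence
        finite a priori; the aim is a bound of order \<open>N powr p\<close> with a constant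
        independent of \<open>N\<close>.\<close>
      define Q where "Q = Max ((\<lambda>n. w n * x N n) ` S)"
      have Q: "w n * x N n \<le> Q" if "n \<in> S" for n
        unfolding Q_def using finS that by (intro Max_ge) auto
      have Q0: "Q \<ge> 0" using Q[OF n0S] x_nonneg[of N n0] by (auto simp: w_def intro: order_trans[rotated])
      have claim: "w n * x N n \<le> r * Q + K * real N powr p" if n: "n \<in> S" for n
      proof -
        have nN: "a * real N < real n" "n \<le> N" using n by (auto simp: S_def)
        define D where "D = real n - a * real N"
        have D: "D > 0" "D \<le> real N" using nN a N by (auto simp: D_def intro: order_trans[of _ "real n"])
        have main: "w n * (W N j * x N (n - j)) \<le>
            (if real j \<le> \<eta> * real N then W N j * ((1 - \<eta>) powr (-p) * Q) else 0)
            + C * real N powr p * (1 + (1/\<eta>) powr p) * x N (n - j)" if j: "j \<in> {1..n}" for j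
        \<comment> \<open>Jumps are measured against the distance \<open>D\<close> from
          \<open>a * N\<close>. A short one stays in \<open>S\<close> and shrinks the distance by a
          factor of at least \<open>1 - \<eta>\<close>, so the maximum \<open>Q\<close> applies. For
          a long one, \<open>D powr p\<close> absorbs the singular part
          \<open>(N / j) powr p\<close> of the weight bound up to a constant times
          \<open>N powr p\<close>.\<close>
        proof (cases "real j \<le> \<eta> * D")
          case True
          have jn: "real (n - j) = real n - real j" using j by auto
          have D': "real (n - j) - a * real N \<ge> (1 - \<eta>) * D"
            using True unfolding jn by (simp add: D_def algebra_simps)
          have D'': "(1 - \<eta>) * D > 0" using D \<eta> by simp
          have S': "n - j \<in> S" using D' D'' nN by (auto simp: S_def)
          have w': "w (n - j) \<ge> (1 - \<eta>) powr p * w n"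
          proof -
            have "(1 - \<eta>) powr p * w n = ((1 - \<eta>) * D) powr p"
              using D \<eta> by (simp add: w_def D_def powr_mult)
            also have "\<dots> \<le> w (n - j)" unfolding w_def
              using D' D'' p by (intro powr_mono2) auto
            finally show ?thesis .
          qed
          have "w n * x N (n - j) = (1 - \<eta>) powr (-p) * (((1 - \<eta>) powr p * w n) * x N (n - j))"
            using \<eta> by (simp add: powr_minus field_simps)
          also have "\<dots> \<le> (1 - \<eta>) powr (-p) * (w (n - j) * x N (n - j))"
            by (intro mult_left_mono mult_right_mono w' x_nonneg) auto
          also have "\<dots> \<le> (1 - \<eta>) powr (-p) * Q"
            by (intro mult_left_mono Q S') auto
          finally have "W N j * (w n * x N (n - j)) \<le> W N j * ((1 - \<eta>) powr (-p) * Q)"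
            by (intro mult_left_mono W_nonneg)
          moreover have "real j \<le> \<eta> * real N" using True D \<eta> by (meson mult_left_mono less_imp_le order_trans)
          moreover have "0 \<le> C * real N powr p * (1 + (1/\<eta>) powr p) * x N (n - j)"
            using C x_nonneg by auto
          ultimately show ?thesis by (simp add: mult.left_commute)
        next
          case False
          have j1: "real j \<ge> 1" using j by auto
          have w1: "w n \<le> real N powr p" unfolding w_def D_def[symmetric]
            using D p by (intro powr_mono2) auto
          have "D * (real N / real j) \<le> real N * (1 / \<eta>)"
            using False \<eta> j1 N D by (simp add: field_simps) 
          hence "(D * (real N / real j)) powr p \<le> (real N * (1 / \<eta>)) powr p"
            using D p N j1 by (intro powr_mono2) auto
          hence w2: "w n * (real N / real j) powr p \<le> real N powr p * (1/\<eta>) powr p"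
            unfolding w_def D_def[symmetric] powr_mult[of D "real N / real j"] powr_mult[of "real N" "1 / \<eta>"]
            by simp
          have "w n * W N j \<le> w n * (C * (1 + (real N / real j) powr p))"
            using elim(3) j by (intro mult_left_mono) (auto simp: w_def)
          also have "\<dots> = C * (w n + w n * (real N / real j) powr p)" by (simp add: algebra_simps)
          also have "\<dots> \<le> C * (real N powr p + real N powr p * (1/\<eta>) powr p)"
            by (intro mult_left_mono add_mono w1 w2 C)
          also have "\<dots> = C * real N powr p * (1 + (1/\<eta>) powr p)" by (simp add: algebra_simps)
          finally have "w n * W N j * x N (n - j) \<le> C * real N powr p * (1 + (1/\<eta>) powr p) * x N (n - j)"
            by (intro mult_right_mono x_nonneg)
          moreover have "0 \<le> (if real j \<le> \<eta> * real N then W N j * ((1 - \<eta>) powr (-p) * Q) else 0)"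
            using W_nonneg Q0 by auto
          ultimately show ?thesis by (simp add: mult.assoc)
        qed
        have sumW: "(\<Sum>j\<in>{1..n}. if real j \<le> \<eta> * real N then W N j else 0) \<le> (\<tau> + e/8 + \<theta> * \<eta>) * real N"
        proof -
          have "(\<Sum>j\<in>{1..n}. if real j \<le> \<eta> * real N then W N j else 0) \<le>
              (\<Sum>j\<in>{1..n}. \<bar>W N j - \<theta>\<bar> + (if real j \<le> \<eta> * real N then \<theta> else 0))"
            by (intro sum_mono) (auto split: if_splits)
          also have "\<dots> = (\<Sum>j<n. \<bar>W N (Suc j) - \<theta>\<bar>) + (\<Sum>j\<in>{1..n}. if real j \<le> \<eta> * real N then \<theta> else 0)"
            by (simp only: sum.distrib) (simp add: sum.atLeast1_atMost_eq)
          also have "(\<Sum>j<n. \<bar>W N (Suc j) - \<theta>\<bar>) \<le> (\<Sum>j. \<bar>W N (Suc j) - \<theta>\<bar>)"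
            by (rule sum_le_suminf[OF elim(2)]) auto
          also have "\<dots> \<le> (\<tau> + e/8) * real N" using elim(1) N by (simp add: divide_less_eq less_imp_le)
          also have "(\<Sum>j\<in>{1..n}. if real j \<le> \<eta> * real N then \<theta> else 0) \<le> \<theta> * (\<eta> * real N)"
          proof -
            have "(\<Sum>j\<in>{1..n}. if real j \<le> \<eta> * real N then \<theta> else 0) =
               (\<Sum>j\<in>{1..n} \<inter> {j. real j \<le> \<eta> * real N}. \<theta>)"
              by (subst sum.inter_restrict) auto
            also have "\<dots> = \<theta> * real (card ({1..n} \<inter> {j. real j \<le> \<eta> * real N}))" by simp
            also have "real (card ({1..n} \<inter> {j. real j \<le> \<eta> * real N})) \<le> \<eta> * real N"
            proof -
              have "card ({1..n} \<inter> {j. real j \<le> \<eta> * real N}) \<le> card {1..nat \<lfloor>\<eta> * real N\<rfloor>}"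
                by (intro card_mono) (auto intro: le_nat_floor)
              also have "\<dots> = nat \<lfloor>\<eta> * real N\<rfloor>" by simp
              also have "real (nat \<lfloor>\<eta> * real N\<rfloor>) \<le> \<eta> * real N" using \<eta> N by (intro of_nat_floor) auto
              finally show ?thesis by simp
            qed
            finally show ?thesis using \<theta> by (simp add: mult_left_mono)
          qed
          finally show ?thesis by (simp add: algebra_simps)
        qed
        have sumx: "(\<Sum>j\<in>{1..n}. x N (n - j)) \<le> B1 * real N"
        proof -
          have "(\<Sum>j\<in>{1..n}. x N (n - j)) = (\<Sum>i<n. x N i)"
            by (rule sum.reindex_bij_witness[of _ "\<lambda>i. n - i" "\<lambda>j. n - j"]) auto
          also have "\<dots> \<le> (\<Sum>i\<le>N. x N i)" using nN x_nonneg by (intro sum_mono2) auto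
          finally show ?thesis using elim(4) by (simp add: B1_def)
        qed
        define P where "P = C * real N powr p * (1 + (1/\<eta>) powr p)"
        have P: "P \<ge> 0" using C by (auto simp: P_def)
        define q where "q = (1 - \<eta>) powr (-p) * Q"
        have q: "q \<ge> 0" using Q0 by (simp add: q_def)
        have "a * real N * (w n * x N n) \<le> real n * (w n * x N n)"
          using nN x_nonneg by (intro mult_right_mono) (auto simp: w_def)
        also have "\<dots> = w n * (\<Sum>j=1..n. W N j * x N (n - j))"
          using x_rec[of n N] by (simp add: mult_ac)
        also have "\<dots> = (\<Sum>j=1..n. w n * (W N j * x N (n - j)))" by (rule sum_distrib_left)
        also have "\<dots> \<le> (\<Sum>j=1..n. (if real j \<le> \<eta> * real N then W N j * q else 0) + P * x N (n - j))"
          unfolding P_def q_def by (rule sum_mono) (rule main)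
        also have "\<dots> = (\<Sum>j=1..n. if real j \<le> \<eta> * real N then W N j else 0) * q + P * (\<Sum>j=1..n. x N (n - j))"
          by (simp add: sum.distrib sum_distrib_right sum_distrib_left if_distrib[where f = "\<lambda>t. t * q"] cong: if_cong)
        also have "\<dots> \<le> ((\<tau> + e/8 + \<theta> * \<eta>) * real N) * q + P * (B1 * real N)"
          by (intro add_mono mult_right_mono mult_left_mono sumW sumx P q)
        also have "\<dots> = a * real N * (r * Q + K * real N powr p)"
          using a N \<eta> by (simp add: r_def K_def P_def q_def powr_minus field_simps flip: a_def)
        finally show ?thesis using a N by (simp add: mult_le_cancel_left_pos)
      qed
      \<comment> \<open>The maximum is attained in \<open>S\<close>, so \<open>claim\<close> at the
        maximiser reads \<open>Q \<le> r * Q + K * N powr p\<close>, and \<open>r < 1\<close> solves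
        this for \<open>Q\<close>.\<close>
      have "Q \<in> (\<lambda>n. w n * x N n) ` S" unfolding Q_def using finS n0S by (intro Max_in) auto
      then obtain n1 where "n1 \<in> S" "Q = w n1 * x N n1" by auto
      hence "Q \<le> r * Q + K * real N powr p" using claim by simp
      hence "(1 - r) * Q \<le> K * real N powr p" by (simp add: algebra_simps)
      hence QK: "Q \<le> K / (1 - r) * real N powr p" using r by (simp add: field_simps)
      \<comment> \<open>At \<open>n0\<close> the distance to \<open>a * N\<close> is at least
        \<open>e / 2 * N\<close>; the weight is then comparable with \<open>N powr p\<close>, and
        this power cancels.\<close>
      have wn0: "(e / 2 * real N) powr p \<le> w n0" unfolding w_def using eN e N p by (intro powr_mono2) auto
      have "(e / 2 * real N) powr p * x N n0 \<le> K / (1 - r) * real N powr p"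
        by (rule order_trans[OF mult_right_mono[OF wn0 x_nonneg] order_trans[OF Q[OF n0S] QK]])
      hence "real N powr p * ((e / 2) powr p * x N n0) \<le> real N powr p * (K / (1 - r))"
        unfolding powr_mult by (simp add: mult_ac)
      hence "(e / 2) powr p * x N n0 \<le> K / (1 - r)"
        using N by (subst (asm) mult_le_cancel_left_pos) auto
      hence "x N n0 \<le> K / (1 - r) / (e / 2) powr p"
        using e by (subst pos_le_divide_eq) (auto simp: mult.commute)
      also have "\<dots> = K / (1 - r) * (2 / e) powr p" using e by (simp add: powr_divide)
      finally show "x N n0 \<le> B" by (simp add: B_def)
    qed
  qed
  thus ?thesis using B that by blast
qed

text \<open>For \<open>s > \<tau>\<close> this is the derivative of the limiting partial-sum profile
  \<open>max 0 (s - \<tau>) powr \<theta> / Gamma (\<theta> + 1)\<close>.\<close>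

definition f :: "real \<Rightarrow> real" where "f s = (s - \<tau>) powr (\<theta> - 1) / Gamma \<theta>"

lemma Gamma_pos: "Gamma \<theta> > 0" "Gamma (\<theta> + 1) > 0"
  using \<theta> by (auto intro: Gamma_real_pos)

lemma f_cont:
  assumes "e > 0"
  shows "continuous_on {\<tau> + e..b} f"
  unfolding f_def using assms less_imp_neq[OF Gamma_pos(1)]
  by (intro continuous_intros) auto

text \<open>The limit of the recurrence divided by \<open>N\<close>: the constant part of the
  weights sees the partial sums, and the concentrated part acts as multiplication by \<tau>.\<close>

lemma f_g:
  assumes "s > \<tau>"
  shows "s * f s = \<theta> * (max 0 (s - \<tau>) powr \<theta> / Gamma (\<theta> + 1)) + \<tau> * f s"
proof -
  have G1: "Gamma (\<theta> + 1) = \<theta> * Gamma \<theta>"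
    using \<theta> by (intro Gamma_plus1) (auto simp: nonpos_Ints_def)
  have "(s - \<tau>) powr \<theta> = (s - \<tau>) * (s - \<tau>) powr (\<theta> - 1)"
    using assms powr_add[of "s - \<tau>" 1 "\<theta> - 1"] by simp
  hence "(s - \<tau>) * f s = \<theta> * (max 0 (s - \<tau>) powr \<theta> / Gamma (\<theta> + 1))"
    using assms \<theta> Gamma_pos by (simp add: f_def G1 max_def)
  thus ?thesis by (simp add: algebra_simps)
qed

end

section \<open>Contraction of the error and the coefficient asymptotics\<close>

context exp_coeff begin

text \<open>The recurrence minus its limit form \<open>f_g\<close>. The bound collects the
  partial-sum error, the one missing summand \<open>x N n\<close>, the short jumps carrying the
  earlier error \<open>R\<close> and the oscillation \<omega> of \<open>f\<close>, the mismatch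
  between the short-jump mass and \<open>\<tau> * N\<close>, and the long jumps. Only
  \<open>R\<close> need not be small, and its coefficient is about \<tau>.\<close>

lemma x_recurrence_split:
  assumes s: "summable (\<lambda>j. \<bar>W N (Suc j) - \<theta>\<bar>)" and N: "N > 0" and n: "n \<le> N" "\<tau> * real N < real n"
    and \<eta>: "\<eta> > 0" "\<eta> * real N \<le> real n"
    and tl: "\<And>j. real j > \<eta> * real N \<Longrightarrow> \<bar>W N j - \<theta>\<bar> \<le> \<epsilon>1"
    and tot: "(\<Sum>i\<le>N. x N i) \<le> B1 * real N"
    and ps: "\<bar>(\<Sum>i\<le>n. x N i) / real N - max 0 (real n / real N - \<tau>) powr \<theta> / Gamma (\<theta> + 1)\<bar> \<le> \<epsilon>2"
    and near: "\<And>j. real j \<le> \<eta> * real N \<Longrightarrow> \<bar>x N (n - j) - f (real (n - j) / real N)\<bar> \<le> R"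
    and osc: "\<And>j. real j \<le> \<eta> * real N \<Longrightarrow> \<bar>f (real (n - j) / real N) - f (real n / real N)\<bar> \<le> \<omega>"
    and fb: "\<bar>f (real n / real N)\<bar> \<le> Bf" and xb: "x N n \<le> Bx"
    and nonneg: "\<epsilon>1 \<ge> 0" "R \<ge> 0" "\<omega> \<ge> 0" "Bf \<ge> 0"
  shows "real n / real N * \<bar>x N n - f (real n / real N)\<bar> \<le>
     \<theta> * \<epsilon>2 + \<theta> * Bx / real N + (\<Sum>j. \<bar>W N (Suc j) - \<theta>\<bar>) / real N * (R + \<omega>)
     + Bf * (\<bar>(\<Sum>j. W N (Suc j) - \<theta>) / real N - \<tau>\<bar>
           + (\<Sum>j. if real (Suc j) > \<eta> * real N then \<bar>W N (Suc j) - \<theta>\<bar> else 0) / real N)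
     + \<epsilon>1 * B1"
proof -
  define s where "s = real n / real N"
  define g where "g = max 0 (s - \<tau>) powr \<theta> / Gamma (\<theta> + 1)"
  define v where "v = (\<lambda>j. W N j - \<theta>)"
  define J where "J = {j\<in>{1..n}. real j \<le> \<eta> * real N}"
  define J' where "J' = {j\<in>{1..n}. real j > \<eta> * real N}"
  have J: "finite J" "finite J'" "J \<inter> J' = {}" "{1..n} = J \<union> J'"
    by (auto simp: J_def J'_def)
  have Npos: "real N > 0" using N by simp
  have sN: "s * real N = real n" using Npos by (simp add: s_def)
  have s\<tau>: "s > \<tau>" using n Npos by (simp add: s_def pos_less_divide_eq)
  have sv: "summable (\<lambda>j. \<bar>v (Suc j)\<bar>)" using s by (simp add: v_def)
  have sv0: "summable (\<lambda>j. v (Suc j))" by (rule summable_rabs_cancel[OF sv])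
  define t where "t = (\<lambda>j. if real (Suc j) > \<eta> * real N then \<bar>v (Suc j)\<bar> else 0)"
  have st: "summable t" by (rule summable_comparison_test'[OF sv, of 0]) (auto simp: t_def)
  \<comment> \<open>The recurrence for index \<open>n\<close> sees only the indices below
    \<open>n\<close>, whereas \<open>partial_sums\<close> includes \<open>n\<close> itself; the
    difference costs \<open>\<theta> * Bx / N\<close>.\<close>
  define X where "X = (\<Sum>i<n. x N i)"
  have X1: "X = (\<Sum>i\<le>n. x N i) - x N n" unfolding X_def
    by (metis add_diff_cancel_right' lessThan_Suc_atMost sum.lessThan_Suc)
  have Xre: "(\<Sum>j=1..n. x N (n - j)) = X" unfolding X_def
    by (rule sum.reindex_bij_witness[of _ "\<lambda>i. n - i" "\<lambda>j. n - j"]) auto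
  have rec: "real n * x N n = \<theta> * X + (\<Sum>j\<in>J. v j * x N (n - j)) + (\<Sum>j\<in>J'. v j * x N (n - j))"
  proof -
    have "real n * x N n = (\<Sum>j=1..n. \<theta> * x N (n - j) + v j * x N (n - j))"
      unfolding x_rec by (intro sum.cong) (auto simp: v_def algebra_simps)
    also have "\<dots> = \<theta> * X + (\<Sum>j=1..n. v j * x N (n - j))"
      by (simp add: sum.distrib sum_distrib_left flip: Xre)
    also have "(\<Sum>j=1..n. v j * x N (n - j)) = (\<Sum>j\<in>J. v j * x N (n - j)) + (\<Sum>j\<in>J'. v j * x N (n - j))"
      unfolding J(4) using J by (intro sum.union_disjoint) auto
    finally show ?thesis by simp
  qed
  have Jsum: "(\<Sum>j\<in>J. v j * x N (n - j)) = (\<Sum>j\<in>J. v j * (x N (n - j) - f (real (n - j) / real N)))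
      + (\<Sum>j\<in>J. v j * (f (real (n - j) / real N) - f s)) + f s * (\<Sum>j\<in>J. v j)"
    unfolding sum_distrib_left sum.distrib[symmetric] by (intro sum.cong) (auto simp: algebra_simps)
  have id: "real n * (x N n - f s) = \<theta> * (X - real N * g)
      + (\<Sum>j\<in>J. v j * (x N (n - j) - f (real (n - j) / real N)))
      + (\<Sum>j\<in>J. v j * (f (real (n - j) / real N) - f s))
      + f s * ((\<Sum>j\<in>J. v j) - \<tau> * real N) + (\<Sum>j\<in>J'. v j * x N (n - j))"
  proof -
    have "real n * f s = real N * (s * f s)" by (simp add: sN[symmetric])
    also have "s * f s = \<theta> * g + \<tau> * f s" unfolding g_def by (rule f_g[OF s\<tau>])
    finally have "real n * f s = real N * (\<theta> * g + \<tau> * f s)" .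
    thus ?thesis using rec Jsum by (simp add: algebra_simps)
  qed
  have vJ: "(\<Sum>j\<in>J. \<bar>v j\<bar>) \<le> (\<Sum>j. \<bar>v (Suc j)\<bar>)"
  proof -
    have "(\<Sum>j\<in>J. \<bar>v j\<bar>) \<le> (\<Sum>j\<in>{1..n}. \<bar>v j\<bar>)" by (intro sum_mono2) (auto simp: J_def)
    also have "\<dots> = (\<Sum>j<n. \<bar>v (Suc j)\<bar>)" by (simp add: sum.atLeast1_atMost_eq)
    also have "\<dots> \<le> (\<Sum>j. \<bar>v (Suc j)\<bar>)" by (rule sum_le_suminf[OF sv]) auto
    finally show ?thesis .
  qed
  have b1: "\<bar>\<theta> * (X - real N * g)\<bar> \<le> real N * (\<theta> * \<epsilon>2) + \<theta> * Bx"
  proof -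
    have "\<bar>(\<Sum>i\<le>n. x N i) - real N * g\<bar> = real N * \<bar>(\<Sum>i\<le>n. x N i) / real N - g\<bar>"
      using Npos by (simp add: field_simps flip: abs_mult_pos)
    also have "\<dots> \<le> real N * \<epsilon>2"
      using ps by (intro mult_left_mono) (auto simp: g_def s_def)
    finally have "\<bar>X - real N * g\<bar> \<le> real N * \<epsilon>2 + Bx"
      unfolding X1 using xb x_nonneg[of N n] by linarith
    hence "\<theta> * \<bar>X - real N * g\<bar> \<le> \<theta> * (real N * \<epsilon>2 + Bx)" using \<theta> by (intro mult_left_mono) auto
    thus ?thesis unfolding abs_mult abs_of_pos[OF \<theta>] by (simp only: distrib_left mult_ac)
  qed
  have b2: "\<bar>\<Sum>j\<in>J. v j * (x N (n - j) - f (real (n - j) / real N))\<bar> \<le> (\<Sum>j. \<bar>v (Suc j)\<bar>) * R"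
  proof -
    have "\<bar>\<Sum>j\<in>J. v j * (x N (n - j) - f (real (n - j) / real N))\<bar> \<le> (\<Sum>j\<in>J. \<bar>v j\<bar> * R)"
      by (rule order_trans[OF sum_abs sum_mono]) (auto simp: abs_mult J_def simp del: of_nat_diff intro!: mult_left_mono near)
    also have "\<dots> = (\<Sum>j\<in>J. \<bar>v j\<bar>) * R" by (simp add: sum_distrib_right)
    also have "\<dots> \<le> (\<Sum>j. \<bar>v (Suc j)\<bar>) * R" by (intro mult_right_mono vJ nonneg)
    finally show ?thesis .
  qed
  have b3: "\<bar>\<Sum>j\<in>J. v j * (f (real (n - j) / real N) - f s)\<bar> \<le> (\<Sum>j. \<bar>v (Suc j)\<bar>) * \<omega>"
  proof -
    have "\<bar>\<Sum>j\<in>J. v j * (f (real (n - j) / real N) - f s)\<bar> \<le> (\<Sum>j\<in>J. \<bar>v j\<bar> * \<omega>)"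
      unfolding s_def
      by (rule order_trans[OF sum_abs sum_mono]) (auto simp: abs_mult J_def simp del: of_nat_diff intro!: mult_left_mono osc)
    also have "\<dots> = (\<Sum>j\<in>J. \<bar>v j\<bar>) * \<omega>" by (simp add: sum_distrib_right)
    also have "\<dots> \<le> (\<Sum>j. \<bar>v (Suc j)\<bar>) * \<omega>" by (intro mult_right_mono vJ nonneg)
    finally show ?thesis .
  qed
  have b4: "\<bar>(\<Sum>j. v (Suc j)) - (\<Sum>j\<in>J. v j)\<bar> \<le> (\<Sum>j. t j)"
  proof -
    have inj: "inj_on (\<lambda>j. j - 1) J" by (auto simp: J_def inj_on_def)
    define J0 where "J0 = (\<lambda>j. j - 1) ` J"
    have finJ0: "finite J0" unfolding J0_def by (rule finite_imageI[OF J(1)])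
    \<comment> \<open>The assumption \<open>\<eta> * N \<le> n\<close> ensures that the short jumps
      are limited by \<open>\<eta> * N\<close> alone and not by \<open>n\<close>, so that replacing
      the full series by the sum over \<open>J\<close> loses just the tail.\<close>
    have J0: "J0 = {j. real (Suc j) \<le> \<eta> * real N}"
    proof (intro equalityI subsetI)
      fix j assume j: "j \<in> {j. real (Suc j) \<le> \<eta> * real N}"
      hence "real (Suc j) \<le> real n" using \<eta> by (simp add: le_trans) 
      hence "Suc j \<in> J" using j by (auto simp: J_def)
      thus "j \<in> J0" unfolding J0_def by (intro image_eqI[of _ _ "Suc j"]) auto
    qed (auto simp: J0_def J_def Suc_diff_1)
    have "(\<Sum>j\<in>J. v j) = (\<Sum>j\<in>J0. v (Suc j))"
      unfolding J0_def by (subst sum.reindex[OF inj]) (auto intro!: sum.cong simp: J_def Suc_diff_1)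
    also have "\<dots> = (\<Sum>j. if j \<in> J0 then v (Suc j) else 0)"
      using suminf_finite[OF finJ0, of "\<lambda>j. if j \<in> J0 then v (Suc j) else 0"] by simp
    finally have eq: "(\<Sum>j\<in>J. v j) = (\<Sum>j. if j \<in> J0 then v (Suc j) else 0)" .
    have sJ: "summable (\<lambda>j. if j \<in> J0 then v (Suc j) else 0)"
      by (rule summable_finite[OF finJ0]) simp
    have "(\<Sum>j. v (Suc j)) - (\<Sum>j\<in>J. v j) = (\<Sum>j. v (Suc j) - (if j \<in> J0 then v (Suc j) else 0))"
      unfolding eq by (rule suminf_diff[OF sv0 sJ])
    moreover have tb: "\<bar>v (Suc j) - (if j \<in> J0 then v (Suc j) else 0)\<bar> \<le> t j" for j
      by (auto simp: t_def J0)
    moreover have sabs: "summable (\<lambda>j. \<bar>v (Suc j) - (if j \<in> J0 then v (Suc j) else 0)\<bar>)"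
      by (rule summable_comparison_test'[OF st, of 0]) (use tb in auto)
    ultimately show ?thesis
      using order_trans[OF summable_rabs[OF sabs] suminf_le[OF tb sabs st]] by simp
  qed
  have b5: "\<bar>f s * ((\<Sum>j\<in>J. v j) - \<tau> * real N)\<bar> \<le> Bf * (\<bar>(\<Sum>j. v (Suc j)) - \<tau> * real N\<bar> + (\<Sum>j. t j))"
    unfolding abs_mult using b4 fb nonneg by (intro mult_mono) (auto simp: s_def)
  have b6: "\<bar>\<Sum>j\<in>J'. v j * x N (n - j)\<bar> \<le> real N * (\<epsilon>1 * B1)"
  proof -
    have "\<bar>\<Sum>j\<in>J'. v j * x N (n - j)\<bar> \<le> (\<Sum>j\<in>J'. \<epsilon>1 * x N (n - j))"
      by (rule order_trans[OF sum_abs sum_mono])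
         (auto simp: abs_mult J'_def v_def x_nonneg intro!: mult_right_mono tl)
    also have "\<dots> \<le> (\<Sum>j\<in>{1..n}. \<epsilon>1 * x N (n - j))"
      by (intro sum_mono2 mult_nonneg_nonneg nonneg x_nonneg) (auto simp: J'_def)
    also have "\<dots> = \<epsilon>1 * X" by (simp add: sum_distrib_left flip: Xre)
    also have "X \<le> (\<Sum>i\<le>N. x N i)" unfolding X_def using n x_nonneg by (intro sum_mono2) auto
    hence "\<epsilon>1 * X \<le> \<epsilon>1 * (B1 * real N)" using tot nonneg by (intro mult_left_mono) auto
    finally show ?thesis by (simp add: mult_ac)
  qed
  have "real n * \<bar>x N n - f s\<bar> = \<bar>real n * (x N n - f s)\<bar>" by (subst abs_mult) simp
  also have "\<dots> \<le> (real N * (\<theta> * \<epsilon>2) + \<theta> * Bx) + (\<Sum>j. \<bar>v (Suc j)\<bar>) * R + (\<Sum>j. \<bar>v (Suc j)\<bar>) * \<omega>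
      + Bf * (\<bar>(\<Sum>j. v (Suc j)) - \<tau> * real N\<bar> + (\<Sum>j. t j)) + real N * (\<epsilon>1 * B1)"
  proof -
    have "\<bar>a1 + a2 + a3 + a4 + a5\<bar> \<le> c1 + c2 + c3 + c4 + c5"
      if "\<bar>a1\<bar> \<le> c1" "\<bar>a2\<bar> \<le> c2" "\<bar>a3\<bar> \<le> c3" "\<bar>a4\<bar> \<le> c4" "\<bar>a5\<bar> \<le> c5" for a1 a2 a3 a4 a5 c1 c2 c3 c4 c5 :: real
      using that by linarith
    from this[OF b1 b2 b3 b5 b6] show ?thesis unfolding id .
  qed
  finally have "real n * \<bar>x N n - f s\<bar> / real N \<le> ((real N * (\<theta> * \<epsilon>2) + \<theta> * Bx) + (\<Sum>j. \<bar>v (Suc j)\<bar>) * R + (\<Sum>j. \<bar>v (Suc j)\<bar>) * \<omega>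
      + Bf * (\<bar>(\<Sum>j. v (Suc j)) - \<tau> * real N\<bar> + (\<Sum>j. t j)) + real N * (\<epsilon>1 * B1)) / real N"
    by (rule divide_right_mono) simp
  also have "\<dots> = \<theta> * \<epsilon>2 + \<theta> * Bx / real N + (\<Sum>j. \<bar>v (Suc j)\<bar>) / real N * (R + \<omega>)
      + Bf * (\<bar>(\<Sum>j. v (Suc j)) - \<tau> * real N\<bar> / real N + (\<Sum>j. t j) / real N) + \<epsilon>1 * B1"
    using Npos by (simp add: add_divide_distrib algebra_simps)
  also have "\<bar>(\<Sum>j. v (Suc j)) - \<tau> * real N\<bar> / real N = \<bar>(\<Sum>j. v (Suc j)) / real N - \<tau>\<bar>"
  proof -
    have "(\<Sum>j. v (Suc j)) / real N - \<tau> = ((\<Sum>j. v (Suc j)) - \<tau> * real N) / real N"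
      using Npos by (simp add: diff_divide_distrib)
    thus ?thesis by simp
  qed
  finally show ?thesis unfolding s_def v_def t_def by simp
qed

lemma f_bounded:
  assumes "e > 0"
  obtains Bf where "Bf > 0" "\<And>s. \<tau> + e \<le> s \<Longrightarrow> s \<le> 1 \<Longrightarrow> \<bar>f s\<bar> \<le> Bf"
proof -
  have "bounded (f ` {\<tau> + e..1})"
    by (rule compact_imp_bounded[OF compact_continuous_image[OF f_cont[OF assms]]]) simp
  then obtain b where "b > 0" "\<forall>y\<in>f ` {\<tau> + e..1}. norm y \<le> b" unfolding bounded_pos by blast
  thus ?thesis using that[of b] by auto
qed

text \<open>Short jumps from above \<open>\<tau> + e1\<close> land above \<open>\<tau> + e2\<close>,
  where the error is at most \<open>R\<close>; their mass is about \<open>\<tau> * N\<close> while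
  \<open>n \<ge> (\<tau> + e0) * N\<close>. The factor involves only \<open>e0\<close>, so it does
  not deteriorate when the step is repeated with ranges shrinking inside
  \<open>s > \<tau> + e0\<close>.\<close>

lemma contraction_step:
  assumes e: "0 < e0" "e0 < e2" "e2 < e1" and R: "R > 0"
    and IH: "\<forall>\<^sub>F N in sequentially. \<forall>n\<le>N. (\<tau> + e2) * real N \<le> real n \<longrightarrow> \<bar>x N n - f (real n / real N)\<bar> \<le> R"
  shows "\<forall>\<^sub>F N in sequentially. \<forall>n\<le>N. (\<tau> + e1) * real N \<le> real n \<longrightarrow>
     \<bar>x N n - f (real n / real N)\<bar> \<le> (\<tau> + e0/2) / (\<tau> + e0) * R"
proof -
  \<comment> \<open>The available slack, as \<open>(\<tau> + e0/2) * R = \<tau> * R + E\<close>. The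
    remaining errors are made at most \<open>E / 8\<close> each, and there are six of them.\<close>
  define E where "E = e0 / 2 * R"
  have E: "E > 0" using e R by (simp add: E_def)
  have e1: "e1 > 0" "e2 > 0" using e by auto
  obtain Bx where Bx: "Bx > 0" "\<forall>\<^sub>F N in sequentially. \<forall>n\<le>N. (\<tau> + e1) * real N \<le> real n \<longrightarrow> x N n \<le> Bx"
    by (rule x_bounded[OF e1(1)])
  obtain Bf where Bf: "Bf > 0" "\<And>s. \<tau> + e2 \<le> s \<Longrightarrow> s \<le> 1 \<Longrightarrow> \<bar>f s\<bar> \<le> Bf"
    using f_bounded[OF e1(2)] by blast
  define B1 where "B1 = 1 / Gamma (\<theta> + 1) + 1"
  have B1: "B1 > 0" using Gamma_pos by (simp add: B1_def add_pos_pos)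
  define \<omega> where "\<omega> = E / 8 / (\<tau> + 1)"
  have \<omega>: "\<omega> > 0" using E \<tau> by (simp add: \<omega>_def)
  have "uniformly_continuous_on {\<tau> + e2..1} f"
    by (rule compact_uniformly_continuous[OF f_cont[OF e1(2)]]) simp
  hence "\<exists>d>0. \<forall>s\<in>{\<tau> + e2..1}. \<forall>s'\<in>{\<tau> + e2..1}. dist s' s < d \<longrightarrow> dist (f s') (f s) < \<omega>"
    unfolding uniformly_continuous_on_def using \<omega> by blast
  then obtain d where d: "d > 0" "\<And>s s'. s \<in> {\<tau> + e2..1} \<Longrightarrow> s' \<in> {\<tau> + e2..1} \<Longrightarrow> dist s' s < d \<Longrightarrow> dist (f s') (f s) < \<omega>"
    by blast
  \<comment> \<open>Below the modulus of continuity \<open>d\<close> of \<open>f\<close>, and at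
    most \<open>e1 - e2\<close> so that a short jump does not leave the range where the old bound
    holds.\<close>
  define \<eta> where "\<eta> = min (d/2) (e1 - e2)"
  have \<eta>: "\<eta> > 0" "\<eta> < d" "\<eta> \<le> e1 - e2" using d e by (auto simp: \<eta>_def)
  define \<epsilon>1 where "\<epsilon>1 = E / (8 * B1)"
  define \<epsilon>2 where "\<epsilon>2 = E / (8 * \<theta>)"
  define \<epsilon>3 where "\<epsilon>3 = E / (16 * Bf)"
  define \<epsilon>4 where "\<epsilon>4 = min 1 (E / (8 * R))"
  have eps: "\<epsilon>1 > 0" "\<epsilon>2 > 0" "\<epsilon>3 > 0" "\<epsilon>4 > 0" "\<epsilon>4 \<le> 1" "\<epsilon>4 * R \<le> E / 8"
    using E B1 \<theta> Bf R by (auto simp: \<epsilon>1_def \<epsilon>2_def \<epsilon>3_def \<epsilon>4_def min_def field_simps)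
  have v1: "\<forall>\<^sub>F N in sequentially. (\<Sum>j. \<bar>W N (Suc j) - \<theta>\<bar>) / real N < \<tau> + \<epsilon>4"
    by (rule order_tendstoD(2)[OF mean_abs_dev]) (use eps in simp)
  have v2: "\<forall>\<^sub>F N in sequentially. \<bar>(\<Sum>j. W N (Suc j) - \<theta>) / real N - \<tau>\<bar> < \<epsilon>3"
    using tendstoD[OF mean_dev eps(3)] by (simp add: dist_real_def)
  have v3: "\<forall>\<^sub>F N in sequentially. (\<Sum>j. if real (Suc j) > \<eta> * real N then \<bar>W N (Suc j) - \<theta>\<bar> else 0) / real N < \<epsilon>3"
    by (rule order_tendstoD(2)[OF tail_sum[OF \<eta>(1)]]) (use eps in simp)
  have v4: "\<forall>\<^sub>F N in sequentially. \<theta> * Bx / real N < E / 8"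
    by (rule order_tendstoD(2)[of _ 0]) (real_asymp, use E in simp)
  show ?thesis
    using v1 v2 v3 v4 IH Bx(2) summable_dev tail_sup[OF \<eta>(1) eps(1)] partial_sums[OF eps(2)]
      total_bound eventually_gt_at_top[of 0]
  proof eventually_elim
    case (elim N)
    have N: "real N > 0" using elim by simp
    show ?case
    proof (intro allI impI)
      fix n assume n: "n \<le> N" "(\<tau> + e1) * real N \<le> real n"
      have near: "(\<tau> + e2) * real N \<le> real (n - j)" "real (n - j) / real N \<in> {\<tau> + e2..1}"
        "\<bar>real (n - j) / real N - real n / real N\<bar> < d" "j \<le> n" if j: "real j \<le> \<eta> * real N" for j
      proof -
        have "real j \<le> (e1 - e2) * real N"
          using j \<eta>(3) N by (meson mult_right_mono less_imp_le order_trans)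
        hence 1: "(\<tau> + e2) * real N \<le> real n - real j" using n by (simp add: algebra_simps)
        have "(\<tau> + e2) * real N \<ge> 0" using \<tau> e1 N by simp
        hence "real j \<le> real n" using 1 by linarith
        thus jn: "j \<le> n" by simp
        have nj: "real (n - j) = real n - real j" using jn by (rule of_nat_diff)
        show 2: "(\<tau> + e2) * real N \<le> real (n - j)" using 1 nj by simp
        have "real (n - j) \<le> 1 * real N" using n by simp
        thus "real (n - j) / real N \<in> {\<tau> + e2..1}" using 2 N by (simp add: pos_le_divide_eq)
        have "\<bar>real (n - j) / real N - real n / real N\<bar> = real j / real N"
          using jn by (simp add: nj diff_divide_distrib)
        also have "\<dots> \<le> \<eta>" using j N by (simp add: pos_divide_le_eq)
        finally show "\<bar>real (n - j) / real N - real n / real N\<bar> < d" using \<eta> by simp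
      qed
      have n0: "real n / real N \<in> {\<tau> + e2..1}" using near(2)[of 0] N \<eta> by simp
      have "e1 * real N > 0" using e1 N by simp
      hence \<tau>n: "\<tau> * real N < real n" using n by (simp add: algebra_simps)
      have "\<eta> * real N \<le> (\<tau> + e1) * real N"
        using \<eta> \<tau> e1 N by (intro mult_right_mono) auto
      hence \<eta>n: "\<eta> * real N \<le> real n" using n by simp
      have main: "real n / real N * \<bar>x N n - f (real n / real N)\<bar> \<le>
         \<theta> * \<epsilon>2 + \<theta> * Bx / real N + (\<Sum>j. \<bar>W N (Suc j) - \<theta>\<bar>) / real N * (R + \<omega>)
         + Bf * (\<bar>(\<Sum>j. W N (Suc j) - \<theta>) / real N - \<tau>\<bar>
               + (\<Sum>j. if real (Suc j) > \<eta> * real N then \<bar>W N (Suc j) - \<theta>\<bar> else 0) / real N)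
         + \<epsilon>1 * B1"
      proof (rule x_recurrence_split)
        show "(\<Sum>i\<le>N. x N i) \<le> B1 * real N" using elim by (simp add: B1_def)
        show "\<bar>x N (n - j) - f (real (n - j) / real N)\<bar> \<le> R" if "real j \<le> \<eta> * real N" for j
          using elim(5) near(1)[OF that] n by (auto simp del: of_nat_diff)
        show "\<bar>f (real (n - j) / real N) - f (real n / real N)\<bar> \<le> \<omega>" if "real j \<le> \<eta> * real N" for j
          using d(2)[OF n0 near(2)[OF that]] near(3)[OF that] by (simp add: dist_real_def less_imp_le)
        show "\<bar>f (real n / real N)\<bar> \<le> Bf" using n0 by (intro Bf) auto
      qed (use elim n \<tau>n \<eta>n \<eta> eps R \<omega> Bf in auto)
      have t1: "\<theta> * \<epsilon>2 = E / 8" using \<theta> by (simp add: \<epsilon>2_def)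
      have t2: "(\<Sum>j. \<bar>W N (Suc j) - \<theta>\<bar>) / real N * (R + \<omega>) \<le> \<tau> * R + E / 8 + E / 8"
      proof -
        have "(\<Sum>j. \<bar>W N (Suc j) - \<theta>\<bar>) / real N * (R + \<omega>) \<le> (\<tau> + \<epsilon>4) * (R + \<omega>)"
          using elim(1) R \<omega> by (intro mult_right_mono) auto
        also have "\<dots> = \<tau> * R + \<epsilon>4 * R + (\<tau> + \<epsilon>4) * \<omega>" by (simp add: algebra_simps)
        also have "(\<tau> + \<epsilon>4) * \<omega> \<le> (\<tau> + 1) * \<omega>" using eps \<omega> by (intro mult_right_mono) auto
        also have "(\<tau> + 1) * \<omega> = E / 8"
        proof -
          have "\<tau> + 1 \<noteq> 0" using \<tau> by simp
          thus ?thesis unfolding \<omega>_def by (metis nonzero_mult_div_cancel_left times_divide_eq_right)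
        qed
        finally show ?thesis using eps by linarith
      qed
      have t3: "Bf * (\<bar>(\<Sum>j. W N (Suc j) - \<theta>) / real N - \<tau>\<bar>
               + (\<Sum>j. if real (Suc j) > \<eta> * real N then \<bar>W N (Suc j) - \<theta>\<bar> else 0) / real N) \<le> E / 8"
      proof -
        have "Bf * (\<bar>(\<Sum>j. W N (Suc j) - \<theta>) / real N - \<tau>\<bar>
               + (\<Sum>j. if real (Suc j) > \<eta> * real N then \<bar>W N (Suc j) - \<theta>\<bar> else 0) / real N) \<le> Bf * (\<epsilon>3 + \<epsilon>3)"
          using Bf elim(2,3) by (intro mult_left_mono add_mono) auto
        also have "\<dots> = E / 8" using Bf by (simp add: \<epsilon>3_def)
        finally show ?thesis .
      qed
      have t4: "\<epsilon>1 * B1 = E / 8" using B1 by (simp add: \<epsilon>1_def)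
      define \<delta> where "\<delta> = \<bar>x N n - f (real n / real N)\<bar>"
      have "(\<tau> + e0) * \<delta> \<le> real n / real N * \<delta>"
        using n0 e by (intro mult_right_mono) (auto simp: \<delta>_def)
      also have "\<dots> \<le> \<tau> * R + E"
        using main t1 t2 t3 t4 elim(4) E unfolding \<delta>_def by linarith
      also have "\<dots> = (\<tau> + e0/2) * R" by (simp add: E_def algebra_simps)
      finally show "\<bar>x N n - f (real n / real N)\<bar> \<le> (\<tau> + e0/2) / (\<tau> + e0) * R"
        using e \<tau> unfolding \<delta>_def[symmetric] by (simp add: field_simps)
    qed
  qed
qed

text \<open>Iterating the contraction \<open>k\<close> times gives the error
  \<open>r ^ k * B\<close>. The claim is proved for all \<open>e1 > e0\<close> at once, since every
  step needs the previous bound on a slightly larger range.\<close>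

lemma x_limit:
  assumes e: "e > 0" and \<delta>: "\<delta> > 0"
  shows "\<forall>\<^sub>F N in sequentially. \<forall>n\<le>N. (\<tau> + e) * real N \<le> real n \<longrightarrow> \<bar>x N n - f (real n / real N)\<bar> \<le> \<delta>"
proof -
  define e0 where "e0 = e / 2"
  have e0: "e0 > 0" "e0 < e" using e by (auto simp: e0_def)
  define r where "r = (\<tau> + e0/2) / (\<tau> + e0)"
  have r: "0 < r" "r < 1" using \<tau> e0 by (auto simp: r_def)
  obtain Bx where Bx: "Bx > 0" "\<forall>\<^sub>F N in sequentially. \<forall>n\<le>N. (\<tau> + e0) * real N \<le> real n \<longrightarrow> x N n \<le> Bx"
    by (rule x_bounded[OF e0(1)])
  obtain Bf where Bf: "Bf > 0" "\<And>s. \<tau> + e0 \<le> s \<Longrightarrow> s \<le> 1 \<Longrightarrow> \<bar>f s\<bar> \<le> Bf"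
    using f_bounded[OF e0(1)] by blast
  define B where "B = Bx + Bf"
  have B: "B > 0" using Bx Bf by (simp add: B_def)
  have iter: "\<forall>e1>e0. \<forall>\<^sub>F N in sequentially. \<forall>n\<le>N. (\<tau> + e1) * real N \<le> real n \<longrightarrow> \<bar>x N n - f (real n / real N)\<bar> \<le> r ^ k * B" for k
  proof (induction k)
    case 0
    show ?case
    proof (intro allI impI)
      fix e1 assume e1: "e1 > e0"
      show "\<forall>\<^sub>F N in sequentially. \<forall>n\<le>N. (\<tau> + e1) * real N \<le> real n \<longrightarrow> \<bar>x N n - f (real n / real N)\<bar> \<le> r ^ 0 * B"
        using Bx(2) eventually_gt_at_top[of 0]
      proof eventually_elim
        case (elim N)
        show ?case
        proof (intro allI impI)
          fix n assume n: "n \<le> N" "(\<tau> + e1) * real N \<le> real n"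
          have "(\<tau> + e0) * real N \<le> (\<tau> + e1) * real N" using e1 by (intro mult_right_mono) auto
          hence n': "(\<tau> + e0) * real N \<le> real n" using n by simp
          have "\<bar>f (real n / real N)\<bar> \<le> Bf"
            using n n' elim by (intro Bf) (auto simp: pos_le_divide_eq)
          moreover have "x N n \<le> Bx" using elim n n' by auto
          ultimately show "\<bar>x N n - f (real n / real N)\<bar> \<le> r ^ 0 * B"
            using x_nonneg[of N n] by (simp add: B_def)
        qed
      qed
    qed
  next
    case (Suc k)
    show ?case
    proof (intro allI impI)
      fix e1 assume e1: "e1 > e0"
      \<comment> \<open>Any value strictly between \<open>e0\<close> and \<open>e1\<close> works,
        which leaves room for infinitely many steps above \<open>e0\<close>.\<close>
      define e2 where "e2 = (e0 + e1) / 2"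
      have e2: "e0 < e2" "e2 < e1" using e1 by (auto simp: e2_def)
      have "\<forall>\<^sub>F N in sequentially. \<forall>n\<le>N. (\<tau> + e1) * real N \<le> real n \<longrightarrow> \<bar>x N n - f (real n / real N)\<bar> \<le> (\<tau> + e0/2) / (\<tau> + e0) * (r ^ k * B)"
        by (rule contraction_step[OF e0(1) e2]) (use Suc e2 r B in auto)
      thus "\<forall>\<^sub>F N in sequentially. \<forall>n\<le>N. (\<tau> + e1) * real N \<le> real n \<longrightarrow> \<bar>x N n - f (real n / real N)\<bar> \<le> r ^ Suc k * B"
        by (simp add: r_def mult.assoc)
    qed
  qed
  have "(\<lambda>k. r ^ k * B) \<longlonglongrightarrow> 0 * B"
    by (intro tendsto_intros LIMSEQ_power_zero) (use r in auto)
  hence "\<forall>\<^sub>F k in sequentially. r ^ k * B < \<delta>"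
    by (rule order_tendstoD(2)) (use \<delta> in simp)
  then obtain k where k: "r ^ k * B < \<delta>" by (auto simp: eventually_sequentially)
  show ?thesis using iter[of k, rule_format, OF e0(2)]
    by eventually_elim (use k in fastforce)
qed

text \<open>Absolute errors become relative ones because \<open>f\<close> is continuous and positive
  on a compact range away from \<tau>, so that \<open>1 / f\<close> is bounded there.\<close>

theorem h_asymp:
  assumes e: "e > 0" and \<delta>: "\<delta> > 0"
  shows "\<forall>\<^sub>F N in sequentially. \<forall>n\<le>N. (\<tau> + e) * real N \<le> real n \<longrightarrow>
    \<bar>h N n / (exp (F N) * real N powr (\<theta> - 1) * (real n / real N - \<tau>) powr (\<theta> - 1) / Gamma \<theta>) - 1\<bar> \<le> \<delta>"
proof -
  have "continuous_on {\<tau> + e..1} (\<lambda>s. 1 / f s)"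
    using e Gamma_pos(1) by (intro continuous_intros f_cont) (auto simp: f_def)
  hence "bounded ((\<lambda>s. 1 / f s) ` {\<tau> + e..1})"
    by (intro compact_imp_bounded compact_continuous_image) auto
  then obtain b where b: "b > 0" "\<forall>y\<in>(\<lambda>s. 1 / f s) ` {\<tau> + e..1}. norm y \<le> b" unfolding bounded_pos by blast
  have "\<forall>\<^sub>F N in sequentially. \<forall>n\<le>N. (\<tau> + e) * real N \<le> real n \<longrightarrow> \<bar>x N n - f (real n / real N)\<bar> \<le> \<delta> / b"
    by (rule x_limit[OF e]) (use b \<delta> in simp)
  thus ?thesis using eventually_gt_at_top[of 0]
  proof eventually_elim
    case (elim N)
    show ?case
    proof (intro allI impI)
      fix n assume n: "n \<le> N" "(\<tau> + e) * real N \<le> real n"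
      define s where "s = real n / real N"
      have s: "s \<in> {\<tau> + e..1}" using n elim by (auto simp: s_def pos_le_divide_eq)
      have fs: "f s > 0" using s e Gamma_pos(1) by (auto simp: f_def)
      have b': "\<bar>1 / f s\<bar> \<le> b" using b s by auto
      have "h N n / (exp (F N) * real N powr (\<theta> - 1) * (real n / real N - \<tau>) powr (\<theta> - 1) / Gamma \<theta>) = x N n / f s"
        by (simp add: x_def f_def s_def)
      also have "x N n / f s - 1 = (x N n - f s) * (1 / f s)" using fs by (simp add: field_simps)
      also have "\<bar>\<dots>\<bar> = \<bar>x N n - f s\<bar> * \<bar>1 / f s\<bar>" by (rule abs_mult)
      also have "\<dots> \<le> (\<delta> / b) * b"
        using elim n b' b \<delta> by (intro mult_mono) (auto simp: s_def)
      also have "\<dots> = \<delta>" using b by simp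
      finally show "\<bar>h N n / (exp (F N) * real N powr (\<theta> - 1) * (real n / real N - \<tau>) powr (\<theta> - 1) / Gamma \<theta>) - 1\<bar> \<le> \<delta>" .
    qed
  qed
qed

end

section \<open>Fourier transforms of Schwartz densities\<close>

lemma integral_prod_vec:
  fixes g :: "'n::finite \<Rightarrow> real \<Rightarrow> 'b::{real_normed_field,banach,second_countable_topology}"
  assumes g: "\<And>i. integrable lborel (g i)"
  shows integrable_prod_vec: "integrable lborel (\<lambda>x::real^'n. \<Prod>i\<in>UNIV. g i (x $ i))"
    and "(\<integral>x. (\<Prod>i\<in>UNIV. g i (x $ i)) \<partial>(lborel :: (real^'n) measure)) = (\<Prod>i\<in>UNIV. integral\<^sup>L lborel (g i))"
proof -
  define e where "e = (\<lambda>i::'n. axis i (1::real))"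
  have inj: "inj e" by (auto simp: e_def inj_on_def axis_eq_axis)
  have Basis: "(Basis :: (real^'n) set) = range e" by (auto simp: Basis_vec_def e_def)
  define g' where "g' = (\<lambda>b. g (inv e b))"
  have g'e: "g' (e i) = g i" for i using inj by (simp add: g'_def)
  define T where "T = (\<lambda>f :: (real^'n) \<Rightarrow> real. \<Sum>b\<in>Basis. f b *\<^sub>R b)"
  have T: "T f $ i = f (e i)" for f i
  proof -
    have "T f $ i = (\<Sum>k\<in>UNIV. f (e k) * (e k $ i))"
      unfolding T_def Basis by (simp add: sum.reindex[OF inj])
    also have "\<dots> = (\<Sum>k\<in>UNIV. if k = i then f (e k) else 0)"
      by (intro sum.cong) (auto simp: e_def axis_def)
    finally show ?thesis by simp
  qed
  have prodB: "(\<Prod>b\<in>Basis. g' b (f b)) = (\<Prod>i\<in>UNIV. g i (T f $ i))" for f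
    unfolding Basis by (simp add: prod.reindex[OF inj] g'e T)
  interpret product_sigma_finite "\<lambda>b :: real^'n. lborel :: real measure"
    by standard
  have m: "(\<lambda>x::real^'n. \<Prod>i\<in>UNIV. g i (x $ i)) \<in> borel_measurable borel"
  proof (intro borel_measurable_prod)
    fix i
    have "g i \<in> borel_measurable borel" using borel_measurable_integrable[OF g[of i]] by simp
    moreover have "(\<lambda>x::real^'n. x $ i) \<in> borel_measurable borel"
      by (intro borel_measurable_continuous_onI continuous_intros)
    ultimately show "(\<lambda>x::real^'n. g i (x $ i)) \<in> borel_measurable borel"
      by (rule measurable_compose[rotated])
  qed
  have mT: "T \<in> (\<Pi>\<^sub>M b\<in>Basis. lborel) \<rightarrow>\<^sub>M borel" unfolding T_def by measurable
  \<comment> \<open>\<open>lborel\<close> on vectors is the image of a product measure indexed by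
    \<open>Basis\<close>; the map \<open>e\<close> and its inverse translate between
    \<open>Basis\<close> and coordinates in \<open>'n\<close>.\<close>
  have L: "(lborel :: (real^'n) measure) = distr (\<Pi>\<^sub>M b\<in>Basis. lborel) borel T"
    unfolding T_def by (rule lborel_eq)
  have int: "integrable (\<Pi>\<^sub>M b\<in>Basis. lborel) (\<lambda>f. \<Prod>b\<in>Basis. g' b (f b))"
    by (rule product_integrable_prod) (auto simp: g'_def g)
  show "integrable lborel (\<lambda>x::real^'n. \<Prod>i\<in>UNIV. g i (x $ i))"
    unfolding L using int by (subst integrable_distr_eq[OF mT m]) (simp add: prodB)
  have "(\<integral>x. (\<Prod>i\<in>UNIV. g i (x $ i)) \<partial>(lborel :: (real^'n) measure)) =
      (\<integral>f. (\<Prod>b\<in>Basis. g' b (f b)) \<partial>(\<Pi>\<^sub>M b\<in>Basis. lborel))"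
    unfolding L by (subst integral_distr[OF mT m]) (simp add: prodB)
  also have "\<dots> = (\<Prod>b\<in>Basis. integral\<^sup>L lborel (g' b))"
    by (rule product_integral_prod) (auto simp: g'_def g)
  also have "\<dots> = (\<Prod>i\<in>UNIV. integral\<^sup>L lborel (g i))"
    unfolding Basis by (simp add: prod.reindex[OF inj] g'e)
  finally show "(\<integral>x. (\<Prod>i\<in>UNIV. g i (x $ i)) \<partial>(lborel :: (real^'n) measure)) = (\<Prod>i\<in>UNIV. integral\<^sup>L lborel (g i))" .
qed

text \<open>A product over coordinates rather than a power of \<open>1 + norm x\<close>: integrals
  and lattice sums of it factorise, and it is integrable in every dimension.\<close>

definition decay :: "real^'n \<Rightarrow> real" where "decay x = (\<Prod>i\<in>UNIV. 1 / (1 + (x $ i)\<^sup>2))"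

lemma one_plus_square_pos: "0 < 1 + (a::real)\<^sup>2"
  by (rule add_pos_nonneg) auto

lemma decay_pos: "decay x > 0"
  unfolding decay_def by (intro prod_pos) (auto intro: one_plus_square_pos)

lemma decay_le_1: "decay x \<le> 1"
  unfolding decay_def by (intro prod_le_1) (auto simp: divide_le_eq_1 one_plus_square_pos less_imp_le)

lemma integrable_inverse_1_plus_square_lborel: "integrable lborel (\<lambda>x::real. 1 / (1 + x\<^sup>2))"
  using integrable_inverse_1_plus_square by (simp add: set_integrable_def inverse_eq_divide)

lemma integrable_decay: "integrable lborel (decay :: real^'n \<Rightarrow> real)"
  unfolding decay_def[abs_def] by (rule integrable_prod_vec[OF integrable_inverse_1_plus_square_lborel])

text \<open>Serves to compare the weight at a point with the weight at the centre of the unit cube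
  containing it.\<close>

lemma decay_close:
  fixes x y :: "real^'n"
  assumes "\<And>i. \<bar>y $ i - x $ i\<bar> \<le> 1/2"
  shows "decay x \<le> 2 ^ CARD('n) * decay y"
proof -
  have "decay x \<le> (\<Prod>i\<in>(UNIV::'n set). 2 * (1 / (1 + (y $ i)\<^sup>2)))"
    unfolding decay_def
  proof (intro prod_mono conjI)
    fix i
    define a where "a = x $ i" define b where "b = y $ i"
    have "\<bar>b - a\<bar> \<le> \<bar>1/2\<bar>" using assms[of i] by (simp add: a_def b_def)
    hence "(b - a)\<^sup>2 \<le> (1/2)\<^sup>2" by (simp only: abs_le_square_iff)
    hence "(b - a)\<^sup>2 \<le> 1/4" by (simp add: power2_eq_square)
    moreover have "2 * (1 + a\<^sup>2) - (1 + b\<^sup>2) = 1 - 2 * (b - a)\<^sup>2 + (b - 2 * a)\<^sup>2"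
      by (simp add: power2_eq_square algebra_simps)
    moreover have "(b - 2 * a)\<^sup>2 \<ge> 0" by simp
    ultimately have "1 + b\<^sup>2 \<le> 2 * (1 + a\<^sup>2)" by linarith
    hence "1 / (1 + a\<^sup>2) \<le> 2 * (1 / (1 + b\<^sup>2))"
      using one_plus_square_pos[of a] one_plus_square_pos[of b] by (simp add: divide_simps mult.commute split: if_splits)
    thus "1 / (1 + (x $ i)\<^sup>2) \<le> 2 * (1 / (1 + (y $ i)\<^sup>2))" by (simp add: a_def b_def)
  qed (auto intro!: divide_nonneg_nonneg add_nonneg_nonneg)
  also have "\<dots> = 2 ^ CARD('n) * decay y" unfolding prod.distrib decay_def by simp
  finally show ?thesis .
qed

text \<open>Peetre's inequality \<open>1 + a\<^sup>2 \<le> 2 * (1 + (a - b)\<^sup>2) * (1 +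
  b\<^sup>2)\<close> in each coordinate. It controls translates of the weight, hence convolutions
  and difference quotients.\<close>

lemma decay_diff: "decay (x - y) \<le> 2 ^ CARD('n) * decay x / decay (y :: real^'n)"
proof -
  have 1: "1 / (1 + (a - b)\<^sup>2) \<le> 2 * (1 / (1 + a\<^sup>2)) / (1 / (1 + b\<^sup>2))" for a b :: real
  proof -
    have "2 * ((1 + (a - b)\<^sup>2) * (1 + b\<^sup>2)) - (1 + a\<^sup>2) = (a - 2 * b)\<^sup>2 + 1 + 2 * ((a - b)\<^sup>2 * b\<^sup>2)"
      by (simp add: power2_eq_square algebra_simps)
    moreover have "(a - 2 * b)\<^sup>2 + 1 + 2 * ((a - b)\<^sup>2 * b\<^sup>2) \<ge> 0" by simp
    ultimately have le: "1 + a\<^sup>2 \<le> 2 * ((1 + (a - b)\<^sup>2) * (1 + b\<^sup>2))" by linarith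
    have "1 / D \<le> 2 * (1 / A) / (1 / B)" if "A \<le> 2 * (D * B)" "A > 0" "D > 0" "B > 0" for A B D :: real
      using that by (simp add: field_simps)
    from this[OF le one_plus_square_pos one_plus_square_pos one_plus_square_pos] show ?thesis .
  qed
  have "decay (x - y) \<le> (\<Prod>i\<in>UNIV. 2 * (1 / (1 + (x $ i)\<^sup>2)) / (1 / (1 + (y $ i)\<^sup>2)))"
    unfolding decay_def by (intro prod_mono conjI) (use 1 in \<open>auto intro: less_imp_le one_plus_square_pos\<close>)
  also have "\<dots> = 2 ^ CARD('n) * decay x / decay y"
    unfolding prod_dividef prod.distrib decay_def by simp
  finally show ?thesis .
qed

text \<open>Converts the bounds of \<open>schwartz\<close>, stated with powers of
  \<open>1 + norm x\<close>, into bounds by \<open>decay\<close>: each factor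
  \<open>1 + (x $ i)\<^sup>2\<close> is at most \<open>(1 + norm x)\<^sup>2\<close>.\<close>

lemma decay_norm: "1 \<le> decay (x :: real^'n) * (1 + norm x) ^ (2 * CARD('n))"
proof -
  have "(\<Prod>i\<in>(UNIV::'n set). 1 + (x $ i)\<^sup>2) \<le> (\<Prod>i\<in>(UNIV::'n set). (1 + norm x)\<^sup>2)"
  proof (intro prod_mono conjI)
    fix i :: 'n
    have "(x $ i)\<^sup>2 \<le> (norm x)\<^sup>2" using component_le_norm_cart[of x i] by (metis abs_le_square_iff abs_norm_cancel)
    moreover have "(1 + norm x)\<^sup>2 = 1 + 2 * norm x + (norm x)\<^sup>2" by (simp add: power2_sum)
    ultimately show "1 + (x $ i)\<^sup>2 \<le> (1 + norm x)\<^sup>2" using norm_ge_zero[of x] by linarith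
  qed auto
  also have "\<dots> = (1 + norm x) ^ (2 * CARD('n))" by (simp flip: power_mult)
  finally have "(\<Prod>i\<in>(UNIV::'n set). 1 + (x $ i)\<^sup>2) \<le> (1 + norm x) ^ (2 * CARD('n))" .
  moreover have "decay x = 1 / (\<Prod>i\<in>(UNIV::'n set). 1 + (x $ i)\<^sup>2)"
    by (simp add: decay_def prod_dividef)
  moreover have "(\<Prod>i\<in>(UNIV::'n set). 1 + (x $ i)\<^sup>2) > 0" by (intro prod_pos) (auto intro: add_pos_nonneg)
  ultimately show ?thesis by simp
qed

section \<open>Change of variables and the Fourier transform\<close>

lemma borel_measurable_lborel_continuous:
  "continuous_on UNIV f \<Longrightarrow> f \<in> borel_measurable lborel"
  by (simp add: borel_measurable_continuous_onI)

lemma lborel_translate: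
  fixes f :: "'a::euclidean_space \<Rightarrow> 'b::{banach,second_countable_topology}"
  shows "(\<integral>x. f (x + a) \<partial>lborel) = (\<integral>x. f x \<partial>lborel)"
    and integrable_lborel_translate: "integrable lborel (\<lambda>x. f (x + a)) \<longleftrightarrow> integrable lborel f"
proof -
  have bij: "(\<lambda>x. a + x) \<in> lborel \<rightarrow>\<^sub>M borel" by simp
  show I: "integrable lborel (\<lambda>x. f (x + a)) \<longleftrightarrow> integrable lborel f"
  proof -
    have *: "integrable lborel (\<lambda>x. g (x + c))" if "integrable lborel g" for g :: "'a \<Rightarrow> 'b" and c
    proof -
      have "integrable (distr lborel borel ((+) c)) g" using that by (simp add: lborel_distr_plus)
      hence "integrable lborel (\<lambda>x. g (c + x))"
        by (subst (asm) integrable_distr_eq) (use that in auto)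
      thus ?thesis by (simp add: add.commute)
    qed
    show ?thesis using *[of f a] *[of "\<lambda>x. f (x + a)" "- a"] by auto
  qed
  show "(\<integral>x. f (x + a) \<partial>lborel) = (\<integral>x. f x \<partial>lborel)"
  proof (cases "integrable lborel f")
    case True
    have "(\<integral>x. f x \<partial>lborel) = (\<integral>x. f x \<partial>(distr lborel borel ((+) a)))" by (simp add: lborel_distr_plus)
    also have "\<dots> = (\<integral>x. f (a + x) \<partial>lborel)" by (rule integral_distr) (use True in auto)
    finally show ?thesis by (simp add: add.commute)
  next
    case False
    thus ?thesis using I by (simp add: not_integrable_integral_eq)
  qed
qed

lemma lborel_scale:
  fixes f :: "'a::euclidean_space \<Rightarrow> 'b::{banach,second_countable_topology}"
  assumes c: "c > 0" and f: "integrable lborel f"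
  shows "integrable lborel (\<lambda>x. f (c *\<^sub>R x))"
    and "(\<integral>x. f x \<partial>lborel) = c ^ DIM('a) *\<^sub>R (\<integral>x. f (c *\<^sub>R x) \<partial>lborel)"
proof -
  have L: "(lborel :: 'a measure) = density (distr lborel borel (\<lambda>x. 0 + c *\<^sub>R x)) (\<lambda>_. \<bar>c\<bar> ^ DIM('a))"
    using lborel_affine[of c "0::'a"] c by simp
  have m: "f \<in> borel_measurable borel" using f by auto
  have "integrable (density (distr lborel borel (\<lambda>x. 0 + c *\<^sub>R x)) (\<lambda>_. \<bar>c\<bar> ^ DIM('a))) f"
    using f L by simp
  hence "integrable lborel (\<lambda>x. c ^ DIM('a) *\<^sub>R f (c *\<^sub>R x))"
    using c m by (subst (asm) integrable_density) (auto simp: integrable_distr_eq)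
  from integrable_scaleR_right[of "inverse (c ^ DIM('a))", OF this]
  show "integrable lborel (\<lambda>x. f (c *\<^sub>R x))" using c by simp
  have "(\<integral>x. f x \<partial>lborel) = (\<integral>x. f x \<partial>(density (distr lborel borel (\<lambda>x. 0 + c *\<^sub>R x)) (\<lambda>_. \<bar>c\<bar> ^ DIM('a))))"
    using L by simp
  also have "\<dots> = c ^ DIM('a) *\<^sub>R (\<integral>x. f (c *\<^sub>R x) \<partial>lborel)"
    using c m by (subst integral_density) (auto simp: integral_distr)
  finally show "(\<integral>x. f x \<partial>lborel) = c ^ DIM('a) *\<^sub>R (\<integral>x. f (c *\<^sub>R x) \<partial>lborel)" .
qed

text \<open>The characteristic function at \<open>2 * pi * \<xi>\<close>; in this normalisation the
  integer lattice is its own dual and Poisson summation carries no constants.\<close>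

definition fourier :: "(real^'n \<Rightarrow> real) \<Rightarrow> real^'n \<Rightarrow> complex" where
  "fourier f \<xi> = (\<integral>x. complex_of_real (f x) * cis (2 * pi * (\<xi> \<bullet> x)) \<partial>lborel)"

lemma cis_measurable: "(\<lambda>x::real^'n. cis (2 * pi * (\<xi> \<bullet> x))) \<in> borel_measurable borel"
  by (intro borel_measurable_continuous_onI continuous_intros)

lemma integrable_times_cis:
  fixes f :: "real^'n \<Rightarrow> real"
  assumes "integrable lborel f"
  shows "integrable lborel (\<lambda>x. complex_of_real (f x) * cis (2 * pi * (\<xi> \<bullet> x)))"
proof (rule Bochner_Integration.integrable_bound[OF assms])
  show "(\<lambda>x. complex_of_real (f x) * cis (2 * pi * (\<xi> \<bullet> x))) \<in> borel_measurable lborel"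
    using assms cis_measurable[of \<xi>] by auto
qed (auto simp: norm_mult)

lemma fourier_norm_le:
  fixes f :: "real^'n \<Rightarrow> real"
  assumes "integrable lborel f"
  shows "norm (fourier f \<xi>) \<le> (\<integral>x. \<bar>f x\<bar> \<partial>lborel)"
proof -
  have "norm (fourier f \<xi>) \<le> (\<integral>x. norm (complex_of_real (f x) * cis (2 * pi * (\<xi> \<bullet> x))) \<partial>lborel)"
    unfolding fourier_def by (rule integral_norm_bound)
  thus ?thesis by (simp add: norm_mult)
qed

lemma fourier_translate:
  fixes f :: "real^'n \<Rightarrow> real"
  shows "fourier (\<lambda>x. f (x + a)) \<xi> = cis (- (2 * pi * (\<xi> \<bullet> a))) * fourier f \<xi>"
proof -
  have "cis (- (2 * pi * (\<xi> \<bullet> a))) * fourier f \<xi> =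
      cis (- (2 * pi * (\<xi> \<bullet> a))) * (\<integral>x. complex_of_real (f (x + a)) * cis (2 * pi * (\<xi> \<bullet> (x + a))) \<partial>lborel)"
    unfolding fourier_def by (subst lborel_translate[where a = a, symmetric]) simp
  also have "\<dots> = (\<integral>x. cis (- (2 * pi * (\<xi> \<bullet> a))) * (complex_of_real (f (x + a)) * cis (2 * pi * (\<xi> \<bullet> (x + a)))) \<partial>lborel)"
    by simp
  also have "\<dots> = fourier (\<lambda>x. f (x + a)) \<xi>"
    unfolding fourier_def
  proof (intro Bochner_Integration.integral_cong refl)
    fix x :: "real^'n"
    have "cis (- A) * (r * cis B) = r * cis (B - A)" for A B r
      by (simp add: cis_mult mult.left_commute)
    moreover have "2 * pi * (\<xi> \<bullet> (x + a)) - 2 * pi * (\<xi> \<bullet> a) = 2 * pi * (\<xi> \<bullet> x)"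
      by (simp add: inner_add_right algebra_simps)
    ultimately show "cis (- (2 * pi * (\<xi> \<bullet> a))) * (complex_of_real (f (x + a)) * cis (2 * pi * (\<xi> \<bullet> (x + a))))
        = complex_of_real (f (x + a)) * cis (2 * pi * (\<xi> \<bullet> x))"
      by metis
  qed
  finally show ?thesis ..
qed

lemma integrable_decay_bound:
  fixes f :: "real^'n \<Rightarrow> real"
  assumes "continuous_on UNIV f" "\<And>x. \<bar>f x\<bar> \<le> C * decay x"
  shows "integrable lborel f"
proof (rule Bochner_Integration.integrable_bound)
  show "integrable lborel (\<lambda>x :: real^'n. C * decay x)" by (intro integrable_mult_right integrable_decay)
  show "f \<in> borel_measurable lborel" by (rule borel_measurable_lborel_continuous[OF assms(1)])
  have "\<bar>f x\<bar> \<le> \<bar>C * decay x\<bar>" for x using assms(2)[of x] by linarith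
  thus "AE x in lborel. norm (f x) \<le> norm (C * decay x)" by simp
qed

lemma DERIV_line:
  fixes g :: "'a::real_vector \<Rightarrow> real"
  assumes "\<And>x. ((\<lambda>t. g (x + t *\<^sub>R e)) has_real_derivative g' x) (at 0)"
  shows "((\<lambda>t. g (x + t *\<^sub>R e)) has_real_derivative g' (x + t *\<^sub>R e)) (at t)"
  using assms[of "x + t *\<^sub>R e"] DERIV_shift[of "\<lambda>t. g (x + t *\<^sub>R e)" "g' (x + t *\<^sub>R e)" 0 t]
  by (simp add: algebra_simps scaleR_add_left)

lemma line_increment_bound:
  fixes g :: "'a::real_vector \<Rightarrow> real"
  assumes "\<And>x. ((\<lambda>t. g (x + t *\<^sub>R e)) has_real_derivative g' x) (at 0)"
    and "\<And>s. \<bar>s\<bar> \<le> \<bar>t\<bar> \<Longrightarrow> \<bar>g' (x + s *\<^sub>R e)\<bar> \<le> B"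
  shows "\<bar>g (x + t *\<^sub>R e) - g x\<bar> \<le> B * \<bar>t\<bar>"
proof -
  have "norm (g (x + t *\<^sub>R e) - g (x + 0 *\<^sub>R e)) \<le> B * norm (t - 0)"
  proof (rule field_differentiable_bound[where S = "{- \<bar>t\<bar>..\<bar>t\<bar>}" and f = "\<lambda>t. g (x + t *\<^sub>R e)"])
    show "((\<lambda>t. g (x + t *\<^sub>R e)) has_field_derivative g' (x + z *\<^sub>R e)) (at z within {- \<bar>t\<bar>..\<bar>t\<bar>})" for z
      by (rule has_field_derivative_at_within[OF DERIV_line[OF assms(1)]])
  qed (use assms(2) in auto)
  thus ?thesis by simp
qed

text \<open>The definition of \<open>schwartz\<close> provides only partial derivatives, so the way
  from \<open>x\<close> to \<open>y\<close> changes one coordinate at a time; the induction runs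
  over a set of coordinates outside which the two points agree. Continuity of all derivatives
  follows from this estimate.\<close>

lemma partial_derivs_lipschitz:
  fixes g :: "real^'n \<Rightarrow> real"
  assumes der: "\<And>x i. ((\<lambda>t. g (x + t *\<^sub>R axis i 1)) has_real_derivative g' i x) (at 0)"
    and bd: "\<And>x i. \<bar>g' i x\<bar> \<le> C"
  shows "\<bar>g x - g y\<bar> \<le> C * (\<Sum>i\<in>UNIV. \<bar>x $ i - y $ i\<bar>)"
proof -
  have "\<bar>g x - g y\<bar> \<le> C * (\<Sum>i\<in>A. \<bar>x $ i - y $ i\<bar>)" if "finite A" "\<And>i. i \<notin> A \<Longrightarrow> x $ i = y $ i" for A x y
    using that
  proof (induction A arbitrary: x rule: finite_induct)
    case empty
    hence "x = y" by (simp add: vec_eq_iff)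
    thus ?case by simp
  next
    case (insert i A)
    define z where "z = x + (y $ i - x $ i) *\<^sub>R axis i 1"
    have zi: "z $ j = (if j = i then y $ i else x $ j)" for j by (simp add: z_def axis_def)
    have "\<bar>g z - g x\<bar> \<le> C * \<bar>y $ i - x $ i\<bar>" unfolding z_def
      by (rule line_increment_bound[OF der bd])
    moreover have "\<bar>g z - g y\<bar> \<le> C * (\<Sum>j\<in>A. \<bar>z $ j - y $ j\<bar>)"
      by (rule insert.IH) (use insert.prems zi in auto)
    moreover have "(\<Sum>j\<in>A. \<bar>z $ j - y $ j\<bar>) = (\<Sum>j\<in>A. \<bar>x $ j - y $ j\<bar>)"
      by (rule sum.cong) (use insert.hyps zi in auto)
    ultimately show ?case using insert.hyps by (simp add: distrib_left abs_minus_commute[of "x $ i"])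
  qed
  from this[of UNIV x y] show ?thesis by simp
qed

lemma partial_derivs_continuous:
  fixes g :: "real^'n \<Rightarrow> real"
  assumes der: "\<And>x i. ((\<lambda>t. g (x + t *\<^sub>R axis i 1)) has_real_derivative g' i x) (at 0)"
    and bd: "\<And>x i. \<bar>g' i x\<bar> \<le> C"
  shows "continuous_on UNIV g"
proof (rule lipschitz_on_continuous_on)
  have C: "C \<ge> 0" using bd[of undefined undefined] by linarith
  show "(C * real CARD('n))-lipschitz_on UNIV g"
  proof (rule lipschitz_onI)
    fix x y :: "real^'n"
    have "(\<Sum>i\<in>UNIV. \<bar>x $ i - y $ i\<bar>) \<le> (\<Sum>i\<in>(UNIV::'n set). norm (x - y))"
      by (intro sum_mono) (metis component_le_norm_cart vector_minus_component)
    hence "C * (\<Sum>i\<in>UNIV. \<bar>x $ i - y $ i\<bar>) \<le> C * (real CARD('n) * norm (x - y))"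
      using C by (intro mult_left_mono) auto
    thus "dist (g x) (g y) \<le> C * real CARD('n) * dist x y"
      using partial_derivs_lipschitz[OF der bd, of x y] by (simp add: dist_real_def dist_norm)
  qed (use C in auto)
qed

lemma decay_line:
  fixes x :: "real^'n"
  assumes "\<bar>s\<bar> \<le> 1"
  shows "decay (x + s *\<^sub>R axis i 1) \<le> 2 ^ (CARD('n) + 1) * decay x"
proof -
  have "decay (- s *\<^sub>R axis i 1 :: real^'n) = (\<Prod>j\<in>UNIV. if j = i then 1 / (1 + s\<^sup>2) else 1)"
    unfolding decay_def by (intro prod.cong) (auto simp: axis_def)
  also have "\<dots> = 1 / (1 + s\<^sup>2)" by (simp add: prod.delta)
  finally have d: "decay (- s *\<^sub>R axis i 1 :: real^'n) = 1 / (1 + s\<^sup>2)" .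
  have "s\<^sup>2 \<le> 1" using assms by (simp add: abs_square_le_1)
  have "decay (x - (- s *\<^sub>R axis i 1)) \<le> 2 ^ CARD('n) * decay x * (1 + s\<^sup>2)"
    using decay_diff[of x "- s *\<^sub>R axis i 1"] unfolding d by simp
  also have "\<dots> \<le> 2 ^ CARD('n) * decay x * 2"
    using decay_pos[of x] \<open>s\<^sup>2 \<le> 1\<close> by (intro mult_left_mono) auto
  finally show ?thesis by simp
qed

text \<open>Difference quotients instead of integration by parts: a translation multiplies the
  transform by a phase, and dominated convergence moves the limit of the quotients inside the
  integral.\<close>

lemma fourier_partial_deriv:
  fixes g g1 :: "real^'n \<Rightarrow> real"
  assumes der: "\<And>x. ((\<lambda>t. g (x + t *\<^sub>R axis i 1)) has_real_derivative g1 x) (at 0)"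
    and cont: "continuous_on UNIV g" "continuous_on UNIV g1"
    and bd: "\<And>x. \<bar>g x\<bar> \<le> C * decay x" "\<And>x. \<bar>g1 x\<bar> \<le> C1 * decay x"
  shows "fourier g1 \<xi> = - (2 * pi * \<i> * (\<xi> $ i)) * fourier g \<xi>"
proof -
  define e where "e = (axis i 1 :: real^'n)"
  \<comment> \<open>Increments of size at most 1, so that \<open>decay_line\<close> bounds all
    quotients by one multiple of \<open>decay\<close>.\<close>
  define t where "t = (\<lambda>n::nat. 1 / real (Suc n))"
  have t: "t n > 0" "t n \<le> 1" for n by (auto simp: t_def)
  have C1: "C1 \<ge> 0" using bd(2)[of undefined] decay_pos[of "undefined :: real^'n"]
    by (metis abs_ge_zero order_trans zero_le_mult_iff not_le)
  have t0: "filterlim t (at 0) sequentially"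
    unfolding filterlim_at using t LIMSEQ_inverse_real_of_nat
    by (auto simp: t_def inverse_eq_divide intro!: always_eventually)
  define s where "s = (\<lambda>n x. complex_of_real ((g (x + t n *\<^sub>R e) - g x) / t n) * cis (2 * pi * (\<xi> \<bullet> x)))"
  have ig: "integrable lborel g" by (rule integrable_decay_bound[OF cont(1) bd(1)])
  have igt: "integrable lborel (\<lambda>x. g (x + a))" for a using ig by (simp add: integrable_lborel_translate)
  have mg: "g \<in> borel_measurable borel" "g1 \<in> borel_measurable borel"
    using cont by (auto intro: borel_measurable_continuous_onI)
  have lim1: "(\<lambda>n. integral\<^sup>L lborel (s n)) \<longlonglongrightarrow> (\<integral>x. complex_of_real (g1 x) * cis (2 * pi * (\<xi> \<bullet> x)) \<partial>lborel)"
  proof (rule integral_dominated_convergence)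
    show "(\<lambda>x. complex_of_real (g1 x) * cis (2 * pi * (\<xi> \<bullet> x))) \<in> borel_measurable lborel"
      using mg cis_measurable[of \<xi>] by auto
    show "s n \<in> borel_measurable lborel" for n
      unfolding s_def using mg cis_measurable[of \<xi>] by measurable
    show "integrable lborel (\<lambda>x. C1 * 2 ^ (CARD('n) + 1) * decay (x :: real^'n))"
      by (intro integrable_mult_right integrable_decay)
    show "AE x in lborel. (\<lambda>n. s n x) \<longlonglongrightarrow> complex_of_real (g1 x) * cis (2 * pi * (\<xi> \<bullet> x))"
    proof (intro AE_I2)
      fix x
      have "(\<lambda>h. (g (x + h *\<^sub>R e) - g x) / h) \<midarrow>0\<rightarrow> g1 x"
        using der[of x] by (simp add: DERIV_def e_def)
      hence "(\<lambda>n. (g (x + t n *\<^sub>R e) - g x) / t n) \<longlonglongrightarrow> g1 x"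
        by (rule filterlim_compose[OF _ t0])
      thus "(\<lambda>n. s n x) \<longlonglongrightarrow> complex_of_real (g1 x) * cis (2 * pi * (\<xi> \<bullet> x))"
        unfolding s_def by (intro tendsto_mult tendsto_of_real tendsto_const)
    qed
    show "AE x in lborel. norm (s n x) \<le> C1 * 2 ^ (CARD('n) + 1) * decay x" for n
    proof (intro AE_I2)
      fix x
      have "\<bar>g (x + t n *\<^sub>R e) - g x\<bar> \<le> (C1 * 2 ^ (CARD('n) + 1) * decay x) * \<bar>t n\<bar>"
        unfolding e_def
      proof (rule line_increment_bound[OF der])
        fix r assume r: "\<bar>r\<bar> \<le> \<bar>t n\<bar>"
        have "\<bar>g1 (x + r *\<^sub>R axis i 1)\<bar> \<le> C1 * decay (x + r *\<^sub>R axis i 1)" by (rule bd)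
        also have "\<dots> \<le> C1 * (2 ^ (CARD('n) + 1) * decay x)"
          using r t[of n] C1 by (intro mult_left_mono decay_line) auto
        finally show "\<bar>g1 (x + r *\<^sub>R axis i 1)\<bar> \<le> C1 * 2 ^ (CARD('n) + 1) * decay x" by simp
      qed
      thus "norm (s n x) \<le> C1 * 2 ^ (CARD('n) + 1) * decay x"
        unfolding s_def norm_mult norm_of_real norm_cis using t[of n] by (simp add: abs_divide pos_divide_le_eq)
    qed
  qed
  have sn: "integral\<^sup>L lborel (s n) = (cis (- (2 * pi * (\<xi> $ i)) * t n) - 1) / complex_of_real (t n) * fourier g \<xi>" for n
  proof -
    have "integral\<^sup>L lborel (s n) = (\<integral>x. (complex_of_real (g (x + t n *\<^sub>R e)) * cis (2 * pi * (\<xi> \<bullet> x))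
        - complex_of_real (g x) * cis (2 * pi * (\<xi> \<bullet> x))) / complex_of_real (t n) \<partial>lborel)"
      unfolding s_def by (intro Bochner_Integration.integral_cong) (auto simp: algebra_simps diff_divide_distrib)
    also have "\<dots> = (fourier (\<lambda>x. g (x + t n *\<^sub>R e)) \<xi> - fourier g \<xi>) / complex_of_real (t n)"
      unfolding fourier_def
      by (subst integral_divide_zero, subst Bochner_Integration.integral_diff) (auto intro: integrable_times_cis igt ig)
    also have "\<dots> = (cis (- (2 * pi * (\<xi> $ i)) * t n) - 1) / complex_of_real (t n) * fourier g \<xi>"
      unfolding fourier_translate
      by (simp add: e_def inner_axis algebra_simps diff_divide_distrib)
    finally show ?thesis .
  qed
  have tc0: "filterlim (\<lambda>n. complex_of_real (t n)) (at 0) sequentially"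
    using t0 unfolding filterlim_at by (auto intro: tendsto_of_real[of _ 0, simplified])
  define a where "a = - (2 * pi * (\<xi> $ i))"
  have "((\<lambda>z. exp (\<i> * of_real a * z)) has_field_derivative (\<i> * of_real a)) (at 0)"
    by (auto intro!: derivative_eq_intros)
  hence "(\<lambda>h. (exp (\<i> * of_real a * h) - 1) / h) \<midarrow>0\<rightarrow> \<i> * of_real a"
    by (simp add: DERIV_def)
  hence "(\<lambda>n. (exp (\<i> * of_real a * complex_of_real (t n)) - 1) / complex_of_real (t n)) \<longlonglongrightarrow> \<i> * of_real a"
    by (rule filterlim_compose[OF _ tc0])
  hence "(\<lambda>n. (cis (a * t n) - 1) / complex_of_real (t n) * fourier g \<xi>) \<longlonglongrightarrow> \<i> * of_real a * fourier g \<xi>"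
    by (intro tendsto_mult tendsto_const) (simp add: cis_conv_exp mult.assoc)
  hence "(\<lambda>n. integral\<^sup>L lborel (s n)) \<longlonglongrightarrow> \<i> * of_real a * fourier g \<xi>"
    unfolding sn a_def .
  from LIMSEQ_unique[OF lim1 this] show ?thesis
    by (simp add: fourier_def a_def mult_ac)
qed

lemma schwartz_decay:
  fixes D :: "'n list \<Rightarrow> real^'n \<Rightarrow> real"
  assumes der: "\<And>\<alpha> x i. ((\<lambda>t. D \<alpha> (x + t *\<^sub>R axis i 1)) has_real_derivative D (i # \<alpha>) x) (at 0)"
    and bd: "\<And>\<alpha> (m::nat). \<exists>C. \<forall>x. (1 + norm x) ^ m * \<bar>D \<alpha> x\<bar> \<le> C"
  shows "continuous_on UNIV (D \<alpha>)" and "\<exists>C\<ge>0. \<forall>x. \<bar>D \<alpha> x\<bar> \<le> C * decay x ^ m"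
proof -
  have dec: "\<exists>C\<ge>0. \<forall>x. \<bar>D \<alpha> x\<bar> \<le> C * decay x ^ m" for m \<alpha>
  proof -
    obtain C where C: "\<And>x. (1 + norm x) ^ (2 * CARD('n) * m) * \<bar>D \<alpha> x\<bar> \<le> C" using bd by blast
    have C0: "C \<ge> 0" using C[of 0] by (auto intro: order_trans[rotated])
    have "\<bar>D \<alpha> x\<bar> \<le> C * decay x ^ m" for x
    proof -
      have "1 \<le> (decay x * (1 + norm x) ^ (2 * CARD('n))) ^ m"
        by (rule one_le_power[OF decay_norm])
      also have "\<dots> = decay x ^ m * (1 + norm x) ^ (2 * CARD('n) * m)"
        by (simp add: power_mult_distrib power_mult)
      finally have "\<bar>D \<alpha> x\<bar> * 1 \<le> \<bar>D \<alpha> x\<bar> * (decay x ^ m * (1 + norm x) ^ (2 * CARD('n) * m))"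
        by (intro mult_left_mono) auto
      also have "\<dots> = decay x ^ m * ((1 + norm x) ^ (2 * CARD('n) * m) * \<bar>D \<alpha> x\<bar>)" by simp
      also have "\<dots> \<le> decay x ^ m * C" using decay_pos[of x] by (intro mult_left_mono C) auto
      finally show ?thesis by (simp add: mult.commute)
    qed
    thus ?thesis using C0 by blast
  qed
  show "\<exists>C\<ge>0. \<forall>x. \<bar>D \<alpha> x\<bar> \<le> C * decay x ^ m" by (rule dec)
  have "\<forall>i. \<exists>C. \<forall>x. \<bar>D (i # \<alpha>) x\<bar> \<le> C" using bd[where m = 0] by simp
  then obtain C where C: "\<And>i x. \<bar>D (i # \<alpha>) x\<bar> \<le> C i" by metis
  have "\<bar>D (i # \<alpha>) x\<bar> \<le> (\<Sum>j\<in>UNIV. \<bar>C j\<bar>)" for i x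
    using C[of i x] member_le_sum[of i UNIV "\<lambda>j. \<bar>C j\<bar>"] by auto
  thus "continuous_on UNIV (D \<alpha>)" by (rule partial_derivs_continuous[OF der])
qed

text \<open>Taking \<open>m\<close> derivatives in direction \<open>i\<close> multiplies the modulus
  of the transform by \<open>\<bar>2 * pi * \<xi> $ i\<bar> ^ m\<close>, and the transform of an
  integrable function is bounded.\<close>

lemma schwartz_fourier_decay:
  fixes \<phi> :: "real^'n \<Rightarrow> real"
  assumes "schwartz \<phi>"
  shows "\<exists>C\<ge>0. \<forall>\<xi> i. \<bar>\<xi> $ i\<bar> ^ m * norm (fourier \<phi> \<xi>) \<le> C"
proof -
  obtain D :: "'n list \<Rightarrow> real^'n \<Rightarrow> real" where D: "D [] = \<phi>"
    and der: "\<And>\<alpha> x i. ((\<lambda>t. D \<alpha> (x + t *\<^sub>R axis i 1)) has_real_derivative D (i # \<alpha>) x) (at 0)"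
    and bd: "\<And>\<alpha> (m::nat). \<exists>C. \<forall>x. (1 + norm x) ^ m * \<bar>D \<alpha> x\<bar> \<le> C"
    using assms unfolding schwartz_def by blast
  note S = schwartz_decay[OF der bd]
  have dec1: "\<exists>C. \<forall>x. \<bar>D \<alpha> x\<bar> \<le> C * decay x" for \<alpha> using S(2)[of \<alpha> 1] by auto
  have int: "integrable lborel (D \<alpha>)" for \<alpha>
    using dec1[of \<alpha>] integrable_decay_bound[OF S(1)] by blast
  have F: "fourier (D (replicate k i)) \<xi> = (- (2 * pi * \<i> * (\<xi> $ i))) ^ k * fourier \<phi> \<xi>" for k i \<xi>
  proof (induction k)
    case (Suc k)
    obtain C where C: "\<And>x. \<bar>D (replicate k i) x\<bar> \<le> C * decay x" using dec1 by blast
    obtain C1 where C1: "\<And>x. \<bar>D (i # replicate k i) x\<bar> \<le> C1 * decay x" using dec1 by blast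
    have "fourier (D (i # replicate k i)) \<xi> = - (2 * pi * \<i> * (\<xi> $ i)) * fourier (D (replicate k i)) \<xi>"
      by (rule fourier_partial_deriv[OF der S(1) S(1) C C1])
    thus ?case by (simp add: Suc)
  qed (simp add: D)
  define C where "C = (\<Sum>i\<in>UNIV. \<integral>x. \<bar>D (replicate m i) x\<bar> \<partial>lborel)"
  have "\<bar>\<xi> $ i\<bar> ^ m * norm (fourier \<phi> \<xi>) \<le> C" for \<xi> i
  proof -
    have "\<bar>\<xi> $ i\<bar> \<le> 2 * pi * \<bar>\<xi> $ i\<bar>" using mult_right_mono[of 1 "2 * pi" "\<bar>\<xi> $ i\<bar>"] pi_ge_two by simp
    hence "\<bar>\<xi> $ i\<bar> ^ m * norm (fourier \<phi> \<xi>) \<le> (2 * pi * \<bar>\<xi> $ i\<bar>) ^ m * norm (fourier \<phi> \<xi>)"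
      by (intro mult_right_mono power_mono) auto
    also have "\<dots> = norm (fourier (D (replicate m i)) \<xi>)"
      unfolding F by (simp add: norm_mult norm_power)
    also have "\<dots> \<le> (\<integral>x. \<bar>D (replicate m i) x\<bar> \<partial>lborel)" by (rule fourier_norm_le[OF int])
    also have "\<dots> \<le> C" unfolding C_def by (rule member_le_sum) auto
    finally show ?thesis .
  qed
  moreover have "C \<ge> 0" unfolding C_def by (intro sum_nonneg integral_nonneg_AE) auto
  ultimately show ?thesis by blast
qed

lemma schwartz_properties:
  assumes "schwartz \<phi>"
  shows "continuous_on UNIV \<phi>" "\<exists>C\<ge>0. \<forall>x. \<bar>\<phi> x\<bar> \<le> C * decay x ^ m"
proof -
  obtain D :: "'a list \<Rightarrow> real^'a \<Rightarrow> real" where D: "D [] = \<phi>"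
    and der: "\<And>\<alpha> x i. ((\<lambda>t. D \<alpha> (x + t *\<^sub>R axis i 1)) has_real_derivative D (i # \<alpha>) x) (at 0)"
    and bd: "\<And>\<alpha> (m::nat). \<exists>C. \<forall>x. (1 + norm x) ^ m * \<bar>D \<alpha> x\<bar> \<le> C"
    using assms unfolding schwartz_def by blast
  show "continuous_on UNIV \<phi>" "\<exists>C\<ge>0. \<forall>x. \<bar>\<phi> x\<bar> \<le> C * decay x ^ m"
    using schwartz_decay[OF der bd, where \<alpha> = "[]"] by (auto simp: D)
qed

section \<open>Bounds for the characteristic function and its powers\<close>

lemma one_minus_cos_ge:
  fixes v :: real
  assumes "\<bar>v\<bar> \<le> 1"
  shows "1 - cos v \<ge> v\<^sup>2 / 4" and "cos v \<ge> 0"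
proof -
  have half: "cos t \<ge> 1/2" if "0 \<le> t" "t \<le> 1" for t :: real
  proof -
    have "t \<le> pi / 3" using that pi_gt3 by simp
    hence "cos (pi / 3) \<le> cos t" using that pi_gt3 by (intro cos_monotone_0_pi_le) auto
    thus ?thesis by (simp add: cos_60)
  qed
  have *: "1 - cos v \<ge> v\<^sup>2 / 4" if v: "0 < v" "v \<le> 1" for v :: real
  proof -
    obtain t where t: "0 < t" "t < v" "cos v = (\<Sum>m<2. cos_coeff m * v ^ m) + (cos (t + 1 / 2 * real 2 * pi) / fact 2) * v ^ 2"
      using Maclaurin_cos_expansion2[of v 2] v by auto
    have "cos v = 1 - cos t / 2 * v\<^sup>2" using t(3) by (simp add: cos_coeff_def numeral_2_eq_2)
    moreover have "cos t / 2 * v\<^sup>2 \<ge> (1/2) / 2 * v\<^sup>2"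
      using half[of t] t v by (intro mult_right_mono divide_right_mono) auto
    ultimately show ?thesis by simp
  qed
  show "1 - cos v \<ge> v\<^sup>2 / 4" using *[of "\<bar>v\<bar>"] assms by (cases "v = 0") auto
  show "cos v \<ge> 0" using half[of "\<bar>v\<bar>"] assms by simp
qed

text \<open>After rotation by the argument, \<open>1 - norm (fourier \<phi> \<xi>)\<close> is the
  integral of \<open>\<phi> * (1 - cos u)\<close> with \<open>u\<close> affine in \<open>x\<close>.
  On a ball where \<phi> is bounded below, the points \<open>x\<close> and \<open>x + e\<close> have
  phases that differ by \<open>2 * v\<close>, so their cosines cannot both be close to 1. The
  argument uses one coordinate of \<xi> at a time and gives a constant uniform on the strip
  \<open>\<bar>\<xi> $ i\<bar> \<le> R\<close>.\<close>

lemma fourier_near_bound: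
  fixes \<phi> :: "real^'n \<Rightarrow> real"
  assumes cont: "continuous_on UNIV \<phi>" and int: "integrable lborel \<phi>" and nn: "\<And>x. \<phi> x \<ge> 0"
    and one: "integral\<^sup>L lborel \<phi> = 1" and R: "R > 0"
  shows "\<exists>c>0. \<forall>\<xi> i. \<bar>\<xi> $ i\<bar> \<le> R \<longrightarrow> norm (fourier \<phi> \<xi>) \<le> 1 - c * (\<xi> $ i)\<^sup>2"
proof -
  have "\<exists>x. \<phi> x > 0"
  proof (rule ccontr)
    assume "\<nexists>x. \<phi> x > 0"
    hence "\<phi> x = 0" for x using nn[of x] by (meson not_less order_antisym)
    hence "\<phi> = (\<lambda>_. 0)" by (rule ext)
    thus False using one by simp
  qed
  then obtain x0 where x0: "\<phi> x0 > 0" by blast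
  define a where "a = \<phi> x0 / 2"
  have a: "a > 0" using x0 by (simp add: a_def)
  have "open {x. a < \<phi> x}" using cont by (intro open_Collect_less continuous_intros)
  moreover have "x0 \<in> {x. a < \<phi> x}" using x0 by (simp add: a_def)
  ultimately obtain r' where r': "r' > 0" "ball x0 r' \<subseteq> {x. a < \<phi> x}" using openE by blast
  define r where "r = r' / 2"
  have r: "r > 0" using r' by (simp add: r_def)
  define B where "B = ball x0 r'"
  define B1 where "B1 = ball x0 r"
  \<comment> \<open>Small enough for \<open>pi * R * t \<le> 1\<close>, the range of
    \<open>one_minus_cos_ge\<close>, and for the shift of \<open>B1\<close> by \<open>t\<close> to
    stay inside \<open>B\<close>, whose radius is twice that of \<open>B1\<close>.\<close>
  define t where "t = min r (1 / (pi * R)) / 2"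
  have t: "t > 0" "t < r" "pi * R * t \<le> 1"
    using r R by (auto simp: t_def min_def field_simps)
  define vol where "vol = measure lborel B1"
  have vol: "vol > 0" unfolding vol_def B1_def using content_ball_pos[OF r] .
  define c where "c = a * vol * (pi * t)\<^sup>2 / 4"
  have c: "c > 0" using a vol t by (simp add: c_def)
  have fin: "emeasure lborel (ball y s) < \<infinity>" for y :: "real^'n" and s
    by (rule emeasure_bounded_finite) simp
  have ind: "integrable lborel (\<lambda>x. indicator (ball y s) x * (z::real))" for y :: "real^'n" and s z
    by (intro integrable_mult_left integrable_real_indicator fin) auto
  have "norm (fourier \<phi> \<xi>) \<le> 1 - c * (\<xi> $ i)\<^sup>2" if \<xi>: "\<bar>\<xi> $ i\<bar> \<le> R" for \<xi> i
  proof -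
    define v where "v = pi * (\<xi> $ i) * t"
    have "\<bar>v\<bar> \<le> pi * R * t" using \<xi> t by (simp add: v_def abs_mult)
    hence v: "\<bar>v\<bar> \<le> 1" using t by linarith
    define b where "b = Arg (fourier \<phi> \<xi>)"
    define u where "u = (\<lambda>x. 2 * pi * (\<xi> \<bullet> x) - b)"
    define k where "k = (\<lambda>x. indicator B x * (1 - cos (u x)))"
    have um: "(\<lambda>x. cos (u x)) \<in> borel_measurable borel"
      unfolding u_def by (intro borel_measurable_continuous_onI continuous_intros)
    have k0: "k x \<ge> 0" for x by (simp add: k_def)
    have kint: "integrable lborel k"
    proof (rule Bochner_Integration.integrable_bound[where f = "\<lambda>x. indicator B x * (2::real)"])
      show "integrable lborel (\<lambda>x. indicator B x * (2::real))"
        unfolding B_def by (rule ind)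
      show "k \<in> borel_measurable lborel" unfolding k_def using um
        by (intro borel_measurable_times borel_measurable_indicator borel_measurable_diff) (auto simp: B_def)
      show "AE x in lborel. norm (k x) \<le> norm (indicator B x * (2::real))"
      proof (intro AE_I2)
        fix x
        show "norm (k x) \<le> norm (indicator B x * (2::real))"
          using cos_ge_minus_one[of "u x"] cos_le_one[of "u x"] by (auto simp: k_def indicator_def)
      qed
    qed
    have cosint: "integrable lborel (\<lambda>x. \<phi> x * cos (u x))"
      by (rule Bochner_Integration.integrable_bound[OF int]) (use um int in \<open>auto simp: abs_mult mult_left_le\<close>)
    have "norm (fourier \<phi> \<xi>) = Re (cis (- b) * fourier \<phi> \<xi>)"
    proof -
      have "cis (- b) * fourier \<phi> \<xi> = cis (- b) * (of_real (norm (fourier \<phi> \<xi>)) * cis b)"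
        using rcis_cmod_Arg[of "fourier \<phi> \<xi>"] by (simp add: rcis_def b_def)
      also have "\<dots> = of_real (norm (fourier \<phi> \<xi>))" by (simp add: cis_mult mult.left_commute)
      finally show ?thesis by simp
    qed
    also have "cis (- b) * fourier \<phi> \<xi> = (\<integral>x. cis (- b) * (complex_of_real (\<phi> x) * cis (2 * pi * (\<xi> \<bullet> x))) \<partial>lborel)"
      by (simp add: fourier_def)
    also have "Re \<dots> = (\<integral>x. Re (cis (- b) * (complex_of_real (\<phi> x) * cis (2 * pi * (\<xi> \<bullet> x)))) \<partial>lborel)"
      by (rule integral_Re[symmetric]) (intro integrable_mult_right integrable_times_cis int)
    also have "\<dots> = (\<integral>x. \<phi> x * cos (u x) \<partial>lborel)"
      by (intro Bochner_Integration.integral_cong refl) (simp add: u_def cos_diff algebra_simps)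
    finally have n1: "norm (fourier \<phi> \<xi>) = (\<integral>x. \<phi> x * cos (u x) \<partial>lborel)" .
    have n2: "1 - norm (fourier \<phi> \<xi>) = (\<integral>x. \<phi> x - \<phi> x * cos (u x) \<partial>lborel)"
      unfolding n1 by (subst Bochner_Integration.integral_diff) (auto simp: int cosint one)
    have n3: "a * (\<integral>x. k x \<partial>lborel) \<le> 1 - norm (fourier \<phi> \<xi>)"
      unfolding n2 integral_mult_right_zero[symmetric]
    proof (rule integral_mono)
      fix x
      have "a * k x \<le> \<phi> x * (1 - cos (u x))"
      proof (cases "x \<in> B")
        case True
        hence "a \<le> \<phi> x" using r' by (auto simp: B_def intro: less_imp_le)
        thus ?thesis using True by (auto simp: k_def intro!: mult_right_mono)
      qed (use nn[of x] in \<open>auto simp: k_def\<close>)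
      thus "a * k x \<le> \<phi> x - \<phi> x * cos (u x)" by (simp add: algebra_simps)
    qed (use kint int cosint in auto)
    define e where "e = (t *\<^sub>R axis i 1 :: real^'n)"
    have ke: "integrable lborel (\<lambda>x. k (x + e))" "(\<integral>x. k (x + e) \<partial>lborel) = (\<integral>x. k x \<partial>lborel)"
      using kint by (simp_all add: integrable_lborel_translate lborel_translate)
    have "(\<integral>x. indicator B1 x * (v\<^sup>2 / 2) \<partial>lborel) \<le> (\<integral>x. k x + k (x + e) \<partial>lborel)"
    proof (rule integral_mono)
      show "integrable lborel (\<lambda>x. indicator B1 x * (v\<^sup>2 / 2))"
        unfolding B1_def by (rule ind)
      show "integrable lborel (\<lambda>x. k x + k (x + e))" using kint ke by auto
      fix x
      show "indicator B1 x * (v\<^sup>2 / 2) \<le> k x + k (x + e)"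
      proof (cases "x \<in> B1")
        case True
        have ne: "norm e = t" using t by (simp add: e_def norm_axis_1)
        have "x \<in> B" using True r by (auto simp: B_def B1_def r_def)
        moreover have "x + e \<in> B"
        proof -
          have "dist x0 (x + e) \<le> dist x0 x + norm e"
            by (metis dist_norm dist_triangle add_diff_cancel_left' dist_commute)
          thus ?thesis using True ne t by (simp add: B_def B1_def r_def)
        qed
        moreover have "u (x + e) = u x + 2 * v"
          by (simp add: u_def v_def e_def inner_add_right inner_axis algebra_simps)
        moreover have "2 - cos (u x) - cos (u x + 2 * v) \<ge> v\<^sup>2 / 2"
        proof -
          \<comment> \<open>Sum to product: whatever the phase \<open>u x\<close>, the two cosines
            add up to at most \<open>2 * cos v\<close>.\<close>
          have "cos (u x) + cos (u x + 2 * v) = 2 * cos (u x + v) * cos v"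
            using cos_plus_cos[of "u x + 2 * v" "u x"] by (simp add: add_divide_distrib algebra_simps)
          also have "\<dots> \<le> 2 * 1 * cos v"
            using one_minus_cos_ge(2)[OF v] by (intro mult_right_mono mult_left_mono) auto
          finally show ?thesis using one_minus_cos_ge(1)[OF v] by simp
        qed
        ultimately show ?thesis using True by (simp add: k_def)
      qed (use k0 in auto)
    qed
    also have "\<dots> = 2 * (\<integral>x. k x \<partial>lborel)" using kint ke by simp
    also have "(\<integral>x. indicator B1 x * (v\<^sup>2 / 2) \<partial>lborel) = vol * (v\<^sup>2 / 2)" by (simp add: vol_def B1_def)
    finally have "vol * v\<^sup>2 / 4 \<le> (\<integral>x. k x \<partial>lborel)" by simp
    hence "a * (vol * v\<^sup>2 / 4) \<le> 1 - norm (fourier \<phi> \<xi>)"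
      using n3 a by (meson mult_left_mono less_imp_le order_trans)
    moreover have "a * (vol * v\<^sup>2 / 4) = c * (\<xi> $ i)\<^sup>2"
      by (simp add: c_def v_def power_mult_distrib)
    ultimately show ?thesis by simp
  qed
  thus ?thesis using c by blast
qed

text \<open>If \<open>M\<close> is the largest coordinate in modulus, the product of the
  denominators is at most \<open>(1 + c * M\<^sup>2) ^ d\<close>. For bounded \<open>M\<close> this
  is compensated by \<open>exp (- c0 * M\<^sup>2)\<close>, beyond that by rapid decay with exponent
  \<open>2 * d + 1\<close>.\<close>

lemma fourier_product_bound:
  fixes \<phi> :: "real^'n \<Rightarrow> real"
  assumes schw: "schwartz \<phi>" and nn: "\<And>x. \<phi> x \<ge> 0" and one: "integral\<^sup>L lborel \<phi> = 1"
  shows "\<exists>c>0. \<forall>\<xi>. norm (fourier \<phi> \<xi>) \<le> (\<Prod>i\<in>UNIV. 1 / (1 + c * (\<xi> $ i)\<^sup>2))"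
proof -
  define d where "d = CARD('n)"
  have d: "d > 0" by (simp add: d_def)
  have cont: "continuous_on UNIV \<phi>" by (rule schwartz_properties[OF schw])
  obtain C' where C': "\<And>x. \<bar>\<phi> x\<bar> \<le> C' * decay x" using schwartz_properties(2)[OF schw, of 1] by auto
  have int: "integrable lborel \<phi>" by (rule integrable_decay_bound[OF cont C'])
  obtain C where C: "C \<ge> 0" "\<And>\<xi> i. \<bar>\<xi> $ i\<bar> ^ (2 * d + 1) * norm (fourier \<phi> \<xi>) \<le> C"
    using schwartz_fourier_decay[OF schw] by metis
  \<comment> \<open>Beyond \<open>R\<close> the one spare factor \<open>M\<close> of the rapid decay
    absorbs the constant \<open>2 ^ d * C\<close>.\<close>
  define R where "R = max 1 (2 ^ d * C)"
  have R: "R \<ge> 1" "R \<ge> 2 ^ d * C" by (auto simp: R_def)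
  obtain c0 where c0: "c0 > 0" "\<And>\<xi> i. \<bar>\<xi> $ i\<bar> \<le> R \<Longrightarrow> norm (fourier \<phi> \<xi>) \<le> 1 - c0 * (\<xi> $ i)\<^sup>2"
    using fourier_near_bound[OF cont int nn one, of R] R by auto
  \<comment> \<open>\<open>d * c \<le> c0\<close> serves the bounded range; \<open>c \<le> 1\<close>
    gives \<open>1 + c * M\<^sup>2 \<le> 2 * M\<^sup>2\<close> in the far range.\<close>
  define c where "c = min 1 (c0 / real d)"
  have c: "c > 0" "c \<le> 1" "real d * c \<le> c0" using c0 d by (auto simp: c_def min_def field_simps)
  have "norm (fourier \<phi> \<xi>) \<le> (\<Prod>i\<in>UNIV. 1 / (1 + c * (\<xi> $ i)\<^sup>2))" for \<xi>
  proof -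
    have "Max (range (\<lambda>i. \<bar>\<xi> $ i\<bar>)) \<in> range (\<lambda>i. \<bar>\<xi> $ i\<bar>)" by (rule Max_in) auto
    then obtain i where i: "\<bar>\<xi> $ i\<bar> = Max (range (\<lambda>i. \<bar>\<xi> $ i\<bar>))" by (metis imageE)
    have max: "\<bar>\<xi> $ j\<bar> \<le> \<bar>\<xi> $ i\<bar>" for j unfolding i by (rule Max_ge) auto
    define M where "M = \<bar>\<xi> $ i\<bar>"
    have M: "M \<ge> 0" by (simp add: M_def)
    define P where "P = (\<Prod>j\<in>(UNIV::'n set). 1 + c * (\<xi> $ j)\<^sup>2)"
    have P0: "P > 0" unfolding P_def using c by (intro prod_pos) (auto intro: add_pos_nonneg)
    have PM: "P \<le> (1 + c * M\<^sup>2) ^ d"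
    proof -
      have "P \<le> (\<Prod>j\<in>(UNIV::'n set). 1 + c * M\<^sup>2)"
        unfolding P_def using c max
        by (intro prod_mono conjI add_nonneg_nonneg add_mono mult_left_mono mult_nonneg_nonneg)
           (auto simp: M_def abs_le_square_iff[symmetric])
      thus ?thesis by (simp add: d_def)
    qed
    have "norm (fourier \<phi> \<xi>) * P \<le> 1"
    proof (cases "M \<le> R")
      case True
      have "norm (fourier \<phi> \<xi>) \<le> 1 - c0 * M\<^sup>2" using c0(2)[of \<xi> i] True by (simp add: M_def)
      also have "\<dots> \<le> exp (- (c0 * M\<^sup>2))" using exp_ge_add_one_self[of "- (c0 * M\<^sup>2)"] by simp
      finally have 1: "norm (fourier \<phi> \<xi>) \<le> exp (- (c0 * M\<^sup>2))" .
      have "P \<le> exp (c * M\<^sup>2) ^ d"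
        using c by (intro order_trans[OF PM] power_mono exp_ge_add_one_self) auto
      also have "\<dots> = exp (real d * c * M\<^sup>2)" by (simp add: mult.assoc flip: exp_of_nat_mult)
      also have "\<dots> \<le> exp (c0 * M\<^sup>2)" using c by (simp add: mult_right_mono)
      finally have "norm (fourier \<phi> \<xi>) * P \<le> exp (- (c0 * M\<^sup>2)) * exp (c0 * M\<^sup>2)"
        using 1 P0 by (intro mult_mono) auto
      thus ?thesis by (simp flip: exp_add)
    next
      case False
      hence M1: "M > 0" "M \<ge> 1" "M \<ge> R" using R by auto
      have "1 + c * M\<^sup>2 \<le> 2 * M\<^sup>2"
      proof -
        have "1 \<le> M\<^sup>2" using M1 by (simp add: one_le_power)
        moreover have "c * M\<^sup>2 \<le> 1 * M\<^sup>2" using c by (intro mult_right_mono) auto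
        ultimately show ?thesis by simp
      qed
      hence "P \<le> (2 * M\<^sup>2) ^ d" using c by (intro order_trans[OF PM] power_mono) auto
      also have "\<dots> = 2 ^ d * M ^ (2 * d)" by (simp add: power_mult_distrib power_mult)
      finally have "M * (norm (fourier \<phi> \<xi>) * P) \<le> M * (norm (fourier \<phi> \<xi>) * (2 ^ d * M ^ (2 * d)))"
        using M by (intro mult_left_mono) auto
      also have "\<dots> = 2 ^ d * (M ^ (2 * d + 1) * norm (fourier \<phi> \<xi>))" by simp
      also have "\<dots> \<le> 2 ^ d * C" using C(2)[of \<xi> i] by (intro mult_left_mono) (auto simp: M_def)
      also have "\<dots> \<le> M * 1" using R M1 by simp
      finally show ?thesis using M1 by (simp only: mult_le_cancel_left_pos)
    qed
    hence "norm (fourier \<phi> \<xi>) \<le> 1 / P" using P0 by (simp add: pos_le_divide_eq)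
    thus ?thesis by (simp add: P_def prod_dividef)
  qed
  thus ?thesis using c by blast
qed

text \<open>One power of the decay of \<phi> pays for the loss in \<open>decay_diff\<close>, the
  other keeps the integral finite. The factor \<open>f\<close> enters with one power and the
  convolution again has one power, so the step can be iterated. The product formula is Fubini's
  theorem combined with \<open>fourier_translate\<close>.\<close>

lemma fourier_convolution_step:
  fixes f \<phi> :: "real^'n \<Rightarrow> real"
  assumes fc: "continuous_on UNIV f" and fn: "\<And>x. f x \<ge> 0" and fb: "\<And>x. \<bar>f x\<bar> \<le> C * decay x"
    and pc: "continuous_on UNIV \<phi>" and pn: "\<And>x. \<phi> x \<ge> 0" and pb: "\<And>x. \<bar>\<phi> x\<bar> \<le> C' * decay x ^ 2"
    and C: "C \<ge> 0" "C' \<ge> 0"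
  defines "g \<equiv> \<lambda>x. \<integral>y. f (x - y) * \<phi> y \<partial>lborel"
  shows "continuous_on UNIV g" "\<And>x. g x \<ge> 0" "\<exists>C\<ge>0. \<forall>x. \<bar>g x\<bar> \<le> C * decay x"
    "fourier g \<xi> = fourier f \<xi> * fourier \<phi> \<xi>"
proof -
  have pb1: "\<bar>\<phi> x\<bar> \<le> C' * decay x" for x
  proof -
    have "C' * decay x ^ 2 \<le> C' * (decay x * 1)" unfolding power2_eq_square
      using C decay_pos[of x] decay_le_1[of x] by (intro mult_left_mono) auto
    thus ?thesis using pb[of x] by simp
  qed
  have pint: "integrable lborel \<phi>" by (rule integrable_decay_bound[OF pc pb1])
  have fint: "integrable lborel f" by (rule integrable_decay_bound[OF fc fb])
  have fC: "\<bar>f x\<bar> \<le> C" for x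
    using fb[of x] mult_left_mono[OF decay_le_1[of x] C(1)] by simp
  have fm: "f \<in> borel_measurable borel" "\<phi> \<in> borel_measurable borel"
    using fc pc by (auto intro: borel_measurable_continuous_onI)
  have c2: "continuous_on UNIV (\<lambda>y. f (x - y) * \<phi> y)" for x
    by (intro continuous_on_mult pc continuous_on_compose2[OF fc] continuous_intros) auto
  have b2: "\<bar>f (x - y) * \<phi> y\<bar> \<le> (C * 2 ^ CARD('n) * C' * decay x) * decay y" for x y
  proof -
    have dp: "decay y > 0" "decay x > 0" by (rule decay_pos)+
    have "\<bar>f (x - y) * \<phi> y\<bar> \<le> (C * decay (x - y)) * (C' * decay y ^ 2)"
      unfolding abs_mult using C decay_pos[of "x - y"] by (intro mult_mono fb pb) auto
    also have "\<dots> \<le> (C * (2 ^ CARD('n) * decay x / decay y)) * (C' * decay y ^ 2)"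
      using C by (intro mult_right_mono mult_left_mono decay_diff) auto
    also have "\<dots> = (C * 2 ^ CARD('n) * C' * decay x) * decay y"
      using dp by (simp add: power2_eq_square field_simps)
    finally show ?thesis .
  qed
  have i2: "integrable lborel (\<lambda>y. f (x - y) * \<phi> y)" for x
    by (rule integrable_decay_bound[OF c2 b2])
  show g0: "g x \<ge> 0" for x unfolding g_def by (intro integral_nonneg_AE AE_I2 mult_nonneg_nonneg fn pn)
  show gb: "\<exists>C\<ge>0. \<forall>x. \<bar>g x\<bar> \<le> C * decay x"
  proof (intro exI conjI allI)
    define I where "I = (\<integral>y. decay (y::real^'n) \<partial>lborel)"
    have I: "I \<ge> 0" unfolding I_def by (intro integral_nonneg_AE AE_I2 less_imp_le decay_pos)
    show "C * 2 ^ CARD('n) * C' * I \<ge> 0" using C I by simp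
    fix x
    have "g x \<le> (\<integral>y. (C * 2 ^ CARD('n) * C' * decay x) * decay (y :: real^'n) \<partial>lborel)"
      unfolding g_def
    proof (rule integral_mono[OF i2])
      show "integrable lborel (\<lambda>y :: real^'n. (C * 2 ^ CARD('n) * C' * decay x) * decay y)"
        by (intro integrable_mult_right integrable_decay)
    qed (rule order_trans[OF abs_ge_self b2])
    also have "\<dots> = (C * 2 ^ CARD('n) * C' * I) * decay x" by (simp add: I_def)
    finally show "\<bar>g x\<bar> \<le> (C * 2 ^ CARD('n) * C' * I) * decay x" using g0[of x] by simp
  qed
  show gc: "continuous_on UNIV g"
    unfolding continuous_on_sequentially
  proof (intro allI ballI impI)
    fix u :: "nat \<Rightarrow> real^'n" and x
    assume u: "(\<forall>n. u n \<in> UNIV) \<and> u \<longlonglongrightarrow> x"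
    have "(\<lambda>n. \<integral>y. f (u n - y) * \<phi> y \<partial>lborel) \<longlonglongrightarrow> (\<integral>y. f (x - y) * \<phi> y \<partial>lborel)"
    proof (rule integral_dominated_convergence)
      show "integrable lborel (\<lambda>y. C * \<phi> y)" using pint by simp
      show "AE y in lborel. (\<lambda>n. f (u n - y) * \<phi> y) \<longlonglongrightarrow> f (x - y) * \<phi> y"
      proof (intro AE_I2 tendsto_mult tendsto_const)
        fix y
        have "(\<lambda>n. u n - y) \<longlonglongrightarrow> x - y" using u by (intro tendsto_diff) auto
        thus "(\<lambda>n. f (u n - y)) \<longlonglongrightarrow> f (x - y)"
          by (rule continuous_on_tendsto_compose[OF fc]) auto
      qed
      show "AE y in lborel. norm (f (u n - y) * \<phi> y) \<le> C * \<phi> y" for n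
        using fC pn by (intro AE_I2) (auto simp: abs_mult intro!: mult_right_mono)
    qed (use borel_measurable_integrable[OF i2] in auto)
    thus "(g \<circ> u) \<longlonglongrightarrow> g x" by (simp add: g_def o_def)
  qed
  define E where "E = (\<lambda>x::real^'n. cis (2 * pi * (\<xi> \<bullet> x)))"
  obtain Cg where Cg: "\<And>x. \<bar>g x\<bar> \<le> Cg * decay x" using gb by blast
  have gint: "integrable lborel g" by (rule integrable_decay_bound[OF gc Cg])
  define h where "h = (\<lambda>x y. complex_of_real (f (x - y) * \<phi> y) * E x)"
  have hint: "integrable (lborel \<Otimes>\<^sub>M lborel) (case_prod h)"
  proof (rule lborel_pair.Fubini_integrable)
    have "continuous_on UNIV (\<lambda>p. h (fst p) (snd p))"
      unfolding h_def E_def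
      by (intro continuous_intros continuous_on_compose2[OF fc] continuous_on_compose2[OF pc]) auto
    hence "(\<lambda>p. h (fst p) (snd p)) \<in> borel_measurable borel"
      by (rule borel_measurable_continuous_onI)
    thus "case_prod h \<in> borel_measurable (lborel \<Otimes>\<^sub>M lborel)"
      by (simp add: lborel_prod case_prod_unfold)
    have "(\<lambda>x. \<integral>y. norm (case_prod h (x, y)) \<partial>lborel) = g"
      using fn pn by (auto simp: h_def E_def g_def norm_mult abs_mult fun_eq_iff)
    thus "integrable lborel (\<lambda>x. \<integral>y. norm (case_prod h (x, y)) \<partial>lborel)" using gint by simp
    show "AE x in lborel. integrable lborel (\<lambda>y. case_prod h (x, y))"
      using i2 by (intro AE_I2) (auto simp: h_def simp del: of_real_mult intro!: integrable_mult_left integrable_of_real)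
  qed
  have "fourier g \<xi> = (\<integral>x. (\<integral>y. h x y \<partial>lborel) \<partial>lborel)"
    unfolding fourier_def h_def E_def g_def
    by (intro Bochner_Integration.integral_cong refl) (simp del: of_real_mult)
  also have "\<dots> = (\<integral>y. (\<integral>x. h x y \<partial>lborel) \<partial>lborel)"
    by (rule lborel_pair.Fubini_integral[OF hint, symmetric])
  also have "\<dots> = (\<integral>y. fourier f \<xi> * (complex_of_real (\<phi> y) * E y) \<partial>lborel)"
  proof (intro Bochner_Integration.integral_cong refl)
    fix y
    have "(\<integral>x. h x y \<partial>lborel) = complex_of_real (\<phi> y) * fourier (\<lambda>x. f (x + (- y))) \<xi>"
      unfolding h_def fourier_def E_def integral_mult_right_zero[symmetric]
      by (intro Bochner_Integration.integral_cong refl) (simp add: mult_ac)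
    also have "\<dots> = fourier f \<xi> * (complex_of_real (\<phi> y) * E y)"
      unfolding fourier_translate by (simp add: E_def mult_ac)
    finally show "(\<integral>x. h x y \<partial>lborel) = fourier f \<xi> * (complex_of_real (\<phi> y) * E y)" .
  qed
  also have "\<dots> = fourier f \<xi> * fourier \<phi> \<xi>" by (simp add: fourier_def E_def)
  finally show "fourier g \<xi> = fourier f \<xi> * fourier \<phi> \<xi>" .
qed

text \<open>All that Poisson summation asks of a convolution power, in one induction: the next
  convolution needs continuity, sign and decay of the previous power together.\<close>

lemma conv_power_properties:
  fixes \<phi> :: "real^'n \<Rightarrow> real"
  assumes schw: "schwartz \<phi>" and nn: "\<And>x. \<phi> x \<ge> 0"
  shows "continuous_on UNIV (conv_power \<phi> (Suc j)) \<and> (\<forall>x. conv_power \<phi> (Suc j) x \<ge> 0) \<and>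
    (\<exists>C\<ge>0. \<forall>x. \<bar>conv_power \<phi> (Suc j) x\<bar> \<le> C * decay x) \<and>
    (\<forall>\<xi>. fourier (conv_power \<phi> (Suc j)) \<xi> = fourier \<phi> \<xi> ^ Suc j)"
proof (induction j)
  case 0
  obtain C where "C \<ge> 0" "\<And>x. \<bar>\<phi> x\<bar> \<le> C * decay x" using schwartz_properties(2)[OF schw, of 1] by auto
  thus ?case using schwartz_properties(1)[OF schw] nn by auto
next
  case (Suc j)
  obtain C' where C': "C' \<ge> 0" "\<And>x. \<bar>\<phi> x\<bar> \<le> C' * decay x ^ 2"
    using schwartz_properties(2)[OF schw, of 2] by auto
  from Suc obtain C where C: "C \<ge> 0" "\<And>x. \<bar>conv_power \<phi> (Suc j) x\<bar> \<le> C * decay x" by auto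
  have c: "continuous_on UNIV (conv_power \<phi> (Suc j))" and n: "\<And>x. conv_power \<phi> (Suc j) x \<ge> 0"
    and f: "\<And>\<xi>. fourier (conv_power \<phi> (Suc j)) \<xi> = fourier \<phi> \<xi> ^ Suc j"
    using Suc by auto
  note S = fourier_convolution_step[OF c n C(2) schwartz_properties(1)[OF schw] nn C'(2) C(1) C'(1)]
  show ?case using S(1-3) S(4) f by (simp add: mult.commute)
qed

section \<open>Poisson summation\<close>

lemma summable_on_iff_integrable_count_space:
  fixes M :: "'a \<Rightarrow> real"
  assumes "\<And>k. M k \<ge> 0"
  shows "M summable_on A \<longleftrightarrow> integrable (count_space A) M"
  using abs_summable_equivalent[of M A] assms by (simp add: Infinite_Set_Sum.abs_summable_on_def)

lemma norm_summable_integrable_count_space: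
  fixes f :: "'a \<Rightarrow> 'b::{banach,second_countable_topology}"
  assumes "(\<lambda>k. norm (f k)) summable_on A"
  shows "integrable (count_space A) f" "infsum f A = (\<integral>k. f k \<partial>count_space A)"
proof -
  show i: "integrable (count_space A) f"
    using abs_summable_equivalent[of f A] assms by (simp add: Infinite_Set_Sum.abs_summable_on_def)
  show "infsum f A = (\<integral>k. f k \<partial>count_space A)"
    using infsetsum_infsum[of f A] i by (simp add: Infinite_Set_Sum.abs_summable_on_def infsetsum_def)
qed

text \<open>\<open>infsum\<close> of an absolutely summable family is a Bochner integral over
  \<open>count_space\<close>, so Lebesgue's theorem applies.\<close>

lemma infsum_dominated_convergence:
  fixes a :: "nat \<Rightarrow> 'k \<Rightarrow> 'b::{banach,second_countable_topology}"
  assumes M: "M summable_on UNIV" and bd: "\<And>n k. norm (a n k) \<le> M k" and lim: "\<And>k. (\<lambda>n. a n k) \<longlonglongrightarrow> b k"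
  shows "(\<lambda>n. infsum (a n) UNIV) \<longlonglongrightarrow> infsum b UNIV"
proof -
  have M0: "M k \<ge> 0" for k using bd[of 0 k] norm_ge_zero order_trans by blast
  have bb: "norm (b k) \<le> M k" for k
    by (rule tendsto_upperbound[OF tendsto_norm[OF lim]]) (use bd in auto)
  have sa: "(\<lambda>k. norm (a n k)) summable_on UNIV" for n
    by (rule summable_on_comparison_test[OF M]) (use bd in auto)
  have sb: "(\<lambda>k. norm (b k)) summable_on UNIV"
    by (rule summable_on_comparison_test[OF M]) (use bb in auto)
  show ?thesis
    unfolding norm_summable_integrable_count_space(2)[OF sa] norm_summable_integrable_count_space(2)[OF sb]
  proof (rule integral_dominated_convergence)
    show "integrable (count_space UNIV) M" using M summable_on_iff_integrable_count_space[of M UNIV] M0 by blast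
  qed (use lim bd in \<open>auto simp: AE_count_space\<close>)
qed

lemma product_summable_lattice:
  fixes g :: "int \<Rightarrow> real"
  assumes g: "\<And>l. g l \<ge> 0" and s: "g summable_on UNIV"
  shows "(\<lambda>k :: 'n::finite \<Rightarrow> int. \<Prod>i\<in>UNIV. g (k i)) summable_on UNIV"
    and "infsum (\<lambda>k :: 'n \<Rightarrow> int. \<Prod>i\<in>UNIV. g (k i)) UNIV = infsum g UNIV ^ CARD('n)"
proof -
  have P: "(PiE UNIV (\<lambda>_. UNIV) :: ('n \<Rightarrow> int) set) = UNIV" by (auto simp: PiE_UNIV_domain)
  have I: "Infinite_Set_Sum.abs_summable_on g UNIV"
    using s g by (simp add: summable_on_iff_integrable_count_space[OF g] Infinite_Set_Sum.abs_summable_on_def)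
  have "Infinite_Set_Sum.abs_summable_on (\<lambda>k :: 'n \<Rightarrow> int. \<Prod>i\<in>UNIV. g (k i)) (PiE UNIV (\<lambda>_. UNIV))"
    by (rule Infinite_Set_Sum.abs_summable_on_prod_PiE) (use I in auto)
  hence "integrable (count_space UNIV) (\<lambda>k :: 'n \<Rightarrow> int. \<Prod>i\<in>UNIV. g (k i))"
    unfolding P Infinite_Set_Sum.abs_summable_on_def .
  thus "(\<lambda>k :: 'n \<Rightarrow> int. \<Prod>i\<in>UNIV. g (k i)) summable_on UNIV"
    by (subst summable_on_iff_integrable_count_space) (auto intro!: prod_nonneg g)
  have "infsum (\<lambda>k :: 'n \<Rightarrow> int. \<Prod>i\<in>UNIV. g (k i)) (PiE UNIV (\<lambda>_. UNIV)) = (\<Prod>i\<in>(UNIV::'n set). infsum g UNIV)"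
    by (rule infsum_prod_PiE_abs) (use s g in auto)
  thus "infsum (\<lambda>k :: 'n \<Rightarrow> int. \<Prod>i\<in>UNIV. g (k i)) UNIV = infsum g UNIV ^ CARD('n)"
    unfolding P by simp
qed

definition lat :: "('n::finite \<Rightarrow> int) \<Rightarrow> real^'n" where "lat k = (\<chi> i. of_int (k i))"

lemma lat_nth [simp]: "lat k $ i = of_int (k i)" by (simp add: lat_def)

lemma int_summable_iff:
  fixes g :: "int \<Rightarrow> real"
  assumes "\<And>l. g l \<ge> 0" "\<And>l. g (- l) = g l" "summable (\<lambda>n. g (int (Suc n)))"
  shows "g summable_on UNIV" "infsum g UNIV = g 0 + 2 * (\<Sum>n. g (int (Suc n)))"
proof -
  let ?S = "\<Sum>n. g (int (Suc n))"
  have h1: "((\<lambda>n. g (int (Suc n))) has_sum ?S) UNIV"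
    by (rule sums_nonneg_imp_has_sum) (use assms in auto)
  have b1: "bij_betw (\<lambda>n. int (Suc n)) UNIV {0<..}"
    by (rule bij_betwI[where g = "\<lambda>l. nat (l - 1)"]) auto
  have b2: "bij_betw (\<lambda>n. - int (Suc n)) UNIV {..<0}"
    by (rule bij_betwI[where g = "\<lambda>l. nat (- l - 1)"]) auto
  have p1: "(g has_sum ?S) {0<..}"
    using h1 has_sum_reindex_bij_betw[OF b1, of g] by simp
  have p2: "(g has_sum ?S) {..<0}"
    using h1 has_sum_reindex_bij_betw[OF b2, of g] assms(2) by (simp del: of_nat_Suc)
  have p3: "(g has_sum g 0) {0}" by (rule has_sum_finiteI) auto
  have "(g has_sum (?S + ?S)) ({0<..} \<union> {..<0})"
    by (rule has_sum_Un_disjoint[OF p1 p2]) auto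
  hence "(g has_sum (g 0 + (?S + ?S))) ({0} \<union> ({0<..} \<union> {..<0}))"
    by (intro has_sum_Un_disjoint[OF p3]) auto
  also have "{0} \<union> ({0<..} \<union> {..<0}) = (UNIV :: int set)" by auto
  finally have "(g has_sum (g 0 + 2 * ?S)) UNIV" by simp
  thus "g summable_on UNIV" "infsum g UNIV = g 0 + 2 * ?S"
    by (auto dest: has_sum_imp_summable infsumI)
qed

text \<open>The de la Vallee-Poussin kernel \<open>4\<^sup>n / (2n choose n) * cos\<^sup>2\<^sup>n (\<pi> t)\<close>: a nonnegative
  trigonometric polynomial of mean 1 concentrating at the integers, whose coefficients
  \<open>(2n choose (n + l)) / (2n choose n)\<close> increase to 1.\<close>
definition vp_kernel :: "nat \<Rightarrow> real \<Rightarrow> real" where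
  "vp_kernel n t = 4 ^ n / real ((2 * n) choose n) * cos (pi * t) ^ (2 * n)"

definition vp_coeff :: "nat \<Rightarrow> int \<Rightarrow> real" where
  "vp_coeff n l = (if \<bar>l\<bar> \<le> int n then real ((2 * n) choose nat (int n + l)) / real ((2 * n) choose n) else 0)"

section \<open>The periodic kernel and its Fourier coefficients\<close>

lemma central_binomial_pos: "real ((2 * n) choose n) > 0"
  by (simp add: zero_less_binomial_iff)

lemma vp_kernel_nonneg: "vp_kernel n t \<ge> 0"
  unfolding vp_kernel_def by (intro mult_nonneg_nonneg) auto

lemma vp_kernel_cont: "continuous_on S (vp_kernel n)"
  unfolding vp_kernel_def[abs_def] by (intro continuous_intros)

lemma vp_kernel_expand:
  "complex_of_real (vp_kernel n t) = (\<Sum>l\<in>{- int n..int n}. complex_of_real (vp_coeff n l) * cis (2 * pi * (of_int l * t)))"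
proof -
  define C where "C = real ((2 * n) choose n)"
  have C: "C > 0" using central_binomial_pos by (simp add: C_def)
  have "complex_of_real (cos (pi * t)) = (cis (pi * t) + cis (- (pi * t))) / 2"
    by (simp add: complex_eq_iff)
  hence "complex_of_real (cos (pi * t)) ^ (2 * n) = ((cis (pi * t) + cis (- (pi * t))) / 2) ^ (2 * n)"
    by (rule arg_cong)
  also have "\<dots> = (cis (pi * t) + cis (- (pi * t))) ^ (2 * n) / 2 ^ (2 * n)"
    by (rule power_divide)
  also have "(2 :: complex) ^ (2 * n) = 4 ^ n" by (simp add: power_mult)
  also have "(cis (pi * t) + cis (- (pi * t))) ^ (2 * n) =
      (\<Sum>m\<le>2 * n. of_nat ((2 * n) choose m) * cis (pi * t) ^ m * cis (- (pi * t)) ^ (2 * n - m))"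
    by (rule binomial_ring)
  also have "\<dots> = (\<Sum>m\<le>2 * n. of_nat ((2 * n) choose m) * cis (2 * pi * (of_int (int m - int n) * t)))"
  proof (rule sum.cong)
    fix m assume m: "m \<in> {..2 * n}"
    have "cis (pi * t) ^ m * cis (- (pi * t)) ^ (2 * n - m) = cis (real m * (pi * t) + real (2 * n - m) * (- (pi * t)))"
      unfolding Complex.DeMoivre by (rule cis_mult)
    also have "real m * (pi * t) + real (2 * n - m) * (- (pi * t)) = 2 * pi * (of_int (int m - int n) * t)"
      using m by (simp add: of_nat_diff algebra_simps)
    finally show "of_nat ((2 * n) choose m) * cis (pi * t) ^ m * cis (- (pi * t)) ^ (2 * n - m) =
       of_nat ((2 * n) choose m) * cis (2 * pi * (of_int (int m - int n) * t))" by (simp add: mult.assoc)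
  qed simp
  finally have "complex_of_real (cos (pi * t)) ^ (2 * n) =
     (\<Sum>m\<le>2 * n. of_nat ((2 * n) choose m) * cis (2 * pi * (of_int (int m - int n) * t))) / 4 ^ n" .
  hence "complex_of_real (vp_kernel n t) =
     (\<Sum>m\<le>2 * n. of_nat ((2 * n) choose m) * cis (2 * pi * (of_int (int m - int n) * t))) / of_real C"
    by (simp add: vp_kernel_def C_def)
  also have "\<dots> = (\<Sum>m\<le>2 * n. complex_of_real (vp_coeff n (int m - int n)) * cis (2 * pi * (of_int (int m - int n) * t)))"
    unfolding sum_divide_distrib
    by (rule sum.cong) (auto simp: vp_coeff_def C_def)
  also have "\<dots> = (\<Sum>l\<in>{- int n..int n}. complex_of_real (vp_coeff n l) * cis (2 * pi * (of_int l * t)))"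
    by (rule sum.reindex_bij_witness[of _ "\<lambda>l. nat (l + int n)" "\<lambda>m. int m - int n"]) auto
  finally show ?thesis .
qed

lemma vp_coeff_bounds: "0 \<le> vp_coeff n l" "vp_coeff n l \<le> 1"
proof -
  have "real ((2 * n) choose m) / real ((2 * n) choose n) \<le> 1" for m
    using central_binomial_pos[of n] binomial_maximum'[of n m] by (simp add: divide_le_eq_1)
  thus "vp_coeff n l \<le> 1" by (auto simp: vp_coeff_def)
qed (auto simp: vp_coeff_def)

lemma vp_coeff_0: "vp_coeff n 0 = 1"
  using central_binomial_pos[of n] by (simp add: vp_coeff_def)

text \<open>Successive coefficients have the ratio \<open>(n - l) / (n + l + 1)\<close>, which tends
  to 1 for fixed \<open>l\<close>; negative \<open>l\<close> follow from the symmetry of the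
  binomials.\<close>

lemma vp_coeff_limit: "(\<lambda>n. vp_coeff n l) \<longlonglongrightarrow> 1"
proof -
  have nonneg: "(\<lambda>n. vp_coeff n (int l)) \<longlonglongrightarrow> 1" for l
  proof (induction l)
    case 0
    show ?case by (simp add: vp_coeff_0)
  next
    case (Suc l)
    have "(\<lambda>n. vp_coeff n (int l) * ((real n - real l) / (real n + real l + 1))) \<longlonglongrightarrow> 1 * 1"
      by (intro tendsto_mult Suc) real_asymp
    moreover have "\<forall>\<^sub>F n in sequentially. vp_coeff n (int l) * ((real n - real l) / (real n + real l + 1)) = vp_coeff n (int (Suc l))"
      using eventually_ge_at_top[of "Suc l"]
    proof eventually_elim
      case (elim n)
      have "Suc (n + l) * ((2 * n) choose Suc (n + l)) = (2 * n - (n + l)) * ((2 * n) choose (n + l))"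
        by (metis binomial_absorb_comp binomial_absorption)
      hence "real (Suc (n + l) * ((2 * n) choose Suc (n + l))) = real ((2 * n - (n + l)) * ((2 * n) choose (n + l)))"
        by (rule arg_cong)
      hence e: "(real n + real l + 1) * real ((2 * n) choose Suc (n + l)) = (real n - real l) * real ((2 * n) choose (n + l))"
        using elim unfolding of_nat_mult by (simp add: of_nat_diff algebra_simps)
      have nl: "nat (int n + int l) = n + l" "nat (int n + int (Suc l)) = Suc (n + l)" by auto
      have pos: "real n + real l + 1 > 0" by (simp add: add_nonneg_pos)
      have "real ((2 * n) choose (n + l)) * ((real n - real l) / (real n + real l + 1)) = real ((2 * n) choose Suc (n + l))"
        using e pos by (simp add: field_simps)
      hence *: "real ((2 * n) choose (n + l)) * ((real n - real l) / (real n + real l + 1)) / C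
          = real ((2 * n) choose Suc (n + l)) / C" for C by simp
      have v: "vp_coeff n (int l) = real ((2 * n) choose (n + l)) / real ((2 * n) choose n)"
        "vp_coeff n (int (Suc l)) = real ((2 * n) choose Suc (n + l)) / real ((2 * n) choose n)"
        using elim unfolding vp_coeff_def nl by auto
      show ?case unfolding v times_divide_eq_left by (rule *)
    qed
    ultimately show ?case by (auto intro: Lim_transform_eventually)
  qed
  have sym: "vp_coeff n (- int l) = vp_coeff n (int l)" for n l
  proof (cases "l \<le> n")
    case True
    have nl: "nat (int n + int l) = n + l" "nat (int n - int l) = n - l" using True by auto
    have "(2 * n) choose (n - l) = (2 * n) choose (2 * n - (n - l))" by (rule binomial_symmetric) auto
    also have "2 * n - (n - l) = n + l" using True by simp
    finally show ?thesis using True by (simp add: vp_coeff_def nl)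
  qed (auto simp: vp_coeff_def)
  show ?thesis
    using nonneg[of "nat \<bar>l\<bar>"] sym[of _ "nat \<bar>l\<bar>"] by (cases "l \<ge> 0") auto
qed

lemma integral_cis_period:
  fixes a :: real
  shows "integrable lborel (\<lambda>t. indicator {a..<a + 1} t *\<^sub>R cis (2 * pi * (of_int l * t)))"
    and "(\<integral>t. indicator {a..<a + 1} t *\<^sub>R cis (2 * pi * (of_int l * t)) \<partial>lborel) = (if l = 0 then 1 else 0)"
proof -
  define e where "e = (\<lambda>t::real. cis (2 * pi * (of_int l * t)))"
  have ec: "continuous_on S e" for S unfolding e_def by (intro continuous_intros)
  have em: "e \<in> borel_measurable borel" using ec by (rule borel_measurable_continuous_onI)
  have i1: "integrable lborel (\<lambda>t. indicator {a..a + 1} t *\<^sub>R e t)"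
    using borel_integrable_compact[OF compact_Icc ec, of a "a + 1"] .
  have ae: "AE t in lborel. indicator {a..a + 1} t *\<^sub>R e t = indicator {a..<a + 1} t *\<^sub>R e t"
    using AE_lborel_singleton[of "a + 1"] by eventually_elim (auto simp: indicator_def)
  show "integrable lborel (\<lambda>t. indicator {a..<a + 1} t *\<^sub>R cis (2 * pi * (of_int l * t)))"
    unfolding e_def[symmetric, THEN fun_cong, simplified] 
    by (rule integrable_cong_AE_imp[OF i1]) (use em ae in \<open>auto simp: e_def\<close>)
  have "(\<integral>t. indicator {a..<a + 1} t *\<^sub>R e t \<partial>lborel) = (\<integral>t. indicator {a..a + 1} t *\<^sub>R e t \<partial>lborel)"
    by (rule integral_cong_AE) (use em ae in auto)
  also have "\<dots> = (if l = 0 then 1 else 0)"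
  proof (cases "l = 0")
    case True
    thus ?thesis by (simp add: e_def)
  next
    case False
    define w where "w = 2 * pi * real_of_int l"
    have w: "w \<noteq> 0" using False by (simp add: w_def)
    define F where "F = (\<lambda>t::real. cis (w * t) / (\<i> * of_real w))"
    have "(\<integral>t. indicator {a..a + 1} t *\<^sub>R e t \<partial>lborel) = F (a + 1) - F a"
    proof (rule integral_FTC_atLeastAtMost)
      fix t
      have "((\<lambda>z. exp (\<i> * of_real w * z) / (\<i> * of_real w)) has_field_derivative exp (\<i> * of_real w * of_real t)) (at (of_real t))"
        using w by (auto intro!: derivative_eq_intros)
      hence "((\<lambda>s. exp (\<i> * of_real w * of_real s) / (\<i> * of_real w)) has_vector_derivative exp (\<i> * of_real w * of_real t)) (at t within {a..a + 1})"
        by (rule has_vector_derivative_real_field)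
      thus "(F has_vector_derivative e t) (at t within {a..a + 1})"
        by (simp add: F_def e_def o_def cis_conv_exp w_def mult_ac)
    qed (use ec in auto)
    also have "F (a + 1) = F a"
    proof -
      have "cis (w * (a + 1)) = cis (w * a) * cis (2 * pi * real_of_int l)"
        by (simp add: w_def cis_mult algebra_simps)
      also have "cis (2 * pi * real_of_int l) = 1" by (rule cis_multiple_2pi) auto
      finally show ?thesis by (simp add: F_def)
    qed
    finally show ?thesis using False by simp
  qed
  finally show "(\<integral>t. indicator {a..<a + 1} t *\<^sub>R cis (2 * pi * (of_int l * t)) \<partial>lborel) = (if l = 0 then 1 else 0)"
    by (simp add: e_def)
qed

lemma vp_kernel_integral:
  fixes a :: real
  shows "integrable lborel (\<lambda>t. indicator {a..<a + 1} t * vp_kernel n t)"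
    and "(\<integral>t. indicator {a..<a + 1} t * vp_kernel n t \<partial>lborel) = 1"
proof -
  have eq: "complex_of_real (indicator {a..<a + 1} t * vp_kernel n t) =
     (\<Sum>l\<in>{- int n..int n}. complex_of_real (vp_coeff n l) * (indicator {a..<a + 1} t *\<^sub>R cis (2 * pi * (of_int l * t))))" for t
    unfolding of_real_mult vp_kernel_expand sum_distrib_left by (intro sum.cong) (auto simp: scaleR_conv_of_real)
  have int: "integrable lborel (\<lambda>t. complex_of_real (indicator {a..<a + 1} t * vp_kernel n t))"
    unfolding eq by (intro Bochner_Integration.integrable_sum integrable_mult_right integral_cis_period)
  thus i: "integrable lborel (\<lambda>t. indicator {a..<a + 1} t * vp_kernel n t)"
    by (simp only: complex_of_real_integrable_eq)
  have "complex_of_real (\<integral>t. indicator {a..<a + 1} t * vp_kernel n t \<partial>lborel) =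
     (\<integral>t. (\<Sum>l\<in>{- int n..int n}. complex_of_real (vp_coeff n l) * (indicator {a..<a + 1} t *\<^sub>R cis (2 * pi * (of_int l * t)))) \<partial>lborel)"
    unfolding eq[symmetric] by (rule integral_complex_of_real[symmetric])
  also have "\<dots> = (\<Sum>l\<in>{- int n..int n}. complex_of_real (vp_coeff n l) * (if l = 0 then 1 else 0))"
    by (subst Bochner_Integration.integral_sum)
       (intro integrable_mult_right integral_cis_period, simp only: integral_mult_right_zero integral_cis_period)
  also have "\<dots> = (\<Sum>l\<in>{- int n..int n}. if l = 0 then complex_of_real (vp_coeff n l) else 0)"
    by (intro sum.cong) auto
  also have "\<dots> = 1" by (simp add: vp_coeff_0)
  finally show "(\<integral>t. indicator {a..<a + 1} t * vp_kernel n t \<partial>lborel) = 1"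
    by (simp only: of_real_eq_1_iff)
qed

section \<open>Unit cubes and Poisson summation\<close>

definition vp_prod :: "nat \<Rightarrow> real^'n \<Rightarrow> real" where
  "vp_prod n x = (\<Prod>i\<in>UNIV. vp_kernel n (x $ i))"

text \<open>Half open, so that the cubes tile the space without overlap, and centred at lattice
  points, so that each contains exactly one peak of the kernel, in its interior.\<close>

definition cube :: "('n::finite \<Rightarrow> int) \<Rightarrow> (real^'n) set" where
  "cube k = {x. \<forall>i. x $ i \<in> {of_int (k i) - 1/2..<of_int (k i) - 1/2 + 1}}"

lemma vp_prod_nonneg: "vp_prod n x \<ge> 0"
  unfolding vp_prod_def by (intro prod_nonneg vp_kernel_nonneg ballI)

lemma vp_prod_cont: "continuous_on S (vp_prod n :: real^'n \<Rightarrow> real)"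
  unfolding vp_prod_def[abs_def]
  by (intro continuous_intros continuous_on_compose2[OF vp_kernel_cont[of UNIV]]) auto

lemma vp_prod_0: "vp_prod 0 x = 1"
  by (simp add: vp_prod_def vp_kernel_def)

lemma indicator_cube: "indicator (cube k) x = (\<Prod>i\<in>UNIV. indicator {of_int (k i) - 1/2..<of_int (k i) - 1/2 + 1} (x $ i) :: real)"
  by (auto simp: cube_def indicator_def prod_eq_1_iff)

lemma cube_sets: "cube k \<in> sets borel"
proof -
  have "cube k = (\<Inter>i\<in>UNIV. {x. x $ i \<in> {of_int (k i) - 1/2..<of_int (k i) - 1/2 + 1}})"
    by (auto simp: cube_def)
  also have "\<dots> \<in> sets borel"
  proof (intro sets.finite_INT)
    fix i
    have "(\<lambda>x::real^'a. x $ i) \<in> borel_measurable borel"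
      by (intro borel_measurable_continuous_onI continuous_intros)
    from measurable_sets[OF this, of "{of_int (k i) - 1/2..<of_int (k i) - 1/2 + 1}"]
    show "{x::real^'a. x $ i \<in> {of_int (k i) - 1/2..<of_int (k i) - 1/2 + 1}} \<in> sets borel"
      by (simp add: vimage_def)
  qed auto
  finally show ?thesis .
qed

lemma vp_prod_cube:
  fixes k :: "'n::finite \<Rightarrow> int"
  shows "integrable lborel (\<lambda>x. indicator (cube k) x * vp_prod n x)"
    and "(\<integral>x. indicator (cube k) x * vp_prod n x \<partial>lborel) = 1"
proof -
  have eq: "indicator (cube k) x * vp_prod n x =
      (\<Prod>i\<in>UNIV. (\<lambda>t. indicator {of_int (k i) - 1/2..<of_int (k i) - 1/2 + 1} t * vp_kernel n t) (x $ i))" for x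
    by (simp add: indicator_cube vp_prod_def prod.distrib)
  show "integrable lborel (\<lambda>x. indicator (cube k) x * vp_prod n x)"
    unfolding eq by (rule integrable_prod_vec[OF vp_kernel_integral(1)])
  show "(\<integral>x. indicator (cube k) x * vp_prod n x \<partial>lborel) = 1"
    unfolding eq by (subst integral_prod_vec(2)[OF vp_kernel_integral(1)]) (simp only: vp_kernel_integral(2) prod.neutral_const)
qed

lemma cube_volume:
  "integrable lborel (indicator (cube k) :: real^'n \<Rightarrow> real)" "(\<integral>x. indicator (cube k) x \<partial>(lborel :: (real^'n) measure)) = (1::real)"
  using vp_prod_cube[of k 0] by (simp_all add: vp_prod_0)

lemma vp_kernel_le:
  assumes "n > 0"
  shows "vp_kernel n t \<le> 2 * real n * \<bar>cos (pi * t)\<bar> ^ (2 * n)"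
proof -
  have "4 ^ n / real ((2 * n) choose n) \<le> 2 * real n"
    using central_binomial_lower_bound[OF assms] central_binomial_pos[of n] assms by (simp add: field_simps)
  hence "4 ^ n / real ((2 * n) choose n) * cos (pi * t) ^ (2 * n) \<le> 2 * real n * cos (pi * t) ^ (2 * n)"
    by (intro mult_right_mono) auto
  thus ?thesis by (simp add: vp_kernel_def power_even_abs)
qed

lemma vp_kernel_le':
  assumes "n > 0"
  shows "vp_kernel n t \<le> 2 * real n"
proof -
  have "2 * real n * \<bar>cos (pi * t)\<bar> ^ (2 * n) \<le> 2 * real n"
    by (intro mult_left_le power_le_one) auto
  thus ?thesis using vp_kernel_le[OF assms, of t] by linarith
qed

lemma vp_prod_le:
  fixes x :: "real^'n"
  assumes "n > 0"
  shows "vp_prod n x \<le> (2 * real n) ^ CARD('n)"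
proof -
  have "vp_prod n x \<le> (\<Prod>i\<in>(UNIV::'n set). 2 * real n)"
    unfolding vp_prod_def by (intro prod_mono conjI vp_kernel_nonneg vp_kernel_le' assms)
  thus ?thesis by simp
qed

lemma cos_shift_bound:
  assumes "\<delta> \<ge> 0" "\<bar>t - of_int l\<bar> \<ge> \<delta>" "\<bar>t - of_int l\<bar> \<le> 1/2"
  shows "\<bar>cos (pi * t)\<bar> \<le> cos (pi * \<delta>)"
proof -
  define u where "u = \<bar>t - of_int l\<bar>"
  have cos_abs: "cos (pi * \<bar>r\<bar>) = cos (pi * r)" for r by (simp add: abs_if)
  have "cos (pi * t) = cos (pi * (t - of_int l) + pi * of_int l)" by (simp add: algebra_simps)
  also have "\<dots> = cos (pi * (t - of_int l)) * cos (pi * of_int l)"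
    by (simp add: cos_add sin_integer_2pi sin_zero_iff_int2)
  finally have "\<bar>cos (pi * t)\<bar> = \<bar>cos (pi * (t - of_int l))\<bar> * \<bar>cos (pi * of_int l)\<bar>" by (simp add: abs_mult)
  also have "\<dots> \<le> \<bar>cos (pi * (t - of_int l))\<bar> * 1" by (intro mult_left_mono) auto
  also have "\<bar>cos (pi * (t - of_int l))\<bar> = \<bar>cos (pi * u)\<bar>"
    by (simp add: u_def cos_abs)
  also have "\<bar>cos (pi * u)\<bar> = cos (pi * u)"
    using assms by (intro abs_of_nonneg cos_ge_zero) (auto simp: u_def intro: order_trans[of _ 0])
  also have "cos (pi * u) \<le> cos (pi * \<delta>)"
    using assms by (intro cos_monotone_0_pi_le) (auto simp: u_def intro!: mult_left_le)
  finally show ?thesis by simp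
qed

lemma norm_integral_le:
  fixes f :: "'a \<Rightarrow> 'b::{banach,second_countable_topology}"
  assumes "integrable M f" "integrable M g" "\<And>x. norm (f x) \<le> g x"
  shows "norm (integral\<^sup>L M f) \<le> integral\<^sup>L M g"
  by (rule order_trans[OF integral_norm_bound integral_mono]) (use assms in auto)

text \<open>An approximate identity on one cube. Near the centre continuity of \<open>f\<close>
  decides; elsewhere some coordinate is at least \<delta> away from its integer, and the kernel is
  at most \<open>(2 * n) ^ d * q ^ (2 * n)\<close>, a polynomial times an exponentially small
  factor.\<close>

lemma vp_prod_concentrates:
  fixes f :: "real^'n \<Rightarrow> real"
  assumes fc: "continuous_on UNIV f" and fb: "\<And>x. \<bar>f x\<bar> \<le> S"
  shows "(\<lambda>n. \<integral>x. indicator (cube k) x * (f x * vp_prod n x) \<partial>lborel) \<longlonglongrightarrow> f (lat k)"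
proof (rule LIMSEQ_I)
  fix r :: real assume r: "r > 0"
  have S: "S \<ge> 0" using fb[of undefined] by linarith
  define d where "d = CARD('n)"
  from fc have "isCont f (lat k)" by (simp add: continuous_on_eq_continuous_at)
  then obtain \<delta>1 where \<delta>1: "\<delta>1 > 0" "\<And>x. dist x (lat k) < \<delta>1 \<Longrightarrow> dist (f x) (f (lat k)) < r / 2"
    unfolding continuous_at_eps_delta using r by (metis half_gt_zero)
  \<comment> \<open>The norm is at most the sum of the coordinates in modulus, so a box of
    half-width \<delta> lies in the ball of radius \<open>\<delta>1\<close>. The bound 1/2 keeps
    \<open>cos (pi * \<delta>)\<close> nonnegative.\<close>
  define \<delta> where "\<delta> = min (1/2) (\<delta>1 / real (d + 1))"
  have \<delta>: "\<delta> > 0" "\<delta> \<le> 1/2" "real d * \<delta> < \<delta>1"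
  proof -
    show "\<delta> > 0" using \<delta>1 by (auto simp: \<delta>_def)
    show "\<delta> \<le> 1/2" unfolding \<delta>_def by (rule min.cobounded1)
    have "real d * \<delta> \<le> real d * (\<delta>1 / real (d + 1))" by (intro mult_left_mono) (auto simp: \<delta>_def)
    also have "\<dots> < \<delta>1" using \<delta>1 by (simp add: field_simps)
    finally show "real d * \<delta> < \<delta>1" .
  qed
  define q where "q = cos (pi * \<delta>)"
  have q: "0 \<le> q" "q < 1"
  proof -
    show "0 \<le> q" unfolding q_def using \<delta> by (intro cos_ge_zero) (auto intro: order_trans[of _ 0])
    have "cos (pi * \<delta>) < cos 0" using \<delta> by (intro cos_monotone_0_pi) (auto intro!: mult_left_le)
    thus "q < 1" by (simp add: q_def)
  qed
  define \<rho> where "\<rho> = (\<lambda>n. (2 * real n) ^ d * q ^ (2 * n))"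
  have "(\<lambda>n. 2 * S * \<rho> n) \<longlonglongrightarrow> 2 * S * 0"
  proof (intro tendsto_mult tendsto_const)
    have d0: "d > 0" by (simp add: d_def)
    \<comment> \<open>The \<open>d\<close>-th root distributes the exponential factor over the
      dimensions: \<open>\<rho> n = (2 * (n * y ^ n)) ^ d\<close>, and \<open>n * y ^ n\<close>
      tends to 0.\<close>
    define y where "y = root d (q\<^sup>2)"
    have y: "0 \<le> y" "y < 1" "y ^ d = q\<^sup>2"
      using q d0 by (auto simp: y_def abs_square_less_1)
    have "(\<lambda>n. (2 * (of_nat n * y ^ n)) ^ d) \<longlonglongrightarrow> (2 * 0) ^ d"
      by (intro tendsto_power tendsto_mult tendsto_const powser_times_n_limit_0) (use y in auto)
    moreover have eq: "(2 * (of_nat n * y ^ n)) ^ d = \<rho> n" for n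
    proof -
      have "(y ^ n) ^ d = q ^ (2 * n)" using y(3) by (metis power_commutes power_mult mult.commute)
      thus ?thesis by (simp add: \<rho>_def power_mult_distrib)
    qed
    moreover have "(2 * 0 :: real) ^ d = 0" using d0 by (simp add: zero_power)
    ultimately show "\<rho> \<longlonglongrightarrow> 0" unfolding eq by (simp only:)
  qed
  hence ev: "\<forall>\<^sub>F n in sequentially. 2 * S * \<rho> n < r / 2"
    by (rule order_tendstoD(2)) (use r in simp)
  have "\<forall>\<^sub>F n in sequentially. norm ((\<integral>x. indicator (cube k) x * (f x * vp_prod n x) \<partial>lborel) - f (lat k)) < r"
    using ev eventually_gt_at_top[of 0]
  proof eventually_elim
    case (elim n)
    have fm: "f \<in> borel_measurable borel" "vp_prod n \<in> borel_measurable (borel :: (real^'n) measure)"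
      using fc vp_prod_cont by (auto intro: borel_measurable_continuous_onI)
    have i1: "integrable lborel (\<lambda>x. indicator (cube k) x * (f x * vp_prod n x))"
    proof (rule Bochner_Integration.integrable_bound)
      show "integrable lborel (\<lambda>x. S * (indicator (cube k) x * vp_prod n x))"
        by (intro integrable_mult_right vp_prod_cube)
      show "(\<lambda>x. indicator (cube k) x * (f x * vp_prod n x)) \<in> borel_measurable lborel"
        using fm cube_sets[of k] by simp
      show "AE x in lborel. norm (indicator (cube k) x * (f x * vp_prod n x)) \<le> norm (S * (indicator (cube k) x * vp_prod n x))"
        using fb S vp_prod_nonneg by (intro AE_I2) (auto simp: abs_mult indicator_def intro!: mult_right_mono)
    qed
    have "(\<integral>x. indicator (cube k) x * (f x * vp_prod n x) \<partial>lborel) - f (lat k) =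
       (\<integral>x. indicator (cube k) x * (f x * vp_prod n x) - f (lat k) * (indicator (cube k) x * vp_prod n x) \<partial>lborel)"
      by (subst Bochner_Integration.integral_diff[OF i1]) (use vp_prod_cube[of k n] in auto)
    also have "norm \<dots> \<le> (\<integral>x. r / 2 * (indicator (cube k) x * vp_prod n x) + 2 * S * \<rho> n * indicator (cube k) x \<partial>lborel)"
    proof (rule norm_integral_le)
      show "integrable lborel (\<lambda>x. indicator (cube k) x * (f x * vp_prod n x) - f (lat k) * (indicator (cube k) x * vp_prod n x))"
        by (intro Bochner_Integration.integrable_diff i1 integrable_mult_right vp_prod_cube)
      show "integrable lborel (\<lambda>x. r / 2 * (indicator (cube k) x * vp_prod n x) + 2 * S * \<rho> n * indicator (cube k) x)"
        by (intro Bochner_Integration.integrable_add integrable_mult_right vp_prod_cube cube_volume)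
      fix x :: "real^'n"
      show "norm (indicator (cube k) x * (f x * vp_prod n x) - f (lat k) * (indicator (cube k) x * vp_prod n x))
        \<le> r / 2 * (indicator (cube k) x * vp_prod n x) + 2 * S * \<rho> n * indicator (cube k) x"
      proof (cases "x \<in> cube k")
        case True
        have near: "\<bar>x $ i - of_int (k i)\<bar> \<le> 1/2" for i
        proof -
          have "x $ i \<in> {of_int (k i) - 1/2..<of_int (k i) - 1/2 + 1}" using True unfolding cube_def by blast
          hence "of_int (k i) - 1/2 \<le> x $ i" "x $ i < of_int (k i) - 1/2 + 1" by auto
          thus ?thesis by linarith
        qed
        have \<rho>0: "\<rho> n \<ge> 0" using q by (simp add: \<rho>_def)
        have "\<bar>f x - f (lat k)\<bar> * vp_prod n x \<le> r / 2 * vp_prod n x + 2 * S * \<rho> n"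
        proof (cases "\<forall>i. \<bar>x $ i - of_int (k i)\<bar> < \<delta>")
          case True
          have "dist x (lat k) \<le> (\<Sum>i\<in>UNIV. \<bar>(x - lat k) $ i\<bar>)" unfolding dist_norm by (rule norm_le_l1_cart)
          also have "\<dots> \<le> (\<Sum>i\<in>(UNIV::'n set). \<delta>)" using True by (intro sum_mono) (auto intro: less_imp_le)
          also have "\<dots> < \<delta>1" using \<delta> by (simp add: d_def)
          finally have "\<bar>f x - f (lat k)\<bar> \<le> r / 2" using \<delta>1(2) by (force simp: dist_real_def)
          hence "\<bar>f x - f (lat k)\<bar> * vp_prod n x \<le> r / 2 * vp_prod n x"
            by (intro mult_right_mono vp_prod_nonneg)
          moreover have "2 * S * \<rho> n \<ge> 0" using S \<rho>0 by simp
          ultimately show ?thesis by linarith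
        next
          case False
          then obtain i where i: "\<bar>x $ i - of_int (k i)\<bar> \<ge> \<delta>" by (auto simp: not_less)
          have "vp_prod n x \<le> (\<Prod>j\<in>UNIV. 2 * real n * (if j = i then q ^ (2 * n) else 1))"
            unfolding vp_prod_def
          proof (intro prod_mono conjI vp_kernel_nonneg)
            fix j
            show "vp_kernel n (x $ j) \<le> 2 * real n * (if j = i then q ^ (2 * n) else 1)"
            proof (cases "j = i")
              case True
              have "\<bar>cos (pi * x $ i)\<bar> \<le> q" unfolding q_def using \<delta> i near[of i]
                by (intro cos_shift_bound) auto
              hence "\<bar>cos (pi * x $ i)\<bar> ^ (2 * n) \<le> q ^ (2 * n)" by (intro power_mono) auto
              hence "2 * real n * \<bar>cos (pi * x $ i)\<bar> ^ (2 * n) \<le> 2 * real n * q ^ (2 * n)" by (intro mult_left_mono) auto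
              hence "vp_kernel n (x $ i) \<le> 2 * real n * q ^ (2 * n)"
                using vp_kernel_le[of n "x $ i"] elim(2) by linarith
              thus ?thesis using True by simp
            qed (use vp_kernel_le'[of n] elim in auto)
          qed
          also have "\<dots> = \<rho> n" by (simp add: prod.distrib \<rho>_def d_def prod.delta)
          finally have *: "vp_prod n x \<le> \<rho> n" .
          have "\<bar>f x - f (lat k)\<bar> \<le> 2 * S" using fb[of x] fb[of "lat k"] by linarith
          hence "\<bar>f x - f (lat k)\<bar> * vp_prod n x \<le> 2 * S * \<rho> n" using * S vp_prod_nonneg[of n x]
            by (intro mult_mono) auto
          moreover have "r / 2 * vp_prod n x \<ge> 0" using r vp_prod_nonneg[of n x] by simp
          ultimately show ?thesis by linarith
        qed
        moreover have "norm (f x * vp_prod n x - f (lat k) * vp_prod n x) = \<bar>f x - f (lat k)\<bar> * vp_prod n x"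
          using vp_prod_nonneg[of n x] by (simp add: abs_mult flip: left_diff_distrib)
        ultimately show ?thesis using True by simp
      qed simp
    qed
    also have "\<dots> = r / 2 + 2 * S * \<rho> n"
      using vp_prod_cube[of k n] cube_volume[of k] by simp
    also have "\<dots> < r" using elim by simp
    finally show ?case .
  qed
  thus "\<exists>no. \<forall>n\<ge>no. norm ((\<integral>x. indicator (cube k) x * (f x * vp_prod n x) \<partial>lborel) - f (lat k)) < r"
    by (simp add: eventually_sequentially)
qed

definition latdecay :: "('n::finite \<Rightarrow> int) \<Rightarrow> real" where
  "latdecay k = (\<Prod>i\<in>UNIV. 1 / (1 + (of_int (k i))\<^sup>2))"

lemma latdecay_summable: "(latdecay :: ('n::finite \<Rightarrow> int) \<Rightarrow> real) summable_on UNIV"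
  unfolding latdecay_def[abs_def]
proof (rule product_summable_lattice(1))
  show "(\<lambda>l::int. 1 / (1 + (of_int l)\<^sup>2 :: real)) summable_on UNIV"
  proof (rule int_summable_iff(1))
    have "summable (\<lambda>n. 1 / real (Suc n) ^ 2)"
      using inverse_power_summable[of 2, where 'a = real] by (subst summable_Suc_iff) (simp add: inverse_eq_divide)
    thus "summable (\<lambda>n. 1 / (1 + (real_of_int (int (Suc n)))\<^sup>2))"
      by (rule summable_comparison_test'[where N = 0]) (auto intro!: frac_le simp del: of_nat_Suc)
  qed (auto intro!: divide_nonneg_nonneg add_nonneg_nonneg)
qed (auto intro!: divide_nonneg_nonneg add_nonneg_nonneg)

lemma decay_lat: "decay (lat k) = latdecay k"
  by (simp add: decay_def latdecay_def)

lemma decay_cube: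
  fixes x :: "real^'n"
  assumes "x \<in> cube k"
  shows "decay x \<le> 2 ^ CARD('n) * latdecay k"
  unfolding decay_lat[symmetric]
proof (rule decay_close)
  fix i
  have "x $ i \<in> {of_int (k i) - 1/2..<of_int (k i) - 1/2 + 1}" using assms unfolding cube_def by blast
  hence "of_int (k i) - 1/2 \<le> x $ i" "x $ i < of_int (k i) - 1/2 + 1" by auto
  thus "\<bar>lat k $ i - x $ i\<bar> \<le> 1/2" unfolding lat_nth by linarith
qed

lemma cube_disjoint: "k \<noteq> l \<Longrightarrow> cube k \<inter> cube l = {}"
proof (rule ccontr)
  assume "k \<noteq> l" "cube k \<inter> cube l \<noteq> {}"
  then obtain x where x: "x \<in> cube k" "x \<in> cube l" by auto
  have "k i = l i" for i
  proof -
    have "x $ i \<in> {of_int (k i) - 1/2..<of_int (k i) - 1/2 + 1}" "x $ i \<in> {of_int (l i) - 1/2..<of_int (l i) - 1/2 + 1}"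
      using x unfolding cube_def by blast+
    hence "\<bar>real_of_int (k i) - real_of_int (l i)\<bar> < 1" by (auto simp: abs_less_iff)
    thus ?thesis by linarith
  qed
  hence "k = l" by (rule ext)
  thus False using \<open>k \<noteq> l\<close> by simp
qed

lemma cube_cover: "x \<in> cube (\<lambda>i. \<lfloor>x $ i + 1/2\<rfloor>)"
proof -
  have "x $ i \<in> {of_int \<lfloor>x $ i + 1/2\<rfloor> - 1/2..<of_int \<lfloor>x $ i + 1/2\<rfloor> - 1/2 + 1}" for i
    using of_int_floor_le[of "x $ i + 1/2"] floor_correct[of "x $ i + 1/2"] by (simp add: algebra_simps)
  thus ?thesis unfolding cube_def by blast
qed

lemma integral_cubes:
  fixes g :: "real^'n \<Rightarrow> real"
  assumes g: "integrable lborel g" and s: "(\<lambda>k. norm (\<integral>x. indicator (cube k) x * g x \<partial>lborel)) summable_on UNIV"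
  shows "integral\<^sup>L lborel g = infsum (\<lambda>k. \<integral>x. indicator (cube k) x * g x \<partial>lborel) UNIV"
proof -
  \<comment> \<open>The lattice is infinite, so \<open>from_nat_into\<close> enumerates it
    bijectively and countable additivity over the cubes applies.\<close>
  have "inj (\<lambda>l::int. (\<lambda>_::'n. l))" by (auto simp: inj_def fun_eq_iff)
  hence inf: "infinite (UNIV :: ('n \<Rightarrow> int) set)"
    by (metis infinite_UNIV_int finite_subset finite_imageD subset_UNIV)
  define e where "e = from_nat_into (UNIV :: ('n \<Rightarrow> int) set)"
  have e: "bij_betw e UNIV UNIV" unfolding e_def by (rule bij_betw_from_nat_into) (use inf in auto)
  define T where "T = (\<lambda>k. \<integral>x. indicator (cube k) x * g x \<partial>lborel)"
  have U: "(\<Union>i. cube (e i)) = UNIV"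
  proof (intro equalityI subsetI UNIV_I)
    fix x :: "real^'n"
    obtain i where "e i = (\<lambda>i. \<lfloor>x $ i + 1/2\<rfloor>)" using e by (metis bij_betw_def rangeE UNIV_I)
    thus "x \<in> (\<Union>i. cube (e i))" using cube_cover[of x] by (metis UN_iff UNIV_I)
  qed
  have "(LINT x:(\<Union>i. cube (e i))|lborel. g x) = (\<Sum>i. (LINT x:(cube (e i))|lborel. g x))"
  proof (rule lebesgue_integral_countable_add)
    show "cube (e i) \<in> sets lborel" for i using cube_sets by simp
    show "cube (e i) \<inter> cube (e j) = {}" if "i \<noteq> j" for i j
      using that e by (intro cube_disjoint) (auto simp: bij_betw_def inj_def)
    show "set_integrable lborel (\<Union>i. cube (e i)) g" unfolding U using g by (simp add: set_integrable_def)
  qed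
  hence 1: "integral\<^sup>L lborel g = (\<Sum>i. T (e i))"
    unfolding U by (simp add: set_lebesgue_integral_def T_def)
  have "T summable_on UNIV"
    using s unfolding T_def by (rule abs_summable_summable)
  hence "(T has_sum infsum T UNIV) UNIV" by simp
  hence "((\<lambda>i. T (e i)) has_sum infsum T UNIV) UNIV"
    using has_sum_reindex_bij_betw[OF e, of T] by simp
  hence "(\<lambda>i. T (e i)) sums infsum T UNIV" by (rule has_sum_imp_sums)
  thus ?thesis using 1 by (simp add: sums_iff T_def)
qed

lemma cis_sum: "finite A \<Longrightarrow> (\<Prod>i\<in>A. cis (f i)) = cis (\<Sum>i\<in>A. f i)"
  by (induction A rule: finite_induct) (auto simp: cis_mult)

lemma vp_prod_expand:
  fixes x :: "real^'n"
  shows "complex_of_real (vp_prod n x) = (\<Sum>k\<in>PiE UNIV (\<lambda>_. {- int n..int n}).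
     complex_of_real (\<Prod>i\<in>UNIV. vp_coeff n (k i)) * cis (2 * pi * (lat k \<bullet> x)))"
proof -
  have "complex_of_real (vp_prod n x) = (\<Prod>i\<in>UNIV. \<Sum>l\<in>{- int n..int n}. complex_of_real (vp_coeff n l) * cis (2 * pi * (of_int l * x $ i)))"
    by (simp add: vp_prod_def vp_kernel_expand)
  also have "\<dots> = (\<Sum>k\<in>PiE UNIV (\<lambda>_. {- int n..int n}). \<Prod>i\<in>UNIV. complex_of_real (vp_coeff n (k i)) * cis (2 * pi * (of_int (k i) * x $ i)))"
    by (rule prod_sum_PiE) auto
  also have "\<dots> = (\<Sum>k\<in>PiE UNIV (\<lambda>_. {- int n..int n}). complex_of_real (\<Prod>i\<in>UNIV. vp_coeff n (k i)) * cis (2 * pi * (lat k \<bullet> x)))"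
    by (intro sum.cong refl) (simp add: prod.distrib cis_sum inner_vec_def sum_distrib_left)
  finally show ?thesis .
qed

text \<open>The integral of \<open>f\<close> against the periodic kernel is computed twice: cube by
  cube it tends to the sum of \<open>f\<close> over the lattice, and through the trigonometric
  expansion it is a damped sum of Fourier transforms. Both limits are dominated, so no pointwise
  convergence of a Fourier series is involved.\<close>

theorem poisson_summation:
  fixes f :: "real^'n \<Rightarrow> real"
  assumes fc: "continuous_on UNIV f" and fb: "\<And>x. \<bar>f x\<bar> \<le> C * decay x"
    and fs: "(\<lambda>k. norm (fourier f (lat k))) summable_on UNIV"
  shows "complex_of_real (infsum (\<lambda>k. f (lat k)) UNIV) = infsum (\<lambda>k. fourier f (lat k)) UNIV"
proof -
  have C: "C \<ge> 0" using fb[of undefined] decay_pos[of "undefined :: real^'n"]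
    by (metis abs_ge_zero order_trans zero_le_mult_iff not_le)
  have fint: "integrable lborel f" by (rule integrable_decay_bound[OF fc fb])
  have fS: "\<bar>f x\<bar> \<le> C" for x
    using fb[of x] mult_left_mono[OF decay_le_1[of x] C] by simp
  \<comment> \<open>The order is \<open>Suc n\<close> because the pointwise bound
    \<open>vp_prod_le\<close> asks for a positive order.\<close>
  have gint: "integrable lborel (\<lambda>x. f x * vp_prod (Suc n) x)" for n
  proof (rule integrable_decay_bound)
    show "continuous_on UNIV (\<lambda>x. f x * vp_prod (Suc n) x)" by (intro continuous_intros fc vp_prod_cont)
    fix x
    have "\<bar>f x\<bar> * vp_prod (Suc n) x \<le> (C * decay x) * (2 * real (Suc n)) ^ CARD('n)"
      using C decay_pos[of x] by (intro mult_mono fb vp_prod_le vp_prod_nonneg) auto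
    thus "\<bar>f x * vp_prod (Suc n) x\<bar> \<le> (C * (2 * real (Suc n)) ^ CARD('n)) * decay x"
      using vp_prod_nonneg[of "Suc n" x] by (simp add: abs_mult mult_ac)
  qed
  define I where "I = (\<lambda>n. \<integral>x. f x * vp_prod (Suc n) x \<partial>lborel)"
  define T where "T = (\<lambda>n k. \<integral>x. indicator (cube k) x * (f x * vp_prod (Suc n) x) \<partial>lborel)"
  define M where "M = (\<lambda>k :: 'n \<Rightarrow> int. C * 2 ^ CARD('n) * latdecay k)"
  have M: "M summable_on UNIV" unfolding M_def by (intro summable_on_cmult_right latdecay_summable)
  have TM: "norm (T n k) \<le> M k" for n k
  proof -
    have "norm (T n k) \<le> (\<integral>x. M k * (indicator (cube k) x * vp_prod (Suc n) x) \<partial>lborel)"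
      unfolding T_def
    proof (rule norm_integral_le)
      show "integrable lborel (\<lambda>x. indicator (cube k) x * (f x * vp_prod (Suc n) x))"
      proof (rule Bochner_Integration.integrable_bound[OF gint[of n]])
        show "(\<lambda>x. indicator (cube k) x * (f x * vp_prod (Suc n) x)) \<in> borel_measurable lborel"
          using borel_measurable_integrable[OF gint[of n]] cube_sets[of k] by simp
      qed (auto simp: indicator_def)
      show "integrable lborel (\<lambda>x. M k * (indicator (cube k) x * vp_prod (Suc n) x))"
        by (intro integrable_mult_right vp_prod_cube)
      fix x :: "real^'n"
      show "norm (indicator (cube k) x * (f x * vp_prod (Suc n) x)) \<le> M k * (indicator (cube k) x * vp_prod (Suc n) x)"
      proof (cases "x \<in> cube k")
        case True
        have "\<bar>f x\<bar> \<le> M k" unfolding M_def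
          using order_trans[OF fb[of x] mult_left_mono[OF decay_cube[OF True] C]] by (simp add: mult_ac)
        thus ?thesis using True vp_prod_nonneg[of "Suc n" x] by (simp add: abs_mult mult_right_mono)
      qed simp
    qed
    thus ?thesis using vp_prod_cube(2)[of k "Suc n"] by simp
  qed
  have IT: "I n = infsum (T n) UNIV" for n
    unfolding I_def T_def
  proof (rule integral_cubes[OF gint])
    show "(\<lambda>k. norm (\<integral>x. indicator (cube k) x * (f x * vp_prod (Suc n) x) \<partial>lborel)) summable_on UNIV"
      by (rule summable_on_comparison_test[OF M]) (use TM in \<open>auto simp: T_def\<close>)
  qed
  have "(\<lambda>n. infsum (T n) UNIV) \<longlonglongrightarrow> infsum (\<lambda>k. f (lat k)) UNIV"
  proof (rule infsum_dominated_convergence[OF M TM])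
    fix k
    from vp_prod_concentrates[OF fc fS, of k]
    show "(\<lambda>n. T n k) \<longlonglongrightarrow> f (lat k)" unfolding T_def by (rule LIMSEQ_Suc)
  qed
  hence lim1: "(\<lambda>n. complex_of_real (I n)) \<longlonglongrightarrow> complex_of_real (infsum (\<lambda>k. f (lat k)) UNIV)"
    unfolding IT by (intro tendsto_of_real)
  define B where "B = (\<lambda>n (k :: 'n \<Rightarrow> int). complex_of_real (\<Prod>i\<in>UNIV. vp_coeff (Suc n) (k i)) * fourier f (lat k))"
  have IB: "complex_of_real (I n) = infsum (B n) UNIV" for n
  proof -
    let ?P = "PiE UNIV (\<lambda>_. {- int (Suc n)..int (Suc n)}) :: ('n \<Rightarrow> int) set"
    have finP: "finite ?P" by (intro finite_PiE) auto
    have "complex_of_real (I n) = (\<integral>x. complex_of_real (f x * vp_prod (Suc n) x) \<partial>lborel)"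
      unfolding I_def by (rule integral_complex_of_real[symmetric])
    also have "\<dots> = (\<integral>x. (\<Sum>k\<in>?P. complex_of_real (\<Prod>i\<in>UNIV. vp_coeff (Suc n) (k i)) * (complex_of_real (f x) * cis (2 * pi * (lat k \<bullet> x)))) \<partial>lborel)"
      unfolding of_real_mult vp_prod_expand sum_distrib_left
      by (intro Bochner_Integration.integral_cong refl sum.cong) (simp add: mult_ac)
    also have "\<dots> = (\<Sum>k\<in>?P. \<integral>x. complex_of_real (\<Prod>i\<in>UNIV. vp_coeff (Suc n) (k i)) * (complex_of_real (f x) * cis (2 * pi * (lat k \<bullet> x))) \<partial>lborel)"
      by (rule Bochner_Integration.integral_sum) (intro integrable_mult_right integrable_times_cis fint)
    also have "\<dots> = (\<Sum>k\<in>?P. B n k)"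
      unfolding B_def fourier_def by (simp only: integral_mult_right_zero)
    also have "\<dots> = infsum (B n) ?P" by (rule infsum_finite[OF finP, symmetric])
    also have "\<dots> = infsum (B n) UNIV"
    \<comment> \<open>The coefficients vanish beyond the degree, so the finite sum is a sum over the
      whole lattice; this gives all orders a common index set for dominated convergence.\<close>
    proof (rule infsum_cong_neutral)
      fix k assume "k \<in> UNIV - ?P"
      hence "\<exists>i. k i \<notin> {- int (Suc n)..int (Suc n)}" by (simp add: PiE_UNIV_domain Pi_iff del: atLeastAtMost_iff)
      then obtain i where "k i \<notin> {- int (Suc n)..int (Suc n)}" ..
      hence "vp_coeff (Suc n) (k i) = 0" by (auto simp: vp_coeff_def)
      hence "(\<Prod>i\<in>UNIV. vp_coeff (Suc n) (k i)) = 0" by (intro prod_zero) auto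
      thus "B n k = 0" by (simp add: B_def)
    qed auto
    finally show ?thesis .
  qed
  have "(\<lambda>n. infsum (B n) UNIV) \<longlonglongrightarrow> infsum (\<lambda>k. fourier f (lat k)) UNIV"
  proof (rule infsum_dominated_convergence[OF fs])
    fix n and k :: "'n \<Rightarrow> int"
    have "\<bar>\<Prod>i\<in>UNIV. vp_coeff (Suc n) (k i)\<bar> \<le> 1"
      using vp_coeff_bounds by (simp add: prod_nonneg prod_le_1)
    thus "norm (B n k) \<le> norm (fourier f (lat k))"
      unfolding B_def norm_mult norm_of_real by (intro mult_left_le_one_le) auto
  next
    fix k :: "'n \<Rightarrow> int"
    have "(\<lambda>n. \<Prod>i\<in>UNIV. vp_coeff (Suc n) (k i)) \<longlonglongrightarrow> (\<Prod>i\<in>(UNIV::'n set). 1)"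
      by (intro tendsto_prod LIMSEQ_Suc vp_coeff_limit)
    hence "(\<lambda>n. B n k) \<longlonglongrightarrow> complex_of_real (\<Prod>i\<in>(UNIV::'n set). 1) * fourier f (lat k)"
      unfolding B_def by (intro tendsto_mult tendsto_of_real tendsto_const)
    thus "(\<lambda>n. B n k) \<longlonglongrightarrow> fourier f (lat k)" by simp
  qed
  hence "(\<lambda>n. complex_of_real (I n)) \<longlonglongrightarrow> infsum (\<lambda>k. fourier f (lat k)) UNIV" unfolding IB .
  from LIMSEQ_unique[OF lim1 this] show ?thesis .
qed

section \<open>Mean deviation of the weights\<close>

lemma sum_inverse_one_plus_square:
  fixes a :: real
  assumes a: "a > 0"
  shows "summable (\<lambda>n. 1 / (1 + (a * real (Suc n))\<^sup>2))" "(\<Sum>n. 1 / (1 + (a * real (Suc n))\<^sup>2)) \<le> pi / 2 / a"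
proof -
  define f where "f = (\<lambda>n. 1 / (1 + (a * real (Suc n))\<^sup>2))"
  \<comment> \<open>Comparison with an integral: by the mean value theorem each term is below an
    increment of \<open>arctan\<close>, and the increments telescope to at most
    \<open>pi / 2\<close>.\<close>
  have step: "f n \<le> (arctan (a * real (Suc n)) - arctan (a * real n)) / a" for n
  proof -
    have lt: "a * real n < a * real (Suc n)" using a by simp
    obtain z where z: "a * real n < z" "z < a * real (Suc n)"
      "arctan (a * real (Suc n)) - arctan (a * real n) = (a * real (Suc n) - a * real n) * inverse (1 + z\<^sup>2)"
      using MVT2[OF lt, of arctan "\<lambda>z. inverse (1 + z\<^sup>2)"] DERIV_arctan by blast
    have z0: "0 \<le> z" using z(1) a by (meson less_imp_le mult_nonneg_nonneg of_nat_0_le_iff order_trans)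
    have "z\<^sup>2 \<le> (a * real (Suc n))\<^sup>2" using z z0 by (intro power_mono) auto
    hence "f n \<le> 1 / (1 + z\<^sup>2)" unfolding f_def
      by (intro divide_left_mono mult_pos_pos one_plus_square_pos) auto
    also have "\<dots> = (arctan (a * real (Suc n)) - arctan (a * real n)) / a"
    proof -
      have "a * real (Suc n) - a * real n = a" by (simp add: algebra_simps)
      thus ?thesis unfolding z(3) using a by (simp add: inverse_eq_divide)
    qed
    finally show ?thesis .
  qed
  have partial: "(\<Sum>n<m. f n) \<le> pi / 2 / a" for m
  proof -
    have "(\<Sum>n<m. f n) \<le> (\<Sum>n<m. (arctan (a * real (Suc n)) - arctan (a * real n)) / a)"
      by (intro sum_mono step)
    also have "\<dots> = (\<Sum>n<m. arctan (a * real (Suc n)) - arctan (a * real n)) / a"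
      by (simp only: sum_divide_distrib)
    also have "\<dots> = (arctan (a * real m) - arctan (a * real 0)) / a"
      by (subst sum_lessThan_telescope) simp
    also have "\<dots> \<le> pi / 2 / a" using a arctan_ubound[of "a * real m"] by (intro divide_right_mono) auto
    finally show ?thesis .
  qed
  have f0: "f n \<ge> 0" for n unfolding f_def by (intro divide_nonneg_pos one_plus_square_pos) auto
  have "summable f" by (rule summableI_nonneg_bounded[OF f0 partial])
  thus "summable (\<lambda>n. 1 / (1 + (a * real (Suc n))\<^sup>2))" by (simp only: f_def)
  have "suminf f \<le> pi / 2 / a" by (rule suminf_le_const[OF \<open>summable f\<close> partial])
  thus "(\<Sum>n. 1 / (1 + (a * real (Suc n))\<^sup>2)) \<le> pi / 2 / a" by (simp only: f_def)
qed

text \<open>The \<open>j\<close> factors are grouped into \<open>q\<close> blocks of length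
  \<open>j div q\<close>, which is at least \<open>j / (2 * q)\<close>, and Bernoulli's inequality
  is applied within each block. This gives growth of degree \<open>q\<close> in \<open>j * u\<close>
  instead of degree 1.\<close>

lemma power_lower_bound:
  fixes u :: real
  assumes "u \<ge> 0" "1 \<le> q" "q \<le> j"
  shows "(1 + real j * u / (2 * real q)) ^ q \<le> (1 + u) ^ j"
proof -
  define m where "m = j div q"
  have m: "q * m \<le> j" "j < q * (m + 1)" "m \<ge> 1"
    using assms by (auto simp: m_def dividend_less_times_div div_greater_zero_iff Suc_leI)
  have "real j \<le> real q * (2 * real m)"
  proof -
    have "j \<le> q * (m + m)" using m(2,3) by (meson add_left_mono less_imp_le_nat mult_le_mono2 order_trans)
    hence "real j \<le> real (q * (m + m))" by (simp only: of_nat_le_iff)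
    thus ?thesis by simp
  qed
  hence "real j * u \<le> (real q * (2 * real m)) * u" using assms by (intro mult_right_mono) auto
  hence "real j * u / (2 * real q) \<le> real m * u" using assms by (simp add: field_simps)
  hence "1 + real j * u / (2 * real q) \<le> 1 + real m * u" by simp
  also have "\<dots> \<le> (1 + u) ^ m" using Bernoulli_inequality[of u m] assms by simp
  finally have "(1 + real j * u / (2 * real q)) ^ q \<le> ((1 + u) ^ m) ^ q"
    using assms by (intro power_mono) auto
  also have "\<dots> = (1 + u) ^ (q * m)" by (simp add: power_mult[symmetric] mult.commute)
  also have "\<dots> \<le> (1 + u) ^ j" using m assms by (intro power_increasing) auto
  finally show ?thesis .
qed

text \<open>Convexity in \<open>y\<close>: on [0, 1] the graph lies below the chord between 0 and
  1.\<close>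

lemma power_convex_bound:
  fixes C y :: real
  assumes "0 \<le> y" "y \<le> 1" "C \<ge> 0"
  shows "(1 + C * y) ^ d \<le> 1 + y * ((1 + C) ^ d - 1)"
proof (induction d)
  case (Suc d)
  define B where "B = (1 + C) ^ d - 1"
  have B: "B \<ge> 0" using assms by (simp add: B_def)
  have "(1 + C * y) ^ Suc d \<le> (1 + C * y) * (1 + y * B)"
    using Suc assms by (auto simp: B_def intro!: mult_left_mono)
  also have "\<dots> = 1 + y * (C + B) + (C * B * y) * y" by (simp add: algebra_simps)
  also have "\<dots> \<le> 1 + y * (C + B) + (C * B * y) * 1"
    using assms B by (intro add_left_mono mult_left_mono) auto
  also have "\<dots> = 1 + y * ((1 + C) ^ Suc d - 1)" by (simp add: B_def algebra_simps)
  finally show ?case .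
qed simp

section \<open>The weights as lattice sums of powers of the characteristic function\<close>

locale schwartz_density =
  fixes \<phi> :: "real^'n::finite \<Rightarrow> real"
  assumes schw: "schwartz \<phi>" and nonneg: "\<And>x. \<phi> x \<ge> 0" and one: "integral\<^sup>L lborel \<phi> = 1"
begin

text \<open>\<open>W\<close> divided by \<theta>, so that the zero frequency contributes exactly
  1.\<close>

definition w :: "real \<Rightarrow> nat \<Rightarrow> real" where
  "w L j = L ^ CARD('n) * infsum (\<lambda>k. conv_power \<phi> j (L *\<^sub>R lat k)) UNIV"

definition c :: real where
  "c = (SOME c. c > 0 \<and> (\<forall>\<xi>. norm (fourier \<phi> \<xi>) \<le> (\<Prod>i\<in>UNIV. 1 / (1 + c * (\<xi> $ i)\<^sup>2))))"

lemma c: "c > 0" "norm (fourier \<phi> \<xi>) \<le> (\<Prod>i\<in>UNIV. 1 / (1 + c * (\<xi> $ i)\<^sup>2))"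
  using someI_ex[OF fourier_product_bound[OF schw nonneg one]] unfolding c_def by blast+

lemma W_eq: "W \<theta> \<phi> L j = \<theta> * w L j"
  by (simp add: W_def w_def lat_def)

lemma conv_cont: "j \<ge> 1 \<Longrightarrow> continuous_on UNIV (conv_power \<phi> j)"
  and conv_nonneg: "j \<ge> 1 \<Longrightarrow> conv_power \<phi> j x \<ge> 0"
  and conv_bound: "j \<ge> 1 \<Longrightarrow> \<exists>C\<ge>0. \<forall>x. \<bar>conv_power \<phi> j x\<bar> \<le> C * decay x"
  and conv_fourier: "j \<ge> 1 \<Longrightarrow> fourier (conv_power \<phi> j) \<xi> = fourier \<phi> \<xi> ^ j"
  using conv_power_properties[OF schw nonneg, of "j - 1"] by auto

lemma w_nonneg: "L \<ge> 0 \<Longrightarrow> w L j \<ge> 0"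
proof -
  assume L: "L \<ge> 0"
  have "conv_power \<phi> j x \<ge> 0" for x using conv_nonneg by (cases "j = 0") auto
  thus ?thesis unfolding w_def using L by (intro mult_nonneg_nonneg infsum_nonneg) auto
qed

text \<open>The factor of one coordinate in the bound for the \<open>j\<close>-th power of the
  characteristic function at \<open>k / L\<close>; \<open>ltail\<close> is its sum over positive
  integers.\<close>

definition lterm :: "real \<Rightarrow> nat \<Rightarrow> int \<Rightarrow> real" where
  "lterm L j l = (1 / (1 + c / L\<^sup>2 * (of_int l)\<^sup>2)) ^ j"

definition ltail :: "real \<Rightarrow> nat \<Rightarrow> real" where
  "ltail L j = (\<Sum>n. lterm L j (int (Suc n)))"

lemma lterm_den_pos: "1 + c / L\<^sup>2 * (of_int l)\<^sup>2 \<ge> (1::real)"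
  using c(1) by simp

lemma lterm_nonneg: "lterm L j l \<ge> 0"
  unfolding lterm_def using lterm_den_pos[of L l] by simp

lemma lterm_le:
  assumes L: "L > 0" and j: "j \<ge> 1"
  shows "lterm L j (int (Suc n)) \<le> 1 / (1 + (sqrt (c * real j) / L * real (Suc n))\<^sup>2)"
proof -
  define u where "u = c / L\<^sup>2 * (real (Suc n))\<^sup>2"
  have u: "u \<ge> 0" using c(1) by (simp add: u_def)
  have "(sqrt (c * real j) / L * real (Suc n))\<^sup>2 = real j * u"
    using c(1) by (simp add: u_def power_mult_distrib power_divide)
  moreover have "1 + real j * u \<le> (1 + u) ^ j" using Bernoulli_inequality[of u j] u by simp
  moreover have "lterm L j (int (Suc n)) = 1 / (1 + u) ^ j" by (simp add: lterm_def u_def power_divide)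
  ultimately show ?thesis using u by (auto intro!: divide_left_mono mult_pos_pos add_pos_nonneg)
qed

lemma ltail_summable:
  assumes "L > 0" "j \<ge> 1"
  shows "summable (\<lambda>n. lterm L j (int (Suc n)))"
proof (rule summable_comparison_test'[where N = 0])
  show "summable (\<lambda>n. 1 / (1 + (sqrt (c * real j) / L * real (Suc n))\<^sup>2))"
    using assms c(1) by (intro sum_inverse_one_plus_square) auto
  show "norm (lterm L j (int (Suc n))) \<le> 1 / (1 + (sqrt (c * real j) / L * real (Suc n))\<^sup>2)" for n
    using lterm_le[OF assms] lterm_nonneg[of L j "int (Suc n)"] by (simp del: of_nat_Suc)
qed

lemma ltail_nonneg: "L > 0 \<Longrightarrow> j \<ge> 1 \<Longrightarrow> ltail L j \<ge> 0"
  unfolding ltail_def by (intro suminf_nonneg ltail_summable lterm_nonneg)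

text \<open>Bernoulli's inequality gives \<open>lterm\<close> quadratic decay, and the comparison
  with \<open>arctan\<close> sums it. This is the bound for \<open>j \<le> L\<^sup>2\<close>, where
  about \<open>L / sqrt j\<close> frequencies matter.\<close>

lemma ltail_bound1:
  assumes "L > 0" "j \<ge> 1"
  shows "ltail L j \<le> pi / 2 / sqrt c * (L / sqrt (real j))"
proof -
  have "ltail L j \<le> (\<Sum>n. 1 / (1 + (sqrt (c * real j) / L * real (Suc n))\<^sup>2))"
    unfolding ltail_def
    by (intro suminf_le ltail_summable assms lterm_le sum_inverse_one_plus_square) (use assms c(1) in auto)
  also have "\<dots> \<le> pi / 2 / (sqrt (c * real j) / L)"
    by (rule sum_inverse_one_plus_square) (use assms c(1) in auto)
  also have "\<dots> = pi / 2 / sqrt c * (L / sqrt (real j))" by (simp add: real_sqrt_mult)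
  finally show ?thesis .
qed

text \<open>Two Bernoulli blocks, hence \<open>j \<ge> 2\<close>, give decay of fourth order in the
  frequency. The resulting square of \<open>L\<^sup>2 / j\<close> is what makes the sum over large
  \<open>j\<close> converge.\<close>

lemma ltail_bound2:
  assumes L: "L > 0" and j: "j \<ge> 2"
  shows "ltail L j \<le> 16 / c\<^sup>2 * (\<Sum>n. 1 / real (Suc n) ^ 4) * (L\<^sup>2 / real j)\<^sup>2"
proof -
  have s4: "summable (\<lambda>n. 1 / real (Suc n) ^ 4)"
    using inverse_power_summable[of 4, where 'a = real] by (subst summable_Suc_iff) (simp add: inverse_eq_divide)
  have le: "lterm L j (int (Suc n)) \<le> 16 / c\<^sup>2 * (L\<^sup>2 / real j)\<^sup>2 * (1 / real (Suc n) ^ 4)" for n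
  proof -
    define u where "u = c / L\<^sup>2 * (real (Suc n))\<^sup>2"
    have u: "u > 0" using c(1) L by (simp add: u_def)
    have "(real j * u / 4)\<^sup>2 \<le> (1 + real j * u / (2 * real 2))\<^sup>2" using u by (intro power_mono) auto
    also have "\<dots> \<le> (1 + u) ^ j" by (rule power_lower_bound) (use u j in auto)
    finally have "(real j * u / 4)\<^sup>2 \<le> (1 + u) ^ j" .
    moreover have "(real j * u / 4)\<^sup>2 > 0" using u j by simp
    ultimately have "1 / (1 + u) ^ j \<le> 1 / (real j * u / 4)\<^sup>2" using u by (intro divide_left_mono) auto
    also have "\<dots> = 16 / c\<^sup>2 * (L\<^sup>2 / real j)\<^sup>2 * (1 / real (Suc n) ^ 4)"
    proof -
      have "1 / (J * (c / L2 * m\<^sup>2) / 4)\<^sup>2 = 16 / c\<^sup>2 * (L2 / J)\<^sup>2 * (1 / m ^ 4)"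
        if "J \<noteq> 0" "L2 \<noteq> 0" "m \<noteq> 0" for J L2 m :: real
        using that c(1) by (simp add: field_simps power2_eq_square power4_eq_xxxx)
      thus ?thesis unfolding u_def using L j by simp
    qed
    finally show ?thesis by (simp add: lterm_def u_def power_divide)
  qed
  have "ltail L j \<le> (\<Sum>n. 16 / c\<^sup>2 * (L\<^sup>2 / real j)\<^sup>2 * (1 / real (Suc n) ^ 4))"
    unfolding ltail_def by (intro suminf_le ltail_summable le summable_mult s4) (use L j in auto)
  also have "\<dots> = 16 / c\<^sup>2 * (L\<^sup>2 / real j)\<^sup>2 * (\<Sum>n. 1 / real (Suc n) ^ 4)" by (rule suminf_mult[OF s4])
  finally show ?thesis by (simp add: mult_ac)
qed

lemma lterm_sums:
  assumes "L > 0" "j \<ge> 1"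
  shows "lterm L j summable_on UNIV" "infsum (lterm L j) UNIV = 1 + 2 * ltail L j"
proof -
  have 0: "lterm L j 0 = 1" by (simp add: lterm_def)
  show "lterm L j summable_on UNIV"
    by (rule int_summable_iff(1)[OF lterm_nonneg _ ltail_summable[OF assms]]) (simp add: lterm_def)
  show "infsum (lterm L j) UNIV = 1 + 2 * ltail L j"
    unfolding ltail_def 0[symmetric]
    by (rule int_summable_iff(2)[OF lterm_nonneg _ ltail_summable[OF assms]]) (simp add: lterm_def)
qed

lemma fourier_lat_bound:
  shows "norm (fourier \<phi> ((1 / L) *\<^sub>R lat k) ^ j) \<le> (\<Prod>i\<in>UNIV. lterm L j (k i))"
proof -
  have "norm (fourier \<phi> ((1 / L) *\<^sub>R lat k)) \<le> (\<Prod>i\<in>UNIV. 1 / (1 + c * (((1 / L) *\<^sub>R lat k) $ i)\<^sup>2))" by (rule c(2))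
  also have "\<dots> = (\<Prod>i\<in>UNIV. 1 / (1 + c / L\<^sup>2 * (of_int (k i))\<^sup>2))" by (simp add: power_divide)
  finally have "norm (fourier \<phi> ((1 / L) *\<^sub>R lat k)) ^ j \<le> (\<Prod>i\<in>UNIV. 1 / (1 + c / L\<^sup>2 * (of_int (k i))\<^sup>2)) ^ j"
    by (intro power_mono) auto
  thus ?thesis by (simp add: norm_power lterm_def prod_power_distrib)
qed

lemma fourier_lat_summable:
  assumes "L > 0" "j \<ge> 1"
  shows "(\<lambda>k. norm (fourier \<phi> ((1 / L) *\<^sub>R lat k) ^ j)) summable_on UNIV"
  by (rule summable_on_comparison_test[OF product_summable_lattice(1)[OF lterm_nonneg lterm_sums(1)[OF assms]]])
     (use fourier_lat_bound in auto)

text \<open>Poisson summation for the rescaled function \<open>L ^ d\<close> times the convolution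
  power at \<open>L *\<^sub>R x\<close>: scaling moves the dual lattice to \<open>k / L\<close>, and
  convolution becomes the \<open>j\<close>-th power.\<close>

lemma w_poisson:
  assumes L: "L \<ge> 1" and j: "j \<ge> 1"
  shows "complex_of_real (w L j) = infsum (\<lambda>k. fourier \<phi> ((1 / L) *\<^sub>R lat k) ^ j) UNIV"
proof -
  define f where "f = (\<lambda>x::real^'n. L ^ CARD('n) * conv_power \<phi> j (L *\<^sub>R x))"
  obtain C where C: "C \<ge> 0" "\<And>x. \<bar>conv_power \<phi> j x\<bar> \<le> C * decay x" using conv_bound[OF j] by blast
  have decL: "decay (L *\<^sub>R x) \<le> decay x" for x :: "real^'n"
    unfolding decay_def
  proof (intro prod_mono conjI)
    fix i
    have "1 * (x $ i)\<^sup>2 \<le> L\<^sup>2 * (x $ i)\<^sup>2" using L by (intro mult_right_mono) (auto simp: one_le_power)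
    thus "1 / (1 + ((L *\<^sub>R x) $ i)\<^sup>2) \<le> 1 / (1 + (x $ i)\<^sup>2)"
      by (intro divide_left_mono mult_pos_pos one_plus_square_pos) (auto simp: power_mult_distrib)
  qed (auto intro!: divide_nonneg_nonneg add_nonneg_nonneg)
  have fc: "continuous_on UNIV f" unfolding f_def
    by (intro continuous_intros continuous_on_compose2[OF conv_cont[OF j]]) auto
  have fb: "\<bar>f x\<bar> \<le> (L ^ CARD('n) * C) * decay x" for x
  proof -
    have "\<bar>conv_power \<phi> j (L *\<^sub>R x)\<bar> \<le> C * decay x"
      using C(2)[of "L *\<^sub>R x"] mult_left_mono[OF decL[of x] C(1)] by linarith
    hence "L ^ CARD('n) * \<bar>conv_power \<phi> j (L *\<^sub>R x)\<bar> \<le> L ^ CARD('n) * (C * decay x)"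
      using L by (intro mult_left_mono) auto
    thus ?thesis using L by (simp add: f_def abs_mult mult.assoc)
  qed
  have ff: "fourier f \<xi> = fourier \<phi> ((1 / L) *\<^sub>R \<xi>) ^ j" for \<xi>
  proof -
    define g where "g = (\<lambda>y. complex_of_real (conv_power \<phi> j y) * cis (2 * pi * (((1 / L) *\<^sub>R \<xi>) \<bullet> y)))"
    have gi: "integrable lborel g" unfolding g_def
      by (intro integrable_times_cis integrable_decay_bound[OF conv_cont[OF j] C(2)])
    have "fourier \<phi> ((1 / L) *\<^sub>R \<xi>) ^ j = fourier (conv_power \<phi> j) ((1 / L) *\<^sub>R \<xi>)"
      by (rule conv_fourier[OF j, symmetric])
    also have "\<dots> = (\<integral>y. g y \<partial>lborel)" by (simp only: fourier_def g_def)
    also have "\<dots> = L ^ DIM(real^'n) *\<^sub>R (\<integral>x. g (L *\<^sub>R x) \<partial>lborel)"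
      by (rule lborel_scale(2)) (use L gi in auto)
    also have "\<dots> = (\<integral>x. L ^ CARD('n) *\<^sub>R g (L *\<^sub>R x) \<partial>lborel)" by simp
    also have "\<dots> = fourier f \<xi>"
      unfolding fourier_def
    proof (intro Bochner_Integration.integral_cong refl)
      fix x :: "real^'n"
      have "((1 / L) *\<^sub>R \<xi>) \<bullet> (L *\<^sub>R x) = \<xi> \<bullet> x" using L by simp
      thus "L ^ CARD('n) *\<^sub>R g (L *\<^sub>R x) = complex_of_real (f x) * cis (2 * pi * (\<xi> \<bullet> x))"
        unfolding g_def f_def by (simp only: scaleR_conv_of_real[of _ "_ :: complex"] of_real_mult mult.assoc)
    qed
    finally show ?thesis ..
  qed
  have "complex_of_real (infsum (\<lambda>k. f (lat k)) UNIV) = infsum (\<lambda>k. fourier f (lat k)) UNIV"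
    by (rule poisson_summation[OF fc fb]) (unfold ff, rule fourier_lat_summable, use L j in auto)
  moreover have "infsum (\<lambda>k. f (lat k)) UNIV = w L j"
    unfolding f_def w_def by (rule infsum_cmult_right')
  ultimately show ?thesis by (simp only: ff)
qed

lemma fourier_0: "fourier \<phi> 0 = 1"
  by (simp add: fourier_def one)

text \<open>The zero frequency gives 1. The other frequencies are bounded by the product terms,
  whose total over the lattice factorises into \<open>d\<close> equal one-dimensional sums
  \<open>1 + 2 * ltail L j\<close>.\<close>

lemma w_dev_bound:
  assumes L: "L \<ge> 1" and j: "j \<ge> 1"
  shows "\<bar>w L j - 1\<bar> \<le> (1 + 2 * ltail L j) ^ CARD('n) - 1"
proof -
  have L0: "L > 0" using L by simp
  define g where "g = (\<lambda>k :: 'n \<Rightarrow> int. fourier \<phi> ((1 / L) *\<^sub>R lat k) ^ j)"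
  define P where "P = (\<lambda>k :: 'n \<Rightarrow> int. \<Prod>i\<in>UNIV. lterm L j (k i))"
  have gP: "norm (g k) \<le> P k" for k unfolding g_def P_def by (rule fourier_lat_bound)
  have Ps: "P summable_on UNIV" unfolding P_def
    by (rule product_summable_lattice(1)[OF lterm_nonneg lterm_sums(1)[OF L0 j]])
  have gs: "(\<lambda>k. norm (g k)) summable_on UNIV" unfolding g_def by (rule fourier_lat_summable[OF L0 j])
  define z where "z = (\<lambda>_::'n. 0::int)"
  have latz: "lat z = (0 :: real^'n)" by (simp add: lat_def z_def vec_eq_iff)
  have gz: "g z = 1" by (simp add: g_def latz fourier_0)
  have Pz: "P z = 1" by (simp add: P_def z_def lterm_def)
  have split: "infsum h UNIV = h z + infsum h (UNIV - {z})" if "h summable_on UNIV" for h :: "('n \<Rightarrow> int) \<Rightarrow> 'b::banach"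
  proof -
    have "infsum h ({z} \<union> (UNIV - {z})) = infsum h {z} + infsum h (UNIV - {z})"
      by (rule infsum_Un_disjoint) (use summable_on_subset_banach[OF that] in auto)
    thus ?thesis by simp
  qed
  have "complex_of_real (w L j) - 1 = infsum g (UNIV - {z})"
    unfolding w_poisson[OF L j] g_def[symmetric] using split[of g] abs_summable_summable[OF gs] gz by simp
  hence "norm (complex_of_real (w L j - 1)) = norm (infsum g (UNIV - {z}))" by simp
  also have "\<dots> \<le> infsum (\<lambda>k. norm (g k)) (UNIV - {z})"
    by (rule norm_infsum_bound) (use summable_on_subset_banach[OF gs] in auto)
  also have "\<dots> \<le> infsum P (UNIV - {z})"
    by (rule infsum_mono) (use gP summable_on_subset_banach[OF gs] summable_on_subset_banach[OF Ps] in auto)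
  also have "\<dots> = infsum P UNIV - 1" using split[OF Ps] Pz by simp
  also have "infsum P UNIV = (1 + 2 * ltail L j) ^ CARD('n)"
    unfolding P_def lterm_sums(2)[OF L0 j, symmetric]
    by (rule product_summable_lattice(2)[OF lterm_nonneg lterm_sums(1)[OF L0 j]])
  finally show ?thesis unfolding norm_of_real .
qed

text \<open>The two sides of the relaxation time \<open>L\<^sup>2\<close>. Before it the
  one-dimensional sums are large and their \<open>d\<close>-th power counts, whence the exponent
  \<open>d / 2\<close>; after it they are small and \<open>power_convex_bound\<close> linearises the
  power.\<close>

lemma w_dev_bounds:
  obtains C where "C > 0"
    "\<And>L j. L \<ge> 1 \<Longrightarrow> j \<ge> 1 \<Longrightarrow> real j \<le> L\<^sup>2 \<Longrightarrow> \<bar>w L j - 1\<bar> \<le> C * (L\<^sup>2 / real j) powr (real CARD('n) / 2)"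
    "\<And>L j. L \<ge> 1 \<Longrightarrow> j \<ge> 1 \<Longrightarrow> L\<^sup>2 \<le> real j \<Longrightarrow> \<bar>w L j - 1\<bar> \<le> C * (L\<^sup>2 / real j)\<^sup>2"
proof -
  define A where "A = pi / 2 / sqrt c"
  define B where "B = 16 / c\<^sup>2 * (\<Sum>n. 1 / real (Suc n) ^ 4)"
  have s4: "summable (\<lambda>n. 1 / real (Suc n) ^ 4)"
    using inverse_power_summable[of 4, where 'a = real] by (subst summable_Suc_iff) (simp add: inverse_eq_divide)
  have A: "A > 0" using c(1) by (simp add: A_def)
  have B: "B \<ge> 0" unfolding B_def by (intro mult_nonneg_nonneg suminf_nonneg s4) auto
  define D where "D = 2 * (A + B)"
  have D: "D > 0" using A B by (simp add: D_def)
  define d where "d = CARD('n)"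
  define C where "C = (1 + D) ^ d"
  have C: "C > 0" using D by (simp add: C_def)
  have 1: "\<bar>w L j - 1\<bar> \<le> C * (L\<^sup>2 / real j) powr (real CARD('n) / 2)"
    if L: "L \<ge> 1" and j: "j \<ge> 1" "real j \<le> L\<^sup>2" for L j
  proof -
    define x where "x = L / sqrt (real j)"
    have "sqrt (real j) \<le> L" using L j by (intro real_le_lsqrt) auto
    hence x: "x \<ge> 1" using j by (simp add: x_def)
    have "ltail L j \<le> A * x" unfolding A_def x_def using L j by (intro ltail_bound1) auto
    also have "\<dots> \<le> (A + B) * x" using B x by (intro mult_right_mono) auto
    finally have "ltail L j \<le> (A + B) * x" .
    moreover have "D * x = 2 * ((A + B) * x)" by (simp only: D_def mult.assoc)
    ultimately have "1 + 2 * ltail L j \<le> 1 + D * x" by linarith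
    also have "\<dots> \<le> (1 + D) * x" using x by (simp add: algebra_simps)
    finally have "(1 + 2 * ltail L j) ^ d \<le> ((1 + D) * x) ^ d"
      using ltail_nonneg[of L j] L j by (intro power_mono) auto
    hence "\<bar>w L j - 1\<bar> \<le> C * x ^ d"
      using w_dev_bound[OF L j(1)] by (simp add: C_def d_def power_mult_distrib)
    also have "x ^ d = (L\<^sup>2 / real j) powr (real CARD('n) / 2)"
    proof -
      have "L\<^sup>2 / real j = x powr 2" using x j L by (simp add: x_def power_divide powr_numeral)
      hence "(L\<^sup>2 / real j) powr (real CARD('n) / 2) = x powr real d" by (simp add: powr_powr d_def)
      thus ?thesis using x by (simp add: powr_realpow)
    qed
    finally show ?thesis .
  qed
  have 2: "\<bar>w L j - 1\<bar> \<le> C * (L\<^sup>2 / real j)\<^sup>2"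
    if L: "L \<ge> 1" and j: "j \<ge> 1" "L\<^sup>2 \<le> real j" for L j
  proof -
    define y where "y = (L\<^sup>2 / real j)\<^sup>2"
    have y: "0 \<le> y" "y \<le> 1" using L j by (auto simp: y_def power_le_one)
    have "ltail L j \<le> (A + B) * y"
    proof (cases "j = 1")
      case True
      hence "L\<^sup>2 \<le> 1\<^sup>2" using j by simp
      hence "L \<le> 1" by (rule power2_le_imp_le) simp
      hence "L = 1" using L by simp
      hence "ltail L j \<le> A" "y = 1" using ltail_bound1[of L j] True by (auto simp: A_def y_def)
      thus ?thesis using B by simp
    next
      case False
      hence "ltail L j \<le> B * y" unfolding B_def y_def using L j by (intro ltail_bound2) auto
      also have "\<dots> \<le> (A + B) * y" using A y by (intro mult_right_mono) auto
      finally show ?thesis .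
    qed
    moreover have "D * y = 2 * ((A + B) * y)" by (simp only: D_def mult.assoc)
    ultimately have "1 + 2 * ltail L j \<le> 1 + D * y" by linarith
    hence "(1 + 2 * ltail L j) ^ d \<le> (1 + D * y) ^ d"
      using ltail_nonneg[of L j] L j by (intro power_mono) auto
    also have "\<dots> \<le> 1 + y * ((1 + D) ^ d - 1)" using y D by (intro power_convex_bound) auto
    also have "\<dots> \<le> 1 + C * y" using y by (simp add: C_def algebra_simps)
    finally show ?thesis using w_dev_bound[OF L j(1)] by (simp add: d_def y_def)
  qed
  show ?thesis by (rule that[OF C 1 2])
qed

end

section \<open>Sums of the deviations\<close>

lemma sum_inverse_sqrt_le: "(\<Sum>j=1..m. 1 / sqrt (real j)) \<le> 2 * sqrt (real m)"
proof (induction m)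
  case (Suc m)
  define a b where "a = sqrt (real m)" and "b = sqrt (real (Suc m))"
  have ab: "0 \<le> a" "a \<le> b" "b > 0" "b\<^sup>2 = a\<^sup>2 + 1" by (auto simp: a_def b_def)
  have "1 = (b - a) * (b + a)" using ab by (simp add: power2_eq_square algebra_simps)
  also have "\<dots> \<le> (b - a) * (2 * b)" using ab by (intro mult_left_mono) auto
  finally have "1 / b \<le> 2 * (b - a)" using ab by (simp add: divide_le_eq mult_ac)
  thus ?case using Suc by (simp add: a_def b_def)
qed simp

lemma sum_inverse_le_ln: "m \<ge> 1 \<Longrightarrow> (\<Sum>j=1..m. 1 / real j) \<le> 1 + ln (real m)"
proof (induction m rule: dec_induct)
  case (step m)
  have "1 / real (Suc m) \<le> ln (real (Suc m)) - ln (real m)"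
  proof -
    have "ln (real m / real (Suc m)) \<le> real m / real (Suc m) - 1"
      using step by (intro ln_le_minus_one) auto
    also have "\<dots> = - (1 / real (Suc m))" by (simp add: field_simps)
    finally show ?thesis using step by (simp add: ln_div)
  qed
  thus ?case using step by simp
qed simp

context schwartz_density begin

definition Cw :: real where
  "Cw = (SOME C. C > 0 \<and>
    (\<forall>L j. L \<ge> 1 \<longrightarrow> j \<ge> 1 \<longrightarrow> real j \<le> L\<^sup>2 \<longrightarrow> \<bar>w L j - 1\<bar> \<le> C * (L\<^sup>2 / real j) powr (real CARD('n) / 2)) \<and>
    (\<forall>L j. L \<ge> 1 \<longrightarrow> j \<ge> 1 \<longrightarrow> L\<^sup>2 \<le> real j \<longrightarrow> \<bar>w L j - 1\<bar> \<le> C * (L\<^sup>2 / real j)\<^sup>2))"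

lemma Cw:
  shows "Cw > 0"
    and w_dev_head: "L \<ge> 1 \<Longrightarrow> j \<ge> 1 \<Longrightarrow> real j \<le> L\<^sup>2 \<Longrightarrow> \<bar>w L j - 1\<bar> \<le> Cw * (L\<^sup>2 / real j) powr (real CARD('n) / 2)"
    and w_dev_tail: "L \<ge> 1 \<Longrightarrow> j \<ge> 1 \<Longrightarrow> L\<^sup>2 \<le> real j \<Longrightarrow> \<bar>w L j - 1\<bar> \<le> Cw * (L\<^sup>2 / real j)\<^sup>2"
proof -
  have "\<exists>C. C > 0 \<and>
    (\<forall>L j. L \<ge> 1 \<longrightarrow> j \<ge> 1 \<longrightarrow> real j \<le> L\<^sup>2 \<longrightarrow> \<bar>w L j - 1\<bar> \<le> C * (L\<^sup>2 / real j) powr (real CARD('n) / 2)) \<and>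
    (\<forall>L j. L \<ge> 1 \<longrightarrow> j \<ge> 1 \<longrightarrow> L\<^sup>2 \<le> real j \<longrightarrow> \<bar>w L j - 1\<bar> \<le> C * (L\<^sup>2 / real j)\<^sup>2)"
  proof (rule w_dev_bounds)
    fix C :: real
    assume "C > 0"
      "\<And>L j. L \<ge> 1 \<Longrightarrow> j \<ge> 1 \<Longrightarrow> real j \<le> L\<^sup>2 \<Longrightarrow> \<bar>w L j - 1\<bar> \<le> C * (L\<^sup>2 / real j) powr (real CARD('n) / 2)"
      "\<And>L j. L \<ge> 1 \<Longrightarrow> j \<ge> 1 \<Longrightarrow> L\<^sup>2 \<le> real j \<Longrightarrow> \<bar>w L j - 1\<bar> \<le> C * (L\<^sup>2 / real j)\<^sup>2"
    thus ?thesis by (intro exI[of _ C] conjI allI impI)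
  qed
  from someI_ex[OF this] show "Cw > 0"
    "L \<ge> 1 \<Longrightarrow> j \<ge> 1 \<Longrightarrow> real j \<le> L\<^sup>2 \<Longrightarrow> \<bar>w L j - 1\<bar> \<le> Cw * (L\<^sup>2 / real j) powr (real CARD('n) / 2)"
    "L \<ge> 1 \<Longrightarrow> j \<ge> 1 \<Longrightarrow> L\<^sup>2 \<le> real j \<Longrightarrow> \<bar>w L j - 1\<bar> \<le> Cw * (L\<^sup>2 / real j)\<^sup>2"
    unfolding Cw_def by blast+
qed

text \<open>The squared decay is summed by \<open>sum_inverse_one_plus_square\<close> at scale
  \<open>J\<close>, since \<open>(J / m)\<^sup>2 \<le> 2 / (1 + (m / J)\<^sup>2)\<close> for
  \<open>m \<ge> J\<close>. The case \<open>J = L\<^sup>2\<close> bounds everything after the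
  relaxation time, and \<open>J = \<eta> * N\<close> gives the tail condition of
  \<open>exp_coeff\<close>.\<close>

lemma tail_bound:
  assumes L: "L \<ge> 1" and J: "L\<^sup>2 \<le> J"
  shows "summable (\<lambda>j. if real (Suc j) > J then \<bar>w L (Suc j) - 1\<bar> else 0)"
    and "(\<Sum>j. if real (Suc j) > J then \<bar>w L (Suc j) - 1\<bar> else 0) \<le> pi * Cw * (L\<^sup>2)\<^sup>2 / J"
proof -
  have "1 \<le> L\<^sup>2" using L by (simp add: one_le_power)
  hence J0: "J > 0" using J by linarith
  define g where "g = (\<lambda>j. 2 * Cw * (L\<^sup>2 / J)\<^sup>2 * (1 / (1 + (1 / J * real (Suc j))\<^sup>2)))"
  have le: "(if real (Suc j) > J then \<bar>w L (Suc j) - 1\<bar> else 0) \<le> g j" for j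
  proof (cases "real (Suc j) > J")
    case True
    define m where "m = real (Suc j)"
    have m: "m > J" using True by (simp add: m_def)
    have "\<bar>w L (Suc j) - 1\<bar> \<le> Cw * (L\<^sup>2 / m)\<^sup>2" unfolding m_def using L J True by (intro w_dev_tail) auto
    also have "(L\<^sup>2 / m)\<^sup>2 = (L\<^sup>2 / J)\<^sup>2 * (J / m)\<^sup>2" using J0 m by (simp add: power_divide)
    also have "(J / m)\<^sup>2 \<le> 2 * (1 / (1 + (1 / J * m)\<^sup>2))"
    proof -
      have q: "(1 / J * m)\<^sup>2 \<ge> 1" using m J0 by (simp add: one_le_power)
      have "(J / m)\<^sup>2 = 1 / (1 / J * m)\<^sup>2" using m J0 by (simp add: power_divide)
      also have "\<dots> \<le> 2 * (1 / (1 + (1 / J * m)\<^sup>2))"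
      proof -
        have "1 / z \<le> 2 * (1 / (1 + z))" if "z \<ge> 1" for z :: real using that by (simp add: field_simps)
        thus ?thesis using q by blast
      qed
      finally show ?thesis .
    qed
    finally have "\<bar>w L (Suc j) - 1\<bar> \<le> Cw * ((L\<^sup>2 / J)\<^sup>2 * (2 * (1 / (1 + (1 / J * m)\<^sup>2))))"
      using Cw(1) by (simp add: mult_left_mono)
    thus ?thesis using True by (simp add: g_def m_def mult_ac)
  next
    case False
    have "g j \<ge> 0" unfolding g_def using Cw(1)
      by (intro mult_nonneg_nonneg divide_nonneg_pos one_plus_square_pos) auto
    thus ?thesis using False by simp
  qed
  have sg: "summable g" unfolding g_def using J0 by (intro summable_mult sum_inverse_one_plus_square) auto
  show s: "summable (\<lambda>j. if real (Suc j) > J then \<bar>w L (Suc j) - 1\<bar> else 0)"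
    by (rule summable_comparison_test'[OF sg, of 0]) (use le in \<open>auto split: if_splits\<close>)
  have "(\<Sum>j. if real (Suc j) > J then \<bar>w L (Suc j) - 1\<bar> else 0) \<le> suminf g"
    by (rule suminf_le[OF le s sg])
  also have "\<dots> = 2 * Cw * (L\<^sup>2 / J)\<^sup>2 * (\<Sum>j. 1 / (1 + (1 / J * real (Suc j))\<^sup>2))"
    unfolding g_def using J0 by (intro suminf_mult sum_inverse_one_plus_square) auto
  also have "\<dots> \<le> 2 * Cw * (L\<^sup>2 / J)\<^sup>2 * (pi / 2 / (1 / J))"
    using Cw(1) J0 by (intro mult_left_mono sum_inverse_one_plus_square) auto
  also have "\<dots> = pi * Cw * (L\<^sup>2)\<^sup>2 / J" using J0 by (simp add: power_divide power2_eq_square)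
  finally show "(\<Sum>j. if real (Suc j) > J then \<bar>w L (Suc j) - 1\<bar> else 0) \<le> pi * Cw * (L\<^sup>2)\<^sup>2 / J" .
qed

definition head :: "real \<Rightarrow> nat" where "head L = nat \<lfloor>L\<^sup>2\<rfloor>"

lemma head: "L \<ge> 1 \<Longrightarrow> head L \<ge> 1" "real (head L) \<le> L\<^sup>2" "real j \<le> L\<^sup>2 \<longleftrightarrow> j \<le> head L"
proof -
  show "L \<ge> 1 \<Longrightarrow> head L \<ge> 1" unfolding head_def by (simp add: le_nat_iff le_floor_iff one_le_power)
  show "real (head L) \<le> L\<^sup>2" unfolding head_def by (intro of_nat_floor) auto
  show "real j \<le> L\<^sup>2 \<longleftrightarrow> j \<le> head L" unfolding head_def by (simp add: le_nat_iff le_floor_iff)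
qed

text \<open>Stated for a general \<open>p\<close> so that it covers the signed deviations and their
  absolute values alike.\<close>

lemma sum_head_tail:
  assumes L: "L \<ge> 1" and p: "\<And>j. \<bar>p j\<bar> \<le> \<bar>w L (Suc j) - 1\<bar>"
  shows "summable p" "\<bar>suminf p - (\<Sum>j<head L. p j)\<bar> \<le> pi * Cw * L\<^sup>2"
proof -
  note T = tail_bound[OF L order_refl]
  define t where "t = (\<lambda>j. if real (Suc j) > L\<^sup>2 then \<bar>w L (Suc j) - 1\<bar> else 0)"
  have d: "\<bar>p j - (if j \<in> {..<head L} then p j else 0)\<bar> \<le> t j" for j
    using p[of j] head(3)[of "Suc j" L] by (auto simp: t_def simp del: of_nat_Suc)
  have st: "summable t" using T by (simp add: t_def)
  have sd: "summable (\<lambda>j. \<bar>p j - (if j \<in> {..<head L} then p j else 0)\<bar>)"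
    by (rule summable_comparison_test'[OF st, of 0]) (use d in auto)
  have sf: "summable (\<lambda>j. if j \<in> {..<head L} then p j else 0)"
    by (rule summable_finite[of "{..<head L}"]) auto
  have "summable (\<lambda>j. (p j - (if j \<in> {..<head L} then p j else 0)) + (if j \<in> {..<head L} then p j else 0))"
    by (rule summable_add[OF summable_rabs_cancel[OF sd] sf])
  thus sp: "summable p" by simp
  have "(\<Sum>j<head L. p j) = (\<Sum>j. if j \<in> {..<head L} then p j else 0)"
    by (subst suminf_finite[of "{..<head L}"]) auto
  hence "suminf p - (\<Sum>j<head L. p j) = (\<Sum>j. p j - (if j \<in> {..<head L} then p j else 0))"
    using suminf_diff[OF sp sf] by simp
  also have "\<bar>\<dots>\<bar> \<le> suminf t"
    by (rule order_trans[OF summable_rabs[OF sd] suminf_le[OF d sd st]])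
  also have "\<dots> \<le> pi * Cw * (L\<^sup>2)\<^sup>2 / L\<^sup>2" using T(2) by (simp only: t_def)
  also have "\<dots> = pi * Cw * L\<^sup>2" using L by (simp add: power2_eq_square)
  finally show "\<bar>suminf p - (\<Sum>j<head L. p j)\<bar> \<le> pi * Cw * L\<^sup>2" .
qed

lemma summable_dev: "L \<ge> 1 \<Longrightarrow> summable (\<lambda>j. \<bar>w L (Suc j) - 1\<bar>)"
  by (rule sum_head_tail(1)) auto

text \<open>All conditions on \<open>W\<close> except the two mean deviations follow from the head
  and tail bounds once \<open>L\<^sup>2 = o(N)\<close>: the exponent \<open>d / 2\<close> is that of
  the head, and both tail conditions are quadratic in \<open>L\<^sup>2 / N\<close>. Only the means
  depend on the regime.\<close>

lemma exp_coeff_W: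
  fixes L :: "nat \<Rightarrow> real" and \<theta> \<tau> :: real
  assumes \<theta>: "\<theta> > 0" and \<tau>: "\<tau> \<ge> 0" and L0: "\<And>N. L N \<ge> 0" and L1: "\<forall>\<^sub>F N in sequentially. L N \<ge> 1"
    and LN: "(\<lambda>N. (L N)\<^sup>2 / real N) \<longlonglongrightarrow> 0"
    and m1: "(\<lambda>N. \<theta> * (\<Sum>j. w (L N) (Suc j) - 1) / real N) \<longlonglongrightarrow> \<tau>"
    and m2: "(\<lambda>N. \<theta> * (\<Sum>j. \<bar>w (L N) (Suc j) - 1\<bar>) / real N) \<longlonglongrightarrow> \<tau>"
  shows "exp_coeff \<theta> \<tau> (real CARD('n) / 2) (\<theta> * (1 + Cw)) (\<lambda>N. W \<theta> \<phi> (L N))"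
proof
  have dvs: "W \<theta> \<phi> l j - \<theta> = \<theta> * (w l j - 1)" for l j
    by (simp add: W_eq algebra_simps)
  have dv: "\<bar>W \<theta> \<phi> l j - \<theta>\<bar> = \<theta> * \<bar>w l j - 1\<bar>" for l j
    unfolding dvs abs_mult using \<theta> by simp
  show "0 < \<theta>" "0 \<le> \<tau>" "0 < real CARD('n) / 2" "0 \<le> \<theta> * (1 + Cw)" using \<theta> \<tau> Cw(1) by auto
  show "W \<theta> \<phi> (L N) j \<ge> 0" for N j using \<theta> w_nonneg[OF L0] by (simp add: W_eq)
  show "\<forall>\<^sub>F N in sequentially. summable (\<lambda>j. \<bar>W \<theta> \<phi> (L N) (Suc j) - \<theta>\<bar>)"
    using L1 by eventually_elim (auto simp: dv intro!: summable_mult summable_dev)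
  show "(\<lambda>N. (\<Sum>j. W \<theta> \<phi> (L N) (Suc j) - \<theta>) / real N) \<longlonglongrightarrow> \<tau>"
  proof (rule Lim_transform_eventually[OF m1])
    show "\<forall>\<^sub>F N in sequentially. \<theta> * (\<Sum>j. w (L N) (Suc j) - 1) / real N = (\<Sum>j. W \<theta> \<phi> (L N) (Suc j) - \<theta>) / real N"
      using L1 by eventually_elim
        (simp only: dvs suminf_mult[OF summable_rabs_cancel[OF summable_dev]])
  qed
  show "(\<lambda>N. (\<Sum>j. \<bar>W \<theta> \<phi> (L N) (Suc j) - \<theta>\<bar>) / real N) \<longlonglongrightarrow> \<tau>"
  proof (rule Lim_transform_eventually[OF m2])
    show "\<forall>\<^sub>F N in sequentially. \<theta> * (\<Sum>j. \<bar>w (L N) (Suc j) - 1\<bar>) / real N = (\<Sum>j. \<bar>W \<theta> \<phi> (L N) (Suc j) - \<theta>\<bar>) / real N"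
      using L1 by eventually_elim (simp only: dv suminf_mult[OF summable_dev])
  qed
  have small: "\<forall>\<^sub>F N in sequentially. (L N)\<^sup>2 \<le> \<eta> * real N" if "\<eta> > 0" for \<eta>
  proof -
    have "\<forall>\<^sub>F N in sequentially. (L N)\<^sup>2 / real N < \<eta>"
      by (rule order_tendstoD(2)[OF LN that])
    thus ?thesis using eventually_gt_at_top[of 0]
      by eventually_elim (auto simp: divide_less_eq intro: less_imp_le)
  qed
  show "\<forall>\<^sub>F N in sequentially. \<forall>j\<ge>1. W \<theta> \<phi> (L N) j \<le> \<theta> * (1 + Cw) * (1 + (real N / real j) powr (real CARD('n) / 2))"
    using L1 small[OF zero_less_one]
  proof eventually_elim
    case (elim N)
    show ?case
    proof (intro allI impI)
      fix j :: nat assume j: "j \<ge> 1"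
      define P where "P = (real N / real j) powr (real CARD('n) / 2)"
      have P: "P \<ge> 0" by (simp add: P_def)
      have "w (L N) j - 1 \<le> Cw * (1 + P)"
      proof (cases "real j \<le> (L N)\<^sup>2")
        case True
        have "w (L N) j - 1 \<le> Cw * ((L N)\<^sup>2 / real j) powr (real CARD('n) / 2)"
          using w_dev_head[OF elim(1) j True] by linarith
        also have "\<dots> \<le> Cw * P" unfolding P_def using Cw(1) elim
          by (intro mult_left_mono powr_mono2 divide_right_mono) auto
        also have "\<dots> \<le> Cw * (1 + P)" using Cw(1) by simp
        finally show ?thesis .
      next
        case False
        have "w (L N) j - 1 \<le> Cw * ((L N)\<^sup>2 / real j)\<^sup>2"
          using w_dev_tail[OF elim(1) j] False by linarith
        also have "\<dots> \<le> Cw * 1" using Cw(1) False j by (intro mult_left_mono power_le_one) auto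
        also have "\<dots> \<le> Cw * (1 + P)" using Cw(1) P by simp
        finally show ?thesis .
      qed
      hence "w (L N) j \<le> (1 + Cw) * (1 + P)" using P by (simp add: algebra_simps)
      hence "\<theta> * w (L N) j \<le> \<theta> * ((1 + Cw) * (1 + P))" using \<theta> by (intro mult_left_mono) auto
      thus "W \<theta> \<phi> (L N) j \<le> \<theta> * (1 + Cw) * (1 + (real N / real j) powr (real CARD('n) / 2))"
        by (simp add: W_eq P_def mult.assoc)
    qed
  qed
  fix \<eta> :: real assume \<eta>: "\<eta> > 0"
  have sq0: "(\<lambda>N. K * ((L N)\<^sup>2 / real N)\<^sup>2) \<longlonglongrightarrow> 0" for K
    using tendsto_mult[OF tendsto_const[of K] tendsto_power[OF LN, of 2]] by simp
  show "(\<lambda>N. (\<Sum>j. if \<eta> * real N < real (Suc j) then \<bar>W \<theta> \<phi> (L N) (Suc j) - \<theta>\<bar> else 0) / real N) \<longlonglongrightarrow> 0"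
  proof (rule tendsto_sandwich[OF _ _ tendsto_const sq0])
    have eq: "(if \<eta> * real N < real (Suc j) then \<bar>W \<theta> \<phi> (L N) (Suc j) - \<theta>\<bar> else 0) =
        \<theta> * (if \<eta> * real N < real (Suc j) then \<bar>w (L N) (Suc j) - 1\<bar> else 0)" for N j by (simp add: dv)
    show "\<forall>\<^sub>F N in sequentially. (\<Sum>j. if \<eta> * real N < real (Suc j) then \<bar>W \<theta> \<phi> (L N) (Suc j) - \<theta>\<bar> else 0) / real N
        \<le> \<theta> * pi * Cw / \<eta> * ((L N)\<^sup>2 / real N)\<^sup>2"
      using L1 small[OF \<eta>] eventually_gt_at_top[of 0]
    proof eventually_elim
      case (elim N)
      note T = tail_bound[OF elim(1,2)]
      have "(\<Sum>j. if \<eta> * real N < real (Suc j) then \<bar>W \<theta> \<phi> (L N) (Suc j) - \<theta>\<bar> else 0)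
          \<le> \<theta> * (pi * Cw * ((L N)\<^sup>2)\<^sup>2 / (\<eta> * real N))"
        unfolding eq suminf_mult[OF T(1)] using \<theta> T(2) by (intro mult_left_mono) auto
      hence "(\<Sum>j. if \<eta> * real N < real (Suc j) then \<bar>W \<theta> \<phi> (L N) (Suc j) - \<theta>\<bar> else 0) / real N
          \<le> \<theta> * (pi * Cw * ((L N)\<^sup>2)\<^sup>2 / (\<eta> * real N)) / real N" by (rule divide_right_mono) simp
      also have "\<dots> = \<theta> * pi * Cw / \<eta> * ((L N)\<^sup>2 / real N)\<^sup>2" by (simp add: power_divide power2_eq_square)
      finally show ?case .
    qed
    show "\<forall>\<^sub>F N in sequentially. 0 \<le> (\<Sum>j. if \<eta> * real N < real (Suc j) then \<bar>W \<theta> \<phi> (L N) (Suc j) - \<theta>\<bar> else 0) / real N"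
      using L1 small[OF \<eta>]
    proof eventually_elim
      case (elim N)
      note T = tail_bound[OF elim(1,2)]
      show ?case unfolding eq using \<theta> by (intro divide_nonneg_nonneg suminf_nonneg summable_mult T(1)) auto
    qed
  qed
  fix \<epsilon> :: real assume \<epsilon>: "\<epsilon> > 0"
  have "\<forall>\<^sub>F N in sequentially. \<theta> * Cw / \<eta>\<^sup>2 * ((L N)\<^sup>2 / real N)\<^sup>2 < \<epsilon>"
    by (rule order_tendstoD(2)[OF sq0 \<epsilon>])
  thus "\<forall>\<^sub>F N in sequentially. \<forall>j. \<eta> * real N < real j \<longrightarrow> \<bar>W \<theta> \<phi> (L N) j - \<theta>\<bar> \<le> \<epsilon>"
    using L1 small[OF \<eta>] eventually_gt_at_top[of 0]
  proof eventually_elim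
    case (elim N)
    show ?case
    proof (intro allI impI)
      fix j :: nat assume j: "\<eta> * real N < real j"
      have \<eta>N: "\<eta> * real N > 0" using \<eta> elim by simp
      have j1: "j \<ge> 1" using j \<eta>N by (cases j) auto
      have "\<bar>w (L N) j - 1\<bar> \<le> Cw * ((L N)\<^sup>2 / real j)\<^sup>2"
        using elim j j1 by (intro w_dev_tail) auto
      also have "\<dots> \<le> Cw * ((L N)\<^sup>2 / (\<eta> * real N))\<^sup>2"
        using Cw(1) \<eta>N j less_trans[OF \<eta>N j] zero_le_power2[of "L N"]
        by (intro mult_left_mono power_mono divide_left_mono mult_pos_pos[OF \<eta>N] divide_nonneg_pos less_imp_le[OF j] less_imp_le[OF Cw(1)]) (assumption | simp)+
      finally have "\<theta> * \<bar>w (L N) j - 1\<bar> \<le> \<theta> * (Cw * ((L N)\<^sup>2 / (\<eta> * real N))\<^sup>2)"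
        using \<theta> by (intro mult_left_mono) auto
      also have "\<dots> = \<theta> * Cw / \<eta>\<^sup>2 * ((L N)\<^sup>2 / real N)\<^sup>2" by (simp add: power_divide power_mult_distrib)
      finally show "\<bar>W \<theta> \<phi> (L N) j - \<theta>\<bar> \<le> \<epsilon>" using elim(1) by (simp add: dv)
    qed
  qed
qed

text \<open>The head contributes \<open>L\<close> times a sum of \<open>1 / sqrt j\<close> up to
  \<open>L\<^sup>2\<close>, which is again of order \<open>L\<^sup>2\<close>, like the tail.\<close>

lemma dev_sum_dim1:
  assumes d: "CARD('n) = 1" and L: "L \<ge> 1"
  shows "(\<Sum>j. \<bar>w L (Suc j) - 1\<bar>) \<le> (pi + 2) * Cw * L\<^sup>2"
proof -
  have "(\<Sum>j<head L. \<bar>w L (Suc j) - 1\<bar>) \<le> (\<Sum>j<head L. Cw * L * (1 / sqrt (real (Suc j))))"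
  proof (rule sum_mono)
    fix j assume "j \<in> {..<head L}"
    hence j: "real (Suc j) \<le> L\<^sup>2" using head(3)[of "Suc j" L] by auto
    have "\<bar>w L (Suc j) - 1\<bar> \<le> Cw * (L\<^sup>2 / real (Suc j)) powr (1 / 2)"
      using w_dev_head[OF L _ j] d by simp
    also have "(L\<^sup>2 / real (Suc j)) powr (1 / 2) = L * (1 / sqrt (real (Suc j)))"
      using L by (subst powr_half_sqrt) (auto simp: real_sqrt_divide simp del: of_nat_Suc)
    finally show "\<bar>w L (Suc j) - 1\<bar> \<le> Cw * L * (1 / sqrt (real (Suc j)))" by (simp add: mult.assoc)
  qed
  also have "\<dots> = Cw * L * (\<Sum>j=1..head L. 1 / sqrt (real j))"
    by (simp add: sum_distrib_left sum.atLeast1_atMost_eq)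
  also have "\<dots> \<le> Cw * L * (2 * sqrt (real (head L)))"
    using Cw(1) L by (intro mult_left_mono sum_inverse_sqrt_le) auto
  also have "\<dots> \<le> Cw * L * (2 * L)"
    using Cw(1) L head(2)[of L] by (intro mult_left_mono) (auto intro: real_le_lsqrt)
  finally have "(\<Sum>j<head L. \<bar>w L (Suc j) - 1\<bar>) \<le> 2 * Cw * L\<^sup>2" by (simp add: power2_eq_square mult_ac)
  moreover have "\<bar>(\<Sum>j. \<bar>w L (Suc j) - 1\<bar>) - (\<Sum>j<head L. \<bar>w L (Suc j) - 1\<bar>)\<bar> \<le> pi * Cw * L\<^sup>2"
    by (rule sum_head_tail(2)[OF L]) auto
  ultimately show ?thesis by (simp add: algebra_simps abs_le_iff)
qed

text \<open>In the critical dimension the head is a harmonic sum, whence the logarithm.\<close>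

lemma dev_sum_dim2:
  assumes d: "CARD('n) = 2" and L: "L \<ge> 1"
  shows "(\<Sum>j. \<bar>w L (Suc j) - 1\<bar>) \<le> (pi + 1) * Cw * L\<^sup>2 * (1 + ln (L\<^sup>2))"
proof -
  have L2: "L\<^sup>2 \<ge> 1" using L by (simp add: one_le_power)
  have "(\<Sum>j<head L. \<bar>w L (Suc j) - 1\<bar>) \<le> (\<Sum>j<head L. Cw * L\<^sup>2 * (1 / real (Suc j)))"
  proof (rule sum_mono)
    fix j assume "j \<in> {..<head L}"
    hence j: "real (Suc j) \<le> L\<^sup>2" using head(3)[of "Suc j" L] by auto
    have "\<bar>w L (Suc j) - 1\<bar> \<le> Cw * (L\<^sup>2 / real (Suc j)) powr 1"
      using w_dev_head[OF L _ j] d by simp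
    thus "\<bar>w L (Suc j) - 1\<bar> \<le> Cw * L\<^sup>2 * (1 / real (Suc j))" using L by simp
  qed
  also have "\<dots> = Cw * L\<^sup>2 * (\<Sum>j=1..head L. 1 / real j)"
    by (simp add: sum_distrib_left sum.atLeast1_atMost_eq)
  also have "\<dots> \<le> Cw * L\<^sup>2 * (1 + ln (real (head L)))"
    using Cw(1) L head(1)[OF L] by (intro mult_left_mono sum_inverse_le_ln) auto
  also have "\<dots> \<le> Cw * L\<^sup>2 * (1 + ln (L\<^sup>2))"
    using Cw(1) L L2 head(1)[OF L] head(2)[of L] by (intro mult_left_mono add_left_mono ln_mono) auto
  finally have h: "(\<Sum>j<head L. \<bar>w L (Suc j) - 1\<bar>) \<le> Cw * L\<^sup>2 * (1 + ln (L\<^sup>2))" .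
  have t: "\<bar>(\<Sum>j. \<bar>w L (Suc j) - 1\<bar>) - (\<Sum>j<head L. \<bar>w L (Suc j) - 1\<bar>)\<bar> \<le> pi * Cw * L\<^sup>2"
    by (rule sum_head_tail(2)[OF L]) auto
  have "pi * Cw * L\<^sup>2 * 1 \<le> pi * Cw * L\<^sup>2 * (1 + ln (L\<^sup>2))"
    using Cw(1) L2 by (intro mult_left_mono) auto
  thus ?thesis using h t by (simp add: algebra_simps abs_le_iff)
qed

text \<open>For fixed \<open>j\<close> and growing \<open>L\<close> every lattice point except the
  origin escapes to infinity, where the convolution power decays; dominated convergence leaves its
  value at 0.\<close>

lemma w_over_volume_limit:
  fixes L :: "nat \<Rightarrow> real"
  assumes L: "filterlim L at_top sequentially" and j: "j \<ge> 1"
  shows "(\<lambda>N. w (L N) j / L N ^ CARD('n)) \<longlonglongrightarrow> conv_power \<phi> j 0"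
proof -
  obtain C where C: "C \<ge> 0" "\<And>x. \<bar>conv_power \<phi> j x\<bar> \<le> C * decay x" using conv_bound[OF j] by blast
  \<comment> \<open>The maximum with 1 makes the dominating function valid for every
    \<open>N\<close>, while nothing changes for large \<open>N\<close>.\<close>
  define l where "l = (\<lambda>N. max 1 (L N))"
  have l1: "l N \<ge> 1" for N by (simp add: l_def)
  have ltop: "filterlim l at_top sequentially" unfolding l_def
    by (rule filterlim_at_top_mono[OF L]) auto
  have dec: "decay (l N *\<^sub>R lat k) \<le> latdecay k" for N and k :: "'n \<Rightarrow> int"
    unfolding decay_def latdecay_def
  proof (intro prod_mono conjI)
    fix i
    have "1 * (real_of_int (k i))\<^sup>2 \<le> (l N)\<^sup>2 * (real_of_int (k i))\<^sup>2"
      using l1 by (intro mult_right_mono) (auto simp: one_le_power)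
    thus "1 / (1 + ((l N *\<^sub>R lat k) $ i)\<^sup>2) \<le> 1 / (1 + (real_of_int (k i))\<^sup>2)"
      by (intro divide_left_mono mult_pos_pos one_plus_square_pos) (auto simp: power_mult_distrib)
  qed (auto intro!: divide_nonneg_nonneg add_nonneg_nonneg)
  define z where "z = (\<lambda>_::'n. 0::int)"
  have latz: "lat z = (0 :: real^'n)" by (simp add: lat_def z_def vec_eq_iff)
  have "(\<lambda>N. infsum (\<lambda>k. conv_power \<phi> j (l N *\<^sub>R lat k)) UNIV) \<longlonglongrightarrow> infsum (\<lambda>k. if k = z then conv_power \<phi> j 0 else 0) UNIV"
  proof (rule infsum_dominated_convergence)
    show "(\<lambda>k :: 'n \<Rightarrow> int. C * latdecay k) summable_on UNIV" by (intro summable_on_cmult_right latdecay_summable)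
    show "norm (conv_power \<phi> j (l N *\<^sub>R lat k)) \<le> C * latdecay k" for N k
      using C(2)[of "l N *\<^sub>R lat k"] mult_left_mono[OF dec[of N k] C(1)] by simp
    fix k :: "'n \<Rightarrow> int"
    show "(\<lambda>N. conv_power \<phi> j (l N *\<^sub>R lat k)) \<longlonglongrightarrow> (if k = z then conv_power \<phi> j 0 else 0)"
    proof (cases "k = z")
      case True
      thus ?thesis by (simp add: latz)
    next
      case False
      then obtain i where i: "k i \<noteq> 0" by (auto simp: z_def)
      have le: "norm (conv_power \<phi> j (l N *\<^sub>R lat k)) \<le> C * (1 / l N)" for N
      proof -
        have "decay (l N *\<^sub>R lat k) \<le> (\<Prod>m\<in>UNIV. if m = i then 1 / l N else 1)"
          unfolding decay_def
        proof (intro prod_mono conjI)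
          fix m
          show "1 / (1 + ((l N *\<^sub>R lat k) $ m)\<^sup>2) \<le> (if m = i then 1 / l N else 1)"
          proof (cases "m = i")
            case True
            have "1 \<le> \<bar>real_of_int (k i)\<bar>" using i by linarith
            hence "1 \<le> (real_of_int (k i))\<^sup>2" using abs_le_square_iff[of 1 "real_of_int (k i)"] by simp
            hence "l N * 1 \<le> (l N)\<^sup>2 * (real_of_int (k i))\<^sup>2"
              using l1[of N] by (intro mult_mono) (auto simp: power2_eq_square)
            hence "l N \<le> 1 + ((l N *\<^sub>R lat k) $ i)\<^sup>2" by (simp add: power_mult_distrib)
            thus ?thesis using True l1[of N] by (auto intro!: divide_left_mono mult_pos_pos one_plus_square_pos)
          qed (auto simp: divide_le_eq_1 one_plus_square_pos less_imp_le)
        qed (auto intro!: divide_nonneg_nonneg add_nonneg_nonneg)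
        also have "\<dots> = 1 / l N" by (simp add: prod.delta)
        finally have "C * decay (l N *\<^sub>R lat k) \<le> C * (1 / l N)" using C(1) by (rule mult_left_mono)
        thus ?thesis using C(2)[of "l N *\<^sub>R lat k"] by simp
      qed
      have "(\<lambda>N. C * (1 / l N)) \<longlonglongrightarrow> C * 0"
        by (intro tendsto_mult tendsto_const tendsto_divide_0[OF tendsto_const] filterlim_at_top_imp_at_infinity ltop)
      hence "(\<lambda>N. conv_power \<phi> j (l N *\<^sub>R lat k)) \<longlonglongrightarrow> 0"
        by (intro Lim_null_comparison[OF always_eventually[OF allI[OF le]]]) simp
      thus ?thesis using False by simp
    qed
  qed
  also have "infsum (\<lambda>k. if k = z then conv_power \<phi> j 0 else 0) UNIV = infsum (\<lambda>k. conv_power \<phi> j 0) {z}"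
    by (rule infsum_cong_neutral) auto
  also have "\<dots> = conv_power \<phi> j 0" by simp
  finally have lim: "(\<lambda>N. infsum (\<lambda>k. conv_power \<phi> j (l N *\<^sub>R lat k)) UNIV) \<longlonglongrightarrow> conv_power \<phi> j 0" .
  have "\<forall>\<^sub>F N in sequentially. L N \<ge> 1" using L by (auto simp: filterlim_at_top)
  hence "\<forall>\<^sub>F N in sequentially. infsum (\<lambda>k. conv_power \<phi> j (l N *\<^sub>R lat k)) UNIV = w (L N) j / L N ^ CARD('n)"
    by eventually_elim (auto simp: l_def w_def max_def)
  from Lim_transform_eventually[OF lim this] show ?thesis .
qed

text \<open>Tannery's theorem: divided by the volume, the deviations have the summable majorant
  \<open>Cw * j powr (- 3/2)\<close>, uniformly in \<open>L\<close>. For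
  \<open>j \<le> L\<^sup>2\<close> this is the head bound; for larger \<open>j\<close> the factor
  \<open>L / j\<^sup>2\<close> is at most \<open>sqrt j / j\<^sup>2\<close>. Convergence of the
  series behind \<open>rho_c\<close> comes out as well.\<close>

lemma dev_sum_dim3:
  fixes L :: "nat \<Rightarrow> real"
  assumes d: "CARD('n) \<ge> 3" and L: "filterlim L at_top sequentially"
  shows "(\<lambda>N. (\<Sum>j. w (L N) (Suc j) - 1) / L N ^ CARD('n)) \<longlonglongrightarrow> (\<Sum>j. conv_power \<phi> (Suc j) 0)"
    and "(\<lambda>N. (\<Sum>j. \<bar>w (L N) (Suc j) - 1\<bar>) / L N ^ CARD('n)) \<longlonglongrightarrow> (\<Sum>j. conv_power \<phi> (Suc j) 0)"
    and "summable (\<lambda>j. conv_power \<phi> (Suc j) 0)"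
proof -
  have L1: "\<forall>\<^sub>F N in sequentially. L N \<ge> 1" using L by (auto simp: filterlim_at_top)
  define M where "M = (\<lambda>j::nat. Cw * real (Suc j) powr (- 3/2))"
  have M: "summable M"
  proof -
    have "summable (\<lambda>j::nat. real j powr (- 3/2))" by (subst summable_real_powr_iff) auto
    hence "summable (\<lambda>j::nat. real (Suc j) powr (- 3/2))" by (subst summable_Suc_iff)
    thus ?thesis unfolding M_def by (rule summable_mult)
  qed
  have bound: "\<bar>w l (Suc j) - 1\<bar> / l ^ CARD('n) \<le> M j" if l: "l \<ge> 1" for l j
  proof -
    define m where "m = real (Suc j)"
    have m: "m \<ge> 1" by (simp add: m_def)
    have ld: "l ^ CARD('n) > 0" using l by simp
    show ?thesis
    proof (cases "m \<le> l\<^sup>2")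
      case True
      have "\<bar>w l (Suc j) - 1\<bar> \<le> Cw * (l\<^sup>2 / m) powr (real CARD('n) / 2)"
        unfolding m_def using l True by (intro w_dev_head) (auto simp: m_def)
      also have "(l\<^sup>2 / m) powr (real CARD('n) / 2) = l ^ CARD('n) * m powr (- (real CARD('n) / 2))"
      proof -
        have "(l\<^sup>2) powr (real CARD('n) / 2) = (l powr 2) powr (real CARD('n) / 2)" using l by (simp add: powr_numeral)
        also have "\<dots> = l powr real CARD('n)" by (simp only: powr_powr) simp
        also have "\<dots> = l ^ CARD('n)" using l by (simp add: powr_realpow)
        finally have "(l\<^sup>2) powr (real CARD('n) / 2) = l ^ CARD('n)" .
        moreover have "(l\<^sup>2 / m) powr (real CARD('n) / 2) = (l\<^sup>2) powr (real CARD('n) / 2) * (1 / m powr (real CARD('n) / 2))"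
          using m by (subst powr_divide) auto
        ultimately show ?thesis by (simp only: powr_minus_divide)
      qed
      finally have "\<bar>w l (Suc j) - 1\<bar> / l ^ CARD('n) \<le> Cw * m powr (- (real CARD('n) / 2))"
        using ld by (simp add: pos_divide_le_eq mult_ac)
      also have "\<dots> \<le> Cw * m powr (- 3/2)"
        using Cw(1) d m by (intro mult_left_mono powr_mono) auto
      finally show ?thesis by (simp add: M_def m_def)
    next
      case False
      have "\<bar>w l (Suc j) - 1\<bar> \<le> Cw * (l\<^sup>2 / m)\<^sup>2"
        unfolding m_def using l False by (intro w_dev_tail) (auto simp: m_def)
      hence "\<bar>w l (Suc j) - 1\<bar> / l ^ CARD('n) \<le> Cw * (l\<^sup>2 / m)\<^sup>2 / l ^ CARD('n)"
        using ld by (intro divide_right_mono) auto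
      also have "\<dots> \<le> Cw * (l\<^sup>2 / m)\<^sup>2 / l ^ 3"
        using Cw(1) l d by (intro divide_left_mono power_increasing mult_nonneg_nonneg) auto
      also have "\<dots> = Cw * (l / m\<^sup>2)"
        using l by (simp add: power2_eq_square power3_eq_cube)
      also have "l \<le> sqrt m" using False l by (intro real_le_rsqrt) auto
      hence "Cw * (l / m\<^sup>2) \<le> Cw * (sqrt m / m\<^sup>2)"
        using Cw(1) by (intro mult_left_mono divide_right_mono) auto
      also have "sqrt m / m\<^sup>2 = m powr (- 3/2)"
      proof -
        have "sqrt m / m\<^sup>2 = m powr (1/2) / m powr 2" using m by (simp add: powr_half_sqrt powr_numeral)
        also have "\<dots> = m powr (1/2 - 2)" by (rule powr_diff[symmetric])
        finally show ?thesis by simp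
      qed
      finally show ?thesis by (simp add: M_def m_def)
    qed
  qed
  have inv0: "(\<lambda>N. 1 / L N ^ CARD('n)) \<longlonglongrightarrow> 0"
    by (intro tendsto_divide_0[OF tendsto_const] filterlim_at_top_imp_at_infinity filterlim_pow_at_top L) auto
  have lim: "(\<lambda>N. (w (L N) (Suc j) - 1) / L N ^ CARD('n)) \<longlonglongrightarrow> conv_power \<phi> (Suc j) 0" for j
    using tendsto_diff[OF w_over_volume_limit[OF L, of "Suc j"] inv0] by (simp add: diff_divide_distrib)
  have lima: "(\<lambda>N. \<bar>w (L N) (Suc j) - 1\<bar> / L N ^ CARD('n)) \<longlonglongrightarrow> conv_power \<phi> (Suc j) 0" for j
  proof -
    have "(\<lambda>N. \<bar>(w (L N) (Suc j) - 1) / L N ^ CARD('n)\<bar>) \<longlonglongrightarrow> \<bar>conv_power \<phi> (Suc j) 0\<bar>"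
      by (rule tendsto_rabs[OF lim])
    moreover have "\<forall>\<^sub>F N in sequentially. \<bar>(w (L N) (Suc j) - 1) / L N ^ CARD('n)\<bar> = \<bar>w (L N) (Suc j) - 1\<bar> / L N ^ CARD('n)"
      using L1 by eventually_elim (auto simp: abs_divide)
    ultimately show ?thesis using conv_nonneg[of "Suc j" 0] by (auto intro: Lim_transform_eventually)
  qed
  have ev: "\<forall>\<^sub>F (j, N) in at_top \<times>\<^sub>F sequentially. norm (a N j) \<le> M j"
    if "\<And>N j. L N \<ge> 1 \<Longrightarrow> \<bar>a N j\<bar> = \<bar>w (L N) (Suc j) - 1\<bar> / L N ^ CARD('n)" for a :: "nat \<Rightarrow> nat \<Rightarrow> real"
    unfolding eventually_prod_filter
    by (rule exI[of _ "\<lambda>_. True"], rule exI[of _ "\<lambda>N. L N \<ge> 1"]) (use L1 bound that in auto)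
  have T1: "summable (\<lambda>j. norm (conv_power \<phi> (Suc j) 0)) \<and>
     (\<lambda>N. \<Sum>j. (w (L N) (Suc j) - 1) / L N ^ CARD('n)) \<longlonglongrightarrow> (\<Sum>j. conv_power \<phi> (Suc j) 0)"
    using tannerys_theorem[OF lim ev[of "\<lambda>N j. (w (L N) (Suc j) - 1) / L N ^ CARD('n)"] M] by (auto simp: abs_divide)
  have T2: "(\<lambda>N. \<Sum>j. \<bar>w (L N) (Suc j) - 1\<bar> / L N ^ CARD('n)) \<longlonglongrightarrow> (\<Sum>j. conv_power \<phi> (Suc j) 0)"
    using tannerys_theorem[OF lima ev[of "\<lambda>N j. \<bar>w (L N) (Suc j) - 1\<bar> / L N ^ CARD('n)"] M] by (auto simp: abs_divide)
  show "(\<lambda>N. (\<Sum>j. w (L N) (Suc j) - 1) / L N ^ CARD('n)) \<longlonglongrightarrow> (\<Sum>j. conv_power \<phi> (Suc j) 0)"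
  proof (rule Lim_transform_eventually[OF conjunct2[OF T1]])
    show "\<forall>\<^sub>F N in sequentially. (\<Sum>j. (w (L N) (Suc j) - 1) / L N ^ CARD('n)) = (\<Sum>j. w (L N) (Suc j) - 1) / L N ^ CARD('n)"
      using L1 by eventually_elim (rule suminf_divide[OF summable_rabs_cancel[OF summable_dev]])
  qed
  show "(\<lambda>N. (\<Sum>j. \<bar>w (L N) (Suc j) - 1\<bar>) / L N ^ CARD('n)) \<longlonglongrightarrow> (\<Sum>j. conv_power \<phi> (Suc j) 0)"
  proof (rule Lim_transform_eventually[OF T2])
    show "\<forall>\<^sub>F N in sequentially. (\<Sum>j. \<bar>w (L N) (Suc j) - 1\<bar> / L N ^ CARD('n)) = (\<Sum>j. \<bar>w (L N) (Suc j) - 1\<bar>) / L N ^ CARD('n)"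
      using L1 by eventually_elim (rule suminf_divide[OF summable_dev])
  qed
  show "summable (\<lambda>j. conv_power \<phi> (Suc j) 0)" using summable_norm_cancel[OF conjunct1[OF T1]] .
qed

end

section \<open>The local limit in the plane\<close>

lemma one_plus_sum_le_prod:
  fixes a :: "'i \<Rightarrow> real"
  assumes "finite A" "\<And>i. a i \<ge> 0"
  shows "1 + (\<Sum>i\<in>A. a i) \<le> (\<Prod>i\<in>A. 1 + a i)"
  using assms(1)
proof induction
  case (insert x A)
  have "1 + (\<Sum>i\<in>insert x A. a i) \<le> (1 + a x) * (1 + (\<Sum>i\<in>A. a i))"
    using insert assms(2) by (simp add: algebra_simps sum_nonneg)
  also have "\<dots> \<le> (1 + a x) * (\<Prod>i\<in>A. 1 + a i)" using insert assms(2)[of x] by (intro mult_left_mono) auto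
  finally show ?case using insert by simp
qed simp

lemma norm_times_decay_le: "norm x * decay x \<le> 1"
proof -
  have "(norm x)\<^sup>2 = (\<Sum>i\<in>UNIV. (x $ i)\<^sup>2)"
    unfolding power2_norm_eq_inner inner_vec_def inner_real_def by (simp add: power2_eq_square)
  hence "1 + (norm x)\<^sup>2 \<le> (\<Prod>i\<in>UNIV. 1 + (x $ i)\<^sup>2)" using one_plus_sum_le_prod[of UNIV "\<lambda>i. (x $ i)\<^sup>2"] by simp
  moreover have "norm x \<le> 1 + (norm x)\<^sup>2"
  proof -
    have "0 \<le> (norm x - 1/2)\<^sup>2" by simp
    thus ?thesis by (simp add: power2_eq_square algebra_simps)
  qed
  ultimately have "norm x \<le> (\<Prod>i\<in>UNIV. 1 + (x $ i)\<^sup>2)" by linarith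
  moreover have "decay x = 1 / (\<Prod>i\<in>UNIV. 1 + (x $ i)\<^sup>2)" by (simp add: decay_def prod_dividef)
  moreover have "(\<Prod>i\<in>UNIV. 1 + (x $ i)\<^sup>2) > 0" by (intro prod_pos one_plus_square_pos ballI)
  ultimately show ?thesis by simp
qed

lemma gauss_integral:
  fixes a m :: real
  assumes a: "a > 0"
  shows "integrable lborel (\<lambda>s. exp (- (2 * pi\<^sup>2 * (a * (s + m)\<^sup>2))))"
    and "(\<integral>s. exp (- (2 * pi\<^sup>2 * (a * (s + m)\<^sup>2))) \<partial>lborel) = 1 / sqrt (2 * pi * a)"
proof -
  \<comment> \<open>Chosen so that \<open>1 / (2 * \<sigma>\<^sup>2) = 2 * pi\<^sup>2 * a\<close>,
    which makes the integrand a multiple of a normal density.\<close>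
  define \<sigma> where "\<sigma> = 1 / (2 * pi * sqrt a)"
  have \<sigma>: "\<sigma> > 0" using a by (simp add: \<sigma>_def)
  have \<sigma>2: "\<sigma>\<^sup>2 = 1 / (4 * pi\<^sup>2 * a)" using a by (simp add: \<sigma>_def power_divide power_mult_distrib)
  have "2 * pi * \<sigma>\<^sup>2 = 1 / (2 * pi * a)" unfolding \<sigma>2 by (simp add: power2_eq_square)
  hence s: "sqrt (2 * pi * \<sigma>\<^sup>2) = 1 / sqrt (2 * pi * a)" by (simp add: real_sqrt_divide)
  have e: "exp (- (2 * pi\<^sup>2 * (a * (s + m)\<^sup>2))) = 1 / sqrt (2 * pi * a) * normal_density (- m) \<sigma> s" for s
  proof -
    have "- (s - - m)\<^sup>2 / (2 * \<sigma>\<^sup>2) = - (2 * pi\<^sup>2 * (a * (s + m)\<^sup>2))"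
      using a by (simp add: \<sigma>2)
    thus ?thesis unfolding normal_density_def s using a by simp
  qed
  show "integrable lborel (\<lambda>s. exp (- (2 * pi\<^sup>2 * (a * (s + m)\<^sup>2))))"
    unfolding e by (intro integrable_mult_right integrable_normal_density \<sigma>)
  show "(\<integral>s. exp (- (2 * pi\<^sup>2 * (a * (s + m)\<^sup>2))) \<partial>lborel) = 1 / sqrt (2 * pi * a)"
    unfolding e using \<sigma> by simp
qed

text \<open>The index type is an abstract type with two elements, so Fubini goes through the product
  measure over \<open>Basis\<close>: one coordinate is integrated by
  \<open>product_integral_insert\<close>, the other remains as a singleton product.\<close>

lemma integral_vec2:
  fixes f :: "real^'n::finite \<Rightarrow> real"
  assumes U: "UNIV = {a, b}" and ab: "a \<noteq> b" and f: "integrable lborel f"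
  shows "integral\<^sup>L lborel f = (\<integral>t. (\<integral>s. f (\<chi> i. if i = a then s else t) \<partial>lborel) \<partial>lborel)"
proof -
  define ea eb where "ea = axis a (1::real)" and "eb = axis b (1::real)"
  have Basis: "(Basis :: (real^'n) set) = {ea, eb}"
    using U by (auto simp: Basis_vec_def ea_def eb_def)
  have ne: "ea \<noteq> eb" using ab by (simp add: ea_def eb_def axis_eq_axis)
  define T where "T = (\<lambda>g :: (real^'n) \<Rightarrow> real. \<Sum>b\<in>Basis. g b *\<^sub>R b)"
  have T: "T g = (\<chi> i. if i = a then g ea else g eb)" for g
  proof -
    have "T g $ i = (if i = a then g ea else g eb)" for i
      using ne ab U by (cases "i = a") (auto simp: T_def Basis ea_def eb_def axis_def)
    thus ?thesis by (simp add: vec_eq_iff)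
  qed
  have T_upd: "T (g(ea := s)) = (\<chi> i. if i = a then s else g eb)" for g s
    using ne unfolding T vec_eq_iff by auto
  interpret product_sigma_finite "\<lambda>b :: real^'n. lborel :: real measure"
    by standard
  have mT: "T \<in> (\<Pi>\<^sub>M b\<in>Basis. lborel) \<rightarrow>\<^sub>M borel" unfolding T_def by measurable
  have L: "(lborel :: (real^'n) measure) = distr (\<Pi>\<^sub>M b\<in>Basis. lborel) borel T"
    unfolding T_def by (rule lborel_eq)
  have m: "f \<in> borel_measurable borel" using f by auto
  have int: "integrable (\<Pi>\<^sub>M b\<in>Basis. lborel) (\<lambda>g. f (T g))"
    using f unfolding L by (subst (asm) integrable_distr_eq[OF mT m])
  have "integral\<^sup>L lborel f = (\<integral>g. f (T g) \<partial>(\<Pi>\<^sub>M b\<in>Basis. lborel))"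
    unfolding L by (subst integral_distr[OF mT m]) simp
  also have "\<dots> = (\<integral>g. (\<integral>s. f (T (g(ea := s))) \<partial>lborel) \<partial>(\<Pi>\<^sub>M b\<in>{eb}. lborel))"
    unfolding Basis by (rule product_integral_insert) (use ne int in \<open>auto simp: Basis\<close>)
  also have "\<dots> = (\<integral>g. (\<lambda>t. \<integral>s. f (\<chi> i. if i = a then s else t) \<partial>lborel) (g eb) \<partial>(\<Pi>\<^sub>M b\<in>{eb}. lborel))"
    by (simp only: T_upd)
  also have "\<dots> = (\<integral>t. (\<integral>s. f (\<chi> i. if i = a then s else t) \<partial>lborel) \<partial>lborel)"
  proof (rule product_integral_singleton)
    have "(\<lambda>(t, s). f (\<chi> i. if i = a then s else t)) \<in> borel_measurable (lborel \<Otimes>\<^sub>M lborel)"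
    proof -
      have "continuous_on UNIV (\<lambda>p::real \<times> real. (\<chi> i. if i = a then snd p else fst p) :: real^'n)"
      proof (intro continuous_on_vec_lambda)
        show "continuous_on UNIV (\<lambda>p::real \<times> real. if i = a then snd p else fst p)" for i
          by (cases "i = a") (auto intro: continuous_intros)
      qed
      hence "(\<lambda>p::real \<times> real. (\<chi> i. if i = a then snd p else fst p) :: real^'n) \<in> borel_measurable borel"
        by (rule borel_measurable_continuous_onI)
      hence "(\<lambda>p::real \<times> real. f (\<chi> i. if i = a then snd p else fst p)) \<in> borel_measurable borel"
        by (rule measurable_compose[OF _ m])
      thus ?thesis by (simp add: case_prod_beta' lborel_prod)
    qed
    thus "(\<lambda>t. \<integral>s. f (\<chi> i. if i = a then s else t) \<partial>lborel) \<in> borel_measurable lborel"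
      by (intro lborel.borel_measurable_lebesgue_integral) simp
  qed
  finally show ?thesis .
qed

lemma det_card2:
  fixes A :: "real^'n::finite^'n"
  assumes U: "UNIV = {a, b}" and ab: "a \<noteq> b"
  shows "det A = A $ a $ a * A $ b $ b - A $ a $ b * A $ b $ a"
proof -
  have f: "finite {b}" "a \<notin> {b}" using ab by auto
  show ?thesis
    unfolding det_def U sum_over_permutations_insert[OF f] permutes_sing
    using ab by (simp add: sign_swap_id sign_id swap_id_eq)
qed

text \<open>Turns a lattice sum into the integral of a step function.\<close>
definition round_vec :: "real^'n \<Rightarrow> real^'n" where "round_vec x = lat (\<lambda>i. \<lfloor>x $ i + 1/2\<rfloor>)"

lemma round_vec_measurable: "round_vec \<in> borel_measurable borel"
proof (rule borel_measurable_euclidean_space[THEN iffD2, rule_format])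
  fix b :: "real^'n" assume "b \<in> Basis"
  then obtain i where b: "b = axis i 1" by (auto simp: Basis_vec_def)
  have "(\<lambda>x::real^'n. x $ i + 1/2) \<in> borel_measurable borel"
    by (intro borel_measurable_continuous_onI continuous_intros)
  hence "(\<lambda>x::real^'n. real_of_int \<lfloor>x $ i + 1/2\<rfloor>) \<in> borel_measurable borel" by measurable
  thus "(\<lambda>x. round_vec x \<bullet> b) \<in> borel_measurable borel" by (simp add: b round_vec_def inner_axis)
qed

lemma round_vec_cube: "x \<in> cube k \<Longrightarrow> round_vec x = lat k"
proof -
  assume x: "x \<in> cube k"
  have "\<lfloor>x $ i + 1/2\<rfloor> = k i" for i
  proof -
    have "x $ i \<in> {of_int (k i) - 1/2..<of_int (k i) - 1/2 + 1}" using x unfolding cube_def by blast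
    thus ?thesis by (intro floor_unique) auto
  qed
  thus ?thesis by (simp add: round_vec_def)
qed

lemma round_vec_close: "\<bar>x $ i - round_vec x $ i\<bar> \<le> 1/2"
  using floor_correct[of "x $ i + 1/2"] unfolding round_vec_def lat_nth by linarith

lemma scaled_round_close:
  assumes "h > 0"
  shows "\<bar>x $ i - (h *\<^sub>R round_vec ((1 / h) *\<^sub>R x)) $ i\<bar> \<le> h / 2"
proof -
  have "\<bar>h * ((1 / h) *\<^sub>R x) $ i - h * round_vec ((1 / h) *\<^sub>R x) $ i\<bar> \<le> h * (1/2)"
    unfolding right_diff_distrib[symmetric] abs_mult using assms round_vec_close[of "(1 / h) *\<^sub>R x" i]
    by (intro mult_mono) auto
  thus ?thesis using assms by simp
qed

lemma decay_scaled_round: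
  assumes h: "h > 0" "h \<le> 1"
  shows "decay (h *\<^sub>R round_vec ((1 / h) *\<^sub>R x)) \<le> 2 ^ CARD('n) * decay (x :: real^'n)"
proof (rule decay_close)
  show "\<bar>x $ i - (h *\<^sub>R round_vec ((1 / h) *\<^sub>R x)) $ i\<bar> \<le> 1/2" for i
    by (rule order_trans[OF scaled_round_close[OF h(1)]]) (use h(2) in simp)
qed

text \<open>A Riemann sum of mesh \<open>h\<close> is the integral of a function constant on the
  scaled cubes. In this form dominated convergence applies, and the rounded argument keeps the decay
  up to a constant.\<close>

lemma lattice_sum_eq_integral:
  fixes g :: "real^'n \<Rightarrow> real"
  assumes h: "h > 0" "h \<le> 1" and gm: "g \<in> borel_measurable borel" and gb: "\<And>y. \<bar>g y\<bar> \<le> B * decay y"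
    and s: "(\<lambda>k. norm (g (h *\<^sub>R lat k))) summable_on UNIV"
  shows "h ^ CARD('n) * infsum (\<lambda>k. g (h *\<^sub>R lat k)) UNIV = (\<integral>x. g (h *\<^sub>R round_vec ((1 / h) *\<^sub>R x)) \<partial>lborel)"
    and "(\<lambda>x. g (h *\<^sub>R round_vec ((1 / h) *\<^sub>R x))) \<in> borel_measurable lborel"
    and "\<bar>g (h *\<^sub>R round_vec ((1 / h) *\<^sub>R x))\<bar> \<le> B * 2 ^ CARD('n) * decay x"
proof -
  define F where "F = (\<lambda>x. g (h *\<^sub>R round_vec ((1 / h) *\<^sub>R x)))"
  have B: "B \<ge> 0"
  proof -
    have "0 \<le> B * decay (0::real^'n)" using gb[of 0] by linarith
    thus ?thesis using decay_pos[of "0::real^'n"] by (simp add: zero_le_mult_iff)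
  qed
  have "(\<lambda>x::real^'n. h *\<^sub>R round_vec ((1 / h) *\<^sub>R x)) \<in> borel_measurable borel"
    by (intro borel_measurable_scaleR borel_measurable_const measurable_compose[OF _ round_vec_measurable]) auto
  from measurable_compose[OF this gm] have Fm: "F \<in> borel_measurable borel" unfolding F_def .
  thus "(\<lambda>x. g (h *\<^sub>R round_vec ((1 / h) *\<^sub>R x))) \<in> borel_measurable lborel" by (simp add: F_def)
  have Fb: "\<bar>F x\<bar> \<le> B * 2 ^ CARD('n) * decay x" for x
  proof -
    have "\<bar>F x\<bar> \<le> B * decay (h *\<^sub>R round_vec ((1 / h) *\<^sub>R x))" unfolding F_def by (rule gb)
    also have "\<dots> \<le> B * (2 ^ CARD('n) * decay x)" by (intro mult_left_mono decay_scaled_round h B)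
    finally show ?thesis by simp
  qed
  thus "\<bar>g (h *\<^sub>R round_vec ((1 / h) *\<^sub>R x))\<bar> \<le> B * 2 ^ CARD('n) * decay x" by (simp add: F_def)
  have Fi: "integrable lborel F"
  proof (rule Bochner_Integration.integrable_bound)
    show "integrable lborel (\<lambda>x :: real^'n. B * 2 ^ CARD('n) * decay x)" by (intro integrable_mult_right integrable_decay)
    show "F \<in> borel_measurable lborel" using Fm by simp
    have "\<bar>F x\<bar> \<le> \<bar>B * 2 ^ CARD('n) * decay x\<bar>" for x using Fb[of x] by linarith
    thus "AE x in lborel. norm (F x) \<le> norm (B * 2 ^ CARD('n) * decay x)" by simp
  qed
  have Fh: "F (h *\<^sub>R x) = g (h *\<^sub>R round_vec x)" for x using h by (simp add: F_def)
  have cu: "(\<integral>x. indicator (cube k) x * F (h *\<^sub>R x) \<partial>lborel) = g (h *\<^sub>R lat k)" for k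
  proof -
    have "(\<integral>x. indicator (cube k) x * F (h *\<^sub>R x) \<partial>lborel) = (\<integral>x. indicator (cube k) x * g (h *\<^sub>R lat k) \<partial>lborel)"
      unfolding Fh by (intro Bochner_Integration.integral_cong refl) (auto simp: indicator_def round_vec_cube)
    also have "\<dots> = g (h *\<^sub>R lat k)" using cube_volume[of k] by simp
    finally show ?thesis .
  qed
  have "(\<integral>x. F x \<partial>lborel) = h ^ CARD('n) * (\<integral>x. F (h *\<^sub>R x) \<partial>lborel)"
    using lborel_scale(2)[OF h(1) Fi] by simp
  also have "(\<integral>x. F (h *\<^sub>R x) \<partial>lborel) = infsum (\<lambda>k. \<integral>x. indicator (cube k) x * F (h *\<^sub>R x) \<partial>lborel) UNIV"
    by (rule integral_cubes[OF lborel_scale(1)[OF h(1) Fi]]) (unfold cu, rule s)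
  finally show "h ^ CARD('n) * infsum (\<lambda>k. g (h *\<^sub>R lat k)) UNIV = (\<integral>x. g (h *\<^sub>R round_vec ((1 / h) *\<^sub>R x)) \<partial>lborel)"
    unfolding cu by (simp add: F_def)
qed

section \<open>Gaussian approximation of the characteristic function\<close>

locale centred_schwartz_density = schwartz_density \<phi> for \<phi> :: "real^'n::finite \<Rightarrow> real" +
  assumes mean0: "\<And>i. integral\<^sup>L lborel (\<lambda>x. (x $ i) * \<phi> x) = 0"
begin

lemma norm_moment:
  assumes k: "k \<le> 3"
  shows "integrable lborel (\<lambda>x. norm x ^ k * \<phi> x)"
proof -
  \<comment> \<open>Four powers of the weight: up to three compensate \<open>norm x ^ k\<close>, and
    at least one is left for integrability.\<close>
  obtain C where C: "C \<ge> 0" "\<And>x. \<bar>\<phi> x\<bar> \<le> C * decay x ^ 4"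
    using schwartz_properties(2)[OF schw, of 4] by blast
  show ?thesis
  proof (rule integrable_decay_bound)
    show "continuous_on UNIV (\<lambda>x. norm x ^ k * \<phi> x)"
      by (intro continuous_intros schwartz_properties(1)[OF schw])
    fix x :: "real^'n"
    have d: "0 \<le> decay x" "decay x \<le> 1" using decay_pos[of x] decay_le_1[of x] by auto
    have "\<bar>norm x ^ k * \<phi> x\<bar> \<le> norm x ^ k * (C * decay x ^ 4)"
      unfolding abs_mult using C(2)[of x] by (intro mult_mono) auto
    also have "\<dots> = C * ((norm x * decay x) ^ k * decay x ^ (4 - k))"
      using k by (simp add: power_mult_distrib power_add[symmetric])
    also have "\<dots> \<le> C * (1 ^ k * decay x ^ 1)"
      using k d norm_times_decay_le[of x] C(1) by (intro mult_left_mono mult_mono power_mono power_decreasing) auto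
    finally show "\<bar>norm x ^ k * \<phi> x\<bar> \<le> C * decay x" by simp
  qed
qed

lemma moment_integrable:
  assumes k: "k \<le> 3" and g: "continuous_on UNIV g" "\<And>x. \<bar>g x\<bar> \<le> B * norm x ^ k"
  shows "integrable lborel (\<lambda>x. g x * \<phi> x)"
proof (rule Bochner_Integration.integrable_bound)
  show "integrable lborel (\<lambda>x. B * (norm x ^ k * \<phi> x))" by (intro integrable_mult_right norm_moment k)
  show "(\<lambda>x. g x * \<phi> x) \<in> borel_measurable lborel"
    by (intro borel_measurable_lborel_continuous continuous_intros g schwartz_properties(1)[OF schw])
  have "\<bar>g x * \<phi> x\<bar> \<le> \<bar>B * (norm x ^ k * \<phi> x)\<bar>" for x
  proof -
    have "\<bar>g x\<bar> * \<phi> x \<le> B * norm x ^ k * \<phi> x" by (intro mult_right_mono g nonneg)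
    also have "\<dots> \<le> \<bar>B\<bar> * norm x ^ k * \<phi> x" by (intro mult_right_mono nonneg) auto
    finally show ?thesis using nonneg[of x] by (simp add: abs_mult mult.assoc)
  qed
  thus "AE x in lborel. norm (g x * \<phi> x) \<le> norm (B * (norm x ^ k * \<phi> x))" by simp
qed

lemma inner_moment: "k \<le> 3 \<Longrightarrow> integrable lborel (\<lambda>x. (\<xi> \<bullet> x) ^ k * \<phi> x)"
proof (rule moment_integrable)
  fix x
  have "\<bar>\<xi> \<bullet> x\<bar> ^ k \<le> (norm \<xi> * norm x) ^ k" by (intro power_mono Cauchy_Schwarz_ineq2) auto
  thus "\<bar>(\<xi> \<bullet> x) ^ k\<bar> \<le> norm \<xi> ^ k * norm x ^ k" by (simp add: power_abs power_mult_distrib)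
qed (auto intro!: continuous_intros)

text \<open>The covariance quadratic form, that is the variance of the scalar product of \<xi> with
  the centred random vector.\<close>

definition qf :: "real^'n \<Rightarrow> real" where "qf \<xi> = (\<integral>x. (\<xi> \<bullet> x)\<^sup>2 * \<phi> x \<partial>lborel)"

lemma qf_nonneg: "qf \<xi> \<ge> 0"
  unfolding qf_def by (intro integral_nonneg_AE) (auto simp: nonneg)

lemma qf_scale: "qf (t *\<^sub>R \<xi>) = t\<^sup>2 * qf \<xi>"
  unfolding qf_def by (simp add: power_mult_distrib mult.assoc)

lemma qf_expand: "qf \<xi> = (\<Sum>i\<in>UNIV. \<Sum>j\<in>UNIV. \<xi> $ i * \<xi> $ j * cov_matrix \<phi> $ i $ j)"
proof -
  have i: "integrable lborel (\<lambda>x. (x $ i * x $ j) * \<phi> x)" for i j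
  proof (rule moment_integrable[where k = 2 and B = 1])
    fix x :: "real^'n"
    have "\<bar>x $ i\<bar> * \<bar>x $ j\<bar> \<le> norm x * norm x" by (intro mult_mono component_le_norm_cart) auto
    thus "\<bar>x $ i * x $ j\<bar> \<le> 1 * norm x ^ 2" by (simp add: abs_mult power2_eq_square)
  qed (auto intro!: continuous_intros)
  have "qf \<xi> = (\<integral>x. (\<Sum>i\<in>UNIV. \<Sum>j\<in>UNIV. \<xi> $ i * \<xi> $ j * ((x $ i * x $ j) * \<phi> x)) \<partial>lborel)"
    unfolding qf_def
  proof (intro Bochner_Integration.integral_cong refl)
    fix x
    have "(\<xi> \<bullet> x)\<^sup>2 = (\<Sum>i\<in>UNIV. \<Sum>j\<in>UNIV. (\<xi> $ i * x $ i) * (\<xi> $ j * x $ j))"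
      unfolding inner_vec_def power2_eq_square sum_product by simp
    show "(\<xi> \<bullet> x)\<^sup>2 * \<phi> x = (\<Sum>i\<in>UNIV. \<Sum>j\<in>UNIV. \<xi> $ i * \<xi> $ j * ((x $ i * x $ j) * \<phi> x))"
      unfolding \<open>(\<xi> \<bullet> x)\<^sup>2 = _\<close> sum_distrib_right by (simp add: mult_ac)
  qed
  also have "\<dots> = (\<Sum>i\<in>UNIV. \<Sum>j\<in>UNIV. \<xi> $ i * \<xi> $ j * (\<integral>x. (x $ i * x $ j) * \<phi> x \<partial>lborel))"
    using i by simp
  finally show ?thesis by (simp add: cov_matrix_def)
qed

lemma qf_continuous: "continuous_on S qf"
  unfolding qf_expand[abs_def] by (intro continuous_intros)

text \<open>Second-order expansion of the exponential under the integral: the zero mean removes the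
  linear term, and the third absolute moment bounds the remainder.\<close>

lemma fourier_taylor:
  "\<exists>K\<ge>0. \<forall>\<xi>. norm (fourier \<phi> \<xi> - complex_of_real (1 - 2 * pi\<^sup>2 * qf \<xi>)) \<le> K * norm \<xi> ^ 3"
proof -
  define K where "K = (2 * pi) ^ 3 / 6 * (\<integral>x. norm x ^ 3 * \<phi> x \<partial>lborel)"
  have "norm (fourier \<phi> \<xi> - complex_of_real (1 - 2 * pi\<^sup>2 * qf \<xi>)) \<le> K * norm \<xi> ^ 3" for \<xi>
  proof -
    define u where "u = (\<lambda>x. 2 * pi * (\<xi> \<bullet> x))"
    define T where "T = (\<lambda>x. (1 + \<i> * u x) - complex_of_real ((u x)\<^sup>2 / 2))"
    have i0: "integrable lborel \<phi>" using inner_moment[of 0 \<xi>] by simp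
    have i1: "integrable lborel (\<lambda>x. u x * \<phi> x)" using inner_moment[of 1 \<xi>] by (simp add: u_def mult.assoc)
    have i2: "integrable lborel (\<lambda>x. (u x)\<^sup>2 / 2 * \<phi> x)"
      using inner_moment[of 2 \<xi>] by (simp add: u_def power_mult_distrib mult.assoc)
    have z1: "(\<integral>x. u x * \<phi> x \<partial>lborel) = 0"
    proof -
      have ii: "integrable lborel (\<lambda>x. x $ i * \<phi> x)" for i
        by (rule moment_integrable[where k = 1 and B = 1]) (auto intro!: continuous_intros component_le_norm_cart)
      have "(\<integral>x. u x * \<phi> x \<partial>lborel) = (\<integral>x. 2 * pi * (\<Sum>i\<in>UNIV. \<xi> $ i * (x $ i * \<phi> x)) \<partial>lborel)"
        unfolding u_def inner_vec_def by (simp add: sum_distrib_right mult.assoc)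
      also have "\<dots> = 2 * pi * (\<Sum>i\<in>UNIV. \<xi> $ i * (\<integral>x. x $ i * \<phi> x \<partial>lborel))"
        using ii by simp
      finally show ?thesis by (simp add: mean0)
    qed
    have z2: "(\<integral>x. (u x)\<^sup>2 / 2 * \<phi> x \<partial>lborel) = 2 * pi\<^sup>2 * qf \<xi>"
    proof -
      have "(\<integral>x. (u x)\<^sup>2 / 2 * \<phi> x \<partial>lborel) = (\<integral>x. 2 * pi\<^sup>2 * ((\<xi> \<bullet> x)\<^sup>2 * \<phi> x) \<partial>lborel)"
        by (intro Bochner_Integration.integral_cong refl) (simp add: u_def power_mult_distrib)
      thus ?thesis by (simp add: qf_def)
    qed
    have fu: "fourier \<phi> \<xi> = (\<integral>x. complex_of_real (\<phi> x) * cis (u x) \<partial>lborel)" by (simp add: fourier_def u_def)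
    have iC: "integrable lborel (\<lambda>x. complex_of_real (\<phi> x) * cis (u x))"
      using integrable_times_cis[OF i0, of \<xi>] by (simp add: u_def)
    have Te: "complex_of_real (\<phi> x) * T x = complex_of_real (\<phi> x) + \<i> * complex_of_real (u x * \<phi> x) - complex_of_real ((u x)\<^sup>2 / 2 * \<phi> x)" for x
      by (simp add: T_def algebra_simps)
    have iT: "integrable lborel (\<lambda>x. complex_of_real (\<phi> x) * T x)"
      unfolding Te
      by (intro Bochner_Integration.integrable_add Bochner_Integration.integrable_diff
          Bochner_Integration.integrable_mult_right Bochner_Integration.integrable_of_real i0 i1 i2)
    have T: "(\<integral>x. complex_of_real (\<phi> x) * T x \<partial>lborel) = complex_of_real (1 - 2 * pi\<^sup>2 * qf \<xi>)"
    proof -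
      have "(\<integral>x. complex_of_real (\<phi> x) * T x \<partial>lborel) = (\<integral>x. complex_of_real (\<phi> x) \<partial>lborel)
          + \<i> * (\<integral>x. complex_of_real (u x * \<phi> x) \<partial>lborel) - (\<integral>x. complex_of_real ((u x)\<^sup>2 / 2 * \<phi> x) \<partial>lborel)"
        unfolding Te
        by (subst Bochner_Integration.integral_diff Bochner_Integration.integral_add;
            (intro Bochner_Integration.integrable_add
              Bochner_Integration.integrable_mult_right Bochner_Integration.integrable_of_real i0 i1 i2)?)+ simp
      thus ?thesis by (simp only: integral_complex_of_real z1 z2 one) simp
    qed
    have "fourier \<phi> \<xi> - complex_of_real (1 - 2 * pi\<^sup>2 * qf \<xi>) = (\<integral>x. complex_of_real (\<phi> x) * cis (u x) - complex_of_real (\<phi> x) * T x \<partial>lborel)"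
      unfolding T[symmetric] fu by (rule Bochner_Integration.integral_diff[OF iC iT, symmetric])
    also have "norm \<dots> \<le> (\<integral>x. (2 * pi * norm \<xi>) ^ 3 / 6 * (norm x ^ 3 * \<phi> x) \<partial>lborel)"
    proof (rule norm_integral_le)
      show "integrable lborel (\<lambda>x. complex_of_real (\<phi> x) * cis (u x) - complex_of_real (\<phi> x) * T x)"
        by (rule Bochner_Integration.integrable_diff[OF iC iT])
      show "integrable lborel (\<lambda>x. (2 * pi * norm \<xi>) ^ 3 / 6 * (norm x ^ 3 * \<phi> x))"
        by (intro integrable_mult_right norm_moment) simp
      fix x
      have e2: "(\<Sum>k\<le>2. z ^ k / fact k) = 1 + z + z\<^sup>2 / 2" for z :: complex
        by (simp add: numeral_2_eq_2)
      have S: "(\<Sum>k\<le>2. (\<i> * complex_of_real (u x)) ^ k / fact k) = T x"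
        unfolding e2 T_def by (simp add: power_mult_distrib)
      have "norm (cis (u x) - T x) \<le> \<bar>u x\<bar> ^ 3 / 6"
        using iexp_approx1[of "u x" 2] unfolding S by (simp add: cis_conv_exp fact_numeral)
      also have "\<bar>u x\<bar> ^ 3 \<le> (2 * pi * norm \<xi> * norm x) ^ 3"
      proof (rule power_mono)
        have "\<bar>u x\<bar> = 2 * pi * \<bar>\<xi> \<bullet> x\<bar>" by (simp add: u_def abs_mult)
        also have "\<dots> \<le> 2 * pi * (norm \<xi> * norm x)" by (intro mult_left_mono Cauchy_Schwarz_ineq2) auto
        finally show "\<bar>u x\<bar> \<le> 2 * pi * norm \<xi> * norm x" by simp
      qed auto
      finally have "\<phi> x * norm (cis (u x) - T x) \<le> \<phi> x * ((2 * pi * norm \<xi> * norm x) ^ 3 / 6)"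
        using nonneg[of x] by (intro mult_left_mono) (auto simp: divide_right_mono)
      moreover have "norm (complex_of_real (\<phi> x) * cis (u x) - complex_of_real (\<phi> x) * T x) = \<phi> x * norm (cis (u x) - T x)"
        using nonneg[of x] by (simp add: right_diff_distrib[symmetric] norm_mult)
      ultimately show "norm (complex_of_real (\<phi> x) * cis (u x) - complex_of_real (\<phi> x) * T x)
          \<le> (2 * pi * norm \<xi>) ^ 3 / 6 * (norm x ^ 3 * \<phi> x)"
        by (simp add: power_mult_distrib mult_ac)
    qed
    also have "\<dots> = K * norm \<xi> ^ 3" by (simp add: K_def power_mult_distrib)
    finally show ?thesis .
  qed
  moreover have "K \<ge> 0" unfolding K_def
    by (intro mult_nonneg_nonneg integral_nonneg_AE) (auto simp: nonneg)
  ultimately show ?thesis by blast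
qed

lemma fourier_measurable: "fourier \<phi> \<in> borel_measurable borel"
proof -
  have "continuous_on UNIV (\<lambda>p::(real^'n) \<times> (real^'n). complex_of_real (\<phi> (snd p)) * cis (2 * pi * (fst p \<bullet> snd p)))"
    by (intro continuous_intros continuous_on_compose2[OF schwartz_properties(1)[OF schw]]) auto
  hence "(\<lambda>p::(real^'n) \<times> (real^'n). complex_of_real (\<phi> (snd p)) * cis (2 * pi * (fst p \<bullet> snd p))) \<in> borel_measurable (borel \<Otimes>\<^sub>M lborel)"
    unfolding measurable_cong_sets[OF sets_pair_measure_cong[OF refl sets_lborel] refl] borel_prod
    by (rule borel_measurable_continuous_onI)
  hence "(\<lambda>(\<xi>, x). complex_of_real (\<phi> x) * cis (2 * pi * (\<xi> \<bullet> x))) \<in> borel_measurable (borel \<Otimes>\<^sub>M lborel)"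
    by (simp add: case_prod_beta')
  thus ?thesis unfolding fourier_def[abs_def] by (rule lborel.borel_measurable_lebesgue_integral)
qed

lemma fourier_norm_le_1: "norm (fourier \<phi> \<xi>) \<le> 1"
  using fourier_norm_le[of \<phi> \<xi>] inner_moment[of 0 \<xi>] nonneg one by simp

lemma fourier_scaled_bound:
  assumes j: "j \<ge> 1"
  shows "norm (fourier \<phi> ((1 / sqrt (real j)) *\<^sub>R y) ^ j) \<le> (\<Prod>i\<in>UNIV. 1 / (1 + c * (y $ i)\<^sup>2))"
proof -
  have "norm (fourier \<phi> ((1 / sqrt (real j)) *\<^sub>R y)) ^ j \<le> (\<Prod>i\<in>UNIV. 1 / (1 + c * (((1 / sqrt (real j)) *\<^sub>R y) $ i)\<^sup>2)) ^ j"
    by (intro power_mono c) auto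
  also have "\<dots> = (\<Prod>i\<in>UNIV. 1 / (1 + c * (y $ i)\<^sup>2 / real j) ^ j)"
    by (simp add: prod_power_distrib power_divide)
  also have "\<dots> \<le> (\<Prod>i\<in>UNIV. 1 / (1 + c * (y $ i)\<^sup>2))"
  proof (intro prod_mono conjI)
    fix i
    define u where "u = c * (y $ i)\<^sup>2 / real j"
    have u: "u \<ge> 0" using c(1) by (simp add: u_def)
    have "1 + c * (y $ i)\<^sup>2 = 1 + real j * u" using j by (simp add: u_def)
    also have "\<dots> \<le> (1 + u) ^ j" using Bernoulli_inequality[of u j] u by simp
    finally have "1 + c * (y $ i)\<^sup>2 \<le> (1 + u) ^ j" .
    moreover have "1 + c * (y $ i)\<^sup>2 > 0" using c(1) by (intro add_pos_nonneg) auto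
    ultimately show "1 / (1 + c * (y $ i)\<^sup>2 / real j) ^ j \<le> 1 / (1 + c * (y $ i)\<^sup>2)"
      unfolding u_def[symmetric] by (intro divide_left_mono mult_pos_pos) (auto intro: less_le_trans)
    show "0 \<le> 1 / (1 + c * (y $ i)\<^sup>2 / real j) ^ j" using c(1) by simp
  qed
  finally show ?thesis by (simp add: norm_power)
qed

text \<open>The central limit theorem for characteristic functions, along moving arguments
  \<open>y n\<close> because rounding to the lattice shifts the point. For numbers of modulus at
  most 1 the difference of \<open>j\<close>-th powers is at most \<open>j\<close> times the
  difference, and the third-order error \<open>s ^ 3\<close> beats
  \<open>j = 1 / s\<^sup>2\<close>.\<close>

lemma fourier_power_limit:
  fixes j :: "nat \<Rightarrow> nat"
  assumes j: "filterlim j at_top sequentially" "\<And>n. j n \<ge> 1" and y: "y \<longlonglongrightarrow> x"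
  shows "(\<lambda>n. fourier \<phi> ((1 / sqrt (real (j n))) *\<^sub>R y n) ^ j n) \<longlonglongrightarrow> complex_of_real (exp (- (2 * pi\<^sup>2 * qf x)))"
proof -
  obtain K where K: "K \<ge> 0" "\<And>\<xi>. norm (fourier \<phi> \<xi> - complex_of_real (1 - 2 * pi\<^sup>2 * qf \<xi>)) \<le> K * norm \<xi> ^ 3"
    using fourier_taylor by blast
  define s where "s = (\<lambda>n. 1 / sqrt (real (j n)))"
  have s: "s n > 0" "real (j n) * (s n)\<^sup>2 = 1" for n using j(2)[of n] by (auto simp: s_def power_divide)
  have "filterlim (\<lambda>n. real (j n)) at_top sequentially"
    by (rule filterlim_compose[OF filterlim_real_sequentially j(1)])
  moreover have "((\<lambda>x::real. 1 / sqrt x) \<longlongrightarrow> 0) at_top" by real_asymp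
  ultimately have s0: "s \<longlonglongrightarrow> 0" unfolding s_def by (rule filterlim_compose[rotated])
  define v where "v = (\<lambda>n. 2 * pi\<^sup>2 * qf (y n))"
  have qy: "(\<lambda>n. qf (y n)) \<longlonglongrightarrow> qf x"
    using qf_continuous[of UNIV] y by (auto simp: continuous_on_def intro: tendsto_compose)
  have bd: "norm (fourier \<phi> (s n *\<^sub>R y n) ^ j n - complex_of_real (exp (- v n))) \<le> K * norm (y n) ^ 3 * s n + (v n)\<^sup>2 * (s n)\<^sup>2" for n
  proof -
    define u where "u = (s n)\<^sup>2 * v n"
    have u: "u \<ge> 0" by (simp add: u_def v_def qf_nonneg)
    have qu: "2 * pi\<^sup>2 * qf (s n *\<^sub>R y n) = u" by (simp add: u_def v_def qf_scale)
    have ju: "real (j n) * u = v n" using s(2)[of n] by (simp add: u_def mult.assoc[symmetric])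
    have e: "exp (- v n) = exp (- u) ^ j n" by (simp add: exp_of_nat_mult[symmetric] ju)
    have "norm (fourier \<phi> (s n *\<^sub>R y n) ^ j n - complex_of_real (exp (- u)) ^ j n)
        \<le> real (j n) * norm (fourier \<phi> (s n *\<^sub>R y n) - complex_of_real (exp (- u)))"
      by (rule norm_power_diff) (use u fourier_norm_le_1 in auto)
    also have "norm (fourier \<phi> (s n *\<^sub>R y n) - complex_of_real (exp (- u)))
        \<le> norm (fourier \<phi> (s n *\<^sub>R y n) - complex_of_real (1 - u)) + norm (complex_of_real (1 - u) - complex_of_real (exp (- u)))"
      by (rule order_trans[OF _ norm_triangle_ineq]) simp
    also have "\<dots> \<le> K * norm (s n *\<^sub>R y n) ^ 3 + u * u"
    proof (rule add_mono)
      show "norm (fourier \<phi> (s n *\<^sub>R y n) - complex_of_real (1 - u)) \<le> K * norm (s n *\<^sub>R y n) ^ 3"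
        using K(2)[of "s n *\<^sub>R y n"] unfolding qu .
      have "\<bar>1 - u - exp (- u)\<bar> \<le> u * min 1 u" using exp_minus_taylor1[OF u] by (simp add: algebra_simps)
      also have "\<dots> \<le> u * u" using u by (intro mult_left_mono) auto
      finally show "norm (complex_of_real (1 - u) - complex_of_real (exp (- u))) \<le> u * u"
        unfolding of_real_diff[symmetric] norm_of_real by simp
    qed
    finally have "norm (fourier \<phi> (s n *\<^sub>R y n) ^ j n - complex_of_real (exp (- v n)))
        \<le> real (j n) * (K * norm (s n *\<^sub>R y n) ^ 3 + u * u)"
      by (simp add: e mult_left_mono)
    also have "\<dots> = (real (j n) * (s n)\<^sup>2) * (K * norm (y n) ^ 3 * s n) + (real (j n) * (s n)\<^sup>2) * ((v n)\<^sup>2 * (s n)\<^sup>2)"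
      using s(1)[of n] by (simp add: u_def power2_eq_square power3_eq_cube algebra_simps)
    finally show ?thesis by (simp add: s)
  qed
  have "(\<lambda>n. K * norm (y n) ^ 3 * s n + (v n)\<^sup>2 * (s n)\<^sup>2) \<longlonglongrightarrow> K * norm x ^ 3 * 0 + (2 * pi\<^sup>2 * qf x)\<^sup>2 * 0\<^sup>2"
    unfolding v_def by (intro tendsto_intros y s0 qy)
  hence "(\<lambda>n. K * norm (y n) ^ 3 * s n + (v n)\<^sup>2 * (s n)\<^sup>2) \<longlonglongrightarrow> 0" by simp
  hence "(\<lambda>n. fourier \<phi> (s n *\<^sub>R y n) ^ j n - complex_of_real (exp (- v n))) \<longlonglongrightarrow> 0"
    by (rule Lim_null_comparison[rotated]) (simp add: bd)
  moreover have "(\<lambda>n. complex_of_real (exp (- v n))) \<longlonglongrightarrow> complex_of_real (exp (- (2 * pi\<^sup>2 * qf x)))"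
    unfolding v_def by (intro tendsto_intros qy)
  ultimately have "(\<lambda>n. (fourier \<phi> (s n *\<^sub>R y n) ^ j n - complex_of_real (exp (- v n))) + complex_of_real (exp (- v n)))
      \<longlonglongrightarrow> 0 + complex_of_real (exp (- (2 * pi\<^sup>2 * qf x)))" by (rule tendsto_add)
  thus ?thesis by (simp add: s_def)
qed

text \<open>The product bound for rescaled powers is uniform in \<open>j\<close>, so the Gaussian
  limit inherits it. This gives integrability of the Gaussian and later positivity of
  \<open>qf\<close>.\<close>

lemma gauss_le: "exp (- (2 * pi\<^sup>2 * qf x)) \<le> (\<Prod>i\<in>UNIV. 1 / (1 + c * (x $ i)\<^sup>2))"
proof -
  have "(\<lambda>n. norm (fourier \<phi> ((1 / sqrt (real (Suc n))) *\<^sub>R x) ^ Suc n)) \<longlonglongrightarrow> norm (complex_of_real (exp (- (2 * pi\<^sup>2 * qf x))))"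
    by (intro tendsto_norm fourier_power_limit filterlim_Suc tendsto_const) auto
  hence "norm (complex_of_real (exp (- (2 * pi\<^sup>2 * qf x)))) \<le> (\<Prod>i\<in>UNIV. 1 / (1 + c * (x $ i)\<^sup>2))"
    by (rule tendsto_upperbound) (intro always_eventually allI fourier_scaled_bound, auto)
  thus ?thesis by simp
qed

lemma product_le_decay: "(\<Prod>i\<in>UNIV. 1 / (1 + c * (x $ i)\<^sup>2)) \<le> (1 / min c 1) ^ CARD('n) * decay (x :: real^'n)"
proof -
  have "(\<Prod>i\<in>(UNIV::'n set). 1 / (1 + c * (x $ i)\<^sup>2)) \<le> (\<Prod>i\<in>(UNIV::'n set). (1 / min c 1) * (1 / (1 + (x $ i)\<^sup>2)))"
  proof (intro prod_mono conjI)
    fix i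
    have m: "min c 1 > 0" using c(1) by simp
    have "min c 1 * (x $ i)\<^sup>2 \<le> c * (x $ i)\<^sup>2" by (intro mult_right_mono) auto
    hence "min c 1 * (1 + (x $ i)\<^sup>2) \<le> 1 + c * (x $ i)\<^sup>2" using min.cobounded2[of c 1] by (simp only: distrib_left mult_1_right)
    hence "1 / (1 + c * (x $ i)\<^sup>2) \<le> 1 / (min c 1 * (1 + (x $ i)\<^sup>2))"
      using m c(1) by (intro divide_left_mono mult_pos_pos one_plus_square_pos add_pos_nonneg) auto
    thus "1 / (1 + c * (x $ i)\<^sup>2) \<le> (1 / min c 1) * (1 / (1 + (x $ i)\<^sup>2))" by simp
    show "0 \<le> 1 / (1 + c * (x $ i)\<^sup>2)" using c(1) by simp
  qed
  also have "\<dots> = (1 / min c 1) ^ CARD('n) * decay x" unfolding prod.distrib decay_def by simp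
  finally show ?thesis .
qed

lemma gauss_integrable: "integrable lborel (\<lambda>x. exp (- (2 * pi\<^sup>2 * qf x)))"
proof (rule integrable_decay_bound)
  show "continuous_on UNIV (\<lambda>x. exp (- (2 * pi\<^sup>2 * qf x)))" by (intro continuous_intros qf_continuous)
  show "\<bar>exp (- (2 * pi\<^sup>2 * qf x))\<bar> \<le> (1 / min c 1) ^ CARD('n) * decay x" for x
    using order_trans[OF gauss_le product_le_decay] by simp
qed

text \<open>The local limit theorem as a Riemann sum: with frequencies measured in units of
  \<open>1 / sqrt j\<close>, the lattice \<open>k / L\<close> has mesh \<open>sqrt j / L\<close>,
  which tends to 0, and the summands converge to the Gaussian under the common bound by
  \<open>decay\<close>.\<close>

lemma w_local_limit:
  fixes L :: "nat \<Rightarrow> real" and j :: "nat \<Rightarrow> nat"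
  assumes L: "\<And>n. L n \<ge> 1" and j: "\<And>n. j n \<ge> 1" "\<And>n. real (j n) \<le> (L n)\<^sup>2" "filterlim j at_top sequentially"
    and jL: "(\<lambda>n. real (j n) / (L n)\<^sup>2) \<longlonglongrightarrow> 0"
  shows "(\<lambda>n. (sqrt (real (j n)) / L n) ^ CARD('n) * w (L n) (j n)) \<longlonglongrightarrow> (\<integral>x. exp (- (2 * pi\<^sup>2 * qf x)) \<partial>lborel)"
proof -
  define h where "h = (\<lambda>n. sqrt (real (j n)) / L n)"
  have L0: "L n > 0" for n using L[of n] by linarith
  have h: "h n > 0" "h n \<le> 1" for n
    using j(1)[of n] j(2)[of n] L0[of n] by (auto simp: h_def real_le_lsqrt)
  have h0: "h \<longlonglongrightarrow> 0"
  proof -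
    have "h = (\<lambda>n. sqrt (real (j n) / (L n)\<^sup>2))" unfolding h_def
      by (rule ext) (use L0 in \<open>simp add: real_sqrt_divide less_imp_le\<close>)
    thus ?thesis using tendsto_real_sqrt[OF jL] by simp
  qed
  \<comment> \<open>The real part is enough because \<open>w\<close> is real; it keeps the Riemann
    sum inside real integrals.\<close>
  define g where "g = (\<lambda>n y. Re (fourier \<phi> ((1 / sqrt (real (j n))) *\<^sub>R y) ^ j n))"
  define B where "B = (1 / min c 1) ^ CARD('n)"
  have gb: "\<bar>g n y\<bar> \<le> B * decay y" for n y
    unfolding g_def B_def
    by (rule order_trans[OF abs_Re_le_cmod order_trans[OF fourier_scaled_bound[OF j(1)] product_le_decay]])
  have gm: "g n \<in> borel_measurable borel" for n
  proof -
    have "(\<lambda>y::real^'n. (1 / sqrt (real (j n))) *\<^sub>R y) \<in> borel_measurable borel" by measurable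
    from measurable_compose[OF this fourier_measurable] show ?thesis unfolding g_def by measurable
  qed
  have gl: "g n (h n *\<^sub>R lat k) = Re (fourier \<phi> ((1 / L n) *\<^sub>R lat k) ^ j n)" for n k
    using j(1)[of n] by (simp add: g_def h_def)
  have gs: "(\<lambda>k. norm (g n (h n *\<^sub>R lat k))) summable_on UNIV" for n
  proof (rule summable_on_comparison_test[OF fourier_lat_summable[OF L0 j(1)]])
    show "norm (g n (h n *\<^sub>R lat k)) \<le> norm (fourier \<phi> ((1 / L n) *\<^sub>R lat k) ^ j n)" for k
      unfolding gl using abs_Re_le_cmod by simp
  qed auto
  have wg: "w (L n) (j n) = infsum (\<lambda>k. g n (h n *\<^sub>R lat k)) UNIV" for n
  proof -
    have "w (L n) (j n) = Re (infsum (\<lambda>k. fourier \<phi> ((1 / L n) *\<^sub>R lat k) ^ j n) UNIV)"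
      unfolding w_poisson[OF L j(1), symmetric] by simp
    also have "\<dots> = infsum (\<lambda>k. Re (fourier \<phi> ((1 / L n) *\<^sub>R lat k) ^ j n)) UNIV"
      by (rule infsum_Re[symmetric]) (rule abs_summable_summable[OF fourier_lat_summable[OF L0 j(1)]])
    finally show ?thesis by (simp add: gl)
  qed
  note LS = lattice_sum_eq_integral[OF h gm gb gs]
  have eq: "(sqrt (real (j n)) / L n) ^ CARD('n) * w (L n) (j n) = (\<integral>x. g n (h n *\<^sub>R round_vec ((1 / h n) *\<^sub>R x)) \<partial>lborel)" for n
    using LS(1)[of n] by (simp add: wg h_def)
  show ?thesis unfolding eq
  proof (rule integral_dominated_convergence)
    show "(\<lambda>x. exp (- (2 * pi\<^sup>2 * qf x))) \<in> borel_measurable lborel" using gauss_integrable by simp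
    show "(\<lambda>x. g n (h n *\<^sub>R round_vec ((1 / h n) *\<^sub>R x))) \<in> borel_measurable lborel" for n by (rule LS(2))
    show "integrable lborel (\<lambda>x :: real^'n. B * 2 ^ CARD('n) * decay x)" by (intro integrable_mult_right integrable_decay)
    show "AE x in lborel. norm (g n (h n *\<^sub>R round_vec ((1 / h n) *\<^sub>R x))) \<le> B * 2 ^ CARD('n) * decay x" for n
      using LS(3)[of n] by simp
    show "AE x in lborel. (\<lambda>n. g n (h n *\<^sub>R round_vec ((1 / h n) *\<^sub>R x))) \<longlonglongrightarrow> exp (- (2 * pi\<^sup>2 * qf x))"
    proof (intro AE_I2)
      fix x :: "real^'n"
      have "(\<lambda>n. h n *\<^sub>R round_vec ((1 / h n) *\<^sub>R x)) \<longlonglongrightarrow> x"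
      proof (rule vec_tendstoI)
        fix i
        have "(\<lambda>n. h n / 2) \<longlonglongrightarrow> 0 / 2" by (intro tendsto_intros h0) simp
        hence "(\<lambda>n. h n / 2) \<longlonglongrightarrow> 0" by simp
        hence "(\<lambda>n. x $ i - (h n *\<^sub>R round_vec ((1 / h n) *\<^sub>R x)) $ i) \<longlonglongrightarrow> 0"
        proof (rule Lim_null_comparison[rotated])
          show "\<forall>\<^sub>F n in sequentially. norm (x $ i - (h n *\<^sub>R round_vec ((1 / h n) *\<^sub>R x)) $ i) \<le> h n / 2"
            unfolding real_norm_def by (intro always_eventually allI scaled_round_close h(1))
        qed
        hence "(\<lambda>n. x $ i - (x $ i - (h n *\<^sub>R round_vec ((1 / h n) *\<^sub>R x)) $ i)) \<longlonglongrightarrow> x $ i - 0"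
          by (intro tendsto_diff tendsto_const)
        thus "(\<lambda>n. (h n *\<^sub>R round_vec ((1 / h n) *\<^sub>R x)) $ i) \<longlonglongrightarrow> x $ i" by simp
      qed
      from tendsto_Re[OF fourier_power_limit[OF j(3) j(1) this]]
      show "(\<lambda>n. g n (h n *\<^sub>R round_vec ((1 / h n) *\<^sub>R x))) \<longlonglongrightarrow> exp (- (2 * pi\<^sup>2 * qf x))"
        unfolding g_def Re_complex_of_real .
    qed
  qed
qed

text \<open>By \<open>gauss_le\<close> the Gaussian at a nonzero \<xi> is at most
  \<open>1 / (1 + c * (\<xi> $ i)\<^sup>2)\<close> for some nonzero coordinate, hence strictly below
  1.\<close>

lemma qf_pos:
  assumes "\<xi> \<noteq> 0"
  shows "qf \<xi> > 0"
proof -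
  obtain i where i: "\<xi> $ i \<noteq> 0" using assms by (auto simp: vec_eq_iff)
  have le: "1 / (1 + c * (\<xi> $ k)\<^sup>2) \<le> 1" "0 \<le> 1 / (1 + c * (\<xi> $ k)\<^sup>2)" for k
    using c(1) by (auto simp: divide_le_eq add_pos_nonneg)
  have "exp (- (2 * pi\<^sup>2 * qf \<xi>)) \<le> (\<Prod>k\<in>UNIV. 1 / (1 + c * (\<xi> $ k)\<^sup>2))" by (rule gauss_le)
  also have "\<dots> = 1 / (1 + c * (\<xi> $ i)\<^sup>2) * (\<Prod>k\<in>UNIV - {i}. 1 / (1 + c * (\<xi> $ k)\<^sup>2))"
    by (rule prod.remove) auto
  also have "\<dots> \<le> 1 / (1 + c * (\<xi> $ i)\<^sup>2) * 1"
    by (intro mult_left_mono prod_le_1 le conjI)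
  also have "\<dots> < 1"
  proof -
    have "c * (\<xi> $ i)\<^sup>2 > 0" using c(1) i by simp
    thus ?thesis by (simp add: divide_less_eq)
  qed
  finally have "2 * pi\<^sup>2 * qf \<xi> > 0" by simp
  thus ?thesis by (simp add: zero_less_mult_iff)
qed

text \<open>Completing the square diagonalises the form with coefficients \<open>A\<close> and
  \<open>E\<close>, both positive by \<open>qf_pos\<close>, and the shear preserves the determinant
  \<open>A * E\<close>. Integrating one coordinate after the other gives two one-dimensional
  Gaussians.\<close>

lemma gauss_integral_dim2:
  assumes d: "CARD('n) = 2"
  shows "det (cov_matrix \<phi>) > 0"
    and "(\<integral>x. exp (- (2 * pi\<^sup>2 * qf x)) \<partial>lborel) = 1 / (2 * pi * sqrt (det (cov_matrix \<phi>)))"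
proof -
  obtain a b :: 'n where U: "UNIV = {a, b}" and ab: "a \<noteq> b" using d by (auto simp: card_2_iff)
  define A B D where "A = cov_matrix \<phi> $ a $ a" and "B = cov_matrix \<phi> $ a $ b" and "D = cov_matrix \<phi> $ b $ b"
  have B': "cov_matrix \<phi> $ b $ a = B" by (simp add: B_def cov_matrix_def mult.commute)
  define v where "v = (\<lambda>s t. (\<chi> i. if i = a then s else t) :: real^'n)"
  have q: "qf (v s t) = A * s\<^sup>2 + 2 * B * s * t + D * t\<^sup>2" for s t
    unfolding qf_expand U using ab B'
    by (simp add: v_def A_def[symmetric] B_def[symmetric] D_def[symmetric] power2_eq_square algebra_simps)
  have "v 1 0 $ a \<noteq> 0 $ a" by (simp add: v_def)
  hence "v 1 0 \<noteq> 0" by metis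
  from qf_pos[OF this] have A: "A > 0" by (simp add: q)
  define E where "E = D - B\<^sup>2 / A"
  have q2: "qf (v s t) = A * (s + B / A * t)\<^sup>2 + E * t\<^sup>2" for s t
    unfolding q E_def using A by (simp add: power2_eq_square field_simps)
  have "v (- B / A) 1 $ b \<noteq> 0 $ b" using ab by (simp add: v_def)
  hence "v (- B / A) 1 \<noteq> 0" by metis
  from qf_pos[OF this] have E: "E > 0" using A by (simp add: q2)
  have det: "det (cov_matrix \<phi>) = A * E"
    unfolding det_card2[OF U ab] B' A_def[symmetric] B_def[symmetric] D_def[symmetric] E_def
    using A by (simp add: power2_eq_square algebra_simps)
  show "det (cov_matrix \<phi>) > 0" using A E by (simp add: det)
  have "(\<integral>x. exp (- (2 * pi\<^sup>2 * qf x)) \<partial>lborel) = (\<integral>t. (\<integral>s. exp (- (2 * pi\<^sup>2 * qf (v s t))) \<partial>lborel) \<partial>lborel)"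
    unfolding v_def by (rule integral_vec2[OF U ab gauss_integrable])
  also have "\<dots> = (\<integral>t. 1 / sqrt (2 * pi * A) * exp (- (2 * pi\<^sup>2 * (E * (t + 0)\<^sup>2))) \<partial>lborel)"
  proof (intro Bochner_Integration.integral_cong refl)
    fix t :: real
    have "(\<integral>s. exp (- (2 * pi\<^sup>2 * qf (v s t))) \<partial>lborel)
        = (\<integral>s. exp (- (2 * pi\<^sup>2 * (E * (t + 0)\<^sup>2))) * exp (- (2 * pi\<^sup>2 * (A * (s + B / A * t)\<^sup>2))) \<partial>lborel)"
      unfolding q2 exp_add[symmetric] by (intro Bochner_Integration.integral_cong refl) (simp add: algebra_simps)
    thus "(\<integral>s. exp (- (2 * pi\<^sup>2 * qf (v s t))) \<partial>lborel) = 1 / sqrt (2 * pi * A) * exp (- (2 * pi\<^sup>2 * (E * (t + 0)\<^sup>2)))"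
      using gauss_integral(2)[OF A] by simp
  qed
  also have "\<dots> = 1 / sqrt (2 * pi * A) * (1 / sqrt (2 * pi * E))"
    using gauss_integral(2)[OF E, of 0] by (simp only: integral_mult_right_zero)
  also have "\<dots> = 1 / (sqrt ((2 * pi)\<^sup>2 * (A * E)))"
    by (simp add: real_sqrt_mult[symmetric] power2_eq_square mult_ac)
  also have "\<dots> = 1 / (2 * pi * sqrt (det (cov_matrix \<phi>)))" by (simp add: det real_sqrt_mult)
  finally show "(\<integral>x. exp (- (2 * pi\<^sup>2 * qf x)) \<partial>lborel) = 1 / (2 * pi * sqrt (det (cov_matrix \<phi>)))" .
qed

section \<open>The logarithmic sum in dimension two\<close>

definition \<kappa> :: real where "\<kappa> = (\<integral>x. exp (- (2 * pi\<^sup>2 * qf x)) \<partial>lborel)"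

lemma \<kappa>_nonneg: "\<kappa> \<ge> 0"
  unfolding \<kappa>_def by (intro integral_nonneg_AE) auto

text \<open>Obtained from the sequential limit by contradiction: counterexamples for
  \<open>J = Suc n\<close> and \<open>\<eta> = 1 / Suc n\<close> form a sequence to which
  \<open>w_local_limit\<close> applies.\<close>

lemma w_local_uniform:
  assumes d: "CARD('n) = 2" and \<delta>: "\<delta> > 0"
  shows "\<exists>J\<ge>1. \<exists>\<eta>>0. \<forall>L\<ge>1. \<forall>j\<ge>J. real j \<le> \<eta> * L\<^sup>2 \<longrightarrow> \<bar>w L j * (real j / L\<^sup>2) - \<kappa>\<bar> \<le> \<delta>"
proof (rule ccontr)
  assume neg: "\<not> ?thesis"
  have "\<exists>L j. L \<ge> 1 \<and> j \<ge> Suc n \<and> real j \<le> 1 / real (Suc n) * L\<^sup>2 \<and> \<bar>w L j * (real j / L\<^sup>2) - \<kappa>\<bar> > \<delta>" for n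
  proof (rule ccontr)
    assume c: "\<not> ?thesis"
    have "\<forall>L\<ge>1. \<forall>j\<ge>Suc n. real j \<le> 1 / real (Suc n) * L\<^sup>2 \<longrightarrow> \<bar>w L j * (real j / L\<^sup>2) - \<kappa>\<bar> \<le> \<delta>"
      using c by (meson not_less)
    moreover have "Suc n \<ge> 1" "1 / real (Suc n) > 0" by auto
    ultimately show False using neg by blast
  qed
  then obtain L j where Lj: "\<And>n. L n \<ge> 1" "\<And>n. j n \<ge> Suc n" "\<And>n. real (j n) \<le> 1 / real (Suc n) * (L n)\<^sup>2"
    "\<And>n. \<bar>w (L n) (j n) * (real (j n) / (L n)\<^sup>2) - \<kappa>\<bar> > \<delta>" by metis
  have j1: "j n \<ge> 1" for n using Lj(2)[of n] by simp
  have le: "real (j n) / (L n)\<^sup>2 \<le> 1 / real (Suc n)" for n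
  proof -
    have "(L n)\<^sup>2 > 0" using Lj(1)[of n] by simp
    thus ?thesis using Lj(3)[of n] by (simp only: pos_divide_le_eq)
  qed
  have jL: "real (j n) \<le> (L n)\<^sup>2" for n
    using Lj(3)[of n] mult_right_mono[of "1 / real (Suc n)" 1 "(L n)\<^sup>2"] by simp
  have "filterlim j at_top sequentially"
  proof (rule filterlim_at_top_mono[OF filterlim_Suc])
    show "\<forall>\<^sub>F n in sequentially. Suc n \<le> j n" using Lj(2) by simp
  qed
  moreover have "(\<lambda>n. real (j n) / (L n)\<^sup>2) \<longlonglongrightarrow> 0"
    by (rule tendsto_sandwich[OF _ _ tendsto_const LIMSEQ_Suc[OF lim_1_over_n]]) (use le in auto)
  ultimately have "(\<lambda>n. (sqrt (real (j n)) / L n) ^ CARD('n) * w (L n) (j n)) \<longlonglongrightarrow> \<kappa>"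
    unfolding \<kappa>_def by (intro w_local_limit Lj(1) j1 jL)
  hence "(\<lambda>n. w (L n) (j n) * (real (j n) / (L n)\<^sup>2)) \<longlonglongrightarrow> \<kappa>"
    unfolding d by (simp add: power_divide mult.commute)
  hence "\<forall>\<^sub>F n in sequentially. dist (w (L n) (j n) * (real (j n) / (L n)\<^sup>2)) \<kappa> < \<delta>"
    using \<delta> by (rule tendstoD)
  then obtain n where "dist (w (L n) (j n) * (real (j n) / (L n)\<^sup>2)) \<kappa> < \<delta>"
    by (auto simp: eventually_sequentially)
  thus False using Lj(4)[of n] by (simp add: dist_real_def)
qed

lemma harmonic_head:
  assumes L: "L \<ge> 1"
  shows "\<bar>(\<Sum>j<head L. 1 / real (Suc j)) - ln (L\<^sup>2)\<bar> \<le> 1"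
proof -
  have e: "(\<Sum>j<head L. 1 / real (Suc j)) = (\<Sum>j=1..head L. 1 / real j)"
    by (simp add: sum.atLeast1_atMost_eq)
  have L2: "L\<^sup>2 > 0" using L by simp
  have "ln (real (head L)) \<le> ln (L\<^sup>2)"
    using head(1)[OF L] head(2)[of L] L2 by (subst ln_le_cancel_iff) auto
  hence up: "(\<Sum>j=1..head L. 1 / real j) \<le> 1 + ln (L\<^sup>2)"
    using sum_inverse_le_ln[OF head(1)[OF L]] by linarith
  have "\<not> real (head L + 1) \<le> L\<^sup>2" unfolding head(3) by simp
  hence "L\<^sup>2 < real (head L) + 1" by simp
  hence "ln (L\<^sup>2) \<le> ln (real (head L) + 1)" using L2 by (subst ln_le_cancel_iff) auto
  also have "\<dots> \<le> (\<Sum>j=1..head L. 1 / real j)"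
    using ln_le_harm[of "head L"] by (simp add: harm_def inverse_eq_divide)
  finally show ?thesis using up unfolding e by linarith
qed

text \<open>Up to \<open>L\<^sup>2\<close> there are three kinds of indices. The first
  \<open>J\<close> cost at most order \<open>L\<^sup>2\<close> each; those beyond
  \<open>\<eta> * L\<^sup>2\<close> cost order \<open>1 / \<eta>\<close> each and number at most
  \<open>L\<^sup>2\<close>; in between the local limit gives \<open>\<kappa> * L\<^sup>2 / j\<close>
  with error \<open>\<delta> * L\<^sup>2 / j\<close>. The hypotheses on \<open>p\<close> are those
  shared by \<open>w - 1\<close> and its absolute value.\<close>

lemma dev_sum_estimate:
  assumes d: "CARD('n) = 2" and L: "L \<ge> 1" and \<delta>: "\<delta> \<ge> 0" and \<eta>: "\<eta> > 0"
    and loc: "\<And>j. j \<ge> J \<Longrightarrow> real j \<le> \<eta> * L\<^sup>2 \<Longrightarrow> \<bar>w L j * (real j / L\<^sup>2) - \<kappa>\<bar> \<le> \<delta>"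
    and p: "\<And>j. \<bar>p j\<bar> \<le> \<bar>w L (Suc j) - 1\<bar>" "\<And>j u. u \<ge> 0 \<Longrightarrow> \<bar>p j - u\<bar> \<le> \<bar>w L (Suc j) - u\<bar> + 1"
  shows "\<bar>suminf p - \<kappa> * L\<^sup>2 * ln (L\<^sup>2)\<bar>
      \<le> \<delta> * L\<^sup>2 * (1 + ln (L\<^sup>2)) + (pi * Cw + 1 + (Cw + \<kappa>) * (real J + 1 / \<eta>) + \<kappa>) * L\<^sup>2"
proof -
  define m where "m = head L"
  have L2: "L\<^sup>2 > 0" using L by simp
  have mL: "real m \<le> L\<^sup>2" unfolding m_def by (rule head(2))
  have CK: "Cw + \<kappa> \<ge> 0" using Cw(1) \<kappa>_nonneg by simp
  have pt: "\<bar>p j - \<kappa> * L\<^sup>2 * (1 / real (Suc j))\<bar>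
      \<le> \<delta> * L\<^sup>2 * (1 / real (Suc j)) + 1 + (Cw + \<kappa>) * (L\<^sup>2 * (if j < J then 1 else 0) + 1 / \<eta>)" if j: "j < m" for j
  proof -
    define r where "r = real (Suc j)"
    have r: "r \<ge> 1" by (simp add: r_def)
    have rL: "r \<le> L\<^sup>2" unfolding r_def using j head(3)[of "Suc j" L] by (simp add: m_def)
    have n1: "0 \<le> \<delta> * L\<^sup>2 * (1 / r)" "0 \<le> (Cw + \<kappa>) * (L\<^sup>2 * (if j < J then 1 else 0) + 1 / \<eta>)"
      using \<delta> CK \<eta> r L2 by auto
    have "\<bar>p j - \<kappa> * L\<^sup>2 * (1 / r)\<bar> \<le> \<delta> * L\<^sup>2 * (1 / r) + 1 + (Cw + \<kappa>) * (L\<^sup>2 * (if j < J then 1 else 0) + 1 / \<eta>)"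
    proof (cases "J \<le> Suc j \<and> r \<le> \<eta> * L\<^sup>2")
      case True
      have "\<bar>w L (Suc j) * (r / L\<^sup>2) - \<kappa>\<bar> \<le> \<delta>" unfolding r_def using True by (intro loc) (auto simp: r_def)
      hence "\<bar>w L (Suc j) * (r / L\<^sup>2) - \<kappa>\<bar> * (L\<^sup>2 * (1 / r)) \<le> \<delta> * (L\<^sup>2 * (1 / r))"
        using r L2 by (intro mult_right_mono) auto
      moreover have "\<bar>w L (Suc j) * (r / L\<^sup>2) - \<kappa>\<bar> * (L\<^sup>2 * (1 / r)) = \<bar>(w L (Suc j) * (r / L\<^sup>2) - \<kappa>) * (L\<^sup>2 * (1 / r))\<bar>"
        using r L2 by (simp add: abs_mult)
      moreover have "(w L (Suc j) * (r / L\<^sup>2) - \<kappa>) * (L\<^sup>2 * (1 / r)) = w L (Suc j) - \<kappa> * L\<^sup>2 * (1 / r)"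
        using r L2 by (simp add: field_simps)
      moreover have "\<bar>p j - \<kappa> * L\<^sup>2 * (1 / r)\<bar> \<le> \<bar>w L (Suc j) - \<kappa> * L\<^sup>2 * (1 / r)\<bar> + 1"
        using r \<kappa>_nonneg by (intro p(2)) auto
      ultimately show ?thesis using n1(2) by (simp only: mult.assoc) linarith
    next
      case False
      have "\<bar>p j\<bar> \<le> Cw * (L\<^sup>2 * (1 / r))"
        using order_trans[OF p(1) w_dev_head[OF L, of "Suc j"]] rL r d L2 by (simp add: r_def)
      moreover have "\<kappa> * L\<^sup>2 * (1 / r) \<ge> 0" using \<kappa>_nonneg r by simp
      ultimately have "\<bar>p j - \<kappa> * L\<^sup>2 * (1 / r)\<bar> \<le> Cw * (L\<^sup>2 * (1 / r)) + \<kappa> * L\<^sup>2 * (1 / r)" by linarith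
      also have "\<dots> = (Cw + \<kappa>) * (L\<^sup>2 * (1 / r))" by (simp only: distrib_right mult.assoc)
      also have "\<dots> \<le> (Cw + \<kappa>) * (L\<^sup>2 * (if j < J then 1 else 0) + 1 / \<eta>)"
      proof (intro mult_left_mono CK)
        show "L\<^sup>2 * (1 / r) \<le> L\<^sup>2 * (if j < J then 1 else 0) + 1 / \<eta>"
        proof (cases "j < J")
          case True
          have "L\<^sup>2 * (1 / r) \<le> L\<^sup>2 * 1" using r L2 by (intro mult_left_mono) auto
          thus ?thesis using True \<eta> by (simp add: add_increasing2)
        next
          case F: False
          with False have "\<eta> * L\<^sup>2 \<le> r" by auto
          hence "L\<^sup>2 * (1 / r) \<le> 1 / \<eta>" using r \<eta> by (simp add: field_simps)
          thus ?thesis using F by simp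
        qed
      qed
      finally show ?thesis using n1(1) by linarith
    qed
    thus ?thesis by (simp only: r_def)
  qed
  define S where "S = (\<Sum>j<m. 1 / real (Suc j))"
  have S: "\<bar>S - ln (L\<^sup>2)\<bar> \<le> 1" unfolding S_def m_def by (rule harmonic_head[OF L])
  have "\<bar>(\<Sum>j<m. p j) - \<kappa> * L\<^sup>2 * S\<bar> = \<bar>\<Sum>j<m. p j - \<kappa> * L\<^sup>2 * (1 / real (Suc j))\<bar>"
    by (simp only: S_def sum_subtractf sum_distrib_left)
  also have "\<dots> \<le> (\<Sum>j<m. \<delta> * L\<^sup>2 * (1 / real (Suc j)) + 1 + (Cw + \<kappa>) * (L\<^sup>2 * (if j < J then 1 else 0) + 1 / \<eta>))"
    by (rule order_trans[OF sum_abs sum_mono]) (use pt in auto)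
  also have "\<dots> = \<delta> * L\<^sup>2 * S + real m + (Cw + \<kappa>) * (L\<^sup>2 * (\<Sum>j<m. if j < J then 1 else 0) + real m * (1 / \<eta>))"
    by (simp only: S_def sum.distrib sum_distrib_left[symmetric] sum_constant card_lessThan mult_1_right)
  also have "\<dots> \<le> \<delta> * L\<^sup>2 * (1 + ln (L\<^sup>2)) + L\<^sup>2 + (Cw + \<kappa>) * (L\<^sup>2 * real J + L\<^sup>2 * (1 / \<eta>))"
  proof (intro add_mono mult_left_mono CK mL)
    show "S \<le> 1 + ln (L\<^sup>2)" using S by linarith
    show "(\<Sum>j<m. if j < J then 1 else 0) \<le> real J"
    proof -
      have "(\<Sum>j<m. if j < J then 1 else 0) = real (card ({..<m} \<inter> {j. j < J}))" by (simp add: sum.If_cases)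
      also have "card ({..<m} \<inter> {j. j < J}) \<le> card {..<J}" by (intro card_mono) auto
      finally show ?thesis by simp
    qed
    show "real m * (1 / \<eta>) \<le> L\<^sup>2 * (1 / \<eta>)" using mL \<eta> by (intro mult_right_mono) auto
  qed (use \<delta> in auto)
  finally have 1: "\<bar>(\<Sum>j<m. p j) - \<kappa> * L\<^sup>2 * S\<bar> \<le> \<delta> * L\<^sup>2 * (1 + ln (L\<^sup>2)) + L\<^sup>2 + (Cw + \<kappa>) * (L\<^sup>2 * real J + L\<^sup>2 * (1 / \<eta>))" .
  have 2: "\<bar>suminf p - (\<Sum>j<m. p j)\<bar> \<le> pi * Cw * L\<^sup>2" unfolding m_def by (rule sum_head_tail(2)[OF L p(1)])
  have "\<bar>\<kappa> * L\<^sup>2 * S - \<kappa> * L\<^sup>2 * ln (L\<^sup>2)\<bar> = \<kappa> * L\<^sup>2 * \<bar>S - ln (L\<^sup>2)\<bar>"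
    unfolding right_diff_distrib[symmetric] abs_mult using \<kappa>_nonneg by simp
  also have "\<dots> \<le> \<kappa> * L\<^sup>2 * 1" using S \<kappa>_nonneg by (intro mult_left_mono) auto
  finally have 3: "\<bar>\<kappa> * L\<^sup>2 * S - \<kappa> * L\<^sup>2 * ln (L\<^sup>2)\<bar> \<le> \<kappa> * L\<^sup>2" by simp
  have arith: "\<bar>x - v\<bar> \<le> t" if "\<bar>x - y\<bar> \<le> a" "\<bar>y - z\<bar> \<le> b" "\<bar>z - v\<bar> \<le> e" "a + b + e = t" for x y z v a b e t :: real
    using that by linarith
  show ?thesis
    by (rule arith[OF 2 1 3]) (simp add: algebra_simps add_divide_distrib)
qed

lemma dev_sum_dim2_sharp_aux:
  fixes L :: "nat \<Rightarrow> real"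
  assumes d: "CARD('n) = 2" and L: "filterlim L at_top sequentially"
    and p: "\<And>l j. \<bar>p l j\<bar> \<le> \<bar>w l (Suc j) - 1\<bar>" "\<And>l j u. u \<ge> 0 \<Longrightarrow> \<bar>p l j - u\<bar> \<le> \<bar>w l (Suc j) - u\<bar> + 1"
  shows "(\<lambda>N. suminf (p (L N)) / ((L N)\<^sup>2 * ln ((L N)\<^sup>2))) \<longlonglongrightarrow> \<kappa>"
proof (rule tendstoI)
  fix e :: real assume e: "e > 0"
  \<comment> \<open>Dividing the estimate by \<open>L\<^sup>2 * l\<close> with
    \<open>l = ln (L\<^sup>2)\<close> leaves \<open>\<delta> + (\<delta> + C) / l\<close>, which is
    eventually below \<open>2 * \<delta>\<close>.\<close>
  define \<delta> where "\<delta> = e / 3"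
  have \<delta>: "\<delta> > 0" using e by (simp add: \<delta>_def)
  obtain J \<eta> where J: "\<eta> > 0" "\<forall>L\<ge>1. \<forall>j\<ge>J. real j \<le> \<eta> * L\<^sup>2 \<longrightarrow> \<bar>w L j * (real j / L\<^sup>2) - \<kappa>\<bar> \<le> \<delta>"
    using w_local_uniform[OF d \<delta>] by blast
  define C where "C = pi * Cw + 1 + (Cw + \<kappa>) * (real J + 1 / \<eta>) + \<kappa>"
  have "filterlim (\<lambda>x::real. ln (x\<^sup>2)) at_top at_top" by real_asymp
  from filterlim_compose[OF this L] have lnL: "filterlim (\<lambda>N. ln ((L N)\<^sup>2)) at_top sequentially" .
  have "((\<lambda>x::real. (\<delta> + C) / x) \<longlongrightarrow> 0) at_top" by real_asymp
  from filterlim_compose[OF this lnL] have "(\<lambda>N. (\<delta> + C) / ln ((L N)\<^sup>2)) \<longlonglongrightarrow> 0" .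
  from order_tendstoD(2)[OF this \<delta>] have "\<forall>\<^sub>F N in sequentially. (\<delta> + C) / ln ((L N)\<^sup>2) < \<delta>" .
  moreover have "\<forall>\<^sub>F N in sequentially. L N \<ge> 1" using L by (auto simp: filterlim_at_top)
  moreover have "\<forall>\<^sub>F N in sequentially. ln ((L N)\<^sup>2) \<ge> 1" using lnL by (auto simp: filterlim_at_top)
  ultimately show "\<forall>\<^sub>F N in sequentially. dist (suminf (p (L N)) / ((L N)\<^sup>2 * ln ((L N)\<^sup>2))) \<kappa> < e"
  proof eventually_elim
    case (elim N)
    define l where "l = ln ((L N)\<^sup>2)"
    define s where "s = suminf (p (L N))"
    have l: "l \<ge> 1" "(\<delta> + C) / l < \<delta>" using elim by (auto simp: l_def)
    have L2: "(L N)\<^sup>2 > 0" using elim(2) by simp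
    have "\<bar>s - \<kappa> * (L N)\<^sup>2 * l\<bar> \<le> \<delta> * (L N)\<^sup>2 * (1 + l) + C * (L N)\<^sup>2"
      unfolding s_def l_def C_def by (rule dev_sum_estimate[OF d elim(2) less_imp_le[OF \<delta>] J(1)]) (use J(2) elim(2) p in auto)
    hence "\<bar>s - \<kappa> * (L N)\<^sup>2 * l\<bar> / ((L N)\<^sup>2 * l) \<le> (\<delta> * (L N)\<^sup>2 * (1 + l) + C * (L N)\<^sup>2) / ((L N)\<^sup>2 * l)"
      using l L2 by (intro divide_right_mono) auto
    also have "\<dots> = \<delta> + (\<delta> + C) / l" using l L2 by (simp add: field_simps)
    also have "\<delta> + (\<delta> + C) / l < e"
    proof -
      have "e = 3 * \<delta>" by (simp add: \<delta>_def)
      thus ?thesis using l(2) \<delta> by linarith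
    qed
    also have "\<bar>s - \<kappa> * (L N)\<^sup>2 * l\<bar> / ((L N)\<^sup>2 * l) = \<bar>(s - \<kappa> * (L N)\<^sup>2 * l) / ((L N)\<^sup>2 * l)\<bar>"
      using l L2 by (simp add: abs_divide)
    also have "(s - \<kappa> * (L N)\<^sup>2 * l) / ((L N)\<^sup>2 * l) = s / ((L N)\<^sup>2 * l) - \<kappa>"
      using l L2 by (simp add: field_simps)
    finally show ?case by (simp add: dist_real_def s_def l_def)
  qed
qed

lemma dev_sum_dim2_sharp:
  fixes L :: "nat \<Rightarrow> real"
  assumes d: "CARD('n) = 2" and L: "filterlim L at_top sequentially"
  shows "(\<lambda>N. (\<Sum>j. w (L N) (Suc j) - 1) / ((L N)\<^sup>2 * ln ((L N)\<^sup>2))) \<longlonglongrightarrow> \<kappa>"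
    and "(\<lambda>N. (\<Sum>j. \<bar>w (L N) (Suc j) - 1\<bar>) / ((L N)\<^sup>2 * ln ((L N)\<^sup>2))) \<longlonglongrightarrow> \<kappa>"
  by (rule dev_sum_dim2_sharp_aux[OF d L, where p = "\<lambda>l j. w l (Suc j) - 1"]; linarith)
     (rule dev_sum_dim2_sharp_aux[OF d L, where p = "\<lambda>l j. \<bar>w l (Suc j) - 1\<bar>"]; linarith)

end

section \<open>The four regimes\<close>

context schwartz_density begin

text \<open>A translation between the two forms of the result:
  \<open>j \<le> (1 - \<tau> - \<epsilon>) * N\<close> says that \<open>n = N - j\<close> is at
  least \<open>(\<tau> + \<epsilon>) * N\<close>, and \<open>n / N - \<tau>\<close> becomes
  \<open>1 - \<tau> - j / N\<close>.\<close>

lemma coefficients_of_exp_coeff: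
  fixes L :: "nat \<Rightarrow> real"
  assumes \<theta>: "\<theta> > 0" and \<tau>: "\<tau> \<ge> 0" and L1: "\<forall>\<^sub>F N in sequentially. L N \<ge> 1"
    and ex: "exp_coeff \<theta> \<tau> p C (\<lambda>N. W \<theta> \<phi> (L N))"
  shows "(\<forall>\<^sub>F N in sequentially. summable (\<lambda>j. \<bar>F_term \<theta> \<phi> (L N) j\<bar>))
    \<and> (\<forall>\<epsilon>>0. \<forall>\<delta>>0. \<forall>\<^sub>F N in sequentially. \<forall>j::nat. real j \<le> (1 - \<tau> - \<epsilon>) * real N \<longrightarrow>
          \<bar>H \<theta> \<phi> (N - j) (L N) /
             (exp (\<Sum>k. F_term \<theta> \<phi> (L N) k) * real N powr (\<theta> - 1)
               * (1 - \<tau> - real j / real N) powr (\<theta> - 1) / Gamma \<theta>) - 1\<bar> \<le> \<delta>)"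
proof (intro conjI allI impI)
  interpret E: exp_coeff \<theta> \<tau> p C "\<lambda>N. W \<theta> \<phi> (L N)" by (rule ex)
  show "\<forall>\<^sub>F N in sequentially. summable (\<lambda>j. \<bar>F_term \<theta> \<phi> (L N) j\<bar>)"
    using L1
  proof eventually_elim
    case (elim N)
    have "\<bar>F_term \<theta> \<phi> (L N) j\<bar> \<le> \<theta> * \<bar>w (L N) (Suc j) - 1\<bar>" for j
    proof -
      have "F_term \<theta> \<phi> (L N) j = \<theta> * (w (L N) (Suc j) - 1) / real (Suc j)"
        by (simp add: F_term_def W_eq algebra_simps)
      hence "\<bar>F_term \<theta> \<phi> (L N) j\<bar> = \<theta> * \<bar>w (L N) (Suc j) - 1\<bar> / real (Suc j)"
        using \<theta> by (simp add: abs_mult abs_divide)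
      also have "\<dots> \<le> \<theta> * \<bar>w (L N) (Suc j) - 1\<bar> / 1"
        using \<theta> by (intro divide_left_mono) auto
      finally show ?thesis by simp
    qed
    thus ?case
      by (intro summable_comparison_test'[OF summable_mult[OF summable_dev(1)[OF elim]], where N = 0]) simp
  qed
  fix \<epsilon> \<delta> :: real assume "\<epsilon> > 0" "\<delta> > 0"
  from E.h_asymp[OF this] eventually_gt_at_top[of 0]
  show "\<forall>\<^sub>F N in sequentially. \<forall>j::nat. real j \<le> (1 - \<tau> - \<epsilon>) * real N \<longrightarrow>
          \<bar>H \<theta> \<phi> (N - j) (L N) /
             (exp (\<Sum>k. F_term \<theta> \<phi> (L N) k) * real N powr (\<theta> - 1)
               * (1 - \<tau> - real j / real N) powr (\<theta> - 1) / Gamma \<theta>) - 1\<bar> \<le> \<delta>"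
  proof eventually_elim
    case (elim N)
    show ?case
    proof (intro allI impI)
      fix j :: nat assume j: "real j \<le> (1 - \<tau> - \<epsilon>) * real N"
      also have "\<dots> \<le> 1 * real N" using \<tau> \<open>\<epsilon> > 0\<close> by (intro mult_right_mono) auto
      \<comment> \<open>Without \<open>j \<le> N\<close> the natural number \<open>N - j\<close>
        would be truncated to 0.\<close>
      finally have jN: "j \<le> N" by simp
      have le: "(\<tau> + \<epsilon>) * real N \<le> real (N - j)" using j jN by (simp add: of_nat_diff algebra_simps)
      have e1: "real (N - j) / real N - \<tau> = 1 - \<tau> - real j / real N"
        using jN elim(2) by (simp add: of_nat_diff diff_divide_distrib)
      have e2: "E.h N (N - j) = H \<theta> \<phi> (N - j) (L N)" by (simp add: E.h_def E.G_def H_def G_fps_def)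
      have e3: "E.F N = (\<Sum>k. F_term \<theta> \<phi> (L N) k)" by (simp add: E.F_def F_term_def)
      show "\<bar>H \<theta> \<phi> (N - j) (L N) /
             (exp (\<Sum>k. F_term \<theta> \<phi> (L N) k) * real N powr (\<theta> - 1)
               * (1 - \<tau> - real j / real N) powr (\<theta> - 1) / Gamma \<theta>) - 1\<bar> \<le> \<delta>"
        using elim(1)[rule_format, OF diff_le_self le] unfolding e1 e2 e3 .
    qed
  qed
qed

text \<open>The case \<tau> = 0: an upper bound for the absolute deviations settles the signed ones
  too.\<close>

lemma exp_coeff_dev_small:
  fixes L :: "nat \<Rightarrow> real"
  assumes \<theta>: "\<theta> > 0" and L0: "\<And>N. L N \<ge> 0" and L1: "\<forall>\<^sub>F N in sequentially. L N \<ge> 1"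
    and LN: "(\<lambda>N. (L N)\<^sup>2 / real N) \<longlonglongrightarrow> 0"
    and b: "\<forall>\<^sub>F N in sequentially. (\<Sum>j. \<bar>w (L N) (Suc j) - 1\<bar>) / real N \<le> b N" and b0: "b \<longlonglongrightarrow> 0"
  shows "exp_coeff \<theta> 0 (real CARD('n) / 2) (\<theta> * (1 + Cw)) (\<lambda>N. W \<theta> \<phi> (L N))"
proof (rule exp_coeff_W[OF \<theta> order_refl L0 L1 LN])
  have b1: "(\<lambda>N. \<theta> * b N) \<longlonglongrightarrow> 0" using tendsto_mult[OF tendsto_const b0, of \<theta>] by simp
  have up: "\<forall>\<^sub>F N in sequentially. \<bar>\<theta> * (\<Sum>j. w (L N) (Suc j) - 1) / real N\<bar> \<le> \<theta> * b N
      \<and> \<bar>\<theta> * (\<Sum>j. \<bar>w (L N) (Suc j) - 1\<bar>) / real N\<bar> \<le> \<theta> * b N"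
    using b L1
  proof eventually_elim
    case (elim N)
    note s = summable_dev(1)[OF elim(2)]
    define S where "S = (\<Sum>j. \<bar>w (L N) (Suc j) - 1\<bar>)"
    have S0: "S \<ge> 0" unfolding S_def by (intro suminf_nonneg s) auto
    have S1: "\<bar>\<Sum>j. w (L N) (Suc j) - 1\<bar> \<le> S" unfolding S_def by (rule summable_rabs[OF s])
    have "\<theta> * (S / real N) \<le> \<theta> * b N" using elim(1) \<theta> unfolding S_def[symmetric] by (intro mult_left_mono) auto
    moreover have "\<theta> * \<bar>\<Sum>j. w (L N) (Suc j) - 1\<bar> / real N \<le> \<theta> * S / real N"
      using S1 \<theta> by (intro divide_right_mono mult_left_mono) auto
    ultimately show ?case using \<theta> S0 unfolding S_def[symmetric] by (simp add: abs_mult abs_divide)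
  qed
  show "(\<lambda>N. \<theta> * (\<Sum>j. w (L N) (Suc j) - 1) / real N) \<longlonglongrightarrow> 0"
    by (rule Lim_null_comparison[OF _ b1]) (use up in \<open>auto elim: eventually_mono\<close>)
  show "(\<lambda>N. \<theta> * (\<Sum>j. \<bar>w (L N) (Suc j) - 1\<bar>) / real N) \<longlonglongrightarrow> 0"
    by (rule Lim_null_comparison[OF _ b1]) (use up in \<open>auto elim: eventually_mono\<close>)
qed

lemma exp_coeff_super1:
  fixes \<rho> :: "nat \<Rightarrow> real"
  assumes \<theta>: "\<theta> > 0" and d: "CARD('n) = 1" and \<rho>: "filterlim (\<lambda>N. \<rho> N / sqrt (real N)) at_top sequentially" "\<And>N. \<rho> N \<le> real N"
  defines "L \<equiv> (\<lambda>N::nat. (real N / \<rho> N) powr (1 / real CARD('n)))"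
  shows "\<forall>\<^sub>F N in sequentially. L N \<ge> 1"
    and "exp_coeff \<theta> 0 (real CARD('n) / 2) (\<theta> * (1 + Cw)) (\<lambda>N. W \<theta> \<phi> (L N))"
proof -
  have big: "\<forall>\<^sub>F N in sequentially. N > 0 \<and> \<rho> N > 0"
    using filterlim_at_top_dense[THEN iffD1, OF \<rho>(1), rule_format, of 0] eventually_gt_at_top[of 0]
    by eventually_elim (auto simp: zero_less_divide_iff)
  have Le: "\<forall>\<^sub>F N in sequentially. L N = real N / \<rho> N"
    using big by eventually_elim (simp add: L_def d)
  show L1: "\<forall>\<^sub>F N in sequentially. L N \<ge> 1"
    using big Le by eventually_elim (use \<rho>(2) in \<open>simp add: le_divide_eq\<close>)
  \<comment> \<open>Here \<open>L = N / \<rho>\<close>, so \<open>L\<^sup>2 / N\<close> is the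
    inverse square of \<open>\<rho> / sqrt N\<close>. By \<open>dev_sum_dim1\<close> the same
    quantity bounds the mean deviation.\<close>
  have "((\<lambda>x::real. (1 / x)\<^sup>2) \<longlongrightarrow> 0) at_top" by real_asymp
  from filterlim_compose[OF this \<rho>(1)] have "(\<lambda>N. (1 / (\<rho> N / sqrt (real N)))\<^sup>2) \<longlonglongrightarrow> 0" .
  moreover have "\<forall>\<^sub>F N in sequentially. (1 / (\<rho> N / sqrt (real N)))\<^sup>2 = (L N)\<^sup>2 / real N"
    using big Le by eventually_elim (simp add: power_divide power2_eq_square)
  ultimately have LN: "(\<lambda>N. (L N)\<^sup>2 / real N) \<longlonglongrightarrow> 0" by (rule Lim_transform_eventually)
  show "exp_coeff \<theta> 0 (real CARD('n) / 2) (\<theta> * (1 + Cw)) (\<lambda>N. W \<theta> \<phi> (L N))"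
  proof (rule exp_coeff_dev_small[OF \<theta> _ L1 LN])
    \<comment> \<open>\<open>powr\<close> is nonnegative for every base, also for early
      \<open>N\<close> at which \<open>\<rho> N\<close> need not be positive.\<close>
    show "L N \<ge> 0" for N by (simp add: L_def)
    show "\<forall>\<^sub>F N in sequentially. (\<Sum>j. \<bar>w (L N) (Suc j) - 1\<bar>) / real N \<le> (pi + 2) * Cw * ((L N)\<^sup>2 / real N)"
      using L1
    proof eventually_elim
      case (elim N)
      show ?case using divide_right_mono[OF dev_sum_dim1[OF d elim], of "real N"] by simp
    qed
    show "(\<lambda>N. (pi + 2) * Cw * ((L N)\<^sup>2 / real N)) \<longlonglongrightarrow> 0"
      using tendsto_mult[OF tendsto_const LN, of "(pi + 2) * Cw"] by simp
  qed
qed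

lemma dim2_scale:
  fixes \<rho> L :: "nat \<Rightarrow> real"
  assumes d: "CARD('n) = 2" and pos: "\<forall>\<^sub>F N in sequentially. \<rho> N > 0" and \<rho>: "\<And>N. \<rho> N \<le> real N"
    and L: "\<And>N. L N = (real N / \<rho> N) powr (1 / real CARD('n))"
  shows "\<forall>\<^sub>F N in sequentially. (L N)\<^sup>2 = real N / \<rho> N \<and> (L N)\<^sup>2 / real N = 1 / \<rho> N \<and> L N \<ge> 1"
  using pos eventually_gt_at_top[of 0]
proof eventually_elim
  case (elim N)
  have q: "real N / \<rho> N \<ge> 1" using elim \<rho>[of N] by (simp add: le_divide_eq)
  have "L N = sqrt (real N / \<rho> N)" using q by (simp add: L d powr_half_sqrt)
  thus ?case using q elim by auto
qed

lemma exp_coeff_hyper2: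
  fixes \<rho> :: "nat \<Rightarrow> real"
  assumes \<theta>: "\<theta> > 0" and d: "CARD('n) = 2" and \<rho>: "filterlim (\<lambda>N. \<rho> N / ln (real N)) at_top sequentially" "\<And>N. \<rho> N \<le> real N"
  defines "L \<equiv> (\<lambda>N::nat. (real N / \<rho> N) powr (1 / real CARD('n)))"
  shows "\<forall>\<^sub>F N in sequentially. L N \<ge> 1"
    and "exp_coeff \<theta> 0 (real CARD('n) / 2) (\<theta> * (1 + Cw)) (\<lambda>N. W \<theta> \<phi> (L N))"
proof -
  have ln1: "\<forall>\<^sub>F N in sequentially. ln (real N) \<ge> 1" by real_asymp
  have r1: "\<forall>\<^sub>F N in sequentially. \<rho> N / ln (real N) \<ge> 1" using \<rho>(1) by (auto simp: filterlim_at_top)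
  have big: "\<forall>\<^sub>F N in sequentially. \<rho> N \<ge> 1"
    using ln1 r1 by eventually_elim (simp add: le_divide_eq)
  hence pos: "\<forall>\<^sub>F N in sequentially. \<rho> N > 0" by (auto elim: eventually_mono)
  have sc: "\<forall>\<^sub>F N in sequentially. (L N)\<^sup>2 = real N / \<rho> N \<and> (L N)\<^sup>2 / real N = 1 / \<rho> N \<and> L N \<ge> 1"
    by (rule dim2_scale[OF d pos \<rho>(2)]) (simp add: L_def)
  show L1: "\<forall>\<^sub>F N in sequentially. L N \<ge> 1" using sc by (auto elim: eventually_mono)
  have "((\<lambda>x::real. 2 / x) \<longlongrightarrow> 0) at_top" by real_asymp
  from filterlim_compose[OF this \<rho>(1)] have r0: "(\<lambda>N. 2 / (\<rho> N / ln (real N))) \<longlonglongrightarrow> 0" .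
  \<comment> \<open>As \<open>L\<^sup>2 / N = 1 / \<rho>\<close> and
    \<open>L\<^sup>2 \<le> N\<close>, the logarithmic bound of \<open>dev_sum_dim2\<close> is at
    most a constant times \<open>ln N / \<rho>\<close>, which vanishes in this regime.\<close>
  have le: "\<forall>\<^sub>F N in sequentially. (L N)\<^sup>2 / real N \<le> (L N)\<^sup>2 * (1 + ln ((L N)\<^sup>2)) / real N
      \<and> (L N)\<^sup>2 * (1 + ln ((L N)\<^sup>2)) / real N \<le> 2 / (\<rho> N / ln (real N))"
    using sc big ln1
  proof eventually_elim
    case (elim N)
    have N: "real N > 0" using elim(3) by (cases N) auto
    have L2: "(L N)\<^sup>2 \<ge> 1" by (rule one_le_power[OF conjunct2[OF conjunct2[OF elim(1)]]])
    have l0: "ln ((L N)\<^sup>2) \<ge> 0" using L2 by simp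
    have "(L N)\<^sup>2 \<le> real N / 1"
      unfolding conjunct1[OF elim(1)] using elim(2) N by (intro divide_left_mono) auto
    hence "ln ((L N)\<^sup>2) \<le> ln (real N)" using L2 N by (subst ln_le_cancel_iff) auto
    hence l1: "1 + ln ((L N)\<^sup>2) \<le> 2 * ln (real N)" using elim(3) by linarith
    have "(L N)\<^sup>2 * (1 + ln ((L N)\<^sup>2)) / real N = (L N)\<^sup>2 / real N * (1 + ln ((L N)\<^sup>2))" by simp
    also have "(L N)\<^sup>2 / real N = 1 / \<rho> N" using elim(1) by blast
    also have "1 / \<rho> N * (1 + ln ((L N)\<^sup>2)) \<le> 1 / \<rho> N * (2 * ln (real N))"
      using elim(2) by (intro mult_left_mono l1) simp
    finally have "(L N)\<^sup>2 * (1 + ln ((L N)\<^sup>2)) / real N \<le> 2 / (\<rho> N / ln (real N))" by simp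
    moreover have "(L N)\<^sup>2 * 1 / real N \<le> (L N)\<^sup>2 * (1 + ln ((L N)\<^sup>2)) / real N"
      using l0 by (intro divide_right_mono mult_left_mono) auto
    ultimately show ?case by simp
  qed
  have s0: "(\<lambda>N. (L N)\<^sup>2 * (1 + ln ((L N)\<^sup>2)) / real N) \<longlonglongrightarrow> 0"
  proof (rule tendsto_sandwich[OF _ _ tendsto_const r0])
    show "\<forall>\<^sub>F N in sequentially. (L N)\<^sup>2 * (1 + ln ((L N)\<^sup>2)) / real N \<le> 2 / (\<rho> N / ln (real N))"
      using le by (auto elim: eventually_mono)
    show "\<forall>\<^sub>F N in sequentially. 0 \<le> (L N)\<^sup>2 * (1 + ln ((L N)\<^sup>2)) / real N"
      using le by eventually_elim (meson divide_nonneg_nonneg of_nat_0_le_iff order_trans zero_le_power2)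
  qed
  have LN: "(\<lambda>N. (L N)\<^sup>2 / real N) \<longlonglongrightarrow> 0"
  proof (rule tendsto_sandwich[OF _ _ tendsto_const s0])
    show "\<forall>\<^sub>F N in sequentially. (L N)\<^sup>2 / real N \<le> (L N)\<^sup>2 * (1 + ln ((L N)\<^sup>2)) / real N"
      using le by (auto elim: eventually_mono)
  qed auto
  show "exp_coeff \<theta> 0 (real CARD('n) / 2) (\<theta> * (1 + Cw)) (\<lambda>N. W \<theta> \<phi> (L N))"
  proof (rule exp_coeff_dev_small[OF \<theta> _ L1 LN])
    show "L N \<ge> 0" for N by (simp add: L_def)
    show "\<forall>\<^sub>F N in sequentially. (\<Sum>j. \<bar>w (L N) (Suc j) - 1\<bar>) / real N
        \<le> (pi + 1) * Cw * ((L N)\<^sup>2 * (1 + ln ((L N)\<^sup>2)) / real N)"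
      using L1
    proof eventually_elim
      case (elim N)
      show ?case using divide_right_mono[OF dev_sum_dim2[OF d elim], of "real N"] by (simp add: mult.assoc)
    qed
    show "(\<lambda>N. (pi + 1) * Cw * ((L N)\<^sup>2 * (1 + ln ((L N)\<^sup>2)) / real N)) \<longlonglongrightarrow> 0"
      using tendsto_mult[OF tendsto_const s0, of "(pi + 1) * Cw"] by simp
  qed
qed

text \<open>Since \<open>L ^ d = N / r\<close>, normalising the deviation sums by the volume is the
  same as normalising by \<open>N / r\<close>, and \<open>L\<^sup>2 / N\<close> tends to 0 because
  \<open>2 / d < 1\<close>.\<close>

lemma exp_coeff_super3:
  assumes \<theta>: "\<theta> > 0" and d: "CARD('n) \<ge> 3" and r: "r > rho_c \<theta> \<phi>"
  defines "L \<equiv> (\<lambda>N::nat. (real N / r) powr (1 / real CARD('n)))"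
  shows "\<forall>\<^sub>F N in sequentially. L N \<ge> 1" "rho_c \<theta> \<phi> / r \<ge> 0"
    and "exp_coeff \<theta> (rho_c \<theta> \<phi> / r) (real CARD('n) / 2) (\<theta> * (1 + Cw)) (\<lambda>N. W \<theta> \<phi> (L N))"
proof -
  define D where "D = real CARD('n)"
  have D: "D \<ge> 3" using d by (simp add: D_def)
  have s: "summable (\<lambda>j. conv_power \<phi> (Suc j) 0)"
    by (rule dev_sum_dim3(3)[OF d filterlim_real_sequentially])
  have "rho_c \<theta> \<phi> \<ge> 0" unfolding rho_c_def using \<theta> by (intro mult_nonneg_nonneg suminf_nonneg s conv_nonneg) auto
  with r have r0: "r > 0" and "rho_c \<theta> \<phi> / r \<ge> 0" by auto
  thus \<tau>: "rho_c \<theta> \<phi> / r \<ge> 0" by simp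
  have Ltop: "filterlim L at_top sequentially"
    unfolding L_def D_def[symmetric] using r0 D by real_asymp
  show L1: "\<forall>\<^sub>F N in sequentially. L N \<ge> 1" using Ltop by (auto simp: filterlim_at_top)
  have Lp: "\<forall>\<^sub>F N in sequentially. L N ^ CARD('n) = real N / r"
    using eventually_gt_at_top[of 0]
  proof eventually_elim
    case (elim N)
    have "L N ^ CARD('n) = L N powr D" using elim r0 by (simp add: L_def D_def powr_realpow)
    thus ?case using elim r0 D by (simp add: L_def D_def[symmetric] powr_powr)
  qed
  have LN: "(\<lambda>N. (L N)\<^sup>2 / real N) \<longlonglongrightarrow> 0"
  proof -
    have "(\<lambda>N. ((real N / r) powr (1 / D))\<^sup>2 / real N) \<longlonglongrightarrow> 0" using r0 D by real_asymp
    thus ?thesis by (simp add: L_def D_def)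
  qed
  have lim: "(\<lambda>N. \<theta> * S N / real N) \<longlonglongrightarrow> rho_c \<theta> \<phi> / r"
    if S: "(\<lambda>N. S N / L N ^ CARD('n)) \<longlonglongrightarrow> (\<Sum>j. conv_power \<phi> (Suc j) 0)" for S
  proof -
    have "(\<lambda>N. \<theta> * (S N / L N ^ CARD('n)) / r) \<longlonglongrightarrow> \<theta> * (\<Sum>j. conv_power \<phi> (Suc j) 0) / r"
      by (intro tendsto_divide tendsto_mult tendsto_const S) (use r0 in simp)
    moreover have "\<forall>\<^sub>F N in sequentially. \<theta> * (S N / L N ^ CARD('n)) / r = \<theta> * S N / real N"
      using Lp by eventually_elim (use r0 in simp)
    ultimately show ?thesis unfolding rho_c_def by (rule Lim_transform_eventually)
  qed
  show "exp_coeff \<theta> (rho_c \<theta> \<phi> / r) (real CARD('n) / 2) (\<theta> * (1 + Cw)) (\<lambda>N. W \<theta> \<phi> (L N))"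
    by (rule exp_coeff_W[OF \<theta> \<tau> _ L1 LN lim[OF dev_sum_dim3(1)[OF d Ltop]] lim[OF dev_sum_dim3(2)[OF d Ltop]]])
       (simp add: L_def)
qed

end

text \<open>The deviation sum is about \<open>\<kappa> * L\<^sup>2 * ln (L\<^sup>2)\<close>, and
  \<open>L\<^sup>2 / N = 1 / \<rho>\<close>. As \<rho> is of order \<open>ln N\<close>, its own
  logarithm is negligible in \<open>ln (L\<^sup>2) = ln N - ln \<rho>\<close>, so the mean tends to
  \<open>\<theta> * \<kappa> / \<alpha>\<close>, where \<open>\<theta> * \<kappa>\<close> is
  \<open>alpha_c\<close>.\<close>

lemma (in centred_schwartz_density) exp_coeff_super2:
  fixes \<rho> :: "nat \<Rightarrow> real"
  assumes \<theta>: "\<theta> > 0" and d: "CARD('n) = 2" and \<alpha>: "\<alpha> > alpha_c \<theta> \<phi>"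
    and \<rho>: "(\<lambda>N. \<rho> N / ln (real N)) \<longlonglongrightarrow> \<alpha>" "\<And>N. \<rho> N \<le> real N"
  defines "L \<equiv> (\<lambda>N::nat. (real N / \<rho> N) powr (1 / real CARD('n)))"
  shows "\<forall>\<^sub>F N in sequentially. L N \<ge> 1" "alpha_c \<theta> \<phi> / \<alpha> \<ge> 0"
    and "exp_coeff \<theta> (alpha_c \<theta> \<phi> / \<alpha>) (real CARD('n) / 2) (\<theta> * (1 + Cw)) (\<lambda>N. W \<theta> \<phi> (L N))"
proof -
  have ac: "alpha_c \<theta> \<phi> = \<theta> * \<kappa>"
    unfolding \<kappa>_def gauss_integral_dim2(2)[OF d] alpha_c_def by simp
  have "alpha_c \<theta> \<phi> \<ge> 0" using \<theta> \<kappa>_nonneg by (simp add: ac)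
  with \<alpha> have \<alpha>0: "\<alpha> > 0" and "alpha_c \<theta> \<phi> / \<alpha> \<ge> 0" by auto
  thus \<tau>: "alpha_c \<theta> \<phi> / \<alpha> \<ge> 0" by simp
  have lnt: "filterlim (\<lambda>N. ln (real N)) at_top sequentially" by real_asymp
  have rl: "\<forall>\<^sub>F N in sequentially. \<rho> N / ln (real N) * ln (real N) = \<rho> N"
  proof -
    have "\<forall>\<^sub>F N in sequentially. ln (real N) > 0" by real_asymp
    thus ?thesis by eventually_elim simp
  qed
  have \<rho>top: "filterlim \<rho> at_top sequentially"
    by (rule filterlim_cong[THEN iffD1, OF refl refl rl filterlim_tendsto_pos_mult_at_top[OF \<rho>(1) \<alpha>0 lnt]])
  have pos: "\<forall>\<^sub>F N in sequentially. \<rho> N > 0" using \<rho>top by (auto simp: filterlim_at_top_dense)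
  have sc: "\<forall>\<^sub>F N in sequentially. (L N)\<^sup>2 = real N / \<rho> N \<and> (L N)\<^sup>2 / real N = 1 / \<rho> N \<and> L N \<ge> 1"
    by (rule dim2_scale[OF d pos \<rho>(2)]) (simp add: L_def)
  show L1: "\<forall>\<^sub>F N in sequentially. L N \<ge> 1" using sc by (auto elim: eventually_mono)
  have "((\<lambda>x::real. 1 / x) \<longlongrightarrow> 0) at_top" by real_asymp
  from filterlim_compose[OF this \<rho>top] have "(\<lambda>N. 1 / \<rho> N) \<longlonglongrightarrow> 0" .
  hence LN: "(\<lambda>N. (L N)\<^sup>2 / real N) \<longlonglongrightarrow> 0"
    by (rule Lim_transform_eventually) (use sc in \<open>auto elim: eventually_mono\<close>)
  have "((\<lambda>x::real. ln x / x) \<longlongrightarrow> 0) at_top" by real_asymp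
  from filterlim_compose[OF this \<rho>top] have l0: "(\<lambda>N. ln (\<rho> N) / \<rho> N) \<longlonglongrightarrow> 0" .
  have i: "(\<lambda>N. 1 / (\<rho> N / ln (real N))) \<longlonglongrightarrow> 1 / \<alpha>"
    by (intro tendsto_divide tendsto_const \<rho>(1)) (use \<alpha>0 in simp)
  have "(\<lambda>N. 1 / (\<rho> N / ln (real N)) - ln (\<rho> N) / \<rho> N) \<longlonglongrightarrow> 1 / \<alpha> - 0"
    by (rule tendsto_diff[OF i l0])
  hence "(\<lambda>N. 1 / (\<rho> N / ln (real N)) - ln (\<rho> N) / \<rho> N) \<longlonglongrightarrow> 1 / \<alpha>" by simp
  moreover have "\<forall>\<^sub>F N in sequentially. 1 / (\<rho> N / ln (real N)) - ln (\<rho> N) / \<rho> N = ln ((L N)\<^sup>2) / \<rho> N"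
    using sc pos eventually_gt_at_top[of 0]
    by eventually_elim (simp add: ln_div diff_divide_distrib)
  ultimately have lL: "(\<lambda>N. ln ((L N)\<^sup>2) / \<rho> N) \<longlonglongrightarrow> 1 / \<alpha>" by (rule Lim_transform_eventually)
  have lpos: "\<forall>\<^sub>F N in sequentially. ln ((L N)\<^sup>2) / \<rho> N > 0"
    using order_tendstoD(1)[OF lL, of 0] \<alpha>0 by simp
  have Ltop: "filterlim L at_top sequentially"
  proof -
    \<comment> \<open>Divergence of \<open>L\<close> is recovered from its logarithm:
      \<open>ln (L\<^sup>2)\<close> is asymptotic to \<open>\<rho> / \<alpha>\<close>, which tends
      to infinity.\<close>
    have "filterlim (\<lambda>N. ln ((L N)\<^sup>2) / \<rho> N * \<rho> N) at_top sequentially"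
      by (rule filterlim_tendsto_pos_mult_at_top[OF lL _ \<rho>top]) (use \<alpha>0 in simp)
    hence 1: "filterlim (\<lambda>N. sqrt (exp (ln ((L N)\<^sup>2) / \<rho> N * \<rho> N))) at_top sequentially"
      by (intro filterlim_compose[OF sqrt_at_top] filterlim_compose[OF exp_at_top])
    have 2: "\<forall>\<^sub>F N in sequentially. sqrt (exp (ln ((L N)\<^sup>2) / \<rho> N * \<rho> N)) = L N"
      using L1 pos by eventually_elim simp
    show ?thesis by (rule filterlim_cong[THEN iffD1, OF refl refl 2 1])
  qed
  have lim: "(\<lambda>N. \<theta> * S N / real N) \<longlonglongrightarrow> alpha_c \<theta> \<phi> / \<alpha>"
    if S: "(\<lambda>N. S N / ((L N)\<^sup>2 * ln ((L N)\<^sup>2))) \<longlonglongrightarrow> \<kappa>" for S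
  proof -
    have "(\<lambda>N. \<theta> * (S N / ((L N)\<^sup>2 * ln ((L N)\<^sup>2))) * (ln ((L N)\<^sup>2) / \<rho> N)) \<longlonglongrightarrow> \<theta> * \<kappa> * (1 / \<alpha>)"
      by (intro tendsto_mult tendsto_const S lL)
    moreover have "\<forall>\<^sub>F N in sequentially. \<theta> * (S N / ((L N)\<^sup>2 * ln ((L N)\<^sup>2))) * (ln ((L N)\<^sup>2) / \<rho> N) = \<theta> * S N / real N"
      using sc lpos pos
    proof eventually_elim
      case (elim N)
      define l where "l = ln ((L N)\<^sup>2)"
      have "l \<noteq> 0" using elim(2) by (auto simp: l_def)
      moreover have "(L N)\<^sup>2 = real N / \<rho> N" using elim(1) by simp
      ultimately show ?case unfolding l_def[symmetric] using elim(3) by simp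
    qed
    ultimately show ?thesis unfolding ac by (simp add: Lim_transform_eventually)
  qed
  show "exp_coeff \<theta> (alpha_c \<theta> \<phi> / \<alpha>) (real CARD('n) / 2) (\<theta> * (1 + Cw)) (\<lambda>N. W \<theta> \<phi> (L N))"
    by (rule exp_coeff_W[OF \<theta> \<tau> _ L1 LN lim[OF dev_sum_dim2_sharp(1)[OF d Ltop]] lim[OF dev_sum_dim2_sharp(2)[OF d Ltop]]])
       (simp add: L_def)
qed

theorem mainTheorem14:
  fixes \<theta> :: real and \<phi> :: "real^'n \<Rightarrow> real" and \<rho> :: "nat \<Rightarrow> real" and \<tau> :: real
  assumes theta_pos: "\<theta> > 0"
    and schw: "schwartz \<phi>"
    and dens_nonneg: "\<forall>x. \<phi> x \<ge> 0"
    and dens_int: "integral\<^sup>L lborel \<phi> = 1"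
    and mean0: "\<forall>i. integral\<^sup>L lborel (\<lambda>x. (x $ i) * \<phi> x) = 0"
    and regime:
      "(CARD('n) = 1 \<and> filterlim (\<lambda>N. \<rho> N / sqrt (real N)) at_top sequentially
          \<and> (\<forall>N. \<rho> N \<le> real N) \<and> \<tau> = 0)
     \<or> (CARD('n) = 2 \<and> (\<exists>\<alpha>. alpha_c \<theta> \<phi> < \<alpha> \<and> ((\<lambda>N. \<rho> N / ln (real N)) \<longlonglongrightarrow> \<alpha>)
          \<and> (\<forall>N. \<rho> N \<le> real N) \<and> \<tau> = alpha_c \<theta> \<phi> / \<alpha>))
     \<or> (CARD('n) = 2 \<and> filterlim (\<lambda>N. \<rho> N / ln (real N)) at_top sequentially
          \<and> (\<forall>N. \<rho> N \<le> real N) \<and> \<tau> = 0)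
     \<or> (CARD('n) \<ge> 3 \<and> (\<exists>r. r > rho_c \<theta> \<phi> \<and> (\<forall>N. \<rho> N = r) \<and> \<tau> = rho_c \<theta> \<phi> / r))"
  defines "L \<equiv> (\<lambda>N::nat. (real N / \<rho> N) powr (1 / real CARD('n)))"
  shows "(\<forall>\<^sub>F N in sequentially. summable (\<lambda>j. \<bar>F_term \<theta> \<phi> (L N) j\<bar>))
    \<and> (\<forall>\<epsilon>>0. \<forall>\<delta>>0. \<forall>\<^sub>F N in sequentially. \<forall>j::nat. real j \<le> (1 - \<tau> - \<epsilon>) * real N \<longrightarrow>
          \<bar>H \<theta> \<phi> (N - j) (L N) /
             (exp (\<Sum>k. F_term \<theta> \<phi> (L N) k) * real N powr (\<theta> - 1)
               * (1 - \<tau> - real j / real N) powr (\<theta> - 1) / Gamma \<theta>) - 1\<bar> \<le> \<delta>)"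
proof -
  interpret centred_schwartz_density \<phi>
    by unfold_locales (use schw dens_nonneg dens_int mean0 in auto)
  have "\<exists>p C. \<tau> \<ge> 0 \<and> (\<forall>\<^sub>F N in sequentially. L N \<ge> 1) \<and> exp_coeff \<theta> \<tau> p C (\<lambda>N. W \<theta> \<phi> (L N))"
    using regime
  proof (elim disjE conjE exE)
    assume "CARD('n) = 1" "filterlim (\<lambda>N. \<rho> N / sqrt (real N)) at_top sequentially" "\<forall>N. \<rho> N \<le> real N" "\<tau> = 0"
    thus ?thesis using exp_coeff_super1[OF theta_pos, of \<rho>] unfolding L_def by (intro exI conjI) auto
  next
    fix \<alpha> assume "CARD('n) = 2" "alpha_c \<theta> \<phi> < \<alpha>" "(\<lambda>N. \<rho> N / ln (real N)) \<longlonglongrightarrow> \<alpha>" "\<forall>N. \<rho> N \<le> real N" "\<tau> = alpha_c \<theta> \<phi> / \<alpha>"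
    thus ?thesis using exp_coeff_super2[OF theta_pos, of \<alpha> \<rho>] unfolding L_def by (intro exI conjI) auto
  next
    assume "CARD('n) = 2" "filterlim (\<lambda>N. \<rho> N / ln (real N)) at_top sequentially" "\<forall>N. \<rho> N \<le> real N" "\<tau> = 0"
    thus ?thesis using exp_coeff_hyper2[OF theta_pos, of \<rho>] unfolding L_def by (intro exI conjI) auto
  next
    fix r assume "CARD('n) \<ge> 3" "r > rho_c \<theta> \<phi>" "\<forall>N. \<rho> N = r" "\<tau> = rho_c \<theta> \<phi> / r"
    thus ?thesis using exp_coeff_super3[OF theta_pos, of r] unfolding L_def by (intro exI conjI) auto
  qed
  then obtain p C where "\<tau> \<ge> 0" "\<forall>\<^sub>F N in sequentially. L N \<ge> 1" "exp_coeff \<theta> \<tau> p C (\<lambda>N. W \<theta> \<phi> (L N))"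
    by (elim exE conjE)
  thus ?thesis by (rule coefficients_of_exp_coeff[OF theta_pos])
qed

end
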